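(* If $\mathcal D$ is a definable subcategory of a compactly generated triangulated category $\mathcal T$, then the following categories are equivalent: (i) the category $\mathbb L(\mathcal D)^{\rm eq+}$ of pp-imaginaries for $\mathcal D$; (ii) $\mathrm{Coh}(\mathcal T)/\mathrm{Ann}_{\mathrm{Coh}(\mathcal T)}(\mathcal D)$; (iii) $(\mathrm{mod}\text{-}\mathcal T^{\rm c}/\mathcal S_{\mathcal D})^{\rm op}$.
   Context: $\mathcal T$ is a triangulated category with arbitrary coproducts. An object $A$ is compact if $\mathrm{Hom}(A,-)$ commutes with coproducts; $\mathcal T^{\rm c}$ is the full subcategory of compact objects. Compactly generated means that $\mathcal T^{\rm c}$ has only a set of isomorphism classes and that $\mathrm{Hom}(A,X)=0$ for all compact $A$ implies $X=0$. We write $(X,Y)$ for Hom groups. $\mathrm{mod}\text{-}\mathcal T^{\rm c}$ is the (abelian) category of finitely presented additive functors $(\mathcal T^{\rm c})^{\rm op}\to\mathbf{Ab}$; $yX=(-,X)\upharpoonright\mathcal T^{\rm c}$ is the restricted Yoneda functor. $\mathrm{Coh}(\mathcal T)$ is the (abelian) category of coherent functors on $\mathcal T$, i.e. functors $\mathcal T\to\mathbf{Ab}$ of the form $\mathrm{coker}((f,-):(B,-)\to(A,-))$ with $f:A\to B$ in $\mathcal T^{\rm c}$. A full subcategory $\mathcal D$ of $\mathcal T$ is definable if $\mathcal D=\{X: FX=0\ \forall F\in\mathcal A\}$ for some $\mathcal A\subseteq\mathrm{Coh}(\mathcal T)$. $\mathrm{Ann}_{\mathrm{Coh}(\mathcal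 T)}(\mathcal D)=\{F\in\mathrm{Coh}(\mathcal T): FX=0\ \forall X\in\mathcal D\}$ and $\mathcal S_{\mathcal D}=\{G\in\mathrm{mod}\text{-}\mathcal T^{\rm c}:(G,yX)=0\ \forall X\in\mathcal D\}$; both are Serre subcategories, and the quotients are Serre quotients of abelian categories. Language for $\mathcal T$: there is one sort for each object $A$ of a small version of $\mathcal T^{\rm c}$; elements of $X\in\mathcal T$ of sort $A$ are morphisms $A\to X$. The language has addition and zero on each sort and, for each $f:A\to B$ in $\mathcal T^{\rm c}$, a function symbol interpreted as $b\in(B,X)\mapsto bf\in(A,X)$. A pp formula is a finite system of linear equations with some variables existentially quantified; $\phi(X)$ is its solution set. $\mathbb L(\mathcal T)^{\rm eq+}$ is the (abelian) category whose objects are pp-pairs $\phi/\psi$ (pp formulas in the same free variables with $\psi(X)\le\phi(X)$ for all $X\in\mathcal T$) and whose morphisms are the pp-definable maps: pp formulas which on every $X\in\mathcal T$ define a homomorphism $\phi(X)/\psi(X)\to\phi'(X)/\psi'(X)$, identified if they define the same map on every $X$. $\mathbb L(\mathcal D)^{\rm eq+}$ is the Serre quotient of $\mathbb L(\mathcal T)^{\rm eq+}$ by its Serre subcategory of pp-pairs $\phi/\psi$ closed on $\mathcal D$, i.e. with $\phi(X)=\psi(X)$ for all $X\in\mathcal D$. *)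

theory Defs
  imports "HOL-Algebra.Free_Abelian_Groups" "HOL-Library.Equipollence"
begin

section \<open>Categories, functors and equivalences\<close>

record ('o, 'm) cat =
  Obj :: "'o set"
  Mor :: "'m set"
  Src :: "'m \<Rightarrow> 'o"
  Tgt :: "'m \<Rightarrow> 'o"
  Ident :: "'o \<Rightarrow> 'm"
  Cmp :: "'m \<Rightarrow> 'm \<Rightarrow> 'm"  (infixl "\<cdot>\<index>" 75)

text \<open>Composition is written in the usual order: \<open>g \<cdot> f\<close> means first \<open>f\<close>, then \<open>g\<close>.\<close>

definition Hom :: "('o, 'm, 'z) cat_scheme \<Rightarrow> 'o \<Rightarrow> 'o \<Rightarrow> 'm set" where
  "Hom C A B = {f \<in> Mor C. Src C f = A \<and> Tgt C f = B}"

locale category =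
  fixes C :: "('o, 'm, 'z) cat_scheme" (structure)
  assumes Src_in_Obj: "f \<in> Mor C \<Longrightarrow> Src C f \<in> Obj C"
    and Tgt_in_Obj: "f \<in> Mor C \<Longrightarrow> Tgt C f \<in> Obj C"
    and Ident_in_Hom: "A \<in> Obj C \<Longrightarrow> Ident C A \<in> Hom C A A"
    and Cmp_in_Hom: "f \<in> Hom C A B \<Longrightarrow> g \<in> Hom C B D \<Longrightarrow> g \<cdot> f \<in> Hom C A D"
    and Cmp_Ident: "f \<in> Hom C A B \<Longrightarrow> f \<cdot> Ident C A = f"
    and Ident_Cmp: "f \<in> Hom C A B \<Longrightarrow> Ident C B \<cdot> f = f"
    and Cmp_assoc: "f \<in> Hom C A B \<Longrightarrow> g \<in> Hom C B D \<Longrightarrow> h \<in> Hom C D E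
      \<Longrightarrow> h \<cdot> (g \<cdot> f) = (h \<cdot> g) \<cdot> f"

definition iso_mor :: "('o, 'm, 'z) cat_scheme \<Rightarrow> 'm \<Rightarrow> bool" where
  "iso_mor C f \<longleftrightarrow> f \<in> Mor C \<and>
     (\<exists>g \<in> Hom C (Tgt C f) (Src C f).
        Cmp C g f = Ident C (Src C f) \<and> Cmp C f g = Ident C (Tgt C f))"

definition isomorphic :: "('o, 'm, 'z) cat_scheme \<Rightarrow> 'o \<Rightarrow> 'o \<Rightarrow> bool" where
  "isomorphic C A B \<longleftrightarrow> (\<exists>f \<in> Hom C A B. iso_mor C f)"

definition op_cat :: "('o, 'm, 'z) cat_scheme \<Rightarrow> ('o, 'm, 'z) cat_scheme" where
  "op_cat C = C\<lparr>Src := Tgt C, Tgt := Src C, Cmp := (\<lambda>g f. Cmp C f g)\<rparr>"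

definition full_subcat :: "('o, 'm, 'z) cat_scheme \<Rightarrow> 'o set \<Rightarrow> ('o, 'm, 'z) cat_scheme" where
  "full_subcat C P = C\<lparr>Obj := P, Mor := {f \<in> Mor C. Src C f \<in> P \<and> Tgt C f \<in> P}\<rparr>"

text \<open>A functor is given by its action \<open>Fo\<close> on objects and \<open>Fm\<close> on morphisms.\<close>

definition is_functor ::
  "('o1, 'm1, 'z1) cat_scheme \<Rightarrow> ('o2, 'm2, 'z2) cat_scheme \<Rightarrow> ('o1 \<Rightarrow> 'o2) \<Rightarrow> ('m1 \<Rightarrow> 'm2) \<Rightarrow> bool" where
  "is_functor C D Fo Fm \<longleftrightarrow> category C \<and> category D \<and>
     (\<forall>A \<in> Obj C. Fo A \<in> Obj D) \<and>
     (\<forall>f \<in> Mor C. Fm f \<in> Hom D (Fo (Src C f)) (Fo (Tgt C f))) \<and>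
     (\<forall>A \<in> Obj C. Fm (Ident C A) = Ident D (Fo A)) \<and>
     (\<forall>f \<in> Mor C. \<forall>g \<in> Mor C. Tgt C f = Src C g \<longrightarrow> Fm (Cmp C g f) = Cmp D (Fm g) (Fm f))"

definition natural_iso ::
  "('o1, 'm1, 'z1) cat_scheme \<Rightarrow> ('o2, 'm2, 'z2) cat_scheme \<Rightarrow> ('o1 \<Rightarrow> 'o2) \<Rightarrow> ('m1 \<Rightarrow> 'm2)
    \<Rightarrow> ('o1 \<Rightarrow> 'o2) \<Rightarrow> ('m1 \<Rightarrow> 'm2) \<Rightarrow> ('o1 \<Rightarrow> 'm2) \<Rightarrow> bool" where
  "natural_iso C D Fo Fm Go Gm \<tau> \<longleftrightarrow>
     (\<forall>A \<in> Obj C. \<tau> A \<in> Hom D (Fo A) (Go A) \<and> iso_mor D (\<tau> A)) \<and>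
     (\<forall>f \<in> Mor C. Cmp D (\<tau> (Tgt C f)) (Fm f) = Cmp D (Gm f) (\<tau> (Src C f)))"

definition cat_equivalence ::
  "('o1, 'm1, 'z1) cat_scheme \<Rightarrow> ('o2, 'm2, 'z2) cat_scheme \<Rightarrow> ('o1 \<Rightarrow> 'o2) \<Rightarrow> ('m1 \<Rightarrow> 'm2) \<Rightarrow> bool" where
  "cat_equivalence C D Fo Fm \<longleftrightarrow> is_functor C D Fo Fm \<and>
     (\<exists>Go Gm. is_functor D C Go Gm \<and>
        (\<exists>\<eta>. natural_iso C C id id (Go \<circ> Fo) (Gm \<circ> Fm) \<eta>) \<and>
        (\<exists>\<epsilon>. natural_iso D D (Fo \<circ> Go) (Fm \<circ> Gm) id id \<epsilon>))"

definition equivalent_categories ::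
  "('o1, 'm1, 'z1) cat_scheme \<Rightarrow> ('o2, 'm2, 'z2) cat_scheme \<Rightarrow> bool" where
  "equivalent_categories C D \<longleftrightarrow> (\<exists>Fo Fm. cat_equivalence C D Fo Fm)"


section \<open>Zero objects, kernels and cokernels, coproducts\<close>

definition zero_obj :: "('o, 'm, 'z) cat_scheme \<Rightarrow> 'o \<Rightarrow> bool" where
  "zero_obj C Z \<longleftrightarrow> Z \<in> Obj C \<and>
     (\<forall>A \<in> Obj C. (\<exists>!f. f \<in> Hom C A Z) \<and> (\<exists>!f. f \<in> Hom C Z A))"

definition zero_mor :: "('o, 'm, 'z) cat_scheme \<Rightarrow> 'm \<Rightarrow> bool" where
  "zero_mor C f \<longleftrightarrow> (\<exists>Z g h. zero_obj C Z \<and> g \<in> Hom C (Src C f) Z \<and> h \<in> Hom C Z (Tgt C f) \<and> f = Cmp C h g)"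

definition is_kernel :: "('o, 'm, 'z) cat_scheme \<Rightarrow> 'm \<Rightarrow> 'm \<Rightarrow> bool" where
  "is_kernel C f k \<longleftrightarrow> f \<in> Mor C \<and> k \<in> Mor C \<and> Tgt C k = Src C f \<and> zero_mor C (Cmp C f k) \<and>
     (\<forall>g \<in> Mor C. Tgt C g = Src C f \<and> zero_mor C (Cmp C f g) \<longrightarrow>
        (\<exists>!h. h \<in> Hom C (Src C g) (Src C k) \<and> Cmp C k h = g))"

definition is_cokernel :: "('o, 'm, 'z) cat_scheme \<Rightarrow> 'm \<Rightarrow> 'm \<Rightarrow> bool" where
  "is_cokernel C f c \<longleftrightarrow> f \<in> Mor C \<and> c \<in> Mor C \<and> Src C c = Tgt C f \<and> zero_mor C (Cmp C c f) \<and>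
     (\<forall>g \<in> Mor C. Src C g = Tgt C f \<and> zero_mor C (Cmp C g f) \<longrightarrow>
        (\<exists>!h. h \<in> Hom C (Tgt C c) (Tgt C g) \<and> Cmp C h c = g))"

definition is_coproduct ::
  "('o, 'm, 'z) cat_scheme \<Rightarrow> 'i set \<Rightarrow> ('i \<Rightarrow> 'o) \<Rightarrow> 'o \<Rightarrow> ('i \<Rightarrow> 'm) \<Rightarrow> bool" where
  "is_coproduct C I X P inc \<longleftrightarrow> P \<in> Obj C \<and> (\<forall>i \<in> I. inc i \<in> Hom C (X i) P) \<and>
     (\<forall>Y \<in> Obj C. \<forall>g. (\<forall>i \<in> I. g i \<in> Hom C (X i) Y) \<longrightarrow>
        (\<exists>!h. h \<in> Hom C P Y \<and> (\<forall>i \<in> I. Cmp C h (inc i) = g i)))"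


section \<open>Serre quotients\<close>

text \<open>
  The quotient of an abelian category \<open>C\<close> by a Serre subcategory \<open>S\<close> is the localisation of \<open>C\<close> at
  the morphisms whose kernel and cokernel lie in \<open>S\<close>.  The localisation is the one of Gabriel and
  Zisman: the objects are those of \<open>C\<close>, and a morphism is a class of composable words in the
  morphisms of \<open>C\<close> and the formal inverses of the morphisms in \<open>W\<close>, modulo the congruence generated
  by the relations of \<open>C\<close> and the cancellation of formal inverses.  Words are read from left to
  right, i.e. in diagrammatic order.
\<close>

datatype 'm letter = Fwd 'm | Bwd 'm

inductive path :: "('o, 'm, 'z) cat_scheme \<Rightarrow> 'm set \<Rightarrow> 'o \<Rightarrow> 'm letter list \<Rightarrow> 'o \<Rightarrow> bool"
  for C W where
  path_Nil: "X \<in> Obj C \<Longrightarrow> path C W X [] X"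
| path_Fwd: "f \<in> Hom C X Y \<Longrightarrow> path C W Y p Z \<Longrightarrow> path C W X (Fwd f # p) Z"
| path_Bwd: "s \<in> W \<Longrightarrow> s \<in> Hom C Y X \<Longrightarrow> path C W Y p Z \<Longrightarrow> path C W X (Bwd s # p) Z"

inductive path_eq ::
  "('o, 'm, 'z) cat_scheme \<Rightarrow> 'm set \<Rightarrow> 'o \<Rightarrow> 'o \<Rightarrow> 'm letter list \<Rightarrow> 'm letter list \<Rightarrow> bool"
  for C W where
  path_eq_refl: "path C W X p Y \<Longrightarrow> path_eq C W X Y p p"
| path_eq_sym: "path_eq C W X Y p q \<Longrightarrow> path_eq C W X Y q p"
| path_eq_trans: "path_eq C W X Y p q \<Longrightarrow> path_eq C W X Y q r \<Longrightarrow> path_eq C W X Y p r"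
| path_eq_cong: "path C W U a X \<Longrightarrow> path_eq C W X Y p q \<Longrightarrow> path C W Y b V
    \<Longrightarrow> path_eq C W U V (a @ p @ b) (a @ q @ b)"
| path_eq_Cmp: "f \<in> Hom C X Y \<Longrightarrow> g \<in> Hom C Y Z
    \<Longrightarrow> path_eq C W X Z [Fwd f, Fwd g] [Fwd (Cmp C g f)]"
| path_eq_Ident: "X \<in> Obj C \<Longrightarrow> path_eq C W X X [Fwd (Ident C X)] []"
| path_eq_Fwd_Bwd: "s \<in> W \<Longrightarrow> s \<in> Hom C X Y \<Longrightarrow> path_eq C W X X [Fwd s, Bwd s] []"
| path_eq_Bwd_Fwd: "s \<in> W \<Longrightarrow> s \<in> Hom C X Y \<Longrightarrow> path_eq C W Y Y [Bwd s, Fwd s] []"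

definition localisation ::
  "('o, 'm, 'z) cat_scheme \<Rightarrow> 'm set \<Rightarrow> ('o, 'o \<times> 'o \<times> 'm letter list set) cat" where
  "localisation C W =
     \<lparr>Obj = Obj C,
      Mor = {(X, Y, {q. path_eq C W X Y p q}) | X Y p. path C W X p Y},
      Src = (\<lambda>(X, Y, c). X),
      Tgt = (\<lambda>(X, Y, c). Y),
      Ident = (\<lambda>X. (X, X, {q. path_eq C W X X [] q})),
      Cmp = (\<lambda>(Y, Z, d) (X, Y', c). (X, Z, {r. \<exists>p \<in> c. \<exists>q \<in> d. path_eq C W X Z (p @ q) r}))\<rparr>"

definition serre_isos :: "('o, 'm, 'z) cat_scheme \<Rightarrow> 'o set \<Rightarrow> 'm set" where
  "serre_isos C S = {f \<in> Mor C. (\<exists>k. is_kernel C f k \<and> Src C k \<in> S) \<and>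
                                (\<exists>c. is_cokernel C f c \<and> Tgt C c \<in> S)}"

definition serre_quotient ::
  "('o, 'm, 'z) cat_scheme \<Rightarrow> 'o set \<Rightarrow> ('o, 'o \<times> 'o \<times> 'm letter list set) cat" where
  "serre_quotient C S = localisation C (serre_isos C S)"


section \<open>Additive and triangulated categories\<close>

record ('o, 'm) preadd_cat = "('o, 'm) cat" +
  Add :: "'m \<Rightarrow> 'm \<Rightarrow> 'm"
  Zero :: "'o \<Rightarrow> 'o \<Rightarrow> 'm"

definition hom_grp :: "('o, 'm, 'z) preadd_cat_scheme \<Rightarrow> 'o \<Rightarrow> 'o \<Rightarrow> 'm monoid" where
  "hom_grp C A B = \<lparr>carrier = Hom C A B, monoid.mult = Add C, one = Zero C A B\<rparr>"

definition op_preadd :: "('o, 'm, 'z) preadd_cat_scheme \<Rightarrow> ('o, 'm, 'z) preadd_cat_scheme" where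
  "op_preadd C = (op_cat C)\<lparr>Zero := (\<lambda>A B. Zero C B A)\<rparr>"

locale preadditive_category = category C
  for C :: "('o, 'm, 'z) preadd_cat_scheme" (structure) +
  assumes comm_group_hom_grp: "A \<in> Obj C \<Longrightarrow> B \<in> Obj C \<Longrightarrow> comm_group (hom_grp C A B)"
    and Cmp_Add: "f \<in> Hom C A B \<Longrightarrow> g \<in> Hom C B D \<Longrightarrow> g' \<in> Hom C B D
      \<Longrightarrow> Add C g g' \<cdot> f = Add C (g \<cdot> f) (g' \<cdot> f)"
    and Add_Cmp: "f \<in> Hom C A B \<Longrightarrow> f' \<in> Hom C A B \<Longrightarrow> g \<in> Hom C B D
      \<Longrightarrow> g \<cdot> Add C f f' = Add C (g \<cdot> f) (g \<cdot> f')"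

text \<open>In a preadditive category binary coproducts are biproducts.\<close>

locale additive_category = preadditive_category +
  assumes ex_zero_obj: "\<exists>Z. zero_obj C Z"
    and ex_binary_coproduct: "A \<in> Obj C \<Longrightarrow> B \<in> Obj C
      \<Longrightarrow> \<exists>P inc. is_coproduct C (UNIV :: bool set) (\<lambda>b. if b then A else B) P inc"

record ('o, 'm) tri_cat = "('o, 'm) preadd_cat" +
  ShO :: "'o \<Rightarrow> 'o"
  ShM :: "'m \<Rightarrow> 'm"
  Dist :: "('m \<times> 'm \<times> 'm) set"

definition Neg :: "('o, 'm, 'z) preadd_cat_scheme \<Rightarrow> 'm \<Rightarrow> 'm" where
  "Neg C f = m_inv (hom_grp C (Src C f) (Tgt C f)) f"

definition triangle :: "('o, 'm, 'z) tri_cat_scheme \<Rightarrow> 'm \<times> 'm \<times> 'm \<Rightarrow> bool" where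
  "triangle T = (\<lambda>(u, v, w). u \<in> Mor T \<and> v \<in> Mor T \<and> w \<in> Mor T \<and>
     Src T v = Tgt T u \<and> Src T w = Tgt T v \<and> Tgt T w = ShO T (Src T u))"

text \<open>
  The shift \<open>\<Sigma> = (ShO, ShM)\<close> is an additive self-equivalence; the case of an automorphism is included.
  \<open>Dist\<close> is the class of distinguished triangles \<open>(u, v, w)\<close>, with
  \<open>u : X \<rightarrow> Y\<close>, \<open>v : Y \<rightarrow> Z\<close>, \<open>w : Z \<rightarrow> \<Sigma> X\<close>.
\<close>

locale triangulated_category = additive_category T
  for T :: "('o, 'm, 'z) tri_cat_scheme" (structure) +
  assumes shift_equivalence: "cat_equivalence T T (ShO T) (ShM T)"
    and shift_additive: "f \<in> Hom T A B \<Longrightarrow> g \<in> Hom T A B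
      \<Longrightarrow> ShM T (Add T f g) = Add T (ShM T f) (ShM T g)"
    and Dist_triangle: "t \<in> Dist T \<Longrightarrow> triangle T t"
    and TR1_iso: "\<lbrakk>(u, v, w) \<in> Dist T; triangle T (u', v', w');
        a \<in> Hom T (Src T u) (Src T u'); b \<in> Hom T (Tgt T u) (Tgt T u'); c \<in> Hom T (Tgt T v) (Tgt T v');
        iso_mor T a; iso_mor T b; iso_mor T c;
        b \<cdot> u = u' \<cdot> a; c \<cdot> v = v' \<cdot> b; ShM T a \<cdot> w = w' \<cdot> c\<rbrakk>
      \<Longrightarrow> (u', v', w') \<in> Dist T"
    and TR1_Ident: "X \<in> Obj T \<Longrightarrow> zero_obj T Z
      \<Longrightarrow> (Ident T X, Zero T X Z, Zero T Z (ShO T X)) \<in> Dist T"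
    and TR1_ex: "u \<in> Mor T \<Longrightarrow> \<exists>v w. (u, v, w) \<in> Dist T"
    and TR2: "triangle T (u, v, w)
      \<Longrightarrow> (u, v, w) \<in> Dist T \<longleftrightarrow> (v, w, Neg T (ShM T u)) \<in> Dist T"
    and TR3: "\<lbrakk>(u, v, w) \<in> Dist T; (u', v', w') \<in> Dist T;
        a \<in> Hom T (Src T u) (Src T u'); b \<in> Hom T (Tgt T u) (Tgt T u'); b \<cdot> u = u' \<cdot> a\<rbrakk>
      \<Longrightarrow> \<exists>c \<in> Hom T (Tgt T v) (Tgt T v'). c \<cdot> v = v' \<cdot> b \<and> ShM T a \<cdot> w = w' \<cdot> c"
    and TR4: "\<lbrakk>(u, j, k) \<in> Dist T; (v, l, i) \<in> Dist T; (v \<cdot> u, m, n) \<in> Dist T; Tgt T u = Src T v\<rbrakk>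
      \<Longrightarrow> \<exists>f g. (f, g, ShM T j \<cdot> i) \<in> Dist T \<and>
            f \<in> Hom T (Tgt T j) (Tgt T m) \<and> g \<in> Hom T (Tgt T m) (Tgt T l) \<and>
            f \<cdot> j = m \<cdot> v \<and> n \<cdot> f = k \<and> g \<cdot> m = l \<and> i \<cdot> g = ShM T u \<cdot> n"


section \<open>Compactly generated triangulated categories\<close>

text \<open>
  Sizes are measured by an arbitrary type \<open>'u\<close>: a set is small if its cardinality is smaller than
  that of \<open>'u\<close>, and small index sets may be taken to be subsets of \<open>'u\<close>.  When the cardinality of
  \<open>'u\<close> is strongly inaccessible, the small sets are those of a Grothendieck universe, and "arbitrary
  coproducts" and "only a set of isomorphism classes" get their usual meaning.
\<close>

definition has_small_coproducts :: "'u itself \<Rightarrow> ('o, 'm, 'z) cat_scheme \<Rightarrow> bool" where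
  "has_small_coproducts u C \<longleftrightarrow>
     (\<forall>I :: 'u set. \<forall>X. I \<prec> (UNIV :: 'u set) \<and> X \<in> I \<rightarrow> Obj C \<longrightarrow> (\<exists>P inc. is_coproduct C I X P inc))"

text \<open>
  \<open>A\<close> is compact if for every small coproduct \<open>P\<close> of a family \<open>X\<close>, with injections \<open>inc\<close>, the canonical
  map from the direct sum of the groups \<open>(A, X i)\<close> to \<open>(A, P)\<close>, sending \<open>g\<close> to the finite sum of
  the \<open>inc i \<cdot> g i\<close>, is an isomorphism.
\<close>

definition compacts :: "'u itself \<Rightarrow> ('o, 'm, 'z) preadd_cat_scheme \<Rightarrow> 'o set" where
  "compacts u T = {A \<in> Obj T.
     \<forall>(I :: 'u set) X P inc. I \<prec> (UNIV :: 'u set) \<and> X \<in> I \<rightarrow> Obj T \<and> is_coproduct T I X P inc \<longrightarrow>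
       (\<lambda>g. gfinprod (hom_grp T A P) (\<lambda>i. Cmp T (inc i) (g i)) I)
         \<in> iso (sum_group I (\<lambda>i. hom_grp T A (X i))) (hom_grp T A P)}"

text \<open>The objects of a small version of the category of compact objects.\<close>

definition small_version :: "'u itself \<Rightarrow> ('o, 'm, 'z) preadd_cat_scheme \<Rightarrow> 'o set \<Rightarrow> bool" where
  "small_version u T K \<longleftrightarrow> K \<subseteq> compacts u T \<and> K \<prec> (UNIV :: 'u set) \<and>
     (\<forall>A \<in> compacts u T. \<exists>B \<in> K. isomorphic T A B)"

definition compactly_generated :: "'u itself \<Rightarrow> ('o, 'm, 'z) tri_cat_scheme \<Rightarrow> bool" where
  "compactly_generated u T \<longleftrightarrow> triangulated_category T \<and> has_small_coproducts u T \<and>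
     (\<exists>K. small_version u T K) \<and>
     (\<forall>X \<in> Obj T. (\<forall>A \<in> compacts u T. Hom T A X = {Zero T A X}) \<longrightarrow> zero_obj T X)"


section \<open>Additive functors to abelian groups\<close>

record ('o, 'm, 'a) ab_functor =
  FObj :: "'o \<Rightarrow> 'a monoid"
  FMor :: "'m \<Rightarrow> 'a \<Rightarrow> 'a"

definition additive_functor :: "('o, 'm, 'z) preadd_cat_scheme \<Rightarrow> ('o, 'm, 'a) ab_functor \<Rightarrow> bool" where
  "additive_functor C F \<longleftrightarrow>
     (\<forall>X \<in> Obj C. comm_group (FObj F X)) \<and>
     (\<forall>f \<in> Mor C. FMor F f \<in> hom (FObj F (Src C f)) (FObj F (Tgt C f))) \<and>
     (\<forall>X \<in> Obj C. \<forall>x \<in> carrier (FObj F X). FMor F (Ident C X) x = x) \<and>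
     (\<forall>f \<in> Mor C. \<forall>g \<in> Mor C. Tgt C f = Src C g \<longrightarrow>
        (\<forall>x \<in> carrier (FObj F (Src C f)). FMor F (Cmp C g f) x = FMor F g (FMor F f x))) \<and>
     (\<forall>f \<in> Mor C. \<forall>g \<in> Hom C (Src C f) (Tgt C f). \<forall>x \<in> carrier (FObj F (Src C f)).
        FMor F (Add C f g) x = FMor F f x \<otimes>\<^bsub>FObj F (Tgt C f)\<^esub> FMor F g x)"

text \<open>
  Natural transformations are families of maps that are undefined outside their domains, so that
  equal natural transformations are equal as HOL functions.
\<close>

definition nat_trans ::
  "('o, 'm, 'z) preadd_cat_scheme \<Rightarrow> ('o, 'm, 'a) ab_functor \<Rightarrow> ('o, 'm, 'b) ab_functor
    \<Rightarrow> ('o \<Rightarrow> 'a \<Rightarrow> 'b) set" where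
  "nat_trans C F G =
     {\<eta> \<in> (\<Pi>\<^sub>E X \<in> Obj C. hom (FObj F X) (FObj G X) \<inter> extensional (carrier (FObj F X))).
        \<forall>f \<in> Mor C. \<forall>x \<in> carrier (FObj F (Src C f)).
          \<eta> (Tgt C f) (FMor F f x) = FMor G f (\<eta> (Src C f) x)}"

definition nat_isomorphic ::
  "('o, 'm, 'z) preadd_cat_scheme \<Rightarrow> ('o, 'm, 'a) ab_functor \<Rightarrow> ('o, 'm, 'b) ab_functor \<Rightarrow> bool" where
  "nat_isomorphic C F G \<longleftrightarrow>
     (\<exists>\<eta> \<in> nat_trans C F G. \<forall>X \<in> Obj C. bij_betw (\<eta> X) (carrier (FObj F X)) (carrier (FObj G X)))"

text \<open>
  The functor \<open>coker ((f, -) : (B, -) \<rightarrow> (A, -))\<close> for \<open>f : A \<rightarrow> B\<close>.  Its values are quotients of hom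
  groups, whose elements are cosets.  A morphism \<open>h : X \<rightarrow> Y\<close> sends the coset of \<open>g : A \<rightarrow> X\<close> to that
  of \<open>h \<cdot> g\<close>; the union below is over the representatives \<open>g\<close> of \<open>c\<close>, and they all give the same coset.
\<close>

definition precomp_image :: "('o, 'm, 'z) preadd_cat_scheme \<Rightarrow> 'm \<Rightarrow> 'o \<Rightarrow> 'm set" where
  "precomp_image C f X = (\<lambda>g. Cmp C g f) ` Hom C (Tgt C f) X"

definition coker_functor :: "('o, 'm, 'z) preadd_cat_scheme \<Rightarrow> 'm \<Rightarrow> ('o, 'm, 'm set) ab_functor" where
  "coker_functor C f =
     \<lparr>FObj = (\<lambda>X. hom_grp C (Src C f) X Mod precomp_image C f X),
      FMor = (\<lambda>h c. \<Union>g \<in> c. precomp_image C f (Tgt C h) #>\<^bsub>hom_grp C (Src C f) (Tgt C h)\<^esub> Cmp C h g)\<rparr>"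

text \<open>
  Functors on \<open>C\<close> presented by representable functors \<open>(A, -)\<close> with \<open>A \<in> P\<close>.  The groups have elements
  in the type \<open>'m set\<close>, which contains all the cokernels above, so this restriction on the values
  loses no functor up to isomorphism.
\<close>

definition presented_functors ::
  "('o, 'm, 'z) preadd_cat_scheme \<Rightarrow> 'o set \<Rightarrow> ('o, 'm, 'm set) ab_functor set" where
  "presented_functors C P =
     {F. additive_functor C F \<and>
         (\<exists>f \<in> Mor C. Src C f \<in> P \<and> Tgt C f \<in> P \<and> nat_isomorphic C F (coker_functor C f))}"

text \<open>
  A category whose morphisms from \<open>p\<close> to \<open>q\<close> are families \<open>h \<in> M p q\<close> of maps \<open>h X\<close> defined on the
  group \<open>V p X\<close>, for \<open>X \<in> I\<close>, with composition for each \<open>X\<close> separately.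
\<close>

definition family_cat ::
  "'o set \<Rightarrow> 'p set \<Rightarrow> ('p \<Rightarrow> 'o \<Rightarrow> 'a monoid) \<Rightarrow> ('p \<Rightarrow> 'p \<Rightarrow> ('o \<Rightarrow> 'a \<Rightarrow> 'a) set)
    \<Rightarrow> ('p, 'p \<times> 'p \<times> ('o \<Rightarrow> 'a \<Rightarrow> 'a)) cat" where
  "family_cat I Ps V M =
     \<lparr>Obj = Ps,
      Mor = {(p, q, h). p \<in> Ps \<and> q \<in> Ps \<and> h \<in> M p q},
      Src = (\<lambda>(p, q, h). p),
      Tgt = (\<lambda>(p, q, h). q),
      Ident = (\<lambda>p. (p, p, \<lambda>X\<in>I. \<lambda>x\<in>carrier (V p X). x)),
      Cmp = (\<lambda>(q, r, k) (p, q', h). (p, r, \<lambda>X\<in>I. \<lambda>x\<in>carrier (V p X). k X (h X x)))\<rparr>"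

definition presented_functor_cat where
  "presented_functor_cat C P = family_cat (Obj C) (presented_functors C P) FObj (nat_trans C)"


section \<open>Coherent functors, finitely presented modules and definable subcategories\<close>

definition Coh where
  "Coh u T = presented_functor_cat T (compacts u T)"

definition op_compacts :: "'u itself \<Rightarrow> ('o, 'm, 'z) preadd_cat_scheme \<Rightarrow> ('o, 'm, 'z) preadd_cat_scheme" where
  "op_compacts u T = op_preadd (full_subcat T (compacts u T))"

definition mod_compacts where
  "mod_compacts u T = presented_functor_cat (op_compacts u T) (compacts u T)"

definition restricted_yoneda :: "('o, 'm, 'z) preadd_cat_scheme \<Rightarrow> 'o \<Rightarrow> ('o, 'm, 'm) ab_functor" where
  "restricted_yoneda T X = \<lparr>FObj = (\<lambda>A. hom_grp T A X), FMor = (\<lambda>f g. Cmp T g f)\<rparr>"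

definition vanishes :: "('o, 'm, 'a) ab_functor \<Rightarrow> 'o \<Rightarrow> bool" where
  "vanishes F X \<longleftrightarrow> carrier (FObj F X) = {\<one>\<^bsub>FObj F X\<^esub>}"

definition definable :: "'u itself \<Rightarrow> ('o, 'm, 'z) preadd_cat_scheme \<Rightarrow> 'o set \<Rightarrow> bool" where
  "definable u T D \<longleftrightarrow> (\<exists>\<A> \<subseteq> Obj (Coh u T). D = {X \<in> Obj T. \<forall>F \<in> \<A>. vanishes F X})"

definition Ann_Coh :: "'u itself \<Rightarrow> ('o, 'm, 'z) preadd_cat_scheme \<Rightarrow> 'o set \<Rightarrow> ('o, 'm, 'm set) ab_functor set" where
  "Ann_Coh u T D = {F \<in> Obj (Coh u T). \<forall>X \<in> D. vanishes F X}"

definition S_mod :: "'u itself \<Rightarrow> ('o, 'm, 'z) preadd_cat_scheme \<Rightarrow> 'o set \<Rightarrow> ('o, 'm, 'm set) ab_functor set" where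
  "S_mod u T D = {G \<in> Obj (mod_compacts u T). \<forall>X \<in> D.
     \<forall>\<eta> \<in> nat_trans (op_compacts u T) G (restricted_yoneda T X).
       \<forall>A \<in> compacts u T. \<forall>x \<in> carrier (FObj G A). \<eta> A x = Zero T A X}"


section \<open>Positive primitive formulas and imaginaries\<close>

text \<open>
  The sorts are the objects of a small version \<open>K\<close> of the category of compact objects.  A pp formula
  has free variables of sorts \<open>free\<close>, existentially quantified variables of sorts \<open>bound\<close>, and a
  list of linear equations.  The equation \<open>(E, fs)\<close> of sort \<open>E\<close> is \<open>x\<^sub>0 f\<^sub>0 + x\<^sub>1 f\<^sub>1 + \<dots> = 0\<close>, where
  \<open>x\<^sub>0, x\<^sub>1, \<dots>\<close> are all the variables, free ones first, and \<open>f\<^sub>i\<close> is a morphism from \<open>E\<close> to the sort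
  of \<open>x\<^sub>i\<close>.
\<close>

record ('o, 'm) pp =
  free :: "'o list"
  bound :: "'o list"
  eqns :: "('o \<times> 'm list) list"

definition pp_formula :: "('o, 'm, 'z) preadd_cat_scheme \<Rightarrow> 'o set \<Rightarrow> ('o, 'm) pp \<Rightarrow> bool" where
  "pp_formula T K \<phi> \<longleftrightarrow> set (free \<phi>) \<subseteq> K \<and> set (bound \<phi>) \<subseteq> K \<and>
     (\<forall>(E, fs) \<in> set (eqns \<phi>). E \<in> K \<and> list_all2 (\<lambda>f A. f \<in> Hom T E A) fs (free \<phi> @ bound \<phi>))"

definition tuples :: "('o, 'm, 'z) preadd_cat_scheme \<Rightarrow> 'o list \<Rightarrow> 'o \<Rightarrow> 'm list set" where
  "tuples T As X = {xs. list_all2 (\<lambda>x A. x \<in> Hom T A X) xs As}"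

definition satisfies :: "('o, 'm, 'z) preadd_cat_scheme \<Rightarrow> 'o \<Rightarrow> 'm list \<Rightarrow> 'o \<times> 'm list \<Rightarrow> bool" where
  "satisfies T X xs = (\<lambda>(E, fs).
     finprod (hom_grp T E X) (\<lambda>i. Cmp T (xs ! i) (fs ! i)) {..<length fs} = Zero T E X)"

definition sol :: "('o, 'm, 'z) preadd_cat_scheme \<Rightarrow> ('o, 'm) pp \<Rightarrow> 'o \<Rightarrow> 'm list set" where
  "sol T \<phi> X = {xs \<in> tuples T (free \<phi>) X.
     \<exists>ys \<in> tuples T (bound \<phi>) X. \<forall>e \<in> set (eqns \<phi>). satisfies T X (xs @ ys) e}"

definition sol_grp :: "('o, 'm, 'z) preadd_cat_scheme \<Rightarrow> ('o, 'm) pp \<Rightarrow> 'o \<Rightarrow> 'm list monoid" where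
  "sol_grp T \<phi> X = \<lparr>carrier = sol T \<phi> X, monoid.mult = map2 (Add T), one = map (\<lambda>A. Zero T A X) (free \<phi>)\<rparr>"

definition pp_pairs :: "('o, 'm, 'z) preadd_cat_scheme \<Rightarrow> 'o set \<Rightarrow> (('o, 'm) pp \<times> ('o, 'm) pp) set" where
  "pp_pairs T K = {(\<phi>, \<psi>). pp_formula T K \<phi> \<and> pp_formula T K \<psi> \<and> free \<phi> = free \<psi> \<and>
     (\<forall>X \<in> Obj T. sol T \<psi> X \<subseteq> sol T \<phi> X)}"

definition pair_grp ::
  "('o, 'm, 'z) preadd_cat_scheme \<Rightarrow> ('o, 'm) pp \<times> ('o, 'm) pp \<Rightarrow> 'o \<Rightarrow> 'm list set monoid" where
  "pair_grp T = (\<lambda>(\<phi>, \<psi>) X. sol_grp T \<phi> X Mod sol T \<psi> X)"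

text \<open>
  Pp-definable maps that agree on every \<open>X\<close> are identified, so a morphism is represented by the
  family of homomorphisms \<open>\<phi>(X)/\<psi>(X) \<rightarrow> \<phi>'(X)/\<psi>'(X)\<close> which a pp formula \<open>\<rho>\<close> defines.  The formula
  \<open>\<rho>\<close> defines \<open>h X\<close> if the graph of \<open>h X\<close> is the set of pairs of cosets having representatives
  that satisfy \<open>\<rho>\<close>.
\<close>

definition pp_maps ::
  "('o, 'm, 'z) preadd_cat_scheme \<Rightarrow> 'o set \<Rightarrow> ('o, 'm) pp \<times> ('o, 'm) pp \<Rightarrow> ('o, 'm) pp \<times> ('o, 'm) pp
    \<Rightarrow> ('o \<Rightarrow> 'm list set \<Rightarrow> 'm list set) set" where
  "pp_maps T K p q =
     {h \<in> (\<Pi>\<^sub>E X \<in> Obj T. hom (pair_grp T p X) (pair_grp T q X) \<inter> extensional (carrier (pair_grp T p X))).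
        \<exists>\<rho>. pp_formula T K \<rho> \<and> free \<rho> = free (fst p) @ free (fst q) \<and>
          (\<forall>X \<in> Obj T. \<forall>c \<in> carrier (pair_grp T p X). \<forall>d \<in> carrier (pair_grp T q X).
             h X c = d \<longleftrightarrow> (\<exists>a \<in> c. \<exists>b \<in> d. a @ b \<in> sol T \<rho> X))}"

definition pp_imaginaries where
  "pp_imaginaries T K = family_cat (Obj T) (pp_pairs T K) (pair_grp T) (pp_maps T K)"

definition closed_pairs ::
  "('o, 'm, 'z) preadd_cat_scheme \<Rightarrow> 'o set \<Rightarrow> 'o set \<Rightarrow> (('o, 'm) pp \<times> ('o, 'm) pp) set" where
  "closed_pairs T K D = {(\<phi>, \<psi>) \<in> pp_pairs T K. \<forall>X \<in> D. sol T \<phi> X = sol T \<psi> X}"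

definition pp_imaginaries_on where
  "pp_imaginaries_on T K D = serre_quotient (pp_imaginaries T K) (closed_pairs T K D)"

end

theory Submission
  imports Defs
begin

text \<open>
  A Serre quotient is a localisation, so an equivalence of categories that matches two Serre
  subcategories induces an equivalence of the quotients, because it transports kernels and cokernels.

  For \<open>f : A \<rightarrow> B\<close> between compact objects complete \<open>f\<close> to a triangle \<open>A \<rightarrow> B \<rightarrow> D \<rightarrow> \<Sigma> A\<close> with maps
  \<open>f, g, h\<close>.  By exactness the functor \<open>X \<mapsto> (coker y f, y X) = ker ((B, X) \<rightarrow> (A, X))\<close> is isomorphic to
  the cokernel of \<open>(h, -) : (\<Sigma> A, -) \<rightarrow> (D, -)\<close>, hence coherent.  By the third axiom of triangulated
  categories a map between two modules, given by a map between the objects \<open>B\<close>, extends to the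
  triangles and gives a map between the objects \<open>D\<close> in the same direction, and conversely; the
  indeterminacies correspond by exactness.  This is a duality between finitely presented modules and
  coherent functors, and it takes \<open>S_mod\<close> to \<open>Ann_Coh\<close>.

  Imposing a linear equation on a tuple in a compact object amounts to passing to a cone.  Hence every
  pp formula \<open>\<phi>\<close> has a free realisation: a compact object \<open>D\<close> with a tuple \<open>c\<close> such that \<open>\<phi>(X)\<close>
  consists of the tuples \<open>z c\<close> with \<open>z : D \<rightarrow> X\<close>.  Therefore the pp pairs are, up to isomorphism, the
  coherent functors, and the pp-definable maps between them are the natural transformations.
\<close>

section \<open>Categories and functors\<close>

text \<open>Presentations, cones and free realisations are choices, and they are not functorial: the
  third axiom gives a map of cones that is not unique. Functors between the three categories are
  therefore not written down directly. Instead a witness records all choices made for a pair of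
  objects, and two morphisms are related when common maps between the chosen data induce both.
  Existence of fill-ins makes this relation total in both directions, and exactness makes it
  single-valued in both directions. Such a relation transports universal properties, hence zero
  objects, kernels and cokernels, and with them the class of morphisms that the Serre quotient
  inverts. Two further points shape the details. The shift is an equivalence and perhaps not an
  automorphism, so a given map is the last one of a triangle only after its target has been replaced
  by an isomorphic object. And the sorts are a small set \<open>K\<close> that meets every
  isomorphism class of compact objects but is not assumed closed under sums and cones, so a formula
  over \<open>K\<close> is reached from an arbitrary compact object by moving along an
  isomorphism.\<close>

lemma HomI: "f \<in> Mor C \<Longrightarrow> f \<in> Hom C (Src C f) (Tgt C f)"
  by (simp add: Hom_def)

lemma HomD:
  assumes "f \<in> Hom C A B"
  shows "f \<in> Mor C" "Src C f = A" "Tgt C f = B"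
  using assms by (auto simp: Hom_def)

lemma (in category) Hom_Obj:
  assumes "f \<in> Hom C A B"
  shows "A \<in> Obj C" "B \<in> Obj C"
  using assms Src_in_Obj Tgt_in_Obj by (auto simp: Hom_def)

lemma (in category) Cmp_assoc_middle:
  assumes "f \<in> Hom C A B" "g \<in> Hom C B D" "h \<in> Hom C D E" "k \<in> Hom C E F"
  shows "(k \<cdot> h) \<cdot> (g \<cdot> f) = k \<cdot> ((h \<cdot> g) \<cdot> f)"
  using Cmp_assoc[OF assms(1) assms(2) assms(3)] Cmp_assoc[OF Cmp_in_Hom[OF assms(1,2)] assms(3,4)]
  by simp

lemma op_cat_simps [simp]:
  "Obj (op_cat C) = Obj C" "Mor (op_cat C) = Mor C" "Src (op_cat C) = Tgt C"
  "Tgt (op_cat C) = Src C" "Ident (op_cat C) = Ident C" "Cmp (op_cat C) g f = Cmp C f g"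
  "Hom (op_cat C) A B = Hom C B A" "op_cat (op_cat C) = C"
  by (auto simp: op_cat_def Hom_def)

lemma category_op_cat:
  assumes "category C"
  shows "category (op_cat C)"
proof -
  interpret category C by (fact assms)
  show ?thesis
    by unfold_locales
      (auto simp: Src_in_Obj Tgt_in_Obj Ident_in_Hom Cmp_Ident Ident_Cmp Cmp_assoc intro: Cmp_in_Hom)
qed

lemma iso_morI:
  assumes "f \<in> Hom C A B" "g \<in> Hom C B A" "g \<cdot>\<^bsub>C\<^esub> f = Ident C A" "f \<cdot>\<^bsub>C\<^esub> g = Ident C B"
  shows "iso_mor C f"
  using assms unfolding iso_mor_def Hom_def by auto

lemma iso_morE:
  assumes "iso_mor C f" "f \<in> Hom C A B"
  obtains g where "g \<in> Hom C B A" "g \<cdot>\<^bsub>C\<^esub> f = Ident C A" "f \<cdot>\<^bsub>C\<^esub> g = Ident C B"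
  using assms unfolding iso_mor_def Hom_def by auto

lemma iso_mor_op_cat [simp]: "iso_mor (op_cat C) f \<longleftrightarrow> iso_mor C f"
  unfolding iso_mor_def by auto

text \<open>The choice makes inversion a total function of the morphism, as the recursive evaluation
  of words in a localisation requires.\<close>

definition inv_mor :: "('o, 'm, 'z) cat_scheme \<Rightarrow> 'm \<Rightarrow> 'm" where
  "inv_mor C f = (SOME g. g \<in> Hom C (Tgt C f) (Src C f) \<and>
     g \<cdot>\<^bsub>C\<^esub> f = Ident C (Src C f) \<and> f \<cdot>\<^bsub>C\<^esub> g = Ident C (Tgt C f))"

lemma inv_mor:
  assumes "iso_mor C f" "f \<in> Hom C A B"
  shows "inv_mor C f \<in> Hom C B A" "inv_mor C f \<cdot>\<^bsub>C\<^esub> f = Ident C A" "f \<cdot>\<^bsub>C\<^esub> inv_mor C f = Ident C B"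
proof -
  have "\<exists>g. g \<in> Hom C (Tgt C f) (Src C f) \<and>
     g \<cdot>\<^bsub>C\<^esub> f = Ident C (Src C f) \<and> f \<cdot>\<^bsub>C\<^esub> g = Ident C (Tgt C f)"
    using assms(1) unfolding iso_mor_def by blast
  from someI_ex[OF this, folded inv_mor_def] assms(2)
  show "inv_mor C f \<in> Hom C B A" "inv_mor C f \<cdot>\<^bsub>C\<^esub> f = Ident C A" "f \<cdot>\<^bsub>C\<^esub> inv_mor C f = Ident C B"
    by (auto simp: Hom_def)
qed

lemma iso_mor_inv_mor:
  assumes "iso_mor C f" "f \<in> Hom C A B"
  shows "iso_mor C (inv_mor C f)"
  using inv_mor[OF assms] assms(2) by (blast intro: iso_morI)

lemma is_functorI:
  assumes "category C" "category D" "\<And>A. A \<in> Obj C \<Longrightarrow> Fo A \<in> Obj D"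
    and "\<And>f A B. f \<in> Hom C A B \<Longrightarrow> Fm f \<in> Hom D (Fo A) (Fo B)"
    and "\<And>A. A \<in> Obj C \<Longrightarrow> Fm (Ident C A) = Ident D (Fo A)"
    and "\<And>f g A B E. f \<in> Hom C A B \<Longrightarrow> g \<in> Hom C B E \<Longrightarrow> Fm (g \<cdot>\<^bsub>C\<^esub> f) = Fm g \<cdot>\<^bsub>D\<^esub> Fm f"
  shows "is_functor C D Fo Fm"
  unfolding is_functor_def
proof (intro conjI ballI impI)
  show "Fm f \<in> Hom D (Fo (Src C f)) (Fo (Tgt C f))" if "f \<in> Mor C" for f
    using assms(4) HomI[OF that] .
  fix f g assume "f \<in> Mor C" "g \<in> Mor C" "Tgt C f = Src C g"
  then show "Fm (g \<cdot>\<^bsub>C\<^esub> f) = Fm g \<cdot>\<^bsub>D\<^esub> Fm f"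
    using assms(6)[of f "Src C f" "Tgt C f" g "Tgt C g"] by (simp add: Hom_def)
qed (fact assms(1-3,5))+

lemma is_functorD:
  assumes "is_functor C D Fo Fm"
  shows "category C" "category D" "A \<in> Obj C \<Longrightarrow> Fo A \<in> Obj D"
    and "f \<in> Hom C A B \<Longrightarrow> Fm f \<in> Hom D (Fo A) (Fo B)"
    and "A \<in> Obj C \<Longrightarrow> Fm (Ident C A) = Ident D (Fo A)"
    and "f \<in> Hom C A B \<Longrightarrow> g \<in> Hom C B E \<Longrightarrow> Fm (g \<cdot>\<^bsub>C\<^esub> f) = Fm g \<cdot>\<^bsub>D\<^esub> Fm f"
  using assms unfolding is_functor_def Hom_def by auto

lemma functor_id: "category C \<Longrightarrow> is_functor C C id id"
  by (rule is_functorI) auto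

lemma functor_comp:
  assumes "is_functor C D Fo Fm" "is_functor D E Go Gm"
  shows "is_functor C E (Go \<circ> Fo) (Gm \<circ> Fm)"
proof (rule is_functorI)
  note F = is_functorD[OF assms(1)] and G = is_functorD[OF assms(2)]
  show "category C" "category E" by (fact F(1) G(2))+
  fix A assume A: "A \<in> Obj C"
  show "(Go \<circ> Fo) A \<in> Obj E" "(Gm \<circ> Fm) (Ident C A) = Ident E ((Go \<circ> Fo) A)"
    using A F(3,5) G(3,5) by auto
next
  note F = is_functorD[OF assms(1)] and G = is_functorD[OF assms(2)]
  fix f A B assume f: "f \<in> Hom C A B"
  then show "(Gm \<circ> Fm) f \<in> Hom E ((Go \<circ> Fo) A) ((Go \<circ> Fo) B)"
    using F(4) G(4) by simp
  fix g H assume g: "g \<in> Hom C B H"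
  show "(Gm \<circ> Fm) (g \<cdot>\<^bsub>C\<^esub> f) = (Gm \<circ> Fm) g \<cdot>\<^bsub>E\<^esub> (Gm \<circ> Fm) f"
    using F(6)[OF f g] G(6)[OF F(4)[OF f] F(4)[OF g]] by simp
qed

lemma functor_op_cat:
  assumes "is_functor C D Fo Fm"
  shows "is_functor (op_cat C) (op_cat D) Fo Fm"
  using is_functorD[OF assms] by (intro is_functorI category_op_cat) auto

lemma functor_iso_mor:
  assumes "is_functor C D Fo Fm" "f \<in> Hom C A B" "iso_mor C f"
  shows "iso_mor D (Fm f)"
proof -
  note F = is_functorD[OF assms(1)]
  obtain g where g: "g \<in> Hom C B A" "g \<cdot>\<^bsub>C\<^esub> f = Ident C A" "f \<cdot>\<^bsub>C\<^esub> g = Ident C B"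
    using iso_morE[OF assms(3,2)] by blast
  have AB: "A \<in> Obj C" "B \<in> Obj C"
    using category.Hom_Obj[OF F(1) assms(2)] by auto
  have "Fm g \<cdot>\<^bsub>D\<^esub> Fm f = Ident D (Fo A)" "Fm f \<cdot>\<^bsub>D\<^esub> Fm g = Ident D (Fo B)"
    using g AB F(5) F(6)[OF g(1) assms(2)] F(6)[OF assms(2) g(1)] by auto
  then show ?thesis
    by (rule iso_morI[OF F(4)[OF assms(2)] F(4)[OF g(1)]])
qed

lemma natural_isoI:
  assumes "\<And>A. A \<in> Obj C \<Longrightarrow> \<tau> A \<in> Hom D (Fo A) (Go A)" "\<And>A. A \<in> Obj C \<Longrightarrow> iso_mor D (\<tau> A)"
    and "\<And>f A B. f \<in> Hom C A B \<Longrightarrow> \<tau> B \<cdot>\<^bsub>D\<^esub> Fm f = Gm f \<cdot>\<^bsub>D\<^esub> \<tau> A"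
  shows "natural_iso C D Fo Fm Go Gm \<tau>"
  unfolding natural_iso_def using assms(1,2) assms(3)[OF HomI] by auto

lemma natural_isoD:
  assumes "natural_iso C D Fo Fm Go Gm \<tau>"
  shows "A \<in> Obj C \<Longrightarrow> \<tau> A \<in> Hom D (Fo A) (Go A)" "A \<in> Obj C \<Longrightarrow> iso_mor D (\<tau> A)"
    and "f \<in> Hom C A B \<Longrightarrow> \<tau> B \<cdot>\<^bsub>D\<^esub> Fm f = Gm f \<cdot>\<^bsub>D\<^esub> \<tau> A"
  using assms unfolding natural_iso_def Hom_def by auto

lemma natural_iso_trans:
  assumes D: "category D" and F: "is_functor C D Fo Fm" and G: "is_functor C D Go Gm"
    and H: "is_functor C D Ho Hm"
    and s: "natural_iso C D Fo Fm Go Gm \<sigma>" and t: "natural_iso C D Go Gm Ho Hm \<tau>"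
  shows "natural_iso C D Fo Fm Ho Hm (\<lambda>A. \<tau> A \<cdot>\<^bsub>D\<^esub> \<sigma> A)"
proof (rule natural_isoI)
  interpret D: category D by (fact D)
  note s = natural_isoD[OF s] and t = natural_isoD[OF t]
  fix A assume A: "A \<in> Obj C"
  show m: "\<tau> A \<cdot>\<^bsub>D\<^esub> \<sigma> A \<in> Hom D (Fo A) (Ho A)"
    by (rule D.Cmp_in_Hom[OF s(1)[OF A] t(1)[OF A]])
  note i = inv_mor[OF s(2)[OF A] s(1)[OF A]] and j = inv_mor[OF t(2)[OF A] t(1)[OF A]]
  have "(inv_mor D (\<sigma> A) \<cdot>\<^bsub>D\<^esub> inv_mor D (\<tau> A)) \<cdot>\<^bsub>D\<^esub> (\<tau> A \<cdot>\<^bsub>D\<^esub> \<sigma> A)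
      = inv_mor D (\<sigma> A) \<cdot>\<^bsub>D\<^esub> ((inv_mor D (\<tau> A) \<cdot>\<^bsub>D\<^esub> \<tau> A) \<cdot>\<^bsub>D\<^esub> \<sigma> A)"
    by (rule D.Cmp_assoc_middle[OF s(1)[OF A] t(1)[OF A] j(1) i(1)])
  then have 1: "(inv_mor D (\<sigma> A) \<cdot>\<^bsub>D\<^esub> inv_mor D (\<tau> A)) \<cdot>\<^bsub>D\<^esub> (\<tau> A \<cdot>\<^bsub>D\<^esub> \<sigma> A) = Ident D (Fo A)"
    using i j D.Ident_Cmp[OF s(1)[OF A]] by simp
  have "(\<tau> A \<cdot>\<^bsub>D\<^esub> \<sigma> A) \<cdot>\<^bsub>D\<^esub> (inv_mor D (\<sigma> A) \<cdot>\<^bsub>D\<^esub> inv_mor D (\<tau> A))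
      = \<tau> A \<cdot>\<^bsub>D\<^esub> ((\<sigma> A \<cdot>\<^bsub>D\<^esub> inv_mor D (\<sigma> A)) \<cdot>\<^bsub>D\<^esub> inv_mor D (\<tau> A))"
    by (rule D.Cmp_assoc_middle[OF j(1) i(1) s(1)[OF A] t(1)[OF A]])
  then have 2: "(\<tau> A \<cdot>\<^bsub>D\<^esub> \<sigma> A) \<cdot>\<^bsub>D\<^esub> (inv_mor D (\<sigma> A) \<cdot>\<^bsub>D\<^esub> inv_mor D (\<tau> A)) = Ident D (Ho A)"
    using i j D.Ident_Cmp[OF j(1)] by simp
  show "iso_mor D (\<tau> A \<cdot>\<^bsub>D\<^esub> \<sigma> A)"
    by (rule iso_morI[OF m D.Cmp_in_Hom[OF j(1) i(1)] 1 2])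
next
  interpret D: category D by (fact D)
  note s = natural_isoD[OF s] and t = natural_isoD[OF t]
  fix f A B assume f: "f \<in> Hom C A B"
  then have A: "A \<in> Obj C" and B: "B \<in> Obj C"
    using category.Hom_Obj[OF is_functorD(1)[OF F]] by auto
  note Ff = is_functorD(4)[OF F f] and Gf = is_functorD(4)[OF G f] and Hf = is_functorD(4)[OF H f]
  show "\<tau> B \<cdot>\<^bsub>D\<^esub> \<sigma> B \<cdot>\<^bsub>D\<^esub> Fm f = Hm f \<cdot>\<^bsub>D\<^esub> (\<tau> A \<cdot>\<^bsub>D\<^esub> \<sigma> A)"
    using D.Cmp_assoc[OF Ff s(1)[OF B] t(1)[OF B]] D.Cmp_assoc[OF s(1)[OF A] Gf t(1)[OF B]]
      D.Cmp_assoc[OF s(1)[OF A] t(1)[OF A] Hf] s(3)[OF f] t(3)[OF f] by simp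
qed

lemma natural_iso_sym:
  assumes D: "category D" and F: "is_functor C D Fo Fm" and G: "is_functor C D Go Gm"
    and t: "natural_iso C D Fo Fm Go Gm \<tau>"
  shows "natural_iso C D Go Gm Fo Fm (\<lambda>A. inv_mor D (\<tau> A))"
proof (rule natural_isoI)
  note t = natural_isoD[OF t]
  fix A assume A: "A \<in> Obj C"
  show "inv_mor D (\<tau> A) \<in> Hom D (Go A) (Fo A)" "iso_mor D (inv_mor D (\<tau> A))"
    using inv_mor[OF t(2)[OF A] t(1)[OF A]] iso_mor_inv_mor[OF t(2)[OF A] t(1)[OF A]] by auto
next
  interpret D: category D by (fact D)
  note t = natural_isoD[OF t]
  fix f A B assume f: "f \<in> Hom C A B"
  then have A: "A \<in> Obj C" and B: "B \<in> Obj C"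
    using category.Hom_Obj[OF is_functorD(1)[OF F]] by auto
  note i = inv_mor[OF t(2)[OF A] t(1)[OF A]] and j = inv_mor[OF t(2)[OF B] t(1)[OF B]]
  note Ff = is_functorD(4)[OF F f] and Gf = is_functorD(4)[OF G f]
  have "inv_mor D (\<tau> B) \<cdot>\<^bsub>D\<^esub> Gm f = inv_mor D (\<tau> B) \<cdot>\<^bsub>D\<^esub> (Gm f \<cdot>\<^bsub>D\<^esub> (\<tau> A \<cdot>\<^bsub>D\<^esub> inv_mor D (\<tau> A)))"
    using i D.Cmp_Ident[OF Gf] by simp
  also have "\<dots> = inv_mor D (\<tau> B) \<cdot>\<^bsub>D\<^esub> ((\<tau> B \<cdot>\<^bsub>D\<^esub> Fm f) \<cdot>\<^bsub>D\<^esub> inv_mor D (\<tau> A))"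
    using D.Cmp_assoc[OF i(1) t(1)[OF A] Gf] t(3)[OF f] by simp
  also have "\<dots> = (inv_mor D (\<tau> B) \<cdot>\<^bsub>D\<^esub> \<tau> B) \<cdot>\<^bsub>D\<^esub> (Fm f \<cdot>\<^bsub>D\<^esub> inv_mor D (\<tau> A))"
    by (rule D.Cmp_assoc_middle[OF i(1) Ff t(1)[OF B] j(1), symmetric])
  also have "\<dots> = Fm f \<cdot>\<^bsub>D\<^esub> inv_mor D (\<tau> A)"
    using j D.Ident_Cmp[OF D.Cmp_in_Hom[OF i(1) Ff]] by simp
  finally show "inv_mor D (\<tau> B) \<cdot>\<^bsub>D\<^esub> Gm f = Fm f \<cdot>\<^bsub>D\<^esub> inv_mor D (\<tau> A)" .
qed

lemma natural_iso_whisker_right: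
  assumes "is_functor B C Eo Em" "natural_iso C D Fo Fm Go Gm \<tau>"
  shows "natural_iso B D (Fo \<circ> Eo) (Fm \<circ> Em) (Go \<circ> Eo) (Gm \<circ> Em) (\<tau> \<circ> Eo)"
  using is_functorD[OF assms(1)] natural_isoD[OF assms(2)] by (intro natural_isoI) auto

lemma natural_iso_whisker_left:
  assumes F: "is_functor C D Fo Fm" and G: "is_functor C D Go Gm"
    and H: "is_functor D E Ho Hm" and t: "natural_iso C D Fo Fm Go Gm \<tau>"
  shows "natural_iso C E (Ho \<circ> Fo) (Hm \<circ> Fm) (Ho \<circ> Go) (Hm \<circ> Gm) (Hm \<circ> \<tau>)"
proof (rule natural_isoI)
  note t = natural_isoD[OF t] and H = is_functorD[OF H]
  fix f A B assume f: "f \<in> Hom C A B"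
  then have A: "A \<in> Obj C" and B: "B \<in> Obj C"
    using category.Hom_Obj[OF is_functorD(1)[OF F]] by auto
  show "(Hm \<circ> \<tau>) B \<cdot>\<^bsub>E\<^esub> (Hm \<circ> Fm) f = (Hm \<circ> Gm) f \<cdot>\<^bsub>E\<^esub> (Hm \<circ> \<tau>) A"
    using H(6)[OF is_functorD(4)[OF F f] t(1)[OF B]] H(6)[OF t(1)[OF A] is_functorD(4)[OF G f]]
      t(3)[OF f] by simp
next
  note t = natural_isoD[OF t] and H' = is_functorD[OF H]
  fix A assume A: "A \<in> Obj C"
  show "(Hm \<circ> \<tau>) A \<in> Hom E ((Ho \<circ> Fo) A) ((Ho \<circ> Go) A)" "iso_mor E ((Hm \<circ> \<tau>) A)"
    using H'(4)[OF t(1)[OF A]] functor_iso_mor[OF H t(1)[OF A] t(2)[OF A]] by auto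
qed

lemma equivalent_categoriesI:
  assumes "is_functor C D Fo Fm" "is_functor D C Go Gm"
    and "natural_iso C C id id (Go \<circ> Fo) (Gm \<circ> Fm) \<eta>"
    and "natural_iso D D (Fo \<circ> Go) (Fm \<circ> Gm) id id \<epsilon>"
  shows "equivalent_categories C D"
  using assms unfolding equivalent_categories_def cat_equivalence_def by blast

lemma equivalent_categoriesE:
  assumes "equivalent_categories C D"
  obtains Fo Fm Go Gm \<eta> \<epsilon> where "is_functor C D Fo Fm" "is_functor D C Go Gm"
    "natural_iso C C id id (Go \<circ> Fo) (Gm \<circ> Fm) \<eta>" "natural_iso D D (Fo \<circ> Go) (Fm \<circ> Gm) id id \<epsilon>"
  using assms unfolding equivalent_categories_def cat_equivalence_def by blast

text \<open>The unit of the composite is \<open>\<eta>\<close> followed by \<open>\<eta>'\<close>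
  conjugated by the first equivalence; the counit is formed in the same way on the other
  side.\<close>

lemma equivalent_categories_trans:
  assumes "equivalent_categories C D" "equivalent_categories D E"
  shows "equivalent_categories C E"
proof -
  obtain Fo Fm Go Gm \<eta> \<epsilon> where F: "is_functor C D Fo Fm" and G: "is_functor D C Go Gm"
    and e: "natural_iso C C id id (Go \<circ> Fo) (Gm \<circ> Fm) \<eta>" "natural_iso D D (Fo \<circ> Go) (Fm \<circ> Gm) id id \<epsilon>"
    using equivalent_categoriesE[OF assms(1)] by blast
  obtain Fo' Fm' Go' Gm' \<eta>' \<epsilon>' where F': "is_functor D E Fo' Fm'" and G': "is_functor E D Go' Gm'"
    and e': "natural_iso D D id id (Go' \<circ> Fo') (Gm' \<circ> Fm') \<eta>'"
      "natural_iso E E (Fo' \<circ> Go') (Fm' \<circ> Gm') id id \<epsilon>'"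
    using equivalent_categoriesE[OF assms(2)] by blast
  have C: "category C" and D: "category D" and E: "category E"
    using is_functorD[OF F] is_functorD[OF F'] by auto
  note FF = functor_comp[OF F F'] and GG = functor_comp[OF G' G]
  have "natural_iso C C (Go \<circ> Fo) (Gm \<circ> Fm) ((Go \<circ> Go') \<circ> (Fo' \<circ> Fo)) ((Gm \<circ> Gm') \<circ> (Fm' \<circ> Fm)) (Gm \<circ> (\<eta>' \<circ> Fo))"
    using natural_iso_whisker_left[OF functor_comp[OF F functor_id[OF D]]
        functor_comp[OF F functor_comp[OF F' G']] G natural_iso_whisker_right[OF F e'(1)]]
    by (simp only: o_assoc id_comp comp_id)
  from natural_iso_trans[OF C functor_id[OF C] functor_comp[OF F G] functor_comp[OF FF GG] e(1) this]
  have 1: "natural_iso C C id id ((Go \<circ> Go') \<circ> (Fo' \<circ> Fo)) ((Gm \<circ> Gm') \<circ> (Fm' \<circ> Fm))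
      (\<lambda>A. (Gm \<circ> (\<eta>' \<circ> Fo)) A \<cdot>\<^bsub>C\<^esub> \<eta> A)" .
  have "natural_iso E E ((Fo' \<circ> Fo) \<circ> (Go \<circ> Go')) ((Fm' \<circ> Fm) \<circ> (Gm \<circ> Gm')) (Fo' \<circ> Go') (Fm' \<circ> Gm') (Fm' \<circ> (\<epsilon> \<circ> Go'))"
    using natural_iso_whisker_left[OF functor_comp[OF G' functor_comp[OF G F]]
        functor_comp[OF G' functor_id[OF D]] F' natural_iso_whisker_right[OF G' e(2)]]
    by (simp only: o_assoc id_comp comp_id)
  from natural_iso_trans[OF E functor_comp[OF GG FF] functor_comp[OF G' F'] functor_id[OF E] this e'(2)]
  show ?thesis
    by (rule equivalent_categoriesI[OF FF GG 1])
qed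

section \<open>Localisations\<close>

lemma path_append: "path C W X p Y \<Longrightarrow> path C W Y q Z \<Longrightarrow> path C W X (p @ q) Z"
  by (induction rule: path.induct) (auto intro: path.intros)

lemma (in category) path_Obj:
  assumes "path C W X p Y"
  shows "X \<in> Obj C" "Y \<in> Obj C"
  using assms by (induction rule: path.induct) (auto dest: Hom_Obj)

lemma path_eq_path:
  assumes "category C" "path_eq C W X Y p q"
  shows "path C W X p Y" "path C W X q Y"
proof -
  interpret category C by (fact assms)
  have "path C W X p Y \<and> path C W X q Y"
    using assms(2)
  proof (induction rule: path_eq.induct)
    case (path_eq_Cmp f X Y g Z)
    then show ?case
      using Hom_Obj(2)[OF path_eq_Cmp(2)] Cmp_in_Hom[OF path_eq_Cmp] by (auto intro!: path.intros)
  next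
    case (path_eq_Ident X)
    then show ?case using Ident_in_Hom by (auto intro!: path.intros)
  next
    case (path_eq_Fwd_Bwd s X Y)
    then show ?case using Hom_Obj by (auto intro!: path.intros)
  next
    case (path_eq_Bwd_Fwd s X Y)
    then show ?case using Hom_Obj by (auto intro!: path.intros)
  qed (auto intro: path_append)
  then show "path C W X p Y" "path C W X q Y" by auto
qed

lemma path_eq_append:
  assumes "category C" "path_eq C W X Y p p'" "path_eq C W Y Z q q'"
  shows "path_eq C W X Z (p @ q) (p' @ q')"
proof -
  interpret category C by (fact assms)
  note p = path_eq_path[OF assms(1,2)] and q = path_eq_path[OF assms(1,3)]
  have "path_eq C W X Z ([] @ p @ q) ([] @ p' @ q)"
    by (rule path_eq_cong[OF path_Nil assms(2) q(1)]) (rule path_Obj[OF p(1)])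
  moreover have "path_eq C W X Z (p' @ q @ []) (p' @ q' @ [])"
    by (rule path_eq_cong[OF p(2) assms(3) path_Nil]) (rule path_Obj[OF q(1)])
  ultimately show ?thesis by (auto intro: path_eq_trans)
qed

definition word_class :: "('o, 'm, 'z) cat_scheme \<Rightarrow> 'm set \<Rightarrow> 'o \<Rightarrow> 'o \<Rightarrow> 'm letter list
    \<Rightarrow> 'o \<times> 'o \<times> 'm letter list set" where
  "word_class C W X Y p = (X, Y, {q. path_eq C W X Y p q})"

lemma word_class_eqI: "path_eq C W X Y p q \<Longrightarrow> word_class C W X Y p = word_class C W X Y q"
  unfolding word_class_def by (auto intro: path_eq_trans path_eq_sym)

lemma localisation_simps [simp]: "Obj (localisation C W) = Obj C"
  "Ident (localisation C W) X = word_class C W X X []"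
  by (auto simp: localisation_def word_class_def)

lemma Hom_localisation:
  "Hom (localisation C W) X Y = {word_class C W X Y p | p. path C W X p Y}"
  unfolding Hom_def localisation_def word_class_def by auto

lemma Cmp_word_class:
  assumes "category C" "path C W X p Y" "path C W Y q Z"
  shows "word_class C W Y Z q \<cdot>\<^bsub>localisation C W\<^esub> word_class C W X Y p = word_class C W X Z (p @ q)"
proof -
  have "path_eq C W X Z (p @ q) r"
    if "path_eq C W X Y p p'" "path_eq C W Y Z q q'" "path_eq C W X Z (p' @ q') r" for p' q' r
    by (rule path_eq_trans[OF path_eq_append[OF assms(1) that(1,2)] that(3)])
  moreover have "\<exists>p'. path_eq C W X Y p p' \<and> (\<exists>q'. path_eq C W Y Z q q' \<and> path_eq C W X Z (p' @ q') r)"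
    if "path_eq C W X Z (p @ q) r" for r
    using that assms by (blast intro: path_eq_refl)
  ultimately show ?thesis
    unfolding word_class_def localisation_def by auto
qed

lemma category_localisation:
  assumes "category C"
  shows "category (localisation C W)"
proof -
  interpret category C by (fact assms)
  note [simp] = Cmp_word_class[OF assms]
  show ?thesis
  proof
    fix f assume "f \<in> Mor (localisation C W)"
    then obtain X Y p where "f = (X, Y, {q. path_eq C W X Y p q})" "path C W X p Y"
      by (auto simp: localisation_def)
    then show "Src (localisation C W) f \<in> Obj (localisation C W)"
      "Tgt (localisation C W) f \<in> Obj (localisation C W)"
      using path_Obj by (auto simp: localisation_def)
  next
    fix A assume "A \<in> Obj (localisation C W)"
    then show "Ident (localisation C W) A \<in> Hom (localisation C W) A A"
      by (auto simp: Hom_localisation intro: path_Nil)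
  next
    fix f g A B D assume "f \<in> Hom (localisation C W) A B" "g \<in> Hom (localisation C W) B D"
    then show "g \<cdot>\<^bsub>localisation C W\<^esub> f \<in> Hom (localisation C W) A D"
      unfolding Hom_localisation by (auto intro: path_append)
  next
    fix f A B assume "f \<in> Hom (localisation C W) A B"
    then obtain p where p: "f = word_class C W A B p" "path C W A p B"
      by (auto simp: Hom_localisation)
    then show "f \<cdot>\<^bsub>localisation C W\<^esub> Ident (localisation C W) A = f"
      "Ident (localisation C W) B \<cdot>\<^bsub>localisation C W\<^esub> f = f"
      using path_Obj[OF p(2)] by (auto simp: path_Nil)
  next
    fix f g h A B D E
    assume "f \<in> Hom (localisation C W) A B" "g \<in> Hom (localisation C W) B D"
      "h \<in> Hom (localisation C W) D E"
    then show "h \<cdot>\<^bsub>localisation C W\<^esub> (g \<cdot>\<^bsub>localisation C W\<^esub> f)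
        = (h \<cdot>\<^bsub>localisation C W\<^esub> g) \<cdot>\<^bsub>localisation C W\<^esub> f"
      unfolding Hom_localisation by (auto simp: path_append)
  qed
qed

definition loc_mor :: "('o, 'm, 'z) cat_scheme \<Rightarrow> 'm set \<Rightarrow> 'm \<Rightarrow> 'o \<times> 'o \<times> 'm letter list set" where
  "loc_mor C W f = word_class C W (Src C f) (Tgt C f) [Fwd f]"

lemma loc_mor: "f \<in> Hom C X Y \<Longrightarrow> loc_mor C W f = word_class C W X Y [Fwd f]"
  by (simp add: loc_mor_def Hom_def)

lemma loc_mor_functor:
  assumes "category C"
  shows "is_functor C (localisation C W) id (loc_mor C W)"
proof -
  interpret category C by (fact assms)
  have path1: "path C W A [Fwd f] B" if "f \<in> Hom C A B" for f A B
    using that Hom_Obj by (auto intro!: path.intros)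
  show ?thesis
  proof (rule is_functorI)
    fix f g A B E assume f: "f \<in> Hom C A B" and g: "g \<in> Hom C B E"
    show "loc_mor C W (g \<cdot>\<^bsub>C\<^esub> f) = loc_mor C W g \<cdot>\<^bsub>localisation C W\<^esub> loc_mor C W f"
      using word_class_eqI[OF path_eq_Cmp[OF f g]] Cmp_word_class[OF assms path1[OF f] path1[OF g]]
      by (simp add: loc_mor[OF f] loc_mor[OF g] loc_mor[OF Cmp_in_Hom[OF f g]])
  next
    fix A assume "A \<in> Obj C"
    then show "loc_mor C W (Ident C A) = Ident (localisation C W) (id A)"
      using word_class_eqI[OF path_eq_Ident] by (simp add: loc_mor[OF Ident_in_Hom])
  next
    fix f A B assume f: "f \<in> Hom C A B"
    then show "loc_mor C W f \<in> Hom (localisation C W) (id A) (id B)"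
      using path1 by (auto simp: loc_mor[OF f] Hom_localisation)
  qed (use assms category_localisation in auto)
qed

lemma loc_mor_inverse:
  assumes "category C" "s \<in> W" "s \<in> Hom C X Y"
  shows "word_class C W Y X [Bwd s] \<in> Hom (localisation C W) Y X"
    and "word_class C W Y X [Bwd s] \<cdot>\<^bsub>localisation C W\<^esub> loc_mor C W s = Ident (localisation C W) X"
    and "loc_mor C W s \<cdot>\<^bsub>localisation C W\<^esub> word_class C W Y X [Bwd s] = Ident (localisation C W) Y"
proof -
  interpret category C by (fact assms)
  have p: "path C W X [Fwd s] Y" "path C W Y [Bwd s] X"
    using assms Hom_Obj by (auto intro!: path.intros)
  then show "word_class C W Y X [Bwd s] \<in> Hom (localisation C W) Y X"
    by (auto simp: Hom_localisation)
  show "word_class C W Y X [Bwd s] \<cdot>\<^bsub>localisation C W\<^esub> loc_mor C W s = Ident (localisation C W) X"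
    "loc_mor C W s \<cdot>\<^bsub>localisation C W\<^esub> word_class C W Y X [Bwd s] = Ident (localisation C W) Y"
    using word_class_eqI[OF path_eq_Fwd_Bwd[OF assms(2,3)]] word_class_eqI[OF path_eq_Bwd_Fwd[OF assms(2,3)]]
      Cmp_word_class[OF assms(1) p] Cmp_word_class[OF assms(1) p(2,1)]
    by (simp_all add: loc_mor[OF assms(3)])
qed

lemma loc_mor_iso:
  assumes "category C" "s \<in> W" "s \<in> Hom C X Y"
  shows "iso_mor (localisation C W) (loc_mor C W s)"
proof (rule iso_morI)
  show "loc_mor C W s \<in> Hom (localisation C W) X Y"
    using is_functorD(4)[OF loc_mor_functor[OF assms(1)] assms(3)] by simp
qed (fact loc_mor_inverse[OF assms])+

section \<open>The universal property of a localisation\<close>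

primrec word_value :: "('o, 'm, 'z) cat_scheme \<Rightarrow> ('n \<Rightarrow> 'm) \<Rightarrow> 'm \<Rightarrow> 'n letter list \<Rightarrow> 'm" where
  "word_value E Fm e [] = e"
| "word_value E Fm e (l # p) =
     word_value E Fm e p \<cdot>\<^bsub>E\<^esub> (case l of Fwd f \<Rightarrow> Fm f | Bwd s \<Rightarrow> inv_mor E (Fm s))"

locale inverting_functor =
  fixes C :: "('o1, 'm1, 'z1) cat_scheme" and E :: "('o2, 'm2, 'z2) cat_scheme"
    and Fo Fm and W :: "'m1 set"
  assumes lifted: "is_functor C E Fo Fm"
    and inverts: "s \<in> W \<Longrightarrow> s \<in> Hom C X Y \<Longrightarrow> iso_mor E (Fm s)"
begin

sublocale C: category C by (rule is_functorD[OF lifted])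
sublocale E: category E by (rule is_functorD[OF lifted])

text \<open>A word does not record its end object, so the identity from which the evaluation starts
  has to be supplied through \<open>Y\<close>.\<close>

abbreviation val where "val Y p \<equiv> word_value E Fm (Ident E (Fo Y)) p"

lemma val_in_Hom: "path C W X p Y \<Longrightarrow> val Y p \<in> Hom E (Fo X) (Fo Y)"
proof (induction rule: path.induct)
  case (path_Nil X)
  then show ?case using is_functorD(3)[OF lifted] E.Ident_in_Hom by simp
next
  case (path_Fwd f X Y p Z)
  then show ?case using E.Cmp_in_Hom[OF is_functorD(4)[OF lifted path_Fwd(1)]] by simp
next
  case (path_Bwd s Y X p Z)
  then show ?case
    using E.Cmp_in_Hom[OF inv_mor(1)[OF inverts is_functorD(4)[OF lifted path_Bwd(2)]]] by auto
qed

lemma val_append: "path C W X p Y \<Longrightarrow> path C W Y q Z \<Longrightarrow> val Z (p @ q) = val Z q \<cdot>\<^bsub>E\<^esub> val Y p"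
proof (induction rule: path.induct)
  case (path_Nil X)
  then show ?case using E.Cmp_Ident[OF val_in_Hom] by simp
next
  case (path_Fwd f X Y p Y')
  then show ?case
    using E.Cmp_assoc[OF is_functorD(4)[OF lifted path_Fwd(1)] val_in_Hom[OF path_Fwd(2)] val_in_Hom]
    by simp
next
  case (path_Bwd s Y X p Y')
  then show ?case
    using E.Cmp_assoc[OF inv_mor(1)[OF inverts is_functorD(4)[OF lifted path_Bwd(2)]]
        val_in_Hom[OF path_Bwd(3)] val_in_Hom] by auto
qed

text \<open>Every generating relation of the congruence becomes an identity in \<open>E\<close>, the
  cancellation of formal inverses because \<open>Fm s\<close> is invertible there. This is what
  makes \<open>lift\<close> well defined on classes.\<close>

lemma val_eq: "path_eq C W X Y p q \<Longrightarrow> val Y p = val Y q"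
proof (induction rule: path_eq.induct)
  case (path_eq_cong U a X Y p q b V)
  note p = path_eq_path[OF C.category_axioms path_eq_cong(2)]
  show ?case
    using val_append[OF path_eq_cong(1) path_append[OF p(1) path_eq_cong(3)]]
      val_append[OF path_eq_cong(1) path_append[OF p(2) path_eq_cong(3)]]
      val_append[OF p(1) path_eq_cong(3)] val_append[OF p(2) path_eq_cong(3)] path_eq_cong(4) by simp
next
  case (path_eq_Cmp f X Y g Z)
  note F = is_functorD[OF lifted]
  show ?case
    using E.Ident_Cmp[OF F(4)[OF path_eq_Cmp(2)]] F(6)[OF path_eq_Cmp]
      E.Ident_Cmp[OF F(4)[OF C.Cmp_in_Hom[OF path_eq_Cmp]]] by simp
next
  case (path_eq_Ident X)
  then show ?case
    using is_functorD(3,5)[OF lifted] E.Ident_Cmp[OF E.Ident_in_Hom] by simp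
next
  case (path_eq_Fwd_Bwd s X Y)
  note F = is_functorD(4)[OF lifted path_eq_Fwd_Bwd(2)]
  note i = inv_mor[OF inverts[OF path_eq_Fwd_Bwd] F]
  show ?case using i E.Ident_Cmp[OF i(1)] by simp
next
  case (path_eq_Bwd_Fwd s X Y)
  note F = is_functorD(4)[OF lifted path_eq_Bwd_Fwd(2)]
  note i = inv_mor[OF inverts[OF path_eq_Bwd_Fwd] F]
  show ?case using i E.Ident_Cmp[OF F] by simp
qed auto

definition lift :: "'o1 \<times> 'o1 \<times> 'm1 letter list set \<Rightarrow> 'm2" where
  "lift = (\<lambda>(X, Y, c). val Y (SOME p. p \<in> c))"

lemma lift_word_class:
  assumes "path C W X p Y"
  shows "lift (word_class C W X Y p) = val Y p"
proof -
  have "path_eq C W X Y p (SOME q. path_eq C W X Y p q)"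
    by (rule someI) (rule path_eq_refl[OF assms])
  then show ?thesis
    using val_eq unfolding lift_def word_class_def by auto
qed

lemma lift_loc_mor:
  assumes "f \<in> Hom C X Y"
  shows "lift (loc_mor C W f) = Fm f"
proof -
  have "path C W X [Fwd f] Y"
    using assms C.Hom_Obj by (auto intro!: path.intros)
  then show ?thesis
    using lift_word_class E.Ident_Cmp[OF is_functorD(4)[OF lifted assms]] by (simp add: loc_mor[OF assms])
qed

lemma lift_functor: "is_functor (localisation C W) E Fo lift"
proof (rule is_functorI)
  fix f g A B D assume "f \<in> Hom (localisation C W) A B" "g \<in> Hom (localisation C W) B D"
  then show "lift (g \<cdot>\<^bsub>localisation C W\<^esub> f) = lift g \<cdot>\<^bsub>E\<^esub> lift f"
    unfolding Hom_localisation
    by (auto simp: Cmp_word_class[OF C.category_axioms] lift_word_class path_append val_append)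
next
  fix A assume "A \<in> Obj (localisation C W)"
  then show "lift (Ident (localisation C W) A) = Ident E (Fo A)"
    by (simp add: lift_word_class path_Nil)
qed (use is_functorD(3)[OF lifted] in \<open>auto simp: category_localisation[OF C.category_axioms]
      E.category_axioms Hom_localisation lift_word_class val_in_Hom\<close>)

end

text \<open>Naturality needs to be known only on the morphisms of \<open>C\<close>: commuting
  squares paste along composition, and a square for \<open>s\<close> yields one for its formal
  inverse.\<close>

lemma natural_iso_localisation:
  assumes "category C"
    and F: "is_functor (localisation C W) E Fo Fm" and G: "is_functor (localisation C W) E Go Gm"
    and t: "\<And>A. A \<in> Obj C \<Longrightarrow> \<tau> A \<in> Hom E (Fo A) (Go A)" "\<And>A. A \<in> Obj C \<Longrightarrow> iso_mor E (\<tau> A)"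
    and n: "\<And>f A B. f \<in> Hom C A B \<Longrightarrow> \<tau> B \<cdot>\<^bsub>E\<^esub> Fm (loc_mor C W f) = Gm (loc_mor C W f) \<cdot>\<^bsub>E\<^esub> \<tau> A"
  shows "natural_iso (localisation C W) E Fo Fm Go Gm \<tau>"
proof (rule natural_isoI)
  interpret C: category C by (fact assms)
  interpret E: category E by (rule is_functorD[OF F])
  note F' = is_functorD[OF F] and G' = is_functorD[OF G]
  define nat where "nat m A B \<longleftrightarrow> m \<in> Hom (localisation C W) A B \<and> \<tau> B \<cdot>\<^bsub>E\<^esub> Fm m = Gm m \<cdot>\<^bsub>E\<^esub> \<tau> A" for m A B
  have natcomp: "nat (m' \<cdot>\<^bsub>localisation C W\<^esub> m) A D" if "nat m A B" "nat m' B D" for m m' A B D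
  proof -
    interpret L: category "localisation C W" by (rule is_functorD[OF F])
    have m: "m \<in> Hom (localisation C W) A B" "m' \<in> Hom (localisation C W) B D"
      and n: "\<tau> B \<cdot>\<^bsub>E\<^esub> Fm m = Gm m \<cdot>\<^bsub>E\<^esub> \<tau> A" "\<tau> D \<cdot>\<^bsub>E\<^esub> Fm m' = Gm m' \<cdot>\<^bsub>E\<^esub> \<tau> B"
      using that by (auto simp: nat_def)
    have A: "A \<in> Obj C" "B \<in> Obj C" "D \<in> Obj C"
      using L.Hom_Obj[OF m(1)] L.Hom_Obj[OF m(2)] by auto
    have "\<tau> D \<cdot>\<^bsub>E\<^esub> (Fm m' \<cdot>\<^bsub>E\<^esub> Fm m) = (Gm m' \<cdot>\<^bsub>E\<^esub> Gm m) \<cdot>\<^bsub>E\<^esub> \<tau> A"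
      using E.Cmp_assoc[OF F'(4)[OF m(1)] F'(4)[OF m(2)] t(1)[OF A(3)]]
        E.Cmp_assoc[OF F'(4)[OF m(1)] t(1)[OF A(2)] G'(4)[OF m(2)]]
        E.Cmp_assoc[OF t(1)[OF A(1)] G'(4)[OF m(1)] G'(4)[OF m(2)]] n by simp
    then show ?thesis
      using L.Cmp_in_Hom[OF m] F'(6)[OF m] G'(6)[OF m] by (simp add: nat_def)
  qed
  have "nat (word_class C W A B p) A B" if "path C W A p B" for A B p
    using that
  proof (induction rule: path.induct)
    case (path_Nil X)
    then have "Ident (localisation C W) X \<in> Hom (localisation C W) X X"
      using category.Ident_in_Hom[OF F'(1)] by simp
    moreover have "\<tau> X \<cdot>\<^bsub>E\<^esub> Fm (Ident (localisation C W) X) = Gm (Ident (localisation C W) X) \<cdot>\<^bsub>E\<^esub> \<tau> X"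
      using path_Nil F'(5) G'(5) E.Cmp_Ident[OF t(1)] E.Ident_Cmp[OF t(1)]
      by (simp del: localisation_simps(2) add: localisation_simps(1))
    ultimately show ?case by (simp add: nat_def)
  next
    case (path_Fwd f X Y p Z)
    have p: "path C W X [Fwd f] Y"
      using path_Fwd C.Hom_Obj by (auto intro!: path.intros)
    then have "nat (loc_mor C W f) X Y"
      using n[OF path_Fwd(1)] by (auto simp: nat_def Hom_localisation loc_mor[OF path_Fwd(1)])
    from natcomp[OF this path_Fwd(3)] show ?case
      using Cmp_word_class[OF assms(1) p path_Fwd(2)] by (simp add: loc_mor[OF path_Fwd(1)])
  next
    case (path_Bwd s Y X p Z)
    have p: "path C W X [Bwd s] Y"
      using path_Bwd C.Hom_Obj by (auto intro!: path.intros)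
    define b where "b = word_class C W X Y [Bwd s]"
    note b = loc_mor_inverse[OF assms(1) path_Bwd(1,2), folded b_def]
    have s: "loc_mor C W s \<in> Hom (localisation C W) Y X"
      using is_functorD(4)[OF loc_mor_functor[OF assms(1)] path_Bwd(2)] by simp
    have O: "X \<in> Obj C" "Y \<in> Obj C" using C.Hom_Obj[OF path_Bwd(2)] by auto
    have sb: "Fm (loc_mor C W s) \<cdot>\<^bsub>E\<^esub> Fm b = Ident E (Fo X)"
      "Gm b \<cdot>\<^bsub>E\<^esub> Gm (loc_mor C W s) = Ident E (Go Y)"
      using F'(6)[OF b(1) s] F'(5)[of X] G'(6)[OF s b(1)] G'(5)[of Y] b(2,3) O by simp_all
    \<comment> \<open>The square for the formal inverse \<open>b\<close> of \<open>s\<close>: insert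
      \<open>Gm b \<cdot> Gm s\<close>, which is an identity, on the left, move
      \<open>\<tau>\<close> past \<open>s\<close> by naturality, and cancel
      \<open>Fm s \<cdot> Fm b\<close>.\<close>
    have "\<tau> Y \<cdot>\<^bsub>E\<^esub> Fm b = (Gm b \<cdot>\<^bsub>E\<^esub> Gm (loc_mor C W s)) \<cdot>\<^bsub>E\<^esub> (\<tau> Y \<cdot>\<^bsub>E\<^esub> Fm b)"
      using E.Ident_Cmp[OF E.Cmp_in_Hom[OF F'(4)[OF b(1)] t(1)[OF O(2)]]] sb by simp
    also have "\<dots> = Gm b \<cdot>\<^bsub>E\<^esub> ((\<tau> X \<cdot>\<^bsub>E\<^esub> Fm (loc_mor C W s)) \<cdot>\<^bsub>E\<^esub> Fm b)"
      using E.Cmp_assoc_middle[OF F'(4)[OF b(1)] t(1)[OF O(2)] G'(4)[OF s] G'(4)[OF b(1)]] n[OF path_Bwd(2)]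
      by simp
    also have "\<dots> = Gm b \<cdot>\<^bsub>E\<^esub> \<tau> X"
      using E.Cmp_assoc[OF F'(4)[OF b(1)] F'(4)[OF s] t(1)[OF O(1)]] sb E.Cmp_Ident[OF t(1)[OF O(1)]] by simp
    finally have "nat b X Y" using b(1) by (simp add: nat_def)
    from natcomp[OF this path_Bwd(4)] show ?case
      using Cmp_word_class[OF assms(1) p path_Bwd(3)] by (simp add: b_def)
  qed
  then show "\<tau> B \<cdot>\<^bsub>E\<^esub> Fm m = Gm m \<cdot>\<^bsub>E\<^esub> \<tau> A" if "m \<in> Hom (localisation C W) A B" for m A B
    using that by (auto simp: Hom_localisation nat_def)
qed (use t in auto)

text \<open>Each functor, followed by the localisation of its target, inverts the given class and
  hence lifts. On morphisms that come from \<open>C\<close> the composite of the lifts is computed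
  by \<open>Gm (Fm f)\<close>, so the images of the original unit and counit are natural there, and
  then everywhere.\<close>

lemma localisation_equivalence:
  assumes F: "is_functor C D Fo Fm" and G: "is_functor D C Go Gm"
    and h: "natural_iso C C id id (Go \<circ> Fo) (Gm \<circ> Fm) \<eta>"
    and e: "natural_iso D D (Fo \<circ> Go) (Fm \<circ> Gm) id id \<epsilon>"
    and W: "\<And>s. s \<in> W \<Longrightarrow> s \<in> Mor C \<Longrightarrow> Fm s \<in> W'" "\<And>s. s \<in> W' \<Longrightarrow> s \<in> Mor D \<Longrightarrow> Gm s \<in> W"
  shows "equivalent_categories (localisation C W) (localisation D W')"
proof -
  note F' = is_functorD[OF F] and G' = is_functorD[OF G]
  note C = F'(1) and D = F'(2)
  interpret LF: inverting_functor C "localisation D W'" "id \<circ> Fo" "loc_mor D W' \<circ> Fm" W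
  proof
    show "is_functor C (localisation D W') (id \<circ> Fo) (loc_mor D W' \<circ> Fm)"
      by (rule functor_comp[OF F loc_mor_functor[OF D]])
    show "iso_mor (localisation D W') ((loc_mor D W' \<circ> Fm) s)" if "s \<in> W" "s \<in> Hom C X Y" for s X Y
      using loc_mor_iso[OF D W(1)[OF that(1) HomD(1)[OF that(2)]] F'(4)[OF that(2)]] by simp
  qed
  interpret LG: inverting_functor D "localisation C W" "id \<circ> Go" "loc_mor C W \<circ> Gm" W'
  proof
    show "is_functor D (localisation C W) (id \<circ> Go) (loc_mor C W \<circ> Gm)"
      by (rule functor_comp[OF G loc_mor_functor[OF C]])
    show "iso_mor (localisation C W) ((loc_mor C W \<circ> Gm) s)" if "s \<in> W'" "s \<in> Hom D X Y" for s X Y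
      using loc_mor_iso[OF C W(2)[OF that(1) HomD(1)[OF that(2)]] G'(4)[OF that(2)]] by simp
  qed
  note LF = LF.lift_functor LF.lift_loc_mor and LG = LG.lift_functor LG.lift_loc_mor
  note QC = is_functorD[OF loc_mor_functor[OF C, of W]] and QD = is_functorD[OF loc_mor_functor[OF D, of W']]
  show ?thesis
  proof (rule equivalent_categoriesI[OF LF(1) LG(1)])
    note h = natural_isoD[OF h]
    show "natural_iso (localisation C W) (localisation C W) id id (id \<circ> Go \<circ> (id \<circ> Fo)) (LG.lift \<circ> LF.lift)
        (loc_mor C W \<circ> \<eta>)"
    proof (rule natural_iso_localisation[OF C functor_id[OF category_localisation[OF C]]
          functor_comp[OF LF(1) LG(1)]])
      fix f A B assume f: "f \<in> Hom C A B"
      have O: "A \<in> Obj C" "B \<in> Obj C" using category.Hom_Obj[OF C f] by auto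
      show "(loc_mor C W \<circ> \<eta>) B \<cdot>\<^bsub>localisation C W\<^esub> id (loc_mor C W f)
          = (LG.lift \<circ> LF.lift) (loc_mor C W f) \<cdot>\<^bsub>localisation C W\<^esub> (loc_mor C W \<circ> \<eta>) A"
        using QC(6)[OF _ h(1)[OF O(2)], of f A] QC(6)[OF h(1)[OF O(1)], of "Gm (Fm f)"]
          h(3)[OF f] f LF(2)[OF f] LG(2)[OF F'(4)[OF f]] G'(4)[OF F'(4)[OF f]] by simp
    qed (use QC(4)[OF h(1)] functor_iso_mor[OF loc_mor_functor[OF C] h(1) h(2)] in auto)
    note e = natural_isoD[OF e]
    show "natural_iso (localisation D W') (localisation D W') (id \<circ> Fo \<circ> (id \<circ> Go)) (LF.lift \<circ> LG.lift) id id
        (loc_mor D W' \<circ> \<epsilon>)"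
    proof (rule natural_iso_localisation[OF D functor_comp[OF LG(1) LF(1)]
          functor_id[OF category_localisation[OF D]]])
      fix f A B assume f: "f \<in> Hom D A B"
      have O: "A \<in> Obj D" "B \<in> Obj D" using category.Hom_Obj[OF D f] by auto
      show "(loc_mor D W' \<circ> \<epsilon>) B \<cdot>\<^bsub>localisation D W'\<^esub> (LF.lift \<circ> LG.lift) (loc_mor D W' f)
          = id (loc_mor D W' f) \<cdot>\<^bsub>localisation D W'\<^esub> (loc_mor D W' \<circ> \<epsilon>) A"
        using QD(6)[OF _ e(1)[OF O(2)], of "Fm (Gm f)"] QD(6)[OF e(1)[OF O(1)], of f B]
          e(3)[OF f] f LG(2)[OF f] LF(2)[OF G'(4)[OF f]] F'(4)[OF G'(4)[OF f]] by simp
    qed (use QD(4)[OF e(1)] functor_iso_mor[OF loc_mor_functor[OF D] e(1) e(2)] in auto)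
  qed
qed

text \<open>Functors are HOL functions that may differ outside the hom sets. Agreement on the
  category is therefore expressed by an identity transformation and not by an equation between
  functions.\<close>

lemma natural_iso_Ident:
  assumes F: "is_functor C D Fo Fm" and "\<And>f A B. f \<in> Hom C A B \<Longrightarrow> Gm f = Fm f"
    and "\<And>A. A \<in> Obj C \<Longrightarrow> Go A = Fo A"
  shows "natural_iso C D Fo Fm Go Gm (\<lambda>A. Ident D (Fo A))"
proof (rule natural_isoI)
  note F' = is_functorD[OF F]
  interpret D: category D by (fact F'(2))
  fix A assume A: "A \<in> Obj C"
  have i: "Ident D (Fo A) \<in> Hom D (Fo A) (Fo A)" using D.Ident_in_Hom F'(3)[OF A] by simp
  show "Ident D (Fo A) \<in> Hom D (Fo A) (Go A)" using i assms(3)[OF A] by simp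
  show "iso_mor D (Ident D (Fo A))" using D.Ident_Cmp[OF i] i by (auto intro: iso_morI)
next
  note F' = is_functorD[OF F]
  interpret D: category D by (fact F'(2))
  fix f A B assume f: "f \<in> Hom C A B"
  show "Ident D (Fo B) \<cdot>\<^bsub>D\<^esub> Fm f = Gm f \<cdot>\<^bsub>D\<^esub> Ident D (Fo A)"
    using assms(2)[OF f] D.Ident_Cmp[OF F'(4)[OF f]] D.Cmp_Ident[OF F'(4)[OF f]] by simp
qed

text \<open>The uniqueness half of the universal property. The identity transformation is natural on
  morphisms of \<open>C\<close>, hence on all morphisms, and its naturality square is the desired
  equation.\<close>

lemma localisation_functor_unique:
  assumes "category C" and F: "is_functor (localisation C W) E Fo Fm"
    and G: "is_functor (localisation C W) E Fo Gm"
    and eq: "\<And>f A B. f \<in> Hom C A B \<Longrightarrow> Gm (loc_mor C W f) = Fm (loc_mor C W f)"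
    and m: "m \<in> Hom (localisation C W) A B"
  shows "Gm m = Fm m"
proof -
  note F' = is_functorD[OF F] and G' = is_functorD[OF G] and Q = is_functorD[OF loc_mor_functor[OF assms(1)]]
  interpret E: category E by (fact F'(2))
  have i: "Ident E (Fo A) \<in> Hom E (Fo A) (Fo A)" if "A \<in> Obj C" for A
    using E.Ident_in_Hom F'(3) that by simp
  have "natural_iso (localisation C W) E Fo Fm Fo Gm (\<lambda>A. Ident E (Fo A))"
  proof (rule natural_iso_localisation[OF assms(1) F G])
    fix f A B assume f: "f \<in> Hom C A B"
    have "loc_mor C W f \<in> Hom (localisation C W) A B" using Q(4)[OF f] by simp
    then show "Ident E (Fo B) \<cdot>\<^bsub>E\<^esub> Fm (loc_mor C W f) = Gm (loc_mor C W f) \<cdot>\<^bsub>E\<^esub> Ident E (Fo A)"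
      using eq[OF f] E.Ident_Cmp[OF F'(4)] E.Cmp_Ident[OF F'(4)] by metis
  qed (use i E.Ident_Cmp[OF i] in \<open>auto intro: iso_morI\<close>)
  from natural_isoD(3)[OF this m] show ?thesis
    using E.Ident_Cmp[OF F'(4)[OF m]] E.Cmp_Ident[OF G'(4)[OF m]] by simp
qed

text \<open>Both categories solve the same universal problem. The comparison functors are the two
  lifts, so words are never reversed by hand, and uniqueness shows that the composites are
  identities.\<close>

lemma localisation_op_cat:
  assumes "category C"
  shows "equivalent_categories (localisation (op_cat C) W) (op_cat (localisation C W))"
proof -
  note C = assms and O = category_op_cat[OF assms]
  interpret U: inverting_functor "op_cat C" "op_cat (localisation C W)" id "loc_mor C W" W
    using functor_op_cat[OF loc_mor_functor[OF C]] loc_mor_iso[OF C] by unfold_locales auto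
  interpret V: inverting_functor C "op_cat (localisation (op_cat C) W)" id "loc_mor (op_cat C) W" W
    using functor_op_cat[OF loc_mor_functor[OF O]] loc_mor_iso[OF O] by unfold_locales auto
  have UV: "is_functor (localisation C W) (localisation C W) (id \<circ> id) (U.lift \<circ> V.lift)"
    and VU: "is_functor (localisation (op_cat C) W) (localisation (op_cat C) W) (id \<circ> id) (V.lift \<circ> U.lift)"
    using functor_comp[OF V.lift_functor functor_op_cat[OF U.lift_functor]]
      functor_comp[OF U.lift_functor functor_op_cat[OF V.lift_functor]] by simp_all
  note lifts = U.lift_loc_mor V.lift_loc_mor
  have 1: "(U.lift \<circ> V.lift) m = id m" if "m \<in> Hom (localisation C W) A B" for m A B
  proof (rule localisation_functor_unique[OF C functor_id[OF category_localisation[OF C]] _ _ that])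
    show "is_functor (localisation C W) (localisation C W) id (U.lift \<circ> V.lift)"
      using UV by simp
  next
    fix f A B assume "f \<in> Hom C A B"
    then show "(U.lift \<circ> V.lift) (loc_mor C W f) = id (loc_mor C W f)"
      using lifts(1)[of f B A] lifts(2)[of f A B] by simp
  qed
  have 2: "(V.lift \<circ> U.lift) m = id m" if "m \<in> Hom (localisation (op_cat C) W) A B" for m A B
  proof (rule localisation_functor_unique[OF O functor_id[OF category_localisation[OF O]] _ _ that])
    show "is_functor (localisation (op_cat C) W) (localisation (op_cat C) W) id (V.lift \<circ> U.lift)"
      using VU by simp
  next
    fix f A B assume "f \<in> Hom (op_cat C) A B"
    then show "(V.lift \<circ> U.lift) (loc_mor (op_cat C) W f) = id (loc_mor (op_cat C) W f)"
      using lifts(1)[of f A B] lifts(2)[of f B A] by simp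
  qed
  show ?thesis
  proof (rule equivalent_categoriesI[OF U.lift_functor])
    show "is_functor (op_cat (localisation C W)) (localisation (op_cat C) W) id V.lift"
      using functor_op_cat[OF V.lift_functor] by simp
    show "natural_iso (localisation (op_cat C) W) (localisation (op_cat C) W) id id (id \<circ> id) (V.lift \<circ> U.lift)
        (\<lambda>A. Ident (localisation (op_cat C) W) (id A))"
      by (rule natural_iso_Ident[OF functor_id[OF category_localisation[OF O]] 2]) auto
    show "natural_iso (op_cat (localisation C W)) (op_cat (localisation C W)) (id \<circ> id) (U.lift \<circ> V.lift) id id
        (\<lambda>A. Ident (op_cat (localisation C W)) ((id \<circ> id) A))"
      by (rule natural_iso_Ident[OF functor_op_cat[OF UV]]) (simp_all add: 1[simplified])
  qed
qed

section \<open>Equivalences from correspondences\<close>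

text \<open>
  An equivalence is often visible only after choices on both sides have been made.  In a
  correspondence the choices are recorded by a witness \<open>w\<close> relating the objects \<open>p w\<close> and \<open>q w\<close>,
  and \<open>R w w'\<close> is the graph of the induced bijection on morphisms.
\<close>

locale correspondence =
  fixes C :: "('o1, 'm1, 'z1) cat_scheme" and D :: "('o2, 'm2, 'z2) cat_scheme"
    and Wit :: "'w set" and p :: "'w \<Rightarrow> 'o1" and q :: "'w \<Rightarrow> 'o2"
    and R :: "'w \<Rightarrow> 'w \<Rightarrow> 'm1 \<Rightarrow> 'm2 \<Rightarrow> bool"
  assumes cat_C: "category C" and cat_D: "category D"
    and p_Obj: "w \<in> Wit \<Longrightarrow> p w \<in> Obj C" and q_Obj: "w \<in> Wit \<Longrightarrow> q w \<in> Obj D"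
    and p_surj: "A \<in> Obj C \<Longrightarrow> \<exists>w \<in> Wit. p w = A" and q_surj: "B \<in> Obj D \<Longrightarrow> \<exists>w \<in> Wit. q w = B"
    and R_Wit: "R w w' f g \<Longrightarrow> w \<in> Wit \<and> w' \<in> Wit"
    and R_Hom: "R w w' f g \<Longrightarrow> f \<in> Hom C (p w) (p w') \<and> g \<in> Hom D (q w) (q w')"
    and R_total: "w \<in> Wit \<Longrightarrow> w' \<in> Wit \<Longrightarrow> f \<in> Hom C (p w) (p w') \<Longrightarrow> \<exists>g. R w w' f g"
    and R_surj: "w \<in> Wit \<Longrightarrow> w' \<in> Wit \<Longrightarrow> g \<in> Hom D (q w) (q w') \<Longrightarrow> \<exists>f. R w w' f g"
    and R_fun: "R w w' f g \<Longrightarrow> R w w' f g' \<Longrightarrow> g = g'"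
    and R_inj: "R w w' f g \<Longrightarrow> R w w' f' g \<Longrightarrow> f = f'"
    and R_Ident: "w \<in> Wit \<Longrightarrow> R w w (Ident C (p w)) (Ident D (q w))"
    and R_Cmp: "R w w' f g \<Longrightarrow> R w' w'' f' g' \<Longrightarrow> R w w'' (f' \<cdot>\<^bsub>C\<^esub> f) (g' \<cdot>\<^bsub>D\<^esub> g)"
begin

sublocale C: category C by (fact cat_C)
sublocale D: category D by (fact cat_D)

text \<open>Transfer results are proved from \<open>C\<close> to \<open>D\<close> only; this gives
  the other direction.\<close>

lemma correspondence_sym: "correspondence D C Wit q p (\<lambda>w w' g f. R w w' f g)"
  by unfold_locales
    (fact p_Obj q_Obj p_surj q_surj R_Wit R_total R_surj R_fun R_inj R_Ident R_Cmp
      | drule R_Hom, blast)+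

text \<open>Through this, statements about cokernels are obtained from those about kernels.\<close>

lemma correspondence_op: "correspondence (op_cat C) (op_cat D) Wit p q (\<lambda>w w' f g. R w' w f g)"
proof -
  interpret opC: category "op_cat C" by (rule category_op_cat[OF cat_C])
  interpret opD: category "op_cat D" by (rule category_op_cat[OF cat_D])
  show ?thesis
  proof (unfold_locales, unfold op_cat_simps)
  qed (fact p_Obj q_Obj p_surj q_surj | drule R_Hom R_Wit, blast
      | rule R_total R_surj, assumption, assumption, assumption
      | erule (1) R_fun | erule (1) R_inj | erule (1) R_Cmp[rotated] | erule R_Ident)+
qed

lemma unique_Hom_transfer:
  assumes w: "w \<in> Wit" "w' \<in> Wit" and ex1: "\<exists>!f. f \<in> Hom C (p w) (p w')"
  shows "\<exists>!g. g \<in> Hom D (q w) (q w')"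
proof -
  obtain f where f: "f \<in> Hom C (p w) (p w')" and uniq: "\<And>f'. f' \<in> Hom C (p w) (p w') \<Longrightarrow> f' = f"
    using ex1 by blast
  obtain g where g: "R w w' f g" using R_total[OF w f] by blast
  have "g' = g" if g': "g' \<in> Hom D (q w) (q w')" for g'
  proof -
    obtain f' where f': "R w w' f' g'" using R_surj[OF w g'] by blast
    then have "f' = f" using uniq R_Hom by blast
    then show ?thesis using R_fun[OF g] f' by simp
  qed
  then show ?thesis using R_Hom[OF g] by blast
qed

lemma zero_obj_transfer:
  assumes w: "w \<in> Wit" and z: "zero_obj C (p w)"
  shows "zero_obj D (q w)"
  unfolding zero_obj_def
proof (intro conjI ballI)
  show "q w \<in> Obj D" by (rule q_Obj[OF w])
  fix B assume "B \<in> Obj D"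
  then obtain v where v: "v \<in> Wit" "q v = B" using q_surj by blast
  then have "\<exists>!f. f \<in> Hom C (p v) (p w)" "\<exists>!f. f \<in> Hom C (p w) (p v)"
    using z p_Obj unfolding zero_obj_def by auto
  then show "\<exists>!f. f \<in> Hom D B (q w)" "\<exists>!f. f \<in> Hom D (q w) B"
    using unique_Hom_transfer[OF v(1) w] unique_Hom_transfer[OF w v(1)] v(2) by auto
qed

lemma zero_mor_transfer:
  assumes r: "R w w' f g" and z: "zero_mor C f"
  shows "zero_mor D g"
proof -
  note w = R_Wit[OF r] and f = R_Hom[OF r]
  obtain Z a b where "zero_obj C Z" "a \<in> Hom C (Src C f) Z" "b \<in> Hom C Z (Tgt C f)" "f = b \<cdot>\<^bsub>C\<^esub> a"
    using z unfolding zero_mor_def by blast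
  then have Z: "zero_obj C Z" "a \<in> Hom C (p w) Z" "b \<in> Hom C Z (p w')" "f = b \<cdot>\<^bsub>C\<^esub> a"
    using f HomD(2,3)[of f C] by auto
  have "Z \<in> Obj C" using Z(1) by (simp add: zero_obj_def)
  then obtain v where v: "v \<in> Wit" "p v = Z" using p_surj by auto
  have "\<exists>a'. R w v a a'" "\<exists>b'. R v w' b b'"
    using R_total[of w v a] R_total[of v w' b] w v Z by simp_all
  then obtain a' b' where ab: "R w v a a'" "R v w' b b'" by auto
  have g: "g = b' \<cdot>\<^bsub>D\<^esub> a'" using R_fun[OF r] R_Cmp[OF ab] Z(4) by simp
  have zv: "zero_obj D (q v)" using zero_obj_transfer[OF v(1)] v(2) Z(1) by simp
  show ?thesis
    unfolding zero_mor_def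
  proof (intro exI conjI)
    show "zero_obj D (q v)" "g = b' \<cdot>\<^bsub>D\<^esub> a'" by (fact zv g)+
    show "a' \<in> Hom D (Src D g) (q v)" "b' \<in> Hom D (q v) (Tgt D g)"
      using R_Hom[OF ab(1)] R_Hom[OF ab(2)] f HomD(2,3)[of g D] by auto
  qed
qed

end

text \<open>Test morphisms are quantified over hom sets here, the form in which the relation
  \<open>R\<close> between hom sets can be applied to them.\<close>

lemma is_kernel_iff:
  assumes "f \<in> Hom C A B" "k \<in> Hom C K A"
  shows "is_kernel C f k \<longleftrightarrow> zero_mor C (f \<cdot>\<^bsub>C\<^esub> k) \<and>
    (\<forall>X g. g \<in> Hom C X A \<and> zero_mor C (f \<cdot>\<^bsub>C\<^esub> g) \<longrightarrow> (\<exists>!h. h \<in> Hom C X K \<and> k \<cdot>\<^bsub>C\<^esub> h = g))"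
proof -
  have "(\<forall>g \<in> Mor C. Tgt C g = A \<and> zero_mor C (f \<cdot>\<^bsub>C\<^esub> g) \<longrightarrow> (\<exists>!h. h \<in> Hom C (Src C g) K \<and> k \<cdot>\<^bsub>C\<^esub> h = g))
    \<longleftrightarrow> (\<forall>X g. g \<in> Hom C X A \<and> zero_mor C (f \<cdot>\<^bsub>C\<^esub> g) \<longrightarrow> (\<exists>!h. h \<in> Hom C X K \<and> k \<cdot>\<^bsub>C\<^esub> h = g))"
    (is "?l \<longleftrightarrow> ?r")
  proof
    assume l: ?l
    show ?r
    proof (intro allI impI)
      fix X g assume g: "g \<in> Hom C X A \<and> zero_mor C (f \<cdot>\<^bsub>C\<^esub> g)"
      then show "\<exists>!h. h \<in> Hom C X K \<and> k \<cdot>\<^bsub>C\<^esub> h = g"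
        using l[rule_format, of g] HomD[of g C X A] by simp
    qed
  next
    assume r: ?r
    show ?l
    proof (intro ballI impI)
      fix g assume g: "g \<in> Mor C" "Tgt C g = A \<and> zero_mor C (f \<cdot>\<^bsub>C\<^esub> g)"
      then show "\<exists>!h. h \<in> Hom C (Src C g) K \<and> k \<cdot>\<^bsub>C\<^esub> h = g"
        using r[rule_format, of g "Src C g"] HomI[of g C] by simp
    qed
  qed
  then show ?thesis
    unfolding is_kernel_def using HomD[OF assms(1)] HomD[OF assms(2)] by simp
qed

section \<open>Transport of kernels along a correspondence\<close>

context correspondence
begin

text \<open>A test morphism of \<open>D\<close> is pulled back along \<open>R\<close>, factored
  through \<open>k\<close> in \<open>C\<close>, and the factor is sent forward again. Uniqueness is
  seen by pulling a second factor back as well.\<close>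

lemma kernel_transfer:
  assumes r: "R w w' f g" and k: "R w0 w k k'" and ker: "is_kernel C f k"
  shows "is_kernel D g k'"
proof -
  interpret S: correspondence D C Wit q p "\<lambda>w w' g f. R w w' f g" by (rule correspondence_sym)
  have f: "f \<in> Hom C (p w) (p w')" "g \<in> Hom D (q w) (q w')" using R_Hom[OF r] by auto
  have k0: "k \<in> Hom C (p w0) (p w)" "k' \<in> Hom D (q w0) (q w)" using R_Hom[OF k] by auto
  have w: "w \<in> Wit" "w' \<in> Wit" "w0 \<in> Wit" using R_Wit[OF r] R_Wit[OF k] by auto
  note ker = ker[unfolded is_kernel_iff[OF f(1) k0(1)]]
  show ?thesis
    unfolding is_kernel_iff[OF f(2) k0(2)]
  proof (intro conjI allI impI)
    show "zero_mor D (g \<cdot>\<^bsub>D\<^esub> k')"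
      by (rule zero_mor_transfer[OF R_Cmp[OF k r] conjunct1[OF ker]])
  next
    fix X g1 assume "g1 \<in> Hom D X (q w) \<and> zero_mor D (g \<cdot>\<^bsub>D\<^esub> g1)"
    then have g1: "g1 \<in> Hom D X (q w)" and z: "zero_mor D (g \<cdot>\<^bsub>D\<^esub> g1)" by auto
    obtain v where v: "v \<in> Wit" "q v = X" using q_surj[OF D.Hom_Obj(1)[OF g1]] by auto
    obtain f1 where f1: "R v w f1 g1" using R_surj[OF v(1) w(1)] v(2) g1 by auto
    have "zero_mor C (f \<cdot>\<^bsub>C\<^esub> f1)" by (rule S.zero_mor_transfer[OF R_Cmp[OF f1 r] z])
    then have "\<exists>!h. h \<in> Hom C (p v) (p w0) \<and> k \<cdot>\<^bsub>C\<^esub> h = f1"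
      using conjunct2[OF ker, rule_format, of f1 "p v"] R_Hom[OF f1] by simp
    then obtain h where h: "h \<in> Hom C (p v) (p w0)" "k \<cdot>\<^bsub>C\<^esub> h = f1"
      and uniq: "\<And>h'. h' \<in> Hom C (p v) (p w0) \<Longrightarrow> k \<cdot>\<^bsub>C\<^esub> h' = f1 \<Longrightarrow> h' = h"
      by blast
    obtain h' where h': "R v w0 h h'" using R_total[OF v(1) w(3) h(1)] by auto
    show "\<exists>!h. h \<in> Hom D X (q w0) \<and> k' \<cdot>\<^bsub>D\<^esub> h = g1"
    proof (rule ex1I[of _ h'])
      show "h' \<in> Hom D X (q w0) \<and> k' \<cdot>\<^bsub>D\<^esub> h' = g1"
        using R_Hom[OF h'] R_fun[OF R_Cmp[OF h' k]] h(2) f1 v(2) by simp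
      fix h2 assume h2: "h2 \<in> Hom D X (q w0) \<and> k' \<cdot>\<^bsub>D\<^esub> h2 = g1"
      then obtain h1 where h1: "R v w0 h1 h2" using R_surj[OF v(1) w(3), of h2] v(2) by auto
      have "k \<cdot>\<^bsub>C\<^esub> h1 = f1" using R_inj[OF R_Cmp[OF h1 k]] f1 h2 by simp
      then have "h1 = h" using uniq R_Hom[OF h1] by simp
      then show "h2 = h'" using R_fun[OF _ h'] h1 by simp
    qed
  qed
qed

end

lemma zero_obj_op_cat [simp]: "zero_obj (op_cat C) Z \<longleftrightarrow> zero_obj C Z"
  unfolding zero_obj_def by (simp add: conj_commute)

lemma zero_mor_op_cat [simp]: "zero_mor (op_cat C) f \<longleftrightarrow> zero_mor C f"
  unfolding zero_mor_def op_cat_simps zero_obj_op_cat by blast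

lemma is_kernel_op_cat [simp]: "is_kernel (op_cat C) f k \<longleftrightarrow> is_cokernel C f k"
  unfolding is_kernel_def is_cokernel_def by simp

lemma is_cokernel_op_cat [simp]: "is_cokernel (op_cat C) f k \<longleftrightarrow> is_kernel C f k"
  unfolding is_kernel_def is_cokernel_def by simp

lemma serre_isos_op_cat: "serre_isos (op_cat C) S = serre_isos C S"
  unfolding serre_isos_def by (simp add: conj_commute)

section \<open>Serre quotients along a correspondence\<close>

context correspondence
begin

text \<open>A kernel of \<open>f\<close> is matched with a morphism of \<open>D\<close> by picking
  any witness for its source. That morphism is a kernel of \<open>g\<close>, and its source lies in
  \<open>S'\<close> because the witness links it to an object of \<open>S\<close>. The cokernel is
  handled by the opposite correspondence.\<close>

lemma serre_isos_transfer:
  assumes S: "\<And>w. w \<in> Wit \<Longrightarrow> p w \<in> S \<Longrightarrow> q w \<in> S'"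
    and r: "R w w' f g" and f: "f \<in> serre_isos C S"
  shows "g \<in> serre_isos D S'"
proof -
  have w: "w \<in> Wit" "w' \<in> Wit" using R_Wit[OF r] by auto
  have fg: "f \<in> Hom C (p w) (p w')" "g \<in> Hom D (q w) (q w')" using R_Hom[OF r] by auto
  have "\<exists>k'. is_kernel D g k' \<and> Src D k' \<in> S'"
  proof -
    obtain k where k: "is_kernel C f k" "Src C k \<in> S" using f unfolding serre_isos_def by auto
    then have kH: "k \<in> Hom C (Src C k) (p w)" using fg by (auto simp: is_kernel_def Hom_def)
    obtain v where v: "v \<in> Wit" "p v = Src C k" using p_surj[OF C.Hom_Obj(1)[OF kH]] by auto
    obtain k' where k': "R v w k k'" using R_total[OF v(1) w(1), of k] kH v(2) by auto
    have "Src D k' = q v" using conjunct2[OF R_Hom[OF k']] by (rule HomD(2))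
    moreover have "q v \<in> S'" using S[OF v(1)] v(2) k(2) by simp
    ultimately show ?thesis using kernel_transfer[OF r k' k(1)] by auto
  qed
  moreover have "\<exists>c'. is_cokernel D g c' \<and> Tgt D c' \<in> S'"
  proof -
    interpret Op: correspondence "op_cat C" "op_cat D" Wit p q "\<lambda>w w' f g. R w' w f g"
      by (rule correspondence_op)
    obtain c where c: "is_cokernel C f c" "Tgt C c \<in> S" using f unfolding serre_isos_def by auto
    then have cH: "c \<in> Hom C (p w') (Tgt C c)" using fg by (auto simp: is_cokernel_def Hom_def)
    obtain v where v: "v \<in> Wit" "p v = Tgt C c" using p_surj[OF C.Hom_Obj(2)[OF cH]] by auto
    obtain c' where c': "R w' v c c'" using R_total[OF w(2) v(1), of c] cH v(2) by auto
    have "Tgt D c' = q v" using conjunct2[OF R_Hom[OF c']] by (rule HomD(3))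
    moreover have "q v \<in> S'" using S[OF v(1)] v(2) c(2) by simp
    ultimately show ?thesis using Op.kernel_transfer[OF r c'] c(1) by auto
  qed
  ultimately show ?thesis
    using HomD(1)[OF fg(2)] unfolding serre_isos_def by simp
qed

theorem serre_quotient_equivalence:
  assumes S: "\<And>w. w \<in> Wit \<Longrightarrow> p w \<in> S \<longleftrightarrow> q w \<in> S'"
  shows "equivalent_categories (serre_quotient C S) (serre_quotient D S')"
proof -
  interpret Sym: correspondence D C Wit q p "\<lambda>w w' g f. R w w' f g" by (rule correspondence_sym)
  \<comment> \<open>Actual functors are chosen only here: \<open>s\<close> and \<open>t\<close> pick
    a witness over each object of \<open>C\<close> and of \<open>D\<close>. They are unrelated, so
    \<open>t (q (s A))\<close> and \<open>s A\<close> are in general different witnesses over the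
    same object of \<open>D\<close>.\<close>
  obtain s where s: "\<And>A. A \<in> Obj C \<Longrightarrow> s A \<in> Wit \<and> p (s A) = A"
    using bchoice[of "Obj C" "\<lambda>A w. w \<in> Wit \<and> p w = A"] p_surj by auto
  obtain t where t: "\<And>A. A \<in> Obj D \<Longrightarrow> t A \<in> Wit \<and> q (t A) = A"
    using bchoice[of "Obj D" "\<lambda>A w. w \<in> Wit \<and> q w = A"] q_surj by auto
  define Fo Fm where "Fo = q \<circ> s" and "Fm f = (THE g. R (s (Src C f)) (s (Tgt C f)) f g)" for f
  define Go Gm where "Go = p \<circ> t" and "Gm g = (THE f. R (t (Src D g)) (t (Tgt D g)) f g)" for g
  have R_Fm: "R (s A) (s B) f (Fm f)" if f: "f \<in> Hom C A B" for f A B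
  proof -
    have "f \<in> Hom C (p (s A)) (p (s B))" using f s C.Hom_Obj[OF f] by simp
    then obtain g where "R (s A) (s B) f g" using R_total[of "s A" "s B" f] s C.Hom_Obj[OF f] by auto
    then show ?thesis
      unfolding Fm_def HomD(2,3)[OF f] by (rule theI) (rule R_fun[OF _ \<open>R (s A) (s B) f g\<close>])
  qed
  have R_Gm: "R (t A) (t B) (Gm g) g" if g: "g \<in> Hom D A B" for g A B
  proof -
    have "g \<in> Hom D (q (t A)) (q (t B))" using g t D.Hom_Obj[OF g] by simp
    then obtain f where "R (t A) (t B) f g" using R_surj[of "t A" "t B" g] t D.Hom_Obj[OF g] by auto
    then show ?thesis
      unfolding Gm_def HomD(2,3)[OF g] by (rule theI) (rule R_inj[OF _ \<open>R (t A) (t B) f g\<close>])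
  qed
  have F: "is_functor C D Fo Fm"
  proof (rule is_functorI[OF cat_C cat_D])
    fix f A B assume f: "f \<in> Hom C A B"
    show "Fm f \<in> Hom D (Fo A) (Fo B)" using R_Hom[OF R_Fm[OF f]] by (simp add: Fo_def)
    fix g E assume g: "g \<in> Hom C B E"
    show "Fm (g \<cdot>\<^bsub>C\<^esub> f) = Fm g \<cdot>\<^bsub>D\<^esub> Fm f"
      using R_fun[OF R_Fm[OF C.Cmp_in_Hom[OF f g]] R_Cmp[OF R_Fm[OF f] R_Fm[OF g]]] .
  next
    fix A assume A: "A \<in> Obj C"
    show "Fm (Ident C A) = Ident D (Fo A)"
      using R_fun[OF R_Fm[OF C.Ident_in_Hom[OF A]]] R_Ident[of "s A"] s[OF A] by (simp add: Fo_def)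
  qed (use q_Obj s in \<open>simp add: Fo_def\<close>)
  have G: "is_functor D C Go Gm"
  proof (rule is_functorI[OF cat_D cat_C])
    fix f A B assume f: "f \<in> Hom D A B"
    show "Gm f \<in> Hom C (Go A) (Go B)" using R_Hom[OF R_Gm[OF f]] by (simp add: Go_def)
    fix g E assume g: "g \<in> Hom D B E"
    show "Gm (g \<cdot>\<^bsub>D\<^esub> f) = Gm g \<cdot>\<^bsub>C\<^esub> Gm f"
      using R_inj[OF R_Gm[OF D.Cmp_in_Hom[OF f g]] R_Cmp[OF R_Gm[OF f] R_Gm[OF g]]] .
  next
    fix A assume A: "A \<in> Obj D"
    show "Gm (Ident D A) = Ident C (Go A)"
      using R_inj[OF R_Gm[OF D.Ident_in_Hom[OF A]]] R_Ident[of "t A"] t[OF A] by (simp add: Go_def)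
  qed (use p_Obj t in \<open>simp add: Go_def\<close>)
  \<comment> \<open>Single-valuedness of \<open>R\<close> in both directions, compared with the
    related identities, shows that being mutually inverse on one side is the same as being mutually
    inverse on the other.\<close>
  have iso: "iso_mor C f \<and> iso_mor D g"
    if r: "R w w' f g" "R w' w f' g'" and
      e: "g' \<cdot>\<^bsub>D\<^esub> g = Ident D (q w) \<and> g \<cdot>\<^bsub>D\<^esub> g' = Ident D (q w') \<or>
        f' \<cdot>\<^bsub>C\<^esub> f = Ident C (p w) \<and> f \<cdot>\<^bsub>C\<^esub> f' = Ident C (p w')" for w w' f g f' g'
  proof -
    have i: "R w w (Ident C (p w)) (Ident D (q w))" "R w' w' (Ident C (p w')) (Ident D (q w'))"
      using R_Ident R_Wit[OF r(1)] by auto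
    note rr = R_Cmp[OF r] R_Cmp[OF r(2,1)]
    have "g' \<cdot>\<^bsub>D\<^esub> g = Ident D (q w) \<longleftrightarrow> f' \<cdot>\<^bsub>C\<^esub> f = Ident C (p w)"
      "g \<cdot>\<^bsub>D\<^esub> g' = Ident D (q w') \<longleftrightarrow> f \<cdot>\<^bsub>C\<^esub> f' = Ident C (p w')"
      using R_fun[OF i(1), of "g' \<cdot>\<^bsub>D\<^esub> g"] R_inj[OF i(1), of "f' \<cdot>\<^bsub>C\<^esub> f"] R_fun[OF i(2), of "g \<cdot>\<^bsub>D\<^esub> g'"]
        R_inj[OF i(2), of "f \<cdot>\<^bsub>C\<^esub> f'"] rr by auto
    then have "g' \<cdot>\<^bsub>D\<^esub> g = Ident D (q w)" "g \<cdot>\<^bsub>D\<^esub> g' = Ident D (q w')"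
        "f' \<cdot>\<^bsub>C\<^esub> f = Ident C (p w)" "f \<cdot>\<^bsub>C\<^esub> f' = Ident C (p w')"
      using e by auto
    then show ?thesis
      using R_Hom[OF r(1)] R_Hom[OF r(2)] iso_morI[of f C "p w" "p w'" f'] iso_morI[of g D "q w" "q w'" g']
      by simp
  qed
  have iso_D: "iso_mor C f" if r: "R w w' f (Ident D (q w))" and eq: "q w = q w'" for w w' f
  proof -
    have w: "w \<in> Wit" "w' \<in> Wit" using R_Wit[OF r] by auto
    have i: "Ident D (q w) \<in> Hom D (q w) (q w)" using q_Obj[OF w(1)] by (rule D.Ident_in_Hom)
    obtain f' where "R w' w f' (Ident D (q w))" using R_surj[OF w(2,1)] i eq by auto
    from iso[OF r this] show ?thesis using D.Ident_Cmp[OF i] eq by simp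
  qed
  have iso_C: "iso_mor D g" if r: "R w w' (Ident C (p w)) g" and eq: "p w = p w'" for w w' g
  proof -
    have w: "w \<in> Wit" "w' \<in> Wit" using R_Wit[OF r] by auto
    have i: "Ident C (p w) \<in> Hom C (p w) (p w)" using p_Obj[OF w(1)] by (rule C.Ident_in_Hom)
    obtain g' where "R w' w (Ident C (p w)) g'" using R_total[OF w(2,1)] i eq by auto
    from iso[OF r this] show ?thesis using C.Ident_Cmp[OF i] eq by simp
  qed
  \<comment> \<open>The unit at \<open>A\<close> is the morphism related to the identity of
    \<open>q (s A)\<close>, regarded as a morphism between the two witnesses \<open>s A\<close> and
    \<open>t (q (s A))\<close>. The counit arises in the same way with the sides exchanged.\<close>
  have "\<exists>f. R (s A) (t (q (s A))) f (Ident D (q (s A)))" if A: "A \<in> Obj C" for A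
  proof -
    have sA: "s A \<in> Wit" "q (s A) \<in> Obj D" using s[OF A] q_Obj by auto
    then show ?thesis using R_surj[OF sA(1), of _ "Ident D (q (s A))"] t[OF sA(2)] D.Ident_in_Hom[OF sA(2)] by simp
  qed
  then obtain \<eta> where \<eta>: "\<And>A. A \<in> Obj C \<Longrightarrow> R (s A) (t (q (s A))) (\<eta> A) (Ident D (q (s A)))"
    using bchoice[of "Obj C" "\<lambda>A f. R (s A) (t (q (s A))) f (Ident D (q (s A)))"] by auto
  have "\<exists>g. R (s (p (t B))) (t B) (Ident C (p (t B))) g" if B: "B \<in> Obj D" for B
  proof -
    have tB: "t B \<in> Wit" "p (t B) \<in> Obj C" using t[OF B] p_Obj by auto
    then show ?thesis using R_total[OF _ tB(1), of _ "Ident C (p (t B))"] s[OF tB(2)] C.Ident_in_Hom[OF tB(2)] by simp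
  qed
  then obtain \<epsilon> where \<epsilon>: "\<And>B. B \<in> Obj D \<Longrightarrow> R (s (p (t B))) (t B) (Ident C (p (t B))) (\<epsilon> B)"
    using bchoice[of "Obj D" "\<lambda>B. R (s (p (t B))) (t B) (Ident C (p (t B)))"] by auto
  have h: "natural_iso C C id id (Go \<circ> Fo) (Gm \<circ> Fm) \<eta>"
  proof (rule natural_isoI)
    fix A assume A: "A \<in> Obj C"
    have sA: "p (s A) = A" "q (t (q (s A))) = q (s A)" using s[OF A] t[OF q_Obj[of "s A"]] by auto
    show "\<eta> A \<in> Hom C (id A) ((Go \<circ> Fo) A)" "iso_mor C (\<eta> A)"
      using R_Hom[OF \<eta>[OF A]] sA iso_D[OF \<eta>[OF A]] by (auto simp: Go_def Fo_def)
  next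
    fix f A B assume f: "f \<in> Hom C A B"
    note O = C.Hom_Obj[OF f]
    have Ff: "Fm f \<in> Hom D (q (s A)) (q (s B))" using R_Hom[OF R_Fm[OF f]] by simp
    show "\<eta> B \<cdot>\<^bsub>C\<^esub> id f = (Gm \<circ> Fm) f \<cdot>\<^bsub>C\<^esub> \<eta> A"
      using R_inj[OF R_Cmp[OF R_Fm[OF f] \<eta>[OF O(2)]]] R_Cmp[OF \<eta>[OF O(1)] R_Gm[OF Ff]]
        D.Cmp_Ident[OF Ff] D.Ident_Cmp[OF Ff] by simp
  qed
  have e: "natural_iso D D (Fo \<circ> Go) (Fm \<circ> Gm) id id \<epsilon>"
  proof (rule natural_isoI)
    fix B assume B: "B \<in> Obj D"
    have tB: "q (t B) = B" "p (s (p (t B))) = p (t B)" using t[OF B] s[OF p_Obj[of "t B"]] by auto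
    show "\<epsilon> B \<in> Hom D ((Fo \<circ> Go) B) (id B)" "iso_mor D (\<epsilon> B)"
      using R_Hom[OF \<epsilon>[OF B]] tB iso_C[of "s (p (t B))" "t B" "\<epsilon> B"] \<epsilon>[OF B] by (auto simp: Go_def Fo_def)
  next
    fix f A B assume f: "f \<in> Hom D A B"
    note O = D.Hom_Obj[OF f]
    have Gf: "Gm f \<in> Hom C (p (t A)) (p (t B))" using R_Hom[OF R_Gm[OF f]] by simp
    show "\<epsilon> B \<cdot>\<^bsub>D\<^esub> (Fm \<circ> Gm) f = id f \<cdot>\<^bsub>D\<^esub> \<epsilon> A"
      using R_fun[OF R_Cmp[OF R_Fm[OF Gf] \<epsilon>[OF O(2)]]] R_Cmp[OF \<epsilon>[OF O(1)] R_Gm[OF f]]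
        C.Cmp_Ident[OF Gf] C.Ident_Cmp[OF Gf] by simp
  qed
  show ?thesis
    unfolding serre_quotient_def
  proof (rule localisation_equivalence[OF F G h e])
    fix f assume "f \<in> serre_isos C S" "f \<in> Mor C"
    then show "Fm f \<in> serre_isos D S'"
      using serre_isos_transfer[OF _ R_Fm[OF HomI], of S S' f] S by simp
  next
    fix f assume "f \<in> serre_isos D S'" "f \<in> Mor D"
    then show "Gm f \<in> serre_isos C S"
      using Sym.serre_isos_transfer[OF _ R_Gm[OF HomI], of S' S f] S by simp
  qed
qed

end

lemma serre_quotient_op_cat:
  assumes "category C"
  shows "equivalent_categories (serre_quotient (op_cat C) S) (op_cat (serre_quotient C S))"
  using localisation_op_cat[OF assms] by (simp add: serre_quotient_def serre_isos_op_cat)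

section \<open>Additive functors with a presentation\<close>

lemma hom_grp_simps [simp]: "carrier (hom_grp C A B) = Hom C A B" "monoid.mult (hom_grp C A B) = Add C"
  "one (hom_grp C A B) = Zero C A B"
  by (simp_all add: hom_grp_def)

definition Diff :: "('o, 'm, 'z) preadd_cat_scheme \<Rightarrow> 'm \<Rightarrow> 'm \<Rightarrow> 'm" where
  "Diff C f g = Add C f (Neg C g)"

section \<open>Arithmetic in hom groups\<close>

context preadditive_category
begin

lemma Hom_comm_group:
  assumes "f \<in> Hom C A B"
  shows "comm_group (hom_grp C A B)"
  using comm_group_hom_grp Hom_Obj[OF assms] by blast

lemma Add_in_Hom [intro]:
  assumes "f \<in> Hom C A B" "g \<in> Hom C A B"
  shows "Add C f g \<in> Hom C A B"
proof -
  interpret comm_group "hom_grp C A B" by (rule Hom_comm_group[OF assms(1)])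
  show ?thesis using m_closed[of f g] assms by simp
qed

lemma Zero_in_Hom [intro]:
  assumes "A \<in> Obj C" "B \<in> Obj C"
  shows "Zero C A B \<in> Hom C A B"
proof -
  interpret comm_group "hom_grp C A B" by (rule comm_group_hom_grp[OF assms])
  show ?thesis using one_closed by simp
qed

lemma Neg_eq: "f \<in> Hom C A B \<Longrightarrow> Neg C f = inv\<^bsub>hom_grp C A B\<^esub> f"
  by (simp add: Neg_def Hom_def)

lemma Neg_in_Hom [intro]:
  assumes "f \<in> Hom C A B"
  shows "Neg C f \<in> Hom C A B"
proof -
  interpret comm_group "hom_grp C A B" by (rule Hom_comm_group[OF assms(1)])
  show ?thesis using inv_closed[of f] assms by (simp add: Neg_eq[OF assms])
qed

lemma Diff_in_Hom [intro]: "f \<in> Hom C A B \<Longrightarrow> g \<in> Hom C A B \<Longrightarrow> Diff C f g \<in> Hom C A B"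
  by (auto simp: Diff_def)

lemma Add_Zero [simp]:
  assumes "f \<in> Hom C A B"
  shows "Add C f (Zero C A B) = f" "Add C (Zero C A B) f = f"
proof -
  interpret comm_group "hom_grp C A B" by (rule Hom_comm_group[OF assms(1)])
  show "Add C f (Zero C A B) = f" "Add C (Zero C A B) f = f" using r_one[of f] l_one[of f] assms by simp_all
qed

lemma Add_commute:
  assumes "f \<in> Hom C A B" "g \<in> Hom C A B"
  shows "Add C f g = Add C g f"
proof -
  interpret comm_group "hom_grp C A B" by (rule Hom_comm_group[OF assms(1)])
  show ?thesis using m_comm[of f g] assms by simp
qed

lemma Diff_eq_iff:
  assumes "f \<in> Hom C A B" "g \<in> Hom C A B" "h \<in> Hom C A B"
  shows "Diff C f g = h \<longleftrightarrow> f = Add C h g"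
proof -
  interpret comm_group "hom_grp C A B" by (rule Hom_comm_group[OF assms(1)])
  show ?thesis
    using inv_solve_right'[of h f g] assms by (simp add: Diff_def Neg_eq[OF assms(2)])
qed

lemma Diff_eq_Zero_iff:
  assumes "f \<in> Hom C A B" "g \<in> Hom C A B"
  shows "Diff C f g = Zero C A B \<longleftrightarrow> f = g"
  using Diff_eq_iff[OF assms Zero_in_Hom] Hom_Obj[OF assms(1)] assms by auto

lemma Add_self_Zero:
  assumes "f \<in> Hom C A B" "Add C f f = f"
  shows "f = Zero C A B"
proof -
  interpret comm_group "hom_grp C A B" by (rule Hom_comm_group[OF assms(1)])
  show ?thesis using l_cancel_one[of f f] assms by simp
qed

lemma Cmp_Zero:
  assumes "g \<in> Hom C B D" "A \<in> Obj C"
  shows "g \<cdot> Zero C A B = Zero C A D"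
proof -
  note z = Zero_in_Hom[OF assms(2) Hom_Obj(1)[OF assms(1)]]
  show ?thesis
    using Add_Cmp[OF z z assms(1)] z by (intro Add_self_Zero[OF Cmp_in_Hom[OF z assms(1)]]) simp
qed

lemma Zero_Cmp:
  assumes "f \<in> Hom C A B" "D \<in> Obj C"
  shows "Zero C B D \<cdot> f = Zero C A D"
proof -
  note z = Zero_in_Hom[OF Hom_Obj(2)[OF assms(1)] assms(2)]
  show ?thesis
    using Cmp_Add[OF assms(1) z z] z by (intro Add_self_Zero[OF Cmp_in_Hom[OF assms(1) z]]) simp
qed

lemma Diff_Cmp:
  assumes "f \<in> Hom C A B" "g \<in> Hom C B D" "g' \<in> Hom C B D"
  shows "Diff C g g' \<cdot> f = Diff C (g \<cdot> f) (g' \<cdot> f)"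
proof -
  have "Add C (Diff C g g') g' = g"
    using Diff_eq_iff[OF assms(2,3) Diff_in_Hom[OF assms(2,3)]] by simp
  then have "Add C (Diff C g g' \<cdot> f) (g' \<cdot> f) = g \<cdot> f"
    using Cmp_Add[OF assms(1) Diff_in_Hom[OF assms(2,3)] assms(3)] by simp
  then show ?thesis
    using Diff_eq_iff[of "g \<cdot> f" A D "g' \<cdot> f" "Diff C g g' \<cdot> f"] assms Cmp_in_Hom Diff_in_Hom by metis
qed

lemma Cmp_Diff:
  assumes "f \<in> Hom C A B" "f' \<in> Hom C A B" "g \<in> Hom C B D"
  shows "g \<cdot> Diff C f f' = Diff C (g \<cdot> f) (g \<cdot> f')"
proof -
  have "Add C (Diff C f f') f' = f"
    using Diff_eq_iff[OF assms(1,2) Diff_in_Hom[OF assms(1,2)]] by simp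
  then have "Add C (g \<cdot> Diff C f f') (g \<cdot> f') = g \<cdot> f"
    using Add_Cmp[OF Diff_in_Hom[OF assms(1,2)] assms(2,3)] by simp
  then show ?thesis
    using Diff_eq_iff[of "g \<cdot> f" A D "g \<cdot> f'" "g \<cdot> Diff C f f'"] assms Cmp_in_Hom Diff_in_Hom by metis
qed

lemma Neg_Zero: "f \<in> Hom C A B \<Longrightarrow> Neg C f = Diff C (Zero C A B) f"
  by (simp add: Diff_def Add_Zero(2)[OF Neg_in_Hom])

lemma Neg_Cmp:
  assumes "f \<in> Hom C A B" "g \<in> Hom C B D"
  shows "Neg C g \<cdot> f = Neg C (g \<cdot> f)"
  using assms Hom_Obj[OF assms(1)] Hom_Obj[OF assms(2)] Diff_Cmp[OF assms(1) _ assms(2)] Zero_Cmp[OF assms(1)]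
  by (simp add: Neg_Zero[OF assms(2)] Neg_Zero[OF Cmp_in_Hom[OF assms]] Zero_in_Hom)

lemma Cmp_Neg:
  assumes "f \<in> Hom C A B" "g \<in> Hom C B D"
  shows "g \<cdot> Neg C f = Neg C (g \<cdot> f)"
  using assms Hom_Obj[OF assms(1)] Hom_Obj[OF assms(2)] Cmp_Diff[OF _ assms] Cmp_Zero[OF assms(2)]
  by (simp add: Neg_Zero[OF assms(1)] Neg_Zero[OF Cmp_in_Hom[OF assms]] Zero_in_Hom)

lemma Neg_Neg:
  assumes "f \<in> Hom C A B"
  shows "Neg C (Neg C f) = f"
proof -
  interpret comm_group "hom_grp C A B" by (rule Hom_comm_group[OF assms(1)])
  show ?thesis using inv_inv[of f] assms by (simp add: Neg_eq[OF assms] Neg_eq[OF Neg_in_Hom[OF assms], unfolded Neg_eq[OF assms]])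
qed

end

locale additive_functor_on = preadditive_category C
  for C :: "('o, 'm, 'z) preadd_cat_scheme" (structure) and F :: "('o, 'm, 'a) ab_functor" +
  assumes additive: "additive_functor C F"
begin

lemma FObj_group: "X \<in> Obj C \<Longrightarrow> comm_group (FObj F X)"
  using additive by (simp add: additive_functor_def)

lemma FMor_hom: "f \<in> Hom C X Y \<Longrightarrow> FMor F f \<in> hom (FObj F X) (FObj F Y)"
  using additive by (auto simp: additive_functor_def Hom_def)

lemma FMor_closed [intro]: "f \<in> Hom C X Y \<Longrightarrow> x \<in> carrier (FObj F X) \<Longrightarrow> FMor F f x \<in> carrier (FObj F Y)"
  using FMor_hom by (auto simp: hom_def)

lemma FMor_mult:
  "f \<in> Hom C X Y \<Longrightarrow> x \<in> carrier (FObj F X) \<Longrightarrow> y \<in> carrier (FObj F X)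
    \<Longrightarrow> FMor F f (x \<otimes>\<^bsub>FObj F X\<^esub> y) = FMor F f x \<otimes>\<^bsub>FObj F Y\<^esub> FMor F f y"
  using FMor_hom by (auto simp: hom_def)

lemma FMor_one:
  assumes "f \<in> Hom C X Y"
  shows "FMor F f \<one>\<^bsub>FObj F X\<^esub> = \<one>\<^bsub>FObj F Y\<^esub>"
  using hom_one[OF FMor_hom[OF assms]] FObj_group Hom_Obj[OF assms] comm_group.axioms(2) by blast

lemma FMor_Ident: "x \<in> carrier (FObj F X) \<Longrightarrow> X \<in> Obj C \<Longrightarrow> FMor F (Ident C X) x = x"
  using additive by (simp add: additive_functor_def)

lemma FMor_Cmp:
  "f \<in> Hom C X Y \<Longrightarrow> g \<in> Hom C Y Z \<Longrightarrow> x \<in> carrier (FObj F X)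
    \<Longrightarrow> FMor F (g \<cdot> f) x = FMor F g (FMor F f x)"
  using additive by (auto simp: additive_functor_def Hom_def)

lemma FMor_Add:
  "f \<in> Hom C X Y \<Longrightarrow> g \<in> Hom C X Y \<Longrightarrow> x \<in> carrier (FObj F X)
    \<Longrightarrow> FMor F (Add C f g) x = FMor F f x \<otimes>\<^bsub>FObj F Y\<^esub> FMor F g x"
  using additive by (auto simp: additive_functor_def Hom_def)

lemma FMor_eq_iff:
  assumes "f \<in> Hom C X Y" "g \<in> Hom C X Y" "x \<in> carrier (FObj F X)"
  shows "FMor F f x = FMor F g x \<longleftrightarrow> FMor F (Diff C f g) x = \<one>\<^bsub>FObj F Y\<^esub>"
proof -
  interpret G: comm_group "FObj F Y" using FObj_group Hom_Obj[OF assms(1)] by blast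
  have d: "Diff C f g \<in> Hom C X Y" using assms by blast
  have "Add C (Diff C f g) g = f" using Diff_eq_iff[OF assms(1,2) d] by simp
  then have "FMor F f x = FMor F (Diff C f g) x \<otimes>\<^bsub>FObj F Y\<^esub> FMor F g x"
    using FMor_Add[OF d assms(2,3)] by simp
  then show ?thesis
    using G.r_cancel_one[of "FMor F g x" "FMor F (Diff C f g) x"] FMor_closed[OF d assms(3)] FMor_closed[OF assms(2,3)]
    by simp
qed

end

text \<open>
  The transformation \<open>(A, -) \<rightarrow> F\<close> which by the Yoneda lemma corresponds to \<open>a \<in> F A\<close> is a cokernel
  of \<open>(f, -)\<close>.
\<close>

definition presents :: "('o, 'm, 'z) preadd_cat_scheme \<Rightarrow> ('o, 'm, 'a) ab_functor \<Rightarrow> 'm \<Rightarrow> 'a \<Rightarrow> bool" where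
  "presents C F f a \<longleftrightarrow> f \<in> Mor C \<and> a \<in> carrier (FObj F (Src C f)) \<and>
    (\<forall>X \<in> Obj C. \<forall>x \<in> carrier (FObj F X). \<exists>g \<in> Hom C (Src C f) X. x = FMor F g a) \<and>
    (\<forall>X \<in> Obj C. \<forall>g \<in> Hom C (Src C f) X. FMor F g a = \<one>\<^bsub>FObj F X\<^esub> \<longleftrightarrow> g \<in> precomp_image C f X)"

lemma (in preadditive_category) presentsD:
  assumes "presents C F f a" "f \<in> Hom C A B"
  shows "a \<in> carrier (FObj F A)"
    and "X \<in> Obj C \<Longrightarrow> x \<in> carrier (FObj F X) \<Longrightarrow> \<exists>g \<in> Hom C A X. x = FMor F g a"
    and "g \<in> Hom C A X \<Longrightarrow> FMor F g a = \<one>\<^bsub>FObj F X\<^esub> \<longleftrightarrow> (\<exists>k \<in> Hom C B X. g = k \<cdot> f)"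
proof -
  show "a \<in> carrier (FObj F A)"
    and "X \<in> Obj C \<Longrightarrow> x \<in> carrier (FObj F X) \<Longrightarrow> \<exists>g \<in> Hom C A X. x = FMor F g a"
    using assms unfolding presents_def Hom_def by auto
  assume "g \<in> Hom C A X"
  then show "FMor F g a = \<one>\<^bsub>FObj F X\<^esub> \<longleftrightarrow> (\<exists>k \<in> Hom C B X. g = k \<cdot> f)"
    using assms Hom_Obj(2)[of g A X] HomD[OF assms(2)] unfolding presents_def precomp_image_def by auto
qed

lemma (in preadditive_category) presents_self:
  assumes "presents C F f a" "f \<in> Hom C A B"
  shows "FMor F f a = \<one>\<^bsub>FObj F B\<^esub>"
  using presentsD(3)[OF assms assms(2)] Ident_in_Hom[OF Hom_Obj(2)[OF assms(2)]] Ident_Cmp[OF assms(2)]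
  by metis

lemma nat_transD:
  assumes "\<eta> \<in> nat_trans C F G"
  shows "X \<in> Obj C \<Longrightarrow> \<eta> X \<in> hom (FObj F X) (FObj G X)"
    and "X \<in> Obj C \<Longrightarrow> x \<in> carrier (FObj F X) \<Longrightarrow> \<eta> X x \<in> carrier (FObj G X)"
    and "f \<in> Hom C X Y \<Longrightarrow> x \<in> carrier (FObj F X) \<Longrightarrow> \<eta> Y (FMor F f x) = FMor G f (\<eta> X x)"
    and "X \<in> Obj C \<Longrightarrow> \<eta> X \<in> extensional (carrier (FObj F X))"
    and "\<eta> \<in> extensional (Obj C)"
  using assms unfolding nat_trans_def Hom_def by (auto simp: hom_def PiE_def Pi_def)

lemma nat_transI:
  assumes "\<And>X. X \<in> Obj C \<Longrightarrow> \<eta> X \<in> hom (FObj F X) (FObj G X)"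
    and "\<And>f X Y x. f \<in> Hom C X Y \<Longrightarrow> x \<in> carrier (FObj F X) \<Longrightarrow> \<eta> Y (FMor F f x) = FMor G f (\<eta> X x)"
    and "\<And>X. X \<in> Obj C \<Longrightarrow> \<eta> X \<in> extensional (carrier (FObj F X))"
    and "\<eta> \<in> extensional (Obj C)"
  shows "\<eta> \<in> nat_trans C F G"
  unfolding nat_trans_def
proof (intro CollectI conjI PiE_I ballI)
  fix f x assume "f \<in> Mor C" "x \<in> carrier (FObj F (Src C f))"
  then show "\<eta> (Tgt C f) (FMor F f x) = FMor G f (\<eta> (Src C f) x)" using assms(2)[OF HomI] by simp
qed (use assms(1,3,4) in \<open>auto simp: extensional_def\<close>)

section \<open>Natural transformations out of a presented functor\<close>

context preadditive_category
begin

text \<open>Every element of \<open>F X\<close> is of the form \<open>FMor F g a\<close>, so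
  naturality leaves no freedom beyond the value at the generator \<open>a\<close>.\<close>

lemma nat_trans_eqI:
  assumes p: "presents C F f a" and f: "f \<in> Hom C A B"
    and e: "\<eta> \<in> nat_trans C F G" "\<eta>' \<in> nat_trans C F G" and eq: "\<eta> A a = \<eta>' A a"
  shows "\<eta> = \<eta>'"
proof (rule ext)
  fix X show "\<eta> X = \<eta>' X"
  proof (cases "X \<in> Obj C")
    case True
    show ?thesis
    proof (rule extensionalityI[OF nat_transD(4)[OF e(1) True] nat_transD(4)[OF e(2) True]])
      fix x assume "x \<in> carrier (FObj F X)"
      then obtain g where g: "g \<in> Hom C A X" "x = FMor F g a"
        using presentsD(2)[OF p f True] by auto
      then show "\<eta> X x = \<eta>' X x"
        using nat_transD(3)[OF e(1) g(1) presentsD(1)[OF p f]] nat_transD(3)[OF e(2) g(1) presentsD(1)[OF p f]] eq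
        by simp
    qed
  next
    case False
    then show ?thesis using nat_transD(5)[OF e(1)] nat_transD(5)[OF e(2)] by (simp add: extensional_def)
  qed
qed

text \<open>The universal property of the cokernel combined with the Yoneda lemma: the maps
  \<open>g\<close> that kill \<open>a\<close> are the multiples of \<open>f\<close>, and those kill
  \<open>x\<close> as well, so sending \<open>FMor F g a\<close> to \<open>FMor G g x\<close> is
  well defined.\<close>

lemma nat_trans_extension:
  assumes p: "presents C F f a" and f: "f \<in> Hom C A B"
    and F: "additive_functor C F" and G: "additive_functor C G"
    and x: "x \<in> carrier (FObj G A)" "FMor G f x = \<one>\<^bsub>FObj G B\<^esub>"
  obtains \<eta> where "\<eta> \<in> nat_trans C F G" "\<eta> A a = x"
proof -
  interpret F: additive_functor_on C F by unfold_locales (fact F)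
  interpret G: additive_functor_on C G by unfold_locales (fact G)
  note a = presentsD(1)[OF p f]
  have ker: "FMor G g x = \<one>\<^bsub>FObj G X\<^esub>" if g: "g \<in> Hom C A X" "FMor F g a = \<one>\<^bsub>FObj F X\<^esub>" for g X
  proof -
    obtain k where k: "k \<in> Hom C B X" "g = k \<cdot> f" using presentsD(3)[OF p f g(1)] g(2) by auto
    then show ?thesis using G.FMor_Cmp[OF f k(1) x(1)] x(2) G.FMor_one[OF k(1)] by simp
  qed
  have wd: "FMor G g x = FMor G g' x"
    if "g \<in> Hom C A X" "g' \<in> Hom C A X" "FMor F g a = FMor F g' a" for g g' X
    using that ker[of "Diff C g g'"] F.FMor_eq_iff[OF that(1,2) a] G.FMor_eq_iff[OF that(1,2) x(1)]
    by auto
  \<comment> \<open>The chosen \<open>g\<close> expresses \<open>y\<close> in terms of the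
    generator; by \<open>wd\<close> any other such \<open>g\<close> gives the same value.\<close>
  define \<eta> where "\<eta> = (\<lambda>X\<in>Obj C. \<lambda>y\<in>carrier (FObj F X). FMor G (SOME g. g \<in> Hom C A X \<and> FMor F g a = y) x)"
  have \<eta>: "\<eta> X (FMor F g a) = FMor G g x" if g: "g \<in> Hom C A X" for g X
  proof -
    define g' where "g' = (SOME g'. g' \<in> Hom C A X \<and> FMor F g' a = FMor F g a)"
    have "g' \<in> Hom C A X \<and> FMor F g' a = FMor F g a"
      unfolding g'_def by (rule someI[of _ g]) (simp add: g)
    then show ?thesis
      using wd[of g' X g] g Hom_Obj(2)[OF g] F.FMor_closed[OF g a] unfolding \<eta>_def g'_def by simp
  qed
  have "\<eta> \<in> nat_trans C F G"
  proof (rule nat_transI)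
    fix X assume X: "X \<in> Obj C"
    show "\<eta> X \<in> extensional (carrier (FObj F X))" using X by (simp add: \<eta>_def)
    show "\<eta> X \<in> hom (FObj F X) (FObj G X)"
    proof (rule homI)
      fix y assume "y \<in> carrier (FObj F X)"
      then obtain g where g: "g \<in> Hom C A X" "y = FMor F g a" using presentsD(2)[OF p f X] by auto
      then show "\<eta> X y \<in> carrier (FObj G X)" using \<eta>[OF g(1)] G.FMor_closed[OF g(1) x(1)] by simp
      fix z assume "z \<in> carrier (FObj F X)"
      then obtain h where h: "h \<in> Hom C A X" "z = FMor F h a" using presentsD(2)[OF p f X] by auto
      show "\<eta> X (y \<otimes>\<^bsub>FObj F X\<^esub> z) = \<eta> X y \<otimes>\<^bsub>FObj G X\<^esub> \<eta> X z"
        using \<eta>[OF Add_in_Hom[OF g(1) h(1)]] \<eta>[OF g(1)] \<eta>[OF h(1)]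
          F.FMor_Add[OF g(1) h(1) a] G.FMor_Add[OF g(1) h(1) x(1)] g(2) h(2) by simp
    qed
  next
    fix k X Y y assume k: "k \<in> Hom C X Y" and "y \<in> carrier (FObj F X)"
    then obtain g where g: "g \<in> Hom C A X" "y = FMor F g a"
      using presentsD(2)[OF p f Hom_Obj(1)[OF k]] by auto
    show "\<eta> Y (FMor F k y) = FMor G k (\<eta> X y)"
      using \<eta>[OF g(1)] \<eta>[OF Cmp_in_Hom[OF g(1) k]] F.FMor_Cmp[OF g(1) k a] G.FMor_Cmp[OF g(1) k x(1)] g(2)
      by simp
  qed (simp add: \<eta>_def)
  moreover have "\<eta> A a = x"
    using \<eta>[OF Ident_in_Hom[OF Hom_Obj(1)[OF f]]] F.FMor_Ident[OF a] G.FMor_Ident[OF x(1)] Hom_Obj(1)[OF f]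
    by simp
  ultimately show ?thesis by (rule that)
qed

lemma nat_trans_generator:
  assumes p: "presents C F f a" and f: "f \<in> Hom C A B"
    and F: "additive_functor C F" and e: "\<eta> \<in> nat_trans C F G" and G: "additive_functor C G"
  shows "\<eta> A a \<in> carrier (FObj G A)" "FMor G f (\<eta> A a) = \<one>\<^bsub>FObj G B\<^esub>"
proof -
  interpret F: additive_functor_on C F by unfold_locales (fact F)
  interpret G: additive_functor_on C G by unfold_locales (fact G)
  note a = presentsD(1)[OF p f] and O = Hom_Obj[OF f]
  show "\<eta> A a \<in> carrier (FObj G A)" by (rule nat_transD(2)[OF e O(1) a])
  have "FMor F f a = \<one>\<^bsub>FObj F B\<^esub>"
    by (rule presents_self[OF p f])
  moreover have "\<eta> B \<one>\<^bsub>FObj F B\<^esub> = \<one>\<^bsub>FObj G B\<^esub>"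
    by (rule hom_one[OF nat_transD(1)[OF e O(2)]])
      (use F.FObj_group[OF O(2)] G.FObj_group[OF O(2)] in \<open>auto simp: comm_group_def\<close>)
  ultimately show "FMor G f (\<eta> A a) = \<one>\<^bsub>FObj G B\<^esub>"
    using nat_transD(3)[OF e f a] by simp
qed

lemma nat_trans_comp:
  assumes e: "\<eta> \<in> nat_trans C F G" and z: "\<zeta> \<in> nat_trans C G H" and F: "additive_functor C F"
  shows "(\<lambda>X\<in>Obj C. \<lambda>x\<in>carrier (FObj F X). \<zeta> X (\<eta> X x)) \<in> nat_trans C F H"
proof (rule nat_transI)
  interpret F: additive_functor_on C F by unfold_locales (fact F)
  fix X assume X: "X \<in> Obj C"
  interpret FX: comm_group "FObj F X" by (rule F.FObj_group[OF X])
  have "\<zeta> X \<circ> \<eta> X \<in> hom (FObj F X) (FObj H X)"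
    by (rule hom_compose[OF nat_transD(1)[OF e X] nat_transD(1)[OF z X]])
  then show "(\<lambda>X\<in>Obj C. \<lambda>x\<in>carrier (FObj F X). \<zeta> X (\<eta> X x)) X \<in> hom (FObj F X) (FObj H X)"
    using X by (auto simp: hom_def Pi_def)
next
  interpret F: additive_functor_on C F by unfold_locales (fact F)
  fix f X Y x assume f: "f \<in> Hom C X Y" and x: "x \<in> carrier (FObj F X)"
  note O = Hom_Obj[OF f]
  show "(\<lambda>X\<in>Obj C. \<lambda>x\<in>carrier (FObj F X). \<zeta> X (\<eta> X x)) Y (FMor F f x)
      = FMor H f ((\<lambda>X\<in>Obj C. \<lambda>x\<in>carrier (FObj F X). \<zeta> X (\<eta> X x)) X x)"
    using O x F.FMor_closed[OF f x] nat_transD(3)[OF e f x] nat_transD(3)[OF z f nat_transD(2)[OF e O(1) x]]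
    by simp
qed auto

lemma nat_trans_Ident:
  assumes F: "additive_functor C F"
  shows "(\<lambda>X\<in>Obj C. \<lambda>x\<in>carrier (FObj F X). x) \<in> nat_trans C F F"
proof (rule nat_transI)
  interpret F: additive_functor_on C F by unfold_locales (fact F)
  fix X assume X: "X \<in> Obj C"
  interpret FX: comm_group "FObj F X" by (rule F.FObj_group[OF X])
  show "(\<lambda>X\<in>Obj C. \<lambda>x\<in>carrier (FObj F X). x) X \<in> hom (FObj F X) (FObj F X)"
    using X by (auto simp: hom_def)
next
  interpret F: additive_functor_on C F by unfold_locales (fact F)
  fix f X Y x assume f: "f \<in> Hom C X Y" and x: "x \<in> carrier (FObj F X)"
  then show "(\<lambda>X\<in>Obj C. \<lambda>x\<in>carrier (FObj F X). x) Y (FMor F f x)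
      = FMor F f ((\<lambda>X\<in>Obj C. \<lambda>x\<in>carrier (FObj F X). x) X x)"
    using Hom_Obj[OF f] F.FMor_closed[OF f x] by simp
qed auto

text \<open>Two cokernels of the same map. The transformation taking \<open>a\<close> to
  \<open>b\<close> is onto since \<open>b\<close> generates, and injective since both
  \<open>a\<close> and \<open>b\<close> are killed by exactly the multiples of
  \<open>f\<close>.\<close>

lemma presents_nat_isomorphic:
  assumes F: "additive_functor C F" and G: "additive_functor C G"
    and p: "presents C F f a" "presents C G f b"
  shows "nat_isomorphic C F G"
proof -
  interpret F: additive_functor_on C F by unfold_locales (fact F)
  interpret G: additive_functor_on C G by unfold_locales (fact G)
  have f: "f \<in> Hom C (Src C f) (Tgt C f)" using p(1) by (simp add: presents_def HomI)
  have "FMor G f b = \<one>\<^bsub>FObj G (Tgt C f)\<^esub>"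
    by (rule presents_self[OF p(2) f])
  then obtain \<eta> where e: "\<eta> \<in> nat_trans C F G" "\<eta> (Src C f) a = b"
    by (rule nat_trans_extension[OF p(1) f F G presentsD(1)[OF p(2) f]])
  have "bij_betw (\<eta> X) (carrier (FObj F X)) (carrier (FObj G X))" if X: "X \<in> Obj C" for X
  proof -
    have v: "\<eta> X (FMor F g a) = FMor G g b" if "g \<in> Hom C (Src C f) X" for g
      using nat_transD(3)[OF e(1) that presentsD(1)[OF p(1) f]] e(2) by simp
    show ?thesis
    proof (rule bij_betw_imageI)
      show "inj_on (\<eta> X) (carrier (FObj F X))"
      proof (rule inj_onI)
        fix x y assume "x \<in> carrier (FObj F X)" "y \<in> carrier (FObj F X)" and eq: "\<eta> X x = \<eta> X y"
        then obtain g h where g: "g \<in> Hom C (Src C f) X" "x = FMor F g a"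
          and h: "h \<in> Hom C (Src C f) X" "y = FMor F h a" using presentsD(2)[OF p(1) f X] by blast
        have "FMor G g b = FMor G h b" using eq g h v by simp
        then have "FMor G (Diff C g h) b = \<one>\<^bsub>FObj G X\<^esub>"
          using G.FMor_eq_iff[OF g(1) h(1) presentsD(1)[OF p(2) f]] by simp
        then have "FMor F (Diff C g h) a = \<one>\<^bsub>FObj F X\<^esub>"
          using presentsD(3)[OF p(1) f Diff_in_Hom[OF g(1) h(1)]] presentsD(3)[OF p(2) f Diff_in_Hom[OF g(1) h(1)]]
          by simp
        then show "x = y" using F.FMor_eq_iff[OF g(1) h(1) presentsD(1)[OF p(1) f]] g h by simp
      qed
      show "\<eta> X ` carrier (FObj F X) = carrier (FObj G X)"
      proof (intro equalityI subsetI)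
        fix y assume "y \<in> carrier (FObj G X)"
        then obtain g where g: "g \<in> Hom C (Src C f) X" "y = FMor G g b" using presentsD(2)[OF p(2) f X] by auto
        then show "y \<in> \<eta> X ` carrier (FObj F X)"
          using v[OF g(1)] F.FMor_closed[OF g(1) presentsD(1)[OF p(1) f]] by (intro image_eqI[of _ _ "FMor F g a"]) auto
      qed (use nat_transD(2)[OF e(1) X] in auto)
    qed
  qed
  then show ?thesis using e(1) unfolding nat_isomorphic_def by auto
qed

text \<open>The generator is the preimage of \<open>b\<close>; injectivity of the isomorphism
  carries over both generation and relations.\<close>

lemma presents_nat_isomorphic_transfer:
  assumes F: "additive_functor C F" and G: "additive_functor C G"
    and i: "nat_isomorphic C F G" and p: "presents C G f b"
  obtains a where "presents C F f a"
proof -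
  interpret F: additive_functor_on C F by unfold_locales (fact F)
  interpret G: additive_functor_on C G by unfold_locales (fact G)
  obtain \<eta> where e: "\<eta> \<in> nat_trans C F G"
    and bij: "\<And>X. X \<in> Obj C \<Longrightarrow> bij_betw (\<eta> X) (carrier (FObj F X)) (carrier (FObj G X))"
    using i unfolding nat_isomorphic_def by auto
  have fM: "f \<in> Mor C" using p by (simp add: presents_def)
  note f = HomI[OF fM] and O = Src_in_Obj[OF fM]
  have "b \<in> \<eta> (Src C f) ` carrier (FObj F (Src C f))"
    using bij[OF O] presentsD(1)[OF p f] by (simp add: bij_betw_def)
  then obtain a where a: "a \<in> carrier (FObj F (Src C f))" "\<eta> (Src C f) a = b" by auto
  have v: "\<eta> X (FMor F g a) = FMor G g b" if "g \<in> Hom C (Src C f) X" for g X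
    using nat_transD(3)[OF e that a(1)] a(2) by simp
  have inj: "x = y" if "X \<in> Obj C" "x \<in> carrier (FObj F X)" "y \<in> carrier (FObj F X)" "\<eta> X x = \<eta> X y" for X x y
    using bij[OF that(1)] that by (auto simp: bij_betw_def dest: inj_onD)
  have "presents C F f a"
    unfolding presents_def
  proof (intro conjI ballI)
    fix X x assume X: "X \<in> Obj C" and x: "x \<in> carrier (FObj F X)"
    obtain g where g: "g \<in> Hom C (Src C f) X" "\<eta> X x = FMor G g b"
      using presentsD(2)[OF p f X nat_transD(2)[OF e X x]] by auto
    then have "x = FMor F g a" using inj[OF X x F.FMor_closed[OF g(1) a(1)]] v by simp
    then show "\<exists>g\<in>Hom C (Src C f) X. x = FMor F g a" using g(1) by auto
  next
    fix X g assume X: "X \<in> Obj C" and g: "g \<in> Hom C (Src C f) X"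
    have one: "\<one>\<^bsub>FObj F X\<^esub> \<in> carrier (FObj F X)"
      using F.FObj_group[OF X] by (simp add: comm_group_def group.is_monoid monoid.one_closed)
    have "\<eta> X \<one>\<^bsub>FObj F X\<^esub> = \<one>\<^bsub>FObj G X\<^esub>"
      by (rule hom_one[OF nat_transD(1)[OF e X]])
        (use F.FObj_group[OF X] G.FObj_group[OF X] in \<open>auto simp: comm_group_def\<close>)
    then have "FMor F g a = \<one>\<^bsub>FObj F X\<^esub> \<longleftrightarrow> FMor G g b = \<one>\<^bsub>FObj G X\<^esub>"
      using inj[OF X F.FMor_closed[OF g a(1)] one] v[OF g] by auto
    also have "\<dots> \<longleftrightarrow> g \<in> precomp_image C f X"
      using p X g unfolding presents_def by auto
    finally show "FMor F g a = \<one>\<^bsub>FObj F X\<^esub> \<longleftrightarrow> g \<in> precomp_image C f X" .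
  qed (fact fM a(1))+
  then show ?thesis by (rule that)
qed

end

text \<open>This has the shape of \<open>coker_functor\<close> with an arbitrary functor
  \<open>G\<close> and family \<open>N\<close>, so that cokernels of representables and pp pairs
  become two instances of one construction.\<close>

definition quotient_functor :: "('o, 'm, 'z) preadd_cat_scheme \<Rightarrow> ('o, 'm, 'a) ab_functor \<Rightarrow> ('o \<Rightarrow> 'a set)
    \<Rightarrow> ('o, 'm, 'a set) ab_functor" where
  "quotient_functor C G N =
     \<lparr>FObj = (\<lambda>X. FObj G X Mod N X),
      FMor = (\<lambda>h c. \<Union>g \<in> c. N (Tgt C h) #>\<^bsub>FObj G (Tgt C h)\<^esub> FMor G h g)\<rparr>"

section \<open>Quotients of an additive functor by subfunctors\<close>

locale subfunctor = additive_functor_on C G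
  for C :: "('o, 'm, 'z) preadd_cat_scheme" (structure) and G :: "('o, 'm, 'a) ab_functor" +
  fixes N :: "'o \<Rightarrow> 'a set"
  assumes subgroup_N: "X \<in> Obj C \<Longrightarrow> subgroup (N X) (FObj G X)"
    and FMor_N: "f \<in> Hom C X Y \<Longrightarrow> x \<in> N X \<Longrightarrow> FMor G f x \<in> N Y"
begin

abbreviation quot where "quot \<equiv> quotient_functor C G N"
abbreviation coset where "coset X x \<equiv> N X #>\<^bsub>FObj G X\<^esub> x"

lemma normal_N: "X \<in> Obj C \<Longrightarrow> N X \<lhd> FObj G X"
  using comm_group.subgroup_imp_normal[OF FObj_group subgroup_N] .

lemma carrier_quot: "carrier (FObj quot X) = coset X ` carrier (FObj G X)"
  by (simp add: quotient_functor_def carrier_FactGroup)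

lemma one_quot: "\<one>\<^bsub>FObj quot X\<^esub> = N X"
  by (simp add: quotient_functor_def)

lemma coset_mult:
  "X \<in> Obj C \<Longrightarrow> x \<in> carrier (FObj G X) \<Longrightarrow> y \<in> carrier (FObj G X)
    \<Longrightarrow> coset X x \<otimes>\<^bsub>FObj quot X\<^esub> coset X y = coset X (x \<otimes>\<^bsub>FObj G X\<^esub> y)"
  using normal.rcos_sum[OF normal_N] by (simp add: quotient_functor_def)

lemma coset_eq_one_iff:
  assumes "X \<in> Obj C" "x \<in> carrier (FObj G X)"
  shows "coset X x = \<one>\<^bsub>FObj quot X\<^esub> \<longleftrightarrow> x \<in> N X"
proof -
  interpret comm_group "FObj G X" by (rule FObj_group[OF assms(1)])
  show ?thesis
    using coset_join1[OF _ assms(2) subgroup_N[OF assms(1)]] coset_join2[OF assms(2) subgroup_N[OF assms(1)]]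
    by (auto simp: one_quot)
qed

lemma coset_self:
  assumes "X \<in> Obj C" "x \<in> carrier (FObj G X)"
  shows "x \<in> coset X x"
proof -
  interpret comm_group "FObj G X" by (rule FObj_group[OF assms(1)])
  show ?thesis by (rule rcos_self[OF assms(2) subgroup_N[OF assms(1)]])
qed

lemma coset_repr:
  assumes "X \<in> Obj C" "x \<in> carrier (FObj G X)" "y \<in> coset X x"
  shows "y \<in> carrier (FObj G X)" "coset X y = coset X x"
proof -
  interpret comm_group "FObj G X" by (rule FObj_group[OF assms(1)])
  show "coset X y = coset X x"
    using repr_independence[OF assms(3,2) subgroup_N[OF assms(1)]] by simp
  show "y \<in> carrier (FObj G X)"
    using r_coset_subset_G[OF subgroup.subset[OF subgroup_N[OF assms(1)]] assms(2)] assms(3) by blast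
qed

text \<open>All representatives of a coset are sent into one coset, so the union in the definition
  runs over a constant family, which is not empty.\<close>

lemma FMor_coset:
  assumes f: "f \<in> Hom C X Y" and x: "x \<in> carrier (FObj G X)"
  shows "FMor quot f (coset X x) = coset Y (FMor G f x)"
proof -
  note O = Hom_Obj[OF f]
  interpret Y: comm_group "FObj G Y" by (rule FObj_group[OF O(2)])
  have "coset Y (FMor G f y) = coset Y (FMor G f x)" if "y \<in> coset X x" for y
  proof -
    obtain n where n: "n \<in> N X" "y = n \<otimes>\<^bsub>FObj G X\<^esub> x" using \<open>y \<in> coset X x\<close> by (auto simp: r_coset_def)
    have "n \<in> carrier (FObj G X)" using n(1) subgroup.subset[OF subgroup_N[OF O(1)]] by auto
    then have "FMor G f y = FMor G f n \<otimes>\<^bsub>FObj G Y\<^esub> FMor G f x"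
      using n(2) FMor_mult[OF f _ x] by simp
    then have "FMor G f y \<in> coset Y (FMor G f x)" using FMor_N[OF f n(1)] by (auto simp: r_coset_def)
    then show ?thesis by (rule coset_repr(2)[OF O(2) FMor_closed[OF f x]])
  qed
  then have "(\<Union>y \<in> coset X x. coset Y (FMor G f y)) = (\<Union>y \<in> coset X x. coset Y (FMor G f x))"
    by (rule SUP_cong[OF refl])
  moreover have "coset X x \<noteq> {}" using coset_self[OF O(1) x] by auto
  ultimately have "(\<Union>y \<in> coset X x. coset Y (FMor G f y)) = coset Y (FMor G f x)"
    by simp
  then show ?thesis by (simp add: quotient_functor_def HomD(3)[OF f])
qed

lemma additive_quot: "additive_functor C quot"
  unfolding additive_functor_def
proof (intro conjI ballI impI)
  fix X assume X: "X \<in> Obj C"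
  show "comm_group (FObj quot X)"
    using comm_group.abelian_FactGroup[OF FObj_group[OF X] subgroup_N[OF X]] by (simp add: quotient_functor_def)
  fix c assume "c \<in> carrier (FObj quot X)"
  then show "FMor quot (Ident C X) c = c"
    using FMor_coset[OF Ident_in_Hom[OF X]] FMor_Ident[OF _ X] by (auto simp: carrier_quot)
next
  fix f assume "f \<in> Mor C"
  then have f: "f \<in> Hom C (Src C f) (Tgt C f)" by (rule HomI)
  note O = Hom_Obj[OF f]
  show "FMor quot f \<in> hom (FObj quot (Src C f)) (FObj quot (Tgt C f))"
  proof (rule homI)
    fix c assume "c \<in> carrier (FObj quot (Src C f))"
    then obtain x where x: "x \<in> carrier (FObj G (Src C f))" "c = coset (Src C f) x" by (auto simp: carrier_quot)
    then show "FMor quot f c \<in> carrier (FObj quot (Tgt C f))"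
      using FMor_coset[OF f x(1)] FMor_closed[OF f x(1)] by (auto simp: carrier_quot)
    fix d assume "d \<in> carrier (FObj quot (Src C f))"
    then obtain y where y: "y \<in> carrier (FObj G (Src C f))" "d = coset (Src C f) y" by (auto simp: carrier_quot)
    interpret X: comm_group "FObj G (Src C f)" by (rule FObj_group[OF O(1)])
    show "FMor quot f (c \<otimes>\<^bsub>FObj quot (Src C f)\<^esub> d) = FMor quot f c \<otimes>\<^bsub>FObj quot (Tgt C f)\<^esub> FMor quot f d"
      using x y coset_mult[OF O(1) x(1) y(1)] FMor_coset[OF f x(1)] FMor_coset[OF f y(1)]
        FMor_coset[OF f X.m_closed[OF x(1) y(1)]] coset_mult[OF O(2) FMor_closed[OF f x(1)] FMor_closed[OF f y(1)]]
        FMor_mult[OF f x(1) y(1)] by simp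
  qed
  fix c assume "c \<in> carrier (FObj quot (Src C f))"
  then obtain x where x: "x \<in> carrier (FObj G (Src C f))" "c = coset (Src C f) x" by (auto simp: carrier_quot)
  show "FMor quot (g \<cdot> f) c = FMor quot g (FMor quot f c)" if "g \<in> Mor C" "Tgt C f = Src C g" for g
  proof -
    have g: "g \<in> Hom C (Tgt C f) (Tgt C g)" using that by (simp add: Hom_def)
    show ?thesis
      using x(2) FMor_coset[OF f x(1)] FMor_coset[OF g FMor_closed[OF f x(1)]] FMor_coset[OF Cmp_in_Hom[OF f g] x(1)]
        FMor_Cmp[OF f g x(1)] by simp
  qed
  show "FMor quot (Add C f g) c = FMor quot f c \<otimes>\<^bsub>FObj quot (Tgt C f)\<^esub> FMor quot g c"
    if g: "g \<in> Hom C (Src C f) (Tgt C f)" for g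
    using x(2) FMor_coset[OF f x(1)] FMor_coset[OF g x(1)] FMor_coset[OF Add_in_Hom[OF f g] x(1)]
      coset_mult[OF O(2) FMor_closed[OF f x(1)] FMor_closed[OF g x(1)]] FMor_Add[OF f g x(1)] by simp
qed

text \<open>It is applied twice: to a hom functor, which gives the cokernels of representables, and
  to the solution functor of a pp formula, which gives the pp pairs.\<close>

lemma presents_quot:
  assumes f: "f \<in> Hom C A B" and a: "a \<in> carrier (FObj G A)"
    and gen: "\<And>X x. X \<in> Obj C \<Longrightarrow> x \<in> carrier (FObj G X) \<Longrightarrow> \<exists>g \<in> Hom C A X. x = FMor G g a"
    and rel: "\<And>X g. g \<in> Hom C A X \<Longrightarrow> FMor G g a \<in> N X \<longleftrightarrow> (\<exists>k \<in> Hom C B X. g = k \<cdot> f)"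
  shows "presents C quot f (coset A a)"
  unfolding presents_def HomD(2)[OF f]
proof (intro conjI ballI)
  fix X c assume X: "X \<in> Obj C" and "c \<in> carrier (FObj quot X)"
  then obtain x where x: "x \<in> carrier (FObj G X)" "c = coset X x" by (auto simp: carrier_quot)
  then obtain g where "g \<in> Hom C A X" "x = FMor G g a" using gen[OF X] by auto
  then show "\<exists>g\<in>Hom C A X. c = FMor quot g (coset A a)" using FMor_coset[OF _ a] x(2) by auto
next
  fix X g assume X: "X \<in> Obj C" and g: "g \<in> Hom C A X"
  show "FMor quot g (coset A a) = \<one>\<^bsub>FObj quot X\<^esub> \<longleftrightarrow> g \<in> precomp_image C f X"
    using FMor_coset[OF g a] coset_eq_one_iff[OF X FMor_closed[OF g a]] rel[OF g] HomD(3)[OF f]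
    by (auto simp: precomp_image_def)
qed (use HomD(1)[OF f] a in \<open>auto simp: carrier_quot\<close>)

end

definition hom_functor :: "('o, 'm, 'z) preadd_cat_scheme \<Rightarrow> 'o \<Rightarrow> ('o, 'm, 'm) ab_functor" where
  "hom_functor C A = \<lparr>FObj = hom_grp C A, FMor = Cmp C\<rparr>"

lemma coker_functor_eq: "coker_functor C f = quotient_functor C (hom_functor C (Src C f)) (precomp_image C f)"
  by (simp add: coker_functor_def quotient_functor_def hom_functor_def)

context preadditive_category
begin

lemma additive_hom_functor:
  assumes "A \<in> Obj C"
  shows "additive_functor C (hom_functor C A)"
  unfolding additive_functor_def hom_functor_def
proof (simp, intro conjI ballI impI allI)
  show "comm_group (hom_grp C A X)" if "X \<in> Obj C" for X
    by (rule comm_group_hom_grp[OF assms that])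
  show "Ident C X \<cdot> x = x" if "x \<in> Hom C A X" for X x
    by (rule Ident_Cmp[OF that])
  fix f assume "f \<in> Mor C"
  then have f: "f \<in> Hom C (Src C f) (Tgt C f)" by (rule HomI)
  show "Cmp C f \<in> hom (hom_grp C A (Src C f)) (hom_grp C A (Tgt C f))"
    using Cmp_in_Hom[OF _ f] Add_Cmp[OF _ _ f] by (auto simp: hom_def)
  fix x assume x: "x \<in> Hom C A (Src C f)"
  show "Add C f g \<cdot> x = Add C (f \<cdot> x) (g \<cdot> x)" if "g \<in> Hom C (Src C f) (Tgt C f)" for g
    by (rule Cmp_Add[OF x f that])
  show "g \<cdot> f \<cdot> x = g \<cdot> (f \<cdot> x)" if "g \<in> Mor C" "Tgt C f = Src C g" for g
    using Cmp_assoc[OF x f, of g "Tgt C g"] that by (simp add: Hom_def)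
qed

lemma subfunctor_precomp_image:
  assumes f: "f \<in> Hom C A B"
  shows "subfunctor C (hom_functor C A) (precomp_image C f)"
proof -
  interpret additive_functor_on C "hom_functor C A"
    by unfold_locales (rule additive_hom_functor[OF Hom_Obj(1)[OF f]])
  note O = Hom_Obj[OF f]
  have sub: "subgroup (precomp_image C f X) (hom_grp C A X)" if X: "X \<in> Obj C" for X
  proof -
    interpret comm_group "hom_grp C A X" by (rule comm_group_hom_grp[OF O(1) X])
    show ?thesis
    proof (rule subgroupI)
      show "precomp_image C f X \<subseteq> carrier (hom_grp C A X)"
        using Cmp_in_Hom[OF f] by (auto simp: precomp_image_def HomD[OF f])
      show "precomp_image C f X \<noteq> {}"
        using Zero_in_Hom[OF O(2) X] by (auto simp: precomp_image_def HomD[OF f])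
      fix a assume a: "a \<in> precomp_image C f X"
      then obtain g where g: "g \<in> Hom C B X" "a = g \<cdot> f" by (auto simp: precomp_image_def HomD[OF f])
      have "inv\<^bsub>hom_grp C A X\<^esub> a = Neg C g \<cdot> f"
        using Neg_Cmp[OF f g(1)] Neg_eq[OF Cmp_in_Hom[OF f g(1)]] g(2) by simp
      then show "inv\<^bsub>hom_grp C A X\<^esub> a \<in> precomp_image C f X"
        using Neg_in_Hom[OF g(1)] by (auto simp: precomp_image_def HomD[OF f])
      fix b assume "b \<in> precomp_image C f X"
      then obtain h where h: "h \<in> Hom C B X" "b = h \<cdot> f" by (auto simp: precomp_image_def HomD[OF f])
      show "a \<otimes>\<^bsub>hom_grp C A X\<^esub> b \<in> precomp_image C f X"
        using Cmp_Add[OF f g(1) h(1)] Add_in_Hom[OF g(1) h(1)] g(2) h(2)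
        by (auto simp: precomp_image_def HomD[OF f] intro!: image_eqI[of _ _ "Add C g h"])
    qed
  qed
  show ?thesis
  proof (rule subfunctor.intro[OF additive_functor_on_axioms], rule subfunctor_axioms.intro,
      unfold hom_functor_def ab_functor.simps)
    show "subgroup (precomp_image C f X) (hom_grp C A X)" if "X \<in> Obj C" for X by (rule sub[OF that])
    fix h X Y x assume h: "h \<in> Hom C X Y" and "x \<in> precomp_image C f X"
    then obtain g where g: "g \<in> Hom C B X" "x = g \<cdot> f" by (auto simp: precomp_image_def HomD[OF f])
    show "Cmp C h x \<in> precomp_image C f Y"
      using Cmp_assoc[OF f g(1) h] Cmp_in_Hom[OF g(1) h] g(2)
      by (auto simp: precomp_image_def HomD[OF f] hom_functor_def)
  qed
qed

lemma coker_functor: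
  assumes f: "f \<in> Hom C A B"
  shows "additive_functor C (coker_functor C f)" "\<exists>a. presents C (coker_functor C f) f a"
proof -
  note O = Hom_Obj[OF f]
  interpret subfunctor C "hom_functor C A" "precomp_image C f" by (rule subfunctor_precomp_image[OF f])
  show "additive_functor C (coker_functor C f)"
    using additive_quot by (simp add: coker_functor_eq HomD[OF f])
  \<comment> \<open>The generator is the class of the identity, the universal element of the Yoneda
    lemma.\<close>
  have "presents C quot f (coset A (Ident C A))"
  proof (rule presents_quot[OF f])
    show "Ident C A \<in> carrier (FObj (hom_functor C A) A)"
      using Ident_in_Hom[OF O(1)] by (simp add: hom_functor_def)
    show "\<exists>g\<in>Hom C A X. x = FMor (hom_functor C A) g (Ident C A)" if "x \<in> carrier (FObj (hom_functor C A) X)" for X x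
      using that Cmp_Ident[of x A X] by (intro bexI[of _ x]) (auto simp: hom_functor_def)
    show "FMor (hom_functor C A) g (Ident C A) \<in> precomp_image C f X \<longleftrightarrow> (\<exists>k\<in>Hom C B X. g = k \<cdot> f)"
      if "g \<in> Hom C A X" for X g
      using Cmp_Ident[OF that] by (auto simp: hom_functor_def precomp_image_def HomD[OF f])
  qed
  then show "\<exists>a. presents C (coker_functor C f) f a" by (auto simp: coker_functor_eq HomD[OF f])
qed

text \<open>An isomorphism with a cokernel is traded for a generator with known relations. All later
  arguments use this form, since it mentions morphisms of \<open>C\<close> in place of
  cosets.\<close>

lemma presented_functors_iff:
  "F \<in> presented_functors C P \<longleftrightarrow> additive_functor C F \<and>
     (\<exists>f a. Src C f \<in> P \<and> Tgt C f \<in> P \<and> presents C F f a)"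
proof
  assume "F \<in> presented_functors C P"
  then obtain f where F: "additive_functor C F" and f: "f \<in> Mor C" "Src C f \<in> P" "Tgt C f \<in> P"
    and i: "nat_isomorphic C F (coker_functor C f)" unfolding presented_functors_def by auto
  note c = coker_functor[OF HomI[OF f(1)]]
  obtain b where "presents C (coker_functor C f) f b" using c(2) by auto
  then obtain a where "presents C F f a" by (rule presents_nat_isomorphic_transfer[OF F c(1) i])
  then show "additive_functor C F \<and> (\<exists>f a. Src C f \<in> P \<and> Tgt C f \<in> P \<and> presents C F f a)"
    using F f by auto
next
  assume a: "additive_functor C F \<and> (\<exists>f a. Src C f \<in> P \<and> Tgt C f \<in> P \<and> presents C F f a)"
  then obtain f a where F: "additive_functor C F" and f: "Src C f \<in> P" "Tgt C f \<in> P" and p: "presents C F f a"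
    by auto
  then have m: "f \<in> Mor C" by (simp add: presents_def)
  note c = coker_functor[OF HomI[OF m]]
  obtain b where "presents C (coker_functor C f) f b" using c(2) by auto
  then have "nat_isomorphic C F (coker_functor C f)" by (rule presents_nat_isomorphic[OF F c(1) p])
  then show "F \<in> presented_functors C P" using F f m unfolding presented_functors_def by auto
qed

end

text \<open>The objects are labels \<open>p\<close> that stand for functors \<open>\<Phi> p\<close>.
  This lets pp pairs and functors themselves be objects of categories of the same form.\<close>

definition nat_cat where
  "nat_cat C Ps \<Phi> = family_cat (Obj C) Ps (\<lambda>p. FObj (\<Phi> p)) (\<lambda>p q. nat_trans C (\<Phi> p) (\<Phi> q))"

lemma presented_functor_cat_eq: "presented_functor_cat C P = nat_cat C (presented_functors C P) (\<lambda>F. F)"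
  by (simp add: presented_functor_cat_def nat_cat_def)

lemma nat_cat_simps [simp]: "Obj (nat_cat C Ps \<Phi>) = Ps"
  "Ident (nat_cat C Ps \<Phi>) p = (p, p, \<lambda>X\<in>Obj C. \<lambda>x\<in>carrier (FObj (\<Phi> p) X). x)"
  "(q', r, k) \<cdot>\<^bsub>nat_cat C Ps \<Phi>\<^esub> (p, q, h) = (p, r, \<lambda>X\<in>Obj C. \<lambda>x\<in>carrier (FObj (\<Phi> p) X). k X (h X x))"
  by (simp_all add: nat_cat_def family_cat_def)

lemma Hom_nat_cat: "x \<in> Hom (nat_cat C Ps \<Phi>) p q \<longleftrightarrow>
    p \<in> Ps \<and> q \<in> Ps \<and> (\<exists>h \<in> nat_trans C (\<Phi> p) (\<Phi> q). x = (p, q, h))"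
  by (auto simp: Hom_def nat_cat_def family_cat_def)

section \<open>Categories of presented functors and their Serre quotients\<close>

context preadditive_category
begin

lemma category_nat_cat:
  fixes \<Phi> :: "'p \<Rightarrow> ('o, 'm, 'd) ab_functor"
  assumes add: "\<And>p. p \<in> Ps \<Longrightarrow> additive_functor C (\<Phi> p)"
  shows "category (nat_cat C Ps \<Phi>)"
proof
  fix f assume "f \<in> Mor (nat_cat C Ps \<Phi>)"
  then show "Src (nat_cat C Ps \<Phi>) f \<in> Obj (nat_cat C Ps \<Phi>)" "Tgt (nat_cat C Ps \<Phi>) f \<in> Obj (nat_cat C Ps \<Phi>)"
    by (auto simp: nat_cat_def family_cat_def)
next
  fix p assume "p \<in> Obj (nat_cat C Ps \<Phi>)"
  then show "Ident (nat_cat C Ps \<Phi>) p \<in> Hom (nat_cat C Ps \<Phi>) p p"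
    using nat_trans_Ident[OF add] by (simp add: Hom_nat_cat)
next
  fix f g p q r assume "f \<in> Hom (nat_cat C Ps \<Phi>) p q" "g \<in> Hom (nat_cat C Ps \<Phi>) q r"
  then obtain h k where p: "p \<in> Ps" "r \<in> Ps" and hk: "h \<in> nat_trans C (\<Phi> p) (\<Phi> q)" "k \<in> nat_trans C (\<Phi> q) (\<Phi> r)"
    "f = (p, q, h)" "g = (q, r, k)" by (auto simp: Hom_nat_cat)
  show "g \<cdot>\<^bsub>nat_cat C Ps \<Phi>\<^esub> f \<in> Hom (nat_cat C Ps \<Phi>) p r"
    using p nat_trans_comp[OF hk(1,2) add[OF p(1)]] unfolding hk(3,4) nat_cat_simps Hom_nat_cat by blast
next
  have ext: "(\<lambda>X\<in>Obj C. \<lambda>x\<in>carrier (FObj F X). h X x) = h" if "h \<in> nat_trans C F G"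
    for h and F G :: "('o, 'm, 'd) ab_functor"
  proof (rule ext)
    fix X show "(\<lambda>X\<in>Obj C. \<lambda>x\<in>carrier (FObj F X). h X x) X = h X"
      using nat_transD(4,5)[OF that] by (cases "X \<in> Obj C") (auto simp: extensional_def)
  qed
  fix f p q assume "f \<in> Hom (nat_cat C Ps \<Phi>) p q"
  then obtain h where h: "h \<in> nat_trans C (\<Phi> p) (\<Phi> q)" "f = (p, q, h)" by (auto simp: Hom_nat_cat)
  have "(\<lambda>X\<in>Obj C. \<lambda>x\<in>carrier (FObj (\<Phi> p) X). h X ((\<lambda>X\<in>Obj C. \<lambda>x\<in>carrier (FObj (\<Phi> p) X). x) X x))
      = (\<lambda>X\<in>Obj C. \<lambda>x\<in>carrier (FObj (\<Phi> p) X). h X x)"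
    by (intro restrict_ext) simp
  then show "f \<cdot>\<^bsub>nat_cat C Ps \<Phi>\<^esub> Ident (nat_cat C Ps \<Phi>) p = f"
    using ext[OF h(1)] h(2) by simp
  have "(\<lambda>X\<in>Obj C. \<lambda>x\<in>carrier (FObj (\<Phi> p) X). (\<lambda>X\<in>Obj C. \<lambda>x\<in>carrier (FObj (\<Phi> q) X). x) X (h X x))
      = (\<lambda>X\<in>Obj C. \<lambda>x\<in>carrier (FObj (\<Phi> p) X). h X x)"
    using nat_transD(2)[OF h(1)] by (intro restrict_ext) simp
  then show "Ident (nat_cat C Ps \<Phi>) q \<cdot>\<^bsub>nat_cat C Ps \<Phi>\<^esub> f = f"
    using ext[OF h(1)] h(2) by simp
next
  fix f g k p q r s
  assume "f \<in> Hom (nat_cat C Ps \<Phi>) p q" "g \<in> Hom (nat_cat C Ps \<Phi>) q r" "k \<in> Hom (nat_cat C Ps \<Phi>) r s"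
  then obtain f' g' k' where f: "f' \<in> nat_trans C (\<Phi> p) (\<Phi> q)" "f = (p, q, f')"
    and g: "g = (q, r, g')" and k: "k = (r, s, k')"
    by (auto simp: Hom_nat_cat)
  have "(\<lambda>X\<in>Obj C. \<lambda>x\<in>carrier (FObj (\<Phi> p) X). k' X ((\<lambda>X\<in>Obj C. \<lambda>x\<in>carrier (FObj (\<Phi> p) X). g' X (f' X x)) X x))
      = (\<lambda>X\<in>Obj C. \<lambda>x\<in>carrier (FObj (\<Phi> p) X). k' X (g' X (f' X x)))"
    "(\<lambda>X\<in>Obj C. \<lambda>x\<in>carrier (FObj (\<Phi> p) X). (\<lambda>X\<in>Obj C. \<lambda>x\<in>carrier (FObj (\<Phi> q) X). k' X (g' X x)) X (f' X x))
      = (\<lambda>X\<in>Obj C. \<lambda>x\<in>carrier (FObj (\<Phi> p) X). k' X (g' X (f' X x)))"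
    using nat_transD(2)[OF f(1)] by (intro restrict_ext; simp)+
  then show "k \<cdot>\<^bsub>nat_cat C Ps \<Phi>\<^esub> (g \<cdot>\<^bsub>nat_cat C Ps \<Phi>\<^esub> f)
      = k \<cdot>\<^bsub>nat_cat C Ps \<Phi>\<^esub> g \<cdot>\<^bsub>nat_cat C Ps \<Phi>\<^esub> f"
    unfolding f(2) g k nat_cat_simps by simp
qed

text \<open>Transformations between presented functors are squares between the presentations:
  \<open>u\<close> lifts the image of the generator, and \<open>v\<close> expresses that the
  relation \<open>f\<close> is respected. The right-hand side no longer mentions the
  functors.\<close>

lemma presents_nat_trans_iff:
  assumes F: "additive_functor C F" "presents C F f a" and G: "additive_functor C G" "presents C G g b"
    and f: "f \<in> Hom C A B" and g: "g \<in> Hom C A' B'" and u: "u \<in> Hom C A' A"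
  shows "(\<exists>\<eta> \<in> nat_trans C F G. \<eta> A a = FMor G u b) \<longleftrightarrow> (\<exists>v \<in> Hom C B' B. f \<cdot> u = v \<cdot> g)"
proof -
  interpret G: additive_functor_on C G by unfold_locales (fact G)
  note b = presentsD(1)[OF G(2) g]
  have "FMor G f (FMor G u b) = \<one>\<^bsub>FObj G B\<^esub> \<longleftrightarrow> (\<exists>v \<in> Hom C B' B. f \<cdot> u = v \<cdot> g)"
    using presentsD(3)[OF G(2) g Cmp_in_Hom[OF u f]] G.FMor_Cmp[OF u f b] by simp
  moreover have "FMor G f (FMor G u b) = \<one>\<^bsub>FObj G B\<^esub>" if "\<eta> \<in> nat_trans C F G" "\<eta> A a = FMor G u b" for \<eta>
    using nat_trans_generator[OF F(2) f F(1) that(1) G(1)] that(2) by simp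
  moreover have "\<exists>\<eta> \<in> nat_trans C F G. \<eta> A a = FMor G u b" if "FMor G f (FMor G u b) = \<one>\<^bsub>FObj G B\<^esub>"
    by (rule nat_trans_extension[OF F(2) f F(1) G(1) G.FMor_closed[OF u b] that]) auto
  ultimately show ?thesis by auto
qed

text \<open>Which \<open>u\<close> induce a transformation, and when two of them induce the same
  one, depends on the presentations alone. A witness therefore pairs labels whose functors have a
  common presentation \<open>f\<close>, with generators \<open>a\<close> and \<open>b\<close>, and
  \<open>R\<close> relates transformations induced by one and the same \<open>u\<close>.\<close>

theorem presented_serre_quotients:
  fixes \<Phi> :: "'p \<Rightarrow> ('o, 'm, 'a) ab_functor"
    and \<Psi> :: "'q \<Rightarrow> ('o, 'm, 'b) ab_functor"
  assumes add: "\<And>p. p \<in> Ps \<Longrightarrow> additive_functor C (\<Phi> p)" "\<And>q. q \<in> Qs \<Longrightarrow> additive_functor C (\<Psi> q)"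
    and ex: "\<And>p. p \<in> Ps \<Longrightarrow> \<exists>q \<in> Qs. \<exists>f a b. presents C (\<Phi> p) f a \<and> presents C (\<Psi> q) f b"
      "\<And>q. q \<in> Qs \<Longrightarrow> \<exists>p \<in> Ps. \<exists>f a b. presents C (\<Phi> p) f a \<and> presents C (\<Psi> q) f b"
    and S: "\<And>p q f a b. p \<in> Ps \<Longrightarrow> q \<in> Qs \<Longrightarrow> presents C (\<Phi> p) f a \<Longrightarrow> presents C (\<Psi> q) f b
      \<Longrightarrow> p \<in> S \<longleftrightarrow> q \<in> S'"
  shows "equivalent_categories (serre_quotient (nat_cat C Ps \<Phi>) S) (serre_quotient (nat_cat C Qs \<Psi>) S')"
proof -
  let ?P = "nat_cat C Ps \<Phi>" and ?Q = "nat_cat C Qs \<Psi>"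
  define Wit where "Wit = {(p, q, f, a, b). p \<in> Ps \<and> q \<in> Qs \<and> presents C (\<Phi> p) f a \<and> presents C (\<Psi> q) f b}"
  define P where "P = (\<lambda>(p :: 'p, q :: 'q, f :: 'm, a :: 'a, b :: 'b). p)"
  define Q where "Q = (\<lambda>(p :: 'p, q :: 'q, f :: 'm, a :: 'a, b :: 'b). q)"
  define R where "R = (\<lambda>w w' \<eta> \<theta>. w \<in> Wit \<and> w' \<in> Wit \<and>
    \<eta> \<in> Hom ?P (P w) (P w') \<and> \<theta> \<in> Hom ?Q (Q w) (Q w') \<and>
    (case (w, w') of ((p, q, f, a, b), (p', q', f', a', b')) \<Rightarrow>
      \<exists>u \<in> Hom C (Src C f') (Src C f). snd (snd \<eta>) (Src C f) a = FMor (\<Phi> p') u a' \<and>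
        snd (snd \<theta>) (Src C f) b = FMor (\<Psi> q') u b'))"
  have R_iff: "R (p, q, f, a, b) (p', q', f', a', b') \<eta> \<theta> \<longleftrightarrow>
      p \<in> Ps \<and> q \<in> Qs \<and> presents C (\<Phi> p) f a \<and> presents C (\<Psi> q) f b \<and>
      p' \<in> Ps \<and> q' \<in> Qs \<and> presents C (\<Phi> p') f' a' \<and> presents C (\<Psi> q') f' b' \<and>
      (\<exists>h \<in> nat_trans C (\<Phi> p) (\<Phi> p'). \<exists>k \<in> nat_trans C (\<Psi> q) (\<Psi> q'). \<eta> = (p, p', h) \<and> \<theta> = (q, q', k) \<and>
      (\<exists>u \<in> Hom C (Src C f') (Src C f). h (Src C f) a = FMor (\<Phi> p') u a' \<and> k (Src C f) b = FMor (\<Psi> q') u b'))"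
    for p q f a b p' q' f' a' b' \<eta> \<theta>
    unfolding R_def Wit_def P_def Q_def by (auto simp: Hom_nat_cat)
  have pres_Hom: "f \<in> Hom C (Src C f) (Tgt C f)" if "presents C F f a" for F :: "('o, 'm, 'c) ab_functor" and f a
    using that by (simp add: presents_def HomI)
  have lift: "\<exists>u \<in> Hom C (Src C f') (Src C f). h (Src C f) a = FMor G u a' \<and>
      (\<exists>v \<in> Hom C (Tgt C f') (Tgt C f). f \<cdot> u = v \<cdot> f')"
    if F: "additive_functor C F" "presents C F f a" and G: "additive_functor C G" "presents C G f' a'"
      and h: "h \<in> nat_trans C F G" for F G :: "('o, 'm, 'c) ab_functor" and f a f' a' h
  proof -
    note f = pres_Hom[OF F(2)] and f' = pres_Hom[OF G(2)]
    obtain u where u: "u \<in> Hom C (Src C f') (Src C f)" "h (Src C f) a = FMor G u a'"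
      using presentsD(2)[OF G(2) f' Hom_Obj(1)[OF f] nat_trans_generator(1)[OF F(2) f F(1) h G(1)]] by auto
    then show ?thesis using presents_nat_trans_iff[OF F G f f' u(1)] h by blast
  qed
  \<comment> \<open>Two lifts \<open>u\<close> and \<open>u'\<close> induce the same map exactly if
    their difference is a multiple of \<open>f'\<close>. This condition is shared by
    \<open>G\<close> and \<open>H\<close>, so equality on one side forces it on the other.\<close>
  have unique: "k = k'"
    if F: "additive_functor C F" "presents C F f a" and G: "additive_functor C G" "presents C G f' a'"
      and H: "additive_functor C H" "presents C H f' b'"
      and k: "k \<in> nat_trans C F G" "k' \<in> nat_trans C F G"
      and u: "u \<in> Hom C (Src C f') (Src C f)" "u' \<in> Hom C (Src C f') (Src C f)"
      and e: "k (Src C f) a = FMor G u a'" "k' (Src C f) a = FMor G u' a'" "FMor H u b' = FMor H u' b'"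
    for F G :: "('o, 'm, 'c) ab_functor" and H :: "('o, 'm, 'd) ab_functor" and f a f' a' b' k k' u u'
  proof (rule nat_trans_eqI[OF F(2) pres_Hom[OF F(2)] k])
    interpret G: additive_functor_on C G by unfold_locales (fact G)
    interpret H: additive_functor_on C H by unfold_locales (fact H)
    note f' = pres_Hom[OF G(2)] and d = Diff_in_Hom[OF u]
    have "FMor H (Diff C u u') b' = \<one>\<^bsub>FObj H (Src C f)\<^esub>"
      using H.FMor_eq_iff[OF u presentsD(1)[OF H(2) f']] e(3) by simp
    then have "FMor G (Diff C u u') a' = \<one>\<^bsub>FObj G (Src C f)\<^esub>"
      using presentsD(3)[OF H(2) f' d] presentsD(3)[OF G(2) f' d] by simp
    then show "k (Src C f) a = k' (Src C f) a"
      using G.FMor_eq_iff[OF u presentsD(1)[OF G(2) f']] e by simp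
  qed
  interpret correspondence ?P ?Q Wit P Q R
  proof (rule correspondence.intro)
    show "category ?P" by (rule category_nat_cat[OF add(1)])
    show "category ?Q" by (rule category_nat_cat[OF add(2)])
    show "P w \<in> Obj ?P" "Q w \<in> Obj ?Q" if "w \<in> Wit" for w
      using that by (auto simp: Wit_def P_def Q_def)
    show "\<exists>w\<in>Wit. P w = p" if p: "p \<in> Obj ?P" for p
    proof -
      obtain q f a b where "q \<in> Qs" "presents C (\<Phi> p) f a" "presents C (\<Psi> q) f b" using ex(1)[of p] p by auto
      then show ?thesis using p by (intro bexI[of _ "(p, q, f, a, b)"]) (auto simp: Wit_def P_def)
    qed
    show "\<exists>w\<in>Wit. Q w = q" if q: "q \<in> Obj ?Q" for q
    proof -
      obtain p f a b where "p \<in> Ps" "presents C (\<Phi> p) f a" "presents C (\<Psi> q) f b" using ex(2)[of q] q by auto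
      then show ?thesis using q by (intro bexI[of _ "(p, q, f, a, b)"]) (auto simp: Wit_def Q_def)
    qed
    show "w \<in> Wit \<and> w' \<in> Wit"
      "f \<in> Hom ?P (P w) (P w') \<and> g \<in> Hom ?Q (Q w) (Q w')"
      if "R w w' f g" for w w' f g
      using that unfolding R_def by auto
  next
    fix w w' \<eta> assume w: "w \<in> Wit" "w' \<in> Wit" and e: "\<eta> \<in> Hom ?P (P w) (P w')"
    obtain p q f a b where w1: "w = (p, q, f, a, b)" by (cases w)
    obtain p' q' f' a' b' where w2: "w' = (p', q', f', a', b')" by (cases w')
    have m: "p \<in> Ps" "q \<in> Qs" "presents C (\<Phi> p) f a" "presents C (\<Psi> q) f b"
      "p' \<in> Ps" "q' \<in> Qs" "presents C (\<Phi> p') f' a'" "presents C (\<Psi> q') f' b'"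
      using w by (auto simp: w1 w2 Wit_def)
    obtain h where h: "h \<in> nat_trans C (\<Phi> p) (\<Phi> p')" "\<eta> = (p, p', h)"
      using e by (auto simp: w1 w2 P_def Hom_nat_cat)
    obtain u v where u: "u \<in> Hom C (Src C f') (Src C f)" "h (Src C f) a = FMor (\<Phi> p') u a'"
      "v \<in> Hom C (Tgt C f') (Tgt C f)" "f \<cdot> u = v \<cdot> f'"
      using lift[OF add(1)[OF m(1)] m(3) add(1)[OF m(5)] m(7) h(1)] by blast
    obtain k where "k \<in> nat_trans C (\<Psi> q) (\<Psi> q')" "k (Src C f) b = FMor (\<Psi> q') u b'"
      using presents_nat_trans_iff[OF add(2)[OF m(2)] m(4) add(2)[OF m(6)] m(8) pres_Hom[OF m(4)] pres_Hom[OF m(8)] u(1)]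
        u(3,4) by blast
    then have "R w w' \<eta> (q, q', k)" using m h u(1,2) unfolding w1 w2 R_iff by blast
    then show "\<exists>\<theta>. R w w' \<eta> \<theta>" ..
  next
    fix w w' \<theta> assume w: "w \<in> Wit" "w' \<in> Wit" and e: "\<theta> \<in> Hom ?Q (Q w) (Q w')"
    obtain p q f a b where w1: "w = (p, q, f, a, b)" by (cases w)
    obtain p' q' f' a' b' where w2: "w' = (p', q', f', a', b')" by (cases w')
    have m: "p \<in> Ps" "q \<in> Qs" "presents C (\<Phi> p) f a" "presents C (\<Psi> q) f b"
      "p' \<in> Ps" "q' \<in> Qs" "presents C (\<Phi> p') f' a'" "presents C (\<Psi> q') f' b'"
      using w by (auto simp: w1 w2 Wit_def)
    obtain k where k: "k \<in> nat_trans C (\<Psi> q) (\<Psi> q')" "\<theta> = (q, q', k)"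
      using e by (auto simp: w1 w2 Q_def Hom_nat_cat)
    obtain u v where u: "u \<in> Hom C (Src C f') (Src C f)" "k (Src C f) b = FMor (\<Psi> q') u b'"
      "v \<in> Hom C (Tgt C f') (Tgt C f)" "f \<cdot> u = v \<cdot> f'"
      using lift[OF add(2)[OF m(2)] m(4) add(2)[OF m(6)] m(8) k(1)] by blast
    obtain h where "h \<in> nat_trans C (\<Phi> p) (\<Phi> p')" "h (Src C f) a = FMor (\<Phi> p') u a'"
      using presents_nat_trans_iff[OF add(1)[OF m(1)] m(3) add(1)[OF m(5)] m(7) pres_Hom[OF m(3)] pres_Hom[OF m(7)] u(1)]
        u(3,4) by blast
    then have "R w w' (p, p', h) \<theta>" using m k u(1,2) unfolding w1 w2 R_iff by blast
    then show "\<exists>\<eta>. R w w' \<eta> \<theta>" ..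
  next
    fix w w' \<eta> \<theta> \<theta>' assume r: "R w w' \<eta> \<theta>" "R w w' \<eta> \<theta>'"
    obtain p q f a b where w1: "w = (p, q, f, a, b)" by (cases w)
    obtain p' q' f' a' b' where w2: "w' = (p', q', f', a', b')" by (cases w')
    have m: "p \<in> Ps" "q \<in> Qs" "presents C (\<Phi> p) f a" "presents C (\<Psi> q) f b"
      "p' \<in> Ps" "q' \<in> Qs" "presents C (\<Phi> p') f' a'" "presents C (\<Psi> q') f' b'"
      using r(1) unfolding w1 w2 R_iff by auto
    obtain h k u where 1: "h \<in> nat_trans C (\<Phi> p) (\<Phi> p')" "k \<in> nat_trans C (\<Psi> q) (\<Psi> q')"
      "\<eta> = (p, p', h)" "\<theta> = (q, q', k)" "u \<in> Hom C (Src C f') (Src C f)"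
      "h (Src C f) a = FMor (\<Phi> p') u a'" "k (Src C f) b = FMor (\<Psi> q') u b'"
      using r(1) unfolding w1 w2 R_iff by blast
    obtain h' k' u' where 2: "h' \<in> nat_trans C (\<Phi> p) (\<Phi> p')" "k' \<in> nat_trans C (\<Psi> q) (\<Psi> q')"
      "\<eta> = (p, p', h')" "\<theta>' = (q, q', k')" "u' \<in> Hom C (Src C f') (Src C f)"
      "h' (Src C f) a = FMor (\<Phi> p') u' a'" "k' (Src C f) b = FMor (\<Psi> q') u' b'"
      using r(2) unfolding w1 w2 R_iff by blast
    have "FMor (\<Phi> p') u a' = FMor (\<Phi> p') u' a'" using 1(3,6) 2(3,6) by simp
    with 1 2 have "k = k'"
      by (intro unique[OF add(2)[OF m(2)] m(4) add(2)[OF m(6)] m(8) add(1)[OF m(5)] m(7), of k k' u u']) auto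
    then show "\<theta> = \<theta>'" using 1(4) 2(4) by simp
  next
    fix w w' \<eta> \<eta>' \<theta> assume r: "R w w' \<eta> \<theta>" "R w w' \<eta>' \<theta>"
    obtain p q f a b where w1: "w = (p, q, f, a, b)" by (cases w)
    obtain p' q' f' a' b' where w2: "w' = (p', q', f', a', b')" by (cases w')
    have m: "p \<in> Ps" "q \<in> Qs" "presents C (\<Phi> p) f a" "presents C (\<Psi> q) f b"
      "p' \<in> Ps" "q' \<in> Qs" "presents C (\<Phi> p') f' a'" "presents C (\<Psi> q') f' b'"
      using r(1) unfolding w1 w2 R_iff by auto
    obtain h k u where 1: "h \<in> nat_trans C (\<Phi> p) (\<Phi> p')" "k \<in> nat_trans C (\<Psi> q) (\<Psi> q')"
      "\<eta> = (p, p', h)" "\<theta> = (q, q', k)" "u \<in> Hom C (Src C f') (Src C f)"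
      "h (Src C f) a = FMor (\<Phi> p') u a'" "k (Src C f) b = FMor (\<Psi> q') u b'"
      using r(1) unfolding w1 w2 R_iff by blast
    obtain h' k' u' where 2: "h' \<in> nat_trans C (\<Phi> p) (\<Phi> p')" "k' \<in> nat_trans C (\<Psi> q) (\<Psi> q')"
      "\<eta>' = (p, p', h')" "\<theta> = (q, q', k')" "u' \<in> Hom C (Src C f') (Src C f)"
      "h' (Src C f) a = FMor (\<Phi> p') u' a'" "k' (Src C f) b = FMor (\<Psi> q') u' b'"
      using r(2) unfolding w1 w2 R_iff by blast
    have "FMor (\<Psi> q') u b' = FMor (\<Psi> q') u' b'" using 1(4,7) 2(4,7) by simp
    with 1 2 have "h = h'"
      by (intro unique[OF add(1)[OF m(1)] m(3) add(1)[OF m(5)] m(7) add(2)[OF m(6)] m(8), of h h' u u']) auto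
    then show "\<eta> = \<eta>'" using 1(3) 2(3) by simp
  next
    fix w assume w: "w \<in> Wit"
    obtain p q f a b where w1: "w = (p, q, f, a, b)" by (cases w)
    have m: "p \<in> Ps" "q \<in> Qs" "presents C (\<Phi> p) f a" "presents C (\<Psi> q) f b"
      using w by (auto simp: w1 Wit_def)
    interpret F: additive_functor_on C "\<Phi> p" by unfold_locales (rule add(1)[OF m(1)])
    interpret G: additive_functor_on C "\<Psi> q" by unfold_locales (rule add(2)[OF m(2)])
    note f = pres_Hom[OF m(3)]
    note O = Hom_Obj(1)[OF f]
    note ab = presentsD(1)[OF m(3) f] presentsD(1)[OF m(4) f]
    show "R w w (Ident ?P (P w)) (Ident ?Q (Q w))"
      unfolding w1 R_iff
      using m nat_trans_Ident[OF add(1)[OF m(1)]] nat_trans_Ident[OF add(2)[OF m(2)]]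
        Ident_in_Hom[OF O] F.FMor_Ident[OF ab(1) O] G.FMor_Ident[OF ab(2) O] O ab
      by (auto simp: P_def Q_def intro!: bexI[of _ "Ident C (Src C f)"])
  next
    fix w w' \<eta> \<theta> w'' \<eta>' \<theta>' assume r: "R w w' \<eta> \<theta>" "R w' w'' \<eta>' \<theta>'"
    obtain p q f a b where w1: "w = (p, q, f, a, b)" by (cases w)
    obtain p' q' f' a' b' where w2: "w' = (p', q', f', a', b')" by (cases w')
    obtain p'' q'' f'' a'' b'' where w3: "w'' = (p'', q'', f'', a'', b'')" by (cases w'')
    have m: "p \<in> Ps" "q \<in> Qs" "presents C (\<Phi> p) f a" "presents C (\<Psi> q) f b"
      "p' \<in> Ps" "q' \<in> Qs" "presents C (\<Phi> p') f' a'" "presents C (\<Psi> q') f' b'"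
      "p'' \<in> Ps" "q'' \<in> Qs" "presents C (\<Phi> p'') f'' a''" "presents C (\<Psi> q'') f'' b''"
      using r unfolding w1 w2 w3 R_iff by auto
    obtain h k u where hk: "h \<in> nat_trans C (\<Phi> p) (\<Phi> p')" "k \<in> nat_trans C (\<Psi> q) (\<Psi> q')"
      "\<eta> = (p, p', h)" "\<theta> = (q, q', k)" and u: "u \<in> Hom C (Src C f') (Src C f)"
      "h (Src C f) a = FMor (\<Phi> p') u a'" "k (Src C f) b = FMor (\<Psi> q') u b'"
      using r(1) unfolding w1 w2 R_iff by blast
    obtain h' k' u' where hk': "h' \<in> nat_trans C (\<Phi> p') (\<Phi> p'')" "k' \<in> nat_trans C (\<Psi> q') (\<Psi> q'')"
      "\<eta>' = (p', p'', h')" "\<theta>' = (q', q'', k')" and u': "u' \<in> Hom C (Src C f'') (Src C f')"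
      "h' (Src C f') a' = FMor (\<Phi> p'') u' a''" "k' (Src C f') b' = FMor (\<Psi> q'') u' b''"
      using r(2) unfolding w2 w3 R_iff by blast
    interpret F'': additive_functor_on C "\<Phi> p''" by unfold_locales (rule add(1)[OF m(9)])
    interpret G'': additive_functor_on C "\<Psi> q''" by unfold_locales (rule add(2)[OF m(10)])
    note f = pres_Hom[OF m(3)] and f' = pres_Hom[OF m(7)] and f'' = pres_Hom[OF m(11)]
    note O = Hom_Obj(1)[OF f]
    note ab = presentsD(1)[OF m(3) f] presentsD(1)[OF m(4) f] presentsD(1)[OF m(7) f'] presentsD(1)[OF m(8) f']
      presentsD(1)[OF m(11) f''] presentsD(1)[OF m(12) f'']
    have "h' (Src C f) (h (Src C f) a) = FMor (\<Phi> p'') (u \<cdot> u') a''"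
      using u(2) nat_transD(3)[OF hk'(1) u(1) ab(3)] u'(2) F''.FMor_Cmp[OF u'(1) u(1) ab(5)] by simp
    moreover have "k' (Src C f) (k (Src C f) b) = FMor (\<Psi> q'') (u \<cdot> u') b''"
      using u(3) nat_transD(3)[OF hk'(2) u(1) ab(4)] u'(3) G''.FMor_Cmp[OF u'(1) u(1) ab(6)] by simp
    ultimately show "R w w'' (\<eta>' \<cdot>\<^bsub>?P\<^esub> \<eta>) (\<theta>' \<cdot>\<^bsub>?Q\<^esub> \<theta>)"
      unfolding w1 w3 R_iff hk hk' nat_cat_simps
      using m nat_trans_comp[OF hk(1) hk'(1) add(1)[OF m(1)]] nat_trans_comp[OF hk(2) hk'(2) add(2)[OF m(2)]]
        Cmp_in_Hom[OF u'(1) u(1)] O ab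
      by (auto intro!: bexI[of _ "u \<cdot> u'"])
  qed
  show ?thesis
    by (rule serre_quotient_equivalence) (auto simp: Wit_def P_def Q_def dest: S)
qed

end

section \<open>Triangulated categories\<close>

lemma cat_equivalence_sym:
  assumes F: "is_functor C D Fo Fm" and G: "is_functor D C Go Gm"
    and h: "natural_iso C C id id (Go \<circ> Fo) (Gm \<circ> Fm) \<eta>"
    and e: "natural_iso D D (Fo \<circ> Go) (Fm \<circ> Gm) id id \<epsilon>"
  shows "cat_equivalence D C Go Gm"
proof -
  note C = is_functorD(1)[OF F] and D = is_functorD(2)[OF F]
  show ?thesis
    unfolding cat_equivalence_def
    using G F natural_iso_sym[OF C functor_id[OF C] functor_comp[OF F G] h]
      natural_iso_sym[OF D functor_comp[OF G F] functor_id[OF D] e] by blast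
qed

lemma equivalence_faithful:
  assumes E: "cat_equivalence C D Fo Fm" and f: "f \<in> Hom C A B" "f' \<in> Hom C A B" and eq: "Fm f = Fm f'"
  shows "f = f'"
proof -
  obtain Go Gm \<eta> where F: "is_functor C D Fo Fm" and h: "natural_iso C C id id (Go \<circ> Fo) (Gm \<circ> Fm) \<eta>"
    using E unfolding cat_equivalence_def by blast
  interpret C: category C by (rule is_functorD(1)[OF F])
  note h = natural_isoD[OF h]
  note B = C.Hom_Obj(2)[OF f(1)]
  have hB: "\<eta> B \<in> Hom C B ((Go \<circ> Fo) B)" using h(1)[OF B] by simp
  note i = inv_mor[OF h(2)[OF B] hB]
  have "\<eta> B \<cdot>\<^bsub>C\<^esub> f = \<eta> B \<cdot>\<^bsub>C\<^esub> f'" using h(3)[OF f(1)] h(3)[OF f(2)] eq by simp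
  then have "inv_mor C (\<eta> B) \<cdot>\<^bsub>C\<^esub> \<eta> B \<cdot>\<^bsub>C\<^esub> f = inv_mor C (\<eta> B) \<cdot>\<^bsub>C\<^esub> \<eta> B \<cdot>\<^bsub>C\<^esub> f'"
    using C.Cmp_assoc[OF f(1) hB i(1)] C.Cmp_assoc[OF f(2) hB i(1)] by simp
  then show ?thesis using i(2) C.Ident_Cmp[OF f(1)] C.Ident_Cmp[OF f(2)] by simp
qed

text \<open>Conjugating \<open>Gm g\<close> by the unit produces \<open>f\<close> with
  \<open>Gm (Fm f) = Gm g\<close>; the quasi-inverse is itself an equivalence, hence faithful, and
  \<open>Gm\<close> can be cancelled.\<close>

lemma equivalence_full:
  assumes E: "cat_equivalence C D Fo Fm" and A: "A \<in> Obj C" and B: "B \<in> Obj C"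
    and g: "g \<in> Hom D (Fo A) (Fo B)"
  obtains f where "f \<in> Hom C A B" "Fm f = g"
proof -
  obtain Go Gm \<eta> \<epsilon> where F: "is_functor C D Fo Fm" and G: "is_functor D C Go Gm"
    and h: "natural_iso C C id id (Go \<circ> Fo) (Gm \<circ> Fm) \<eta>"
    and e: "natural_iso D D (Fo \<circ> Go) (Fm \<circ> Gm) id id \<epsilon>"
    using E unfolding cat_equivalence_def by blast
  interpret C: category C by (rule is_functorD(1)[OF F])
  note F' = is_functorD[OF F] and G' = is_functorD[OF G]
  note h' = natural_isoD[OF h]
  have hA: "\<eta> A \<in> Hom C A (Go (Fo A))" and hB: "\<eta> B \<in> Hom C B (Go (Fo B))"
    using h'(1)[OF A] h'(1)[OF B] by simp_all
  note i = inv_mor[OF h'(2)[OF A] hA] and j = inv_mor[OF h'(2)[OF B] hB]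
  note Gg = G'(4)[OF g]
  define f where "f = inv_mor C (\<eta> B) \<cdot>\<^bsub>C\<^esub> (Gm g \<cdot>\<^bsub>C\<^esub> \<eta> A)"
  note ga = C.Cmp_in_Hom[OF hA Gg]
  have f: "f \<in> Hom C A B" unfolding f_def by (rule C.Cmp_in_Hom[OF ga j(1)])
  have "\<eta> B \<cdot>\<^bsub>C\<^esub> f = Gm g \<cdot>\<^bsub>C\<^esub> \<eta> A"
    unfolding f_def using C.Cmp_assoc[OF ga j(1) hB] j(3) C.Ident_Cmp[OF ga] by simp
  then have "Gm (Fm f) \<cdot>\<^bsub>C\<^esub> \<eta> A = Gm g \<cdot>\<^bsub>C\<^esub> \<eta> A" using h'(3)[OF f] by simp
  then have "(Gm (Fm f) \<cdot>\<^bsub>C\<^esub> \<eta> A) \<cdot>\<^bsub>C\<^esub> inv_mor C (\<eta> A) = (Gm g \<cdot>\<^bsub>C\<^esub> \<eta> A) \<cdot>\<^bsub>C\<^esub> inv_mor C (\<eta> A)" by simp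
  moreover have GFf: "Gm (Fm f) \<in> Hom C (Go (Fo A)) (Go (Fo B))" by (rule G'(4)[OF F'(4)[OF f]])
  ultimately have "Gm (Fm f) = Gm g"
    using C.Cmp_assoc[OF i(1) hA Gg] C.Cmp_assoc[OF i(1) hA GFf] i(3) C.Cmp_Ident[OF Gg] C.Cmp_Ident[OF GFf]
    by simp
  then have "Fm f = g"
    by (rule equivalence_faithful[OF cat_equivalence_sym[OF F G h e] F'(4)[OF f] g])
  with f show ?thesis by (rule that)
qed

lemma equivalence_ess_surj:
  assumes E: "cat_equivalence C D Fo Fm" and B: "B \<in> Obj D"
  obtains A e e' where "A \<in> Obj C" "e \<in> Hom D (Fo A) B" "e' \<in> Hom D B (Fo A)"
    "e' \<cdot>\<^bsub>D\<^esub> e = Ident D (Fo A)" "e \<cdot>\<^bsub>D\<^esub> e' = Ident D B"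
proof -
  obtain Go Gm \<epsilon> where F: "is_functor C D Fo Fm" and G: "is_functor D C Go Gm"
    and e: "natural_iso D D (Fo \<circ> Go) (Fm \<circ> Gm) id id \<epsilon>"
    using E unfolding cat_equivalence_def by blast
  have e1: "\<epsilon> B \<in> Hom D (Fo (Go B)) B" using natural_isoD(1)[OF e B] by simp
  note i = inv_mor[OF natural_isoD(2)[OF e B] e1]
  show ?thesis by (rule that[OF is_functorD(3)[OF G B] e1 i])
qed

text \<open>A test object is replaced by an isomorphic one of the form \<open>Fo Y'\<close>. By
  fullness the test maps then come from \<open>C\<close>, where the universal property applies, and
  faithfulness returns the uniqueness.\<close>

lemma is_coproduct_equivalence:
  assumes E: "cat_equivalence C D Fo Fm" and c: "is_coproduct C I X P inc" and X: "\<And>i. i \<in> I \<Longrightarrow> X i \<in> Obj C"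
  shows "is_coproduct D I (Fo \<circ> X) (Fo P) (Fm \<circ> inc)"
  unfolding is_coproduct_def
proof (intro conjI ballI allI impI)
  have F: "is_functor C D Fo Fm" using E unfolding cat_equivalence_def by blast
  note F' = is_functorD[OF F]
  interpret C: category C by (rule F'(1))
  interpret D: category D by (rule F'(2))
  have P: "P \<in> Obj C" and inc: "\<And>i. i \<in> I \<Longrightarrow> inc i \<in> Hom C (X i) P"
    and univ: "\<And>Y g. Y \<in> Obj C \<Longrightarrow> (\<And>i. i \<in> I \<Longrightarrow> g i \<in> Hom C (X i) Y) \<Longrightarrow>
      \<exists>!h. h \<in> Hom C P Y \<and> (\<forall>i \<in> I. h \<cdot>\<^bsub>C\<^esub> inc i = g i)"
    using c unfolding is_coproduct_def by auto
  show "Fo P \<in> Obj D" by (rule F'(3)[OF P])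
  show "(Fm \<circ> inc) i \<in> Hom D ((Fo \<circ> X) i) (Fo P)" if "i \<in> I" for i
    using F'(4)[OF inc[OF that]] by simp
  fix Y g assume Y: "Y \<in> Obj D" and g: "\<forall>i\<in>I. g i \<in> Hom D ((Fo \<circ> X) i) Y"
  obtain Y' e e' where e: "Y' \<in> Obj C" "e \<in> Hom D (Fo Y') Y" "e' \<in> Hom D Y (Fo Y')"
    "e' \<cdot>\<^bsub>D\<^esub> e = Ident D (Fo Y')" "e \<cdot>\<^bsub>D\<^esub> e' = Ident D Y" by (rule equivalence_ess_surj[OF E Y])
  have gi: "g i \<in> Hom D (Fo (X i)) Y" if "i \<in> I" for i using g that by simp
  have "\<exists>g'. g' \<in> Hom C (X i) Y' \<and> Fm g' = e' \<cdot>\<^bsub>D\<^esub> g i" if i: "i \<in> I" for i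
    using equivalence_full[OF E X[OF i] e(1) D.Cmp_in_Hom[OF gi[OF i] e(3)]] by blast
  then obtain g' where g': "\<And>i. i \<in> I \<Longrightarrow> g' i \<in> Hom C (X i) Y'" "\<And>i. i \<in> I \<Longrightarrow> Fm (g' i) = e' \<cdot>\<^bsub>D\<^esub> g i"
    using bchoice[of I "\<lambda>i f. f \<in> Hom C (X i) Y' \<and> Fm f = e' \<cdot>\<^bsub>D\<^esub> g i"] by auto
  obtain h where h: "h \<in> Hom C P Y'" "\<And>i. i \<in> I \<Longrightarrow> h \<cdot>\<^bsub>C\<^esub> inc i = g' i"
    and uniq: "\<And>h'. h' \<in> Hom C P Y' \<Longrightarrow> (\<And>i. i \<in> I \<Longrightarrow> h' \<cdot>\<^bsub>C\<^esub> inc i = g' i) \<Longrightarrow> h' = h"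
    using univ[OF e(1) g'(1)] by (metis (no_types, lifting))
  note Fh = F'(4)[OF h(1)]
  show "\<exists>!h. h \<in> Hom D (Fo P) Y \<and> (\<forall>i\<in>I. h \<cdot>\<^bsub>D\<^esub> (Fm \<circ> inc) i = g i)"
  proof (rule ex1I[of _ "e \<cdot>\<^bsub>D\<^esub> Fm h"], intro conjI ballI)
    show "e \<cdot>\<^bsub>D\<^esub> Fm h \<in> Hom D (Fo P) Y" by (rule D.Cmp_in_Hom[OF Fh e(2)])
    fix i assume i: "i \<in> I"
    show "e \<cdot>\<^bsub>D\<^esub> Fm h \<cdot>\<^bsub>D\<^esub> (Fm \<circ> inc) i = g i"
      using D.Cmp_assoc[OF F'(4)[OF inc[OF i]] Fh e(2)] F'(6)[OF inc[OF i] h(1)] h(2)[OF i] g'(2)[OF i]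
        D.Cmp_assoc[OF gi[OF i] e(3) e(2)] e(5) D.Ident_Cmp[OF gi[OF i]] by simp
  next
    fix k assume k: "k \<in> Hom D (Fo P) Y \<and> (\<forall>i\<in>I. k \<cdot>\<^bsub>D\<^esub> (Fm \<circ> inc) i = g i)"
    obtain k' where k': "k' \<in> Hom C P Y'" "Fm k' = e' \<cdot>\<^bsub>D\<^esub> k"
      using equivalence_full[OF E P e(1) D.Cmp_in_Hom[OF conjunct1[OF k] e(3)]] by blast
    have "k' \<cdot>\<^bsub>C\<^esub> inc i = g' i" if i: "i \<in> I" for i
    proof (rule equivalence_faithful[OF E C.Cmp_in_Hom[OF inc[OF i] k'(1)] g'(1)[OF i]])
      show "Fm (k' \<cdot>\<^bsub>C\<^esub> inc i) = Fm (g' i)"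
        using F'(6)[OF inc[OF i] k'(1)] k' g'(2)[OF i] k i
          D.Cmp_assoc[OF F'(4)[OF inc[OF i]] conjunct1[OF k] e(3)] by simp
    qed
    then have "k' = h" by (rule uniq[OF k'(1)])
    then show "k = e \<cdot>\<^bsub>D\<^esub> Fm h"
      using k' D.Cmp_assoc[OF conjunct1[OF k] e(3) e(2)] e(5) D.Ident_Cmp[OF conjunct1[OF k]] by simp
  qed
qed

lemma (in preadditive_category) zero_obj_Hom:
  assumes "zero_obj C Z"
  shows "f \<in> Hom C A Z \<Longrightarrow> f = Zero C A Z" "f \<in> Hom C Z A \<Longrightarrow> f = Zero C Z A"
proof -
  have Z: "Z \<in> Obj C" using assms by (simp add: zero_obj_def)
  show "f = Zero C A Z" if "f \<in> Hom C A Z"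
    using assms Hom_Obj(1)[OF that] Zero_in_Hom[OF Hom_Obj(1)[OF that] Z] that unfolding zero_obj_def by blast
  show "f = Zero C Z A" if "f \<in> Hom C Z A"
    using assms Hom_Obj(2)[OF that] Zero_in_Hom[OF Z Hom_Obj(2)[OF that]] that unfolding zero_obj_def by blast
qed

lemma (in preadditive_category) zero_objI:
  assumes "Z \<in> Obj C" "Ident C Z = Zero C Z Z"
  shows "zero_obj C Z"
  unfolding zero_obj_def
proof (intro conjI ballI assms(1))
  fix A assume A: "A \<in> Obj C"
  show "\<exists>!f. f \<in> Hom C A Z"
  proof (rule ex1I[of _ "Zero C A Z"])
    show "Zero C A Z \<in> Hom C A Z" by (rule Zero_in_Hom[OF A assms(1)])
    fix f assume "f \<in> Hom C A Z"
    then show "f = Zero C A Z" using Ident_Cmp[of f A Z] Zero_Cmp[of f A Z Z] assms by simp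
  qed
  show "\<exists>!f. f \<in> Hom C Z A"
  proof (rule ex1I[of _ "Zero C Z A"])
    show "Zero C Z A \<in> Hom C Z A" by (rule Zero_in_Hom[OF assms(1) A])
    fix f assume "f \<in> Hom C Z A"
    then show "f = Zero C Z A" using Cmp_Ident[of f Z A] Cmp_Zero[of f Z A Z] assms by simp
  qed
qed

section \<open>Exactness of distinguished triangles\<close>

context triangulated_category
begin

lemma shift_functor: "is_functor T T (ShO T) (ShM T)"
  using shift_equivalence unfolding cat_equivalence_def by blast

lemmas shift_Obj = is_functorD(3)[OF shift_functor]
  and shift_Hom = is_functorD(4)[OF shift_functor]
  and shift_Ident = is_functorD(5)[OF shift_functor]
  and shift_Cmp = is_functorD(6)[OF shift_functor]
  and shift_full = equivalence_full[OF shift_equivalence]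
  and shift_faithful = equivalence_faithful[OF shift_equivalence]

lemma shift_Zero:
  assumes "A \<in> Obj T" "B \<in> Obj T"
  shows "ShM T (Zero T A B) = Zero T (ShO T A) (ShO T B)"
proof -
  note z = Zero_in_Hom[OF assms]
  show ?thesis using shift_additive[OF z z] z by (intro Add_self_Zero[OF shift_Hom[OF z]]) simp
qed

lemma shift_zero_obj:
  assumes "zero_obj T Z"
  shows "zero_obj T (ShO T Z)"
proof -
  have Z: "Z \<in> Obj T" using assms by (simp add: zero_obj_def)
  show ?thesis
    using zero_obj_Hom(1)[OF assms Ident_in_Hom[OF Z]] shift_Ident[OF Z] shift_Zero[OF Z Z] shift_Obj[OF Z]
    by (intro zero_objI) simp_all
qed

lemma DistD:
  assumes "(u, v, w) \<in> Dist T" "u \<in> Hom T X Y" "v \<in> Hom T Y Z"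
  shows "w \<in> Hom T Z (ShO T X)"
  using Dist_triangle[OF assms(1)] assms(2,3) unfolding triangle_def Hom_def by auto

lemma Dist_ex:
  assumes "u \<in> Hom T X Y"
  obtains Z v w where "(u, v, w) \<in> Dist T" "v \<in> Hom T Y Z" "w \<in> Hom T Z (ShO T X)"
proof -
  obtain v w where d: "(u, v, w) \<in> Dist T" using TR1_ex HomD(1)[OF assms] by blast
  then have v: "v \<in> Hom T Y (Tgt T v)"
    using Dist_triangle[OF d] assms unfolding triangle_def Hom_def by auto
  show ?thesis by (rule that[OF d v DistD[OF d assms v]])
qed

lemma triangleI: "u \<in> Hom T X Y \<Longrightarrow> v \<in> Hom T Y Z \<Longrightarrow> w \<in> Hom T Z (ShO T X) \<Longrightarrow> triangle T (u, v, w)"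
  unfolding triangle_def Hom_def by auto

lemma Dist_rotate: "(u, v, w) \<in> Dist T \<Longrightarrow> (v, w, Neg T (ShM T u)) \<in> Dist T"
  using TR2[OF Dist_triangle] by blast

lemma Dist_unrotate:
  assumes "(v, w, Neg T (ShM T u)) \<in> Dist T" "u \<in> Hom T X Y" "v \<in> Hom T Y Z" "w \<in> Hom T Z (ShO T X)"
  shows "(u, v, w) \<in> Dist T"
  using TR2[OF triangleI[OF assms(2-4)]] assms(1) by blast

text \<open>The triangle on the identity of \<open>X\<close> maps to the given one by the identity
  and \<open>u\<close>; the fill-in factors \<open>v \<cdot> u\<close> through a zero
  object.\<close>

lemma Dist_Cmp_zero:
  assumes d: "(u, v, w) \<in> Dist T" and u: "u \<in> Hom T X Y" and v: "v \<in> Hom T Y Z"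
  shows "v \<cdot> u = Zero T X Z"
proof -
  obtain N where N: "zero_obj T N" using ex_zero_obj by blast
  have X: "X \<in> Obj T" and Oo: "N \<in> Obj T" using Hom_Obj[OF u] N by (auto simp: zero_obj_def)
  note z = Zero_in_Hom[OF X Oo]
  have "\<exists>c\<in>Hom T (Tgt T (Zero T X N)) (Tgt T v). c \<cdot> Zero T X N = v \<cdot> u \<and>
      ShM T (Ident T X) \<cdot> Zero T N (ShO T X) = w \<cdot> c"
    by (rule TR3[OF TR1_Ident[OF X N] d])
      (use Ident_in_Hom[OF X] u Cmp_Ident[OF u] HomD[OF u] HomD[OF Ident_in_Hom[OF X]] in auto)
  then obtain c where "c \<in> Hom T N Z" "c \<cdot> Zero T X N = v \<cdot> u" using HomD[OF z] HomD[OF v] by auto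
  then show ?thesis using Cmp_Zero X by auto
qed

text \<open>The given triangle maps by zero and \<open>g\<close> to the triangle that begins with
  \<open>N \<rightarrow> W \<rightarrow> W\<close>, where \<open>N\<close> is a zero object; the
  fill-in is the factor. That triangle is the one on the identity of \<open>W\<close>, rotated back,
  with the shift of \<open>N\<close> as its zero object.\<close>

lemma Dist_weak_cokernel:
  assumes d: "(u, v, w) \<in> Dist T" and u: "u \<in> Hom T X Y" and v: "v \<in> Hom T Y Z"
    and g: "g \<in> Hom T Y W" "g \<cdot> u = Zero T X W"
  shows "\<exists>c \<in> Hom T Z W. g = c \<cdot> v"
proof -
  obtain N where N: "zero_obj T N" using ex_zero_obj by blast
  have obj: "X \<in> Obj T" "W \<in> Obj T" "N \<in> Obj T"
    using Hom_Obj[OF u] Hom_Obj[OF g(1)] N by (auto simp: zero_obj_def)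
  note sO = shift_Obj[OF obj(3)]
  note z = Zero_in_Hom[OF obj(3) obj(2)] and i = Ident_in_Hom[OF obj(2)] and z' = Zero_in_Hom[OF obj(2) sO]
  have "Neg T (ShM T (Zero T N W)) = Zero T (ShO T N) (ShO T W)"
    using zero_obj_Hom(2)[OF shift_zero_obj[OF N] Neg_in_Hom[OF shift_Hom[OF z]]] .
  then have "(Zero T N W, Ident T W, Zero T W (ShO T N)) \<in> Dist T"
    using TR1_Ident[OF obj(2) shift_zero_obj[OF N]] by (intro Dist_unrotate[OF _ z i z']) simp
  moreover have "Zero T X N \<in> Hom T X N" using obj by blast
  moreover have "g \<cdot> u = Zero T N W \<cdot> Zero T X N" using g(2) Cmp_Zero[OF z obj(1)] by simp
  ultimately have "\<exists>c\<in>Hom T (Tgt T v) (Tgt T (Ident T W)). c \<cdot> v = Ident T W \<cdot> g \<and>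
      ShM T (Zero T X N) \<cdot> w = Zero T W (ShO T N) \<cdot> c"
    using TR3[OF d, of "Zero T N W" "Ident T W" "Zero T W (ShO T N)" "Zero T X N" g] g(1)
    by (simp add: HomD[OF u] HomD[OF z])
  then show ?thesis using HomD[OF v] HomD[OF i] Ident_Cmp[OF g(1)] by auto
qed

text \<open>The third axiom supplies only the last of three maps, so both triangles are rotated: the
  fill-in goes from the shift of \<open>W\<close> to the shift of \<open>X\<close>, and is brought
  down since the shift is full and faithful. The signs from rotation occur on both sides and
  cancel.\<close>

lemma Dist_weak_kernel:
  assumes d: "(u, v, w) \<in> Dist T" and u: "u \<in> Hom T X Y" and v: "v \<in> Hom T Y Z"
    and g: "g \<in> Hom T W Y" "v \<cdot> g = Zero T W Z"
  shows "\<exists>c \<in> Hom T W X. g = u \<cdot> c"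
proof -
  obtain N where N: "zero_obj T N" using ex_zero_obj by blast
  note w = DistD[OF d u v]
  have obj: "X \<in> Obj T" "Z \<in> Obj T" "W \<in> Obj T" "N \<in> Obj T"
    using Hom_Obj[OF u] Hom_Obj[OF v] Hom_Obj[OF g(1)] N by (auto simp: zero_obj_def)
  note su = shift_Hom[OF u] and i = Ident_in_Hom[OF obj(3)] and sg = shift_Hom[OF g(1)]
  note z = Zero_in_Hom[OF obj(3,4)] and z2 = Zero_in_Hom[OF obj(4) shift_Obj[OF obj(3)]]
    and z3 = Zero_in_Hom[OF obj(4,2)]
  have 1: "(Zero T W N, Zero T N (ShO T W), Neg T (ShM T (Ident T W))) \<in> Dist T"
    by (rule Dist_rotate[OF TR1_Ident[OF obj(3) N]])
  have "Zero T N Z \<cdot> Zero T W N = v \<cdot> g" using g(2) Cmp_Zero[OF z3 obj(3)] by simp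
  then have "\<exists>c\<in>Hom T (Tgt T (Zero T N (ShO T W))) (Tgt T w).
      c \<cdot> Zero T N (ShO T W) = w \<cdot> Zero T N Z \<and> ShM T g \<cdot> Neg T (ShM T (Ident T W)) = Neg T (ShM T u) \<cdot> c"
    using TR3[OF 1 Dist_rotate[OF d], of g "Zero T N Z"] g(1) z3 by (simp add: HomD[OF z] HomD[OF v])
  then obtain c where c: "c \<in> Hom T (ShO T W) (ShO T X)"
    "ShM T g \<cdot> Neg T (ShM T (Ident T W)) = Neg T (ShM T u) \<cdot> c" using HomD[OF z2] HomD[OF w] by auto
  have "ShM T g \<cdot> Neg T (ShM T (Ident T W)) = Neg T (ShM T g)"
    using Cmp_Neg[OF shift_Hom[OF i] sg] shift_Ident[OF obj(3)] Cmp_Ident[OF sg] by simp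
  then have "Neg T (ShM T g) = Neg T (ShM T u \<cdot> c)" using c(2) Neg_Cmp[OF c(1) su] by simp
  then have e: "ShM T g = ShM T u \<cdot> c" using Neg_Neg[OF sg] Neg_Neg[OF Cmp_in_Hom[OF c(1) su]] by metis
  obtain c' where c': "c' \<in> Hom T W X" "ShM T c' = c" by (rule shift_full[OF obj(3,1) c(1)])
  have "g = u \<cdot> c'"
    by (rule shift_faithful[OF g(1) Cmp_in_Hom[OF c'(1) u]])
      (simp only: e c'(2) shift_Cmp[OF c'(1) u])
  then show ?thesis using c'(1) by blast
qed

end

section \<open>Compact objects\<close>

text \<open>
  A coproduct in a preadditive category has projections, so the canonical map in the definition of a
  compact object is always injective, and only its image matters: the finite sums of the \<open>inc i \<cdot> g i\<close>.
\<close>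

inductive finite_sum for C :: "('o, 'm, 'z) preadd_cat_scheme" and I :: "'i set" and X :: "'i \<Rightarrow> 'o"
  and inc :: "'i \<Rightarrow> 'm" and A P :: 'o where
  finite_sum_Zero: "finite_sum C I X inc A P (Zero C A P)"
| finite_sum_step: "i \<in> I \<Longrightarrow> g \<in> Hom C A (X i) \<Longrightarrow> finite_sum C I X inc A P h
    \<Longrightarrow> finite_sum C I X inc A P (Add C (inc i \<cdot>\<^bsub>C\<^esub> g) h)"

locale coproduct = preadditive_category C
  for C :: "('o, 'm, 'z) preadd_cat_scheme" (structure) +
  fixes I :: "'i set" and X P inc
  assumes X_Obj: "i \<in> I \<Longrightarrow> X i \<in> Obj C" and coproduct: "is_coproduct C I X P inc"
begin

lemma P_Obj: "P \<in> Obj C"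
  and inc_Hom: "i \<in> I \<Longrightarrow> inc i \<in> Hom C (X i) P"
  using coproduct unfolding is_coproduct_def by auto

lemma coproduct_univ:
  assumes "Y \<in> Obj C" "\<And>i. i \<in> I \<Longrightarrow> g i \<in> Hom C (X i) Y"
  shows "\<exists>!h. h \<in> Hom C P Y \<and> (\<forall>i \<in> I. h \<cdot> inc i = g i)"
  using coproduct[unfolded is_coproduct_def] assms by simp

lemma coproduct_map:
  assumes "Y \<in> Obj C" "\<And>i. i \<in> I \<Longrightarrow> g i \<in> Hom C (X i) Y"
  obtains h where "h \<in> Hom C P Y" "\<And>i. i \<in> I \<Longrightarrow> h \<cdot> inc i = g i"
proof -
  obtain h where h: "h \<in> Hom C P Y \<and> (\<forall>i \<in> I. h \<cdot> inc i = g i)"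
    using ex1_implies_ex[OF coproduct_univ[OF assms]] ..
  show ?thesis by (rule that[OF conjunct1[OF h]]) (simp add: h)
qed

lemma coproduct_eqI:
  assumes h: "h \<in> Hom C P Y" "h' \<in> Hom C P Y" and eq: "\<And>i. i \<in> I \<Longrightarrow> h \<cdot> inc i = h' \<cdot> inc i"
  shows "h = h'"
proof -
  have Y: "Y \<in> Obj C" using Hom_Obj[OF h(1)] by simp
  have "h' \<cdot> inc i \<in> Hom C (X i) Y" if "i \<in> I" for i by (rule Cmp_in_Hom[OF inc_Hom[OF that] h(2)])
  from coproduct_univ[OF Y this] show ?thesis
  proof (rule ex1E)
    fix k assume k: "\<forall>y. y \<in> Hom C P Y \<and> (\<forall>i \<in> I. y \<cdot> inc i = h' \<cdot> inc i) \<longrightarrow> y = k"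
    have "h = k" "h' = k" using k[rule_format, of h] k[rule_format, of h'] h eq by simp_all
    then show "h = h'" by simp
  qed
qed

lemma projection:
  assumes j: "j \<in> I"
  obtains p where "p \<in> Hom C P (X j)"
    "\<And>i. i \<in> I \<Longrightarrow> p \<cdot> inc i = (if i = j then Ident C (X j) else Zero C (X i) (X j))"
proof (rule coproduct_map[of "X j" "\<lambda>i. if i = j then Ident C (X j) else Zero C (X i) (X j)"])
  show "X j \<in> Obj C" by (rule X_Obj[OF j])
  show "(if i = j then Ident C (X j) else Zero C (X i) (X j)) \<in> Hom C (X i) (X j)" if "i \<in> I" for i
    using Ident_in_Hom Zero_in_Hom X_Obj j that by simp
qed (rule that)

lemma finite_sum_Hom: "finite_sum C I X inc A P h \<Longrightarrow> A \<in> Obj C \<Longrightarrow> h \<in> Hom C A P"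
proof (induction rule: finite_sum.induct)
  case finite_sum_Zero
  then show ?case using P_Obj by blast
next
  case (finite_sum_step i g h)
  then show ?case using Add_in_Hom[OF Cmp_in_Hom[OF finite_sum_step(2) inc_Hom[OF finite_sum_step(1)]]] by blast
qed

lemma sum_Zero: "finite_sum C I X inc A P (Zero C A P)"
  by (rule finite_sum.finite_sum_Zero)

lemma sum_step:
  "i \<in> I \<Longrightarrow> g \<in> Hom C A (X i) \<Longrightarrow> finite_sum C I X inc A P h
    \<Longrightarrow> finite_sum C I X inc A P (Add C (inc i \<cdot> g) h)"
  by (rule finite_sum.finite_sum_step)

lemma finite_sum_Add:
  "finite_sum C I X inc A P h \<Longrightarrow> A \<in> Obj C \<Longrightarrow> finite_sum C I X inc A P k \<Longrightarrow> finite_sum C I X inc A P (Add C h k)"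
proof (induction rule: finite_sum.induct)
  case finite_sum_Zero
  then show ?case using Add_Zero(2)[OF finite_sum_Hom] by metis
next
  case (finite_sum_step i g h)
  have h: "h \<in> Hom C A P" and k: "k \<in> Hom C A P" and ig: "inc i \<cdot> g \<in> Hom C A P"
    using finite_sum_Hom finite_sum_step Cmp_in_Hom[OF finite_sum_step(2) inc_Hom[OF finite_sum_step(1)]] by auto
  interpret comm_group "hom_grp C A P" by (rule Hom_comm_group[OF h])
  have "Add C (Add C (inc i \<cdot> g) h) k = Add C (inc i \<cdot> g) (Add C h k)"
    using m_assoc[of "inc i \<cdot> g" h k] h k ig by simp
  then show ?case
    using sum_step[OF finite_sum_step(1,2) finite_sum_step(4)[OF finite_sum_step(5,6)]] by simp
qed

lemma finite_sum_Cmp: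
  "finite_sum C I X inc A P h \<Longrightarrow> k \<in> Hom C B A \<Longrightarrow> finite_sum C I X inc B P (h \<cdot> k)"
proof (induction rule: finite_sum.induct)
  case finite_sum_Zero
  then show ?case using Zero_Cmp[OF finite_sum_Zero P_Obj] sum_Zero by metis
next
  case (finite_sum_step i g h)
  note i = inc_Hom[OF finite_sum_step(1)]
  have "Add C (inc i \<cdot> g) h \<cdot> k = Add C (inc i \<cdot> (g \<cdot> k)) (h \<cdot> k)"
    using Cmp_Add[OF finite_sum_step(5) Cmp_in_Hom[OF finite_sum_step(2) i]
        finite_sum_Hom[OF finite_sum_step(3) Hom_Obj(2)[OF finite_sum_step(5)]]]
      Cmp_assoc[OF finite_sum_step(5,2) i] by simp
  then show ?case
    using sum_step[OF finite_sum_step(1) Cmp_in_Hom[OF finite_sum_step(5,2)]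
        finite_sum_step(4)[OF finite_sum_step(5)]] by simp
qed

text \<open>\<open>J\<close> collects the summands that occur in \<open>h\<close>. The condition is
  phrased with endomorphisms of \<open>P\<close> so that it applies directly to the partial
  identities constructed below.\<close>

lemma finite_sum_support:
  "finite_sum C I X inc A P h \<Longrightarrow> A \<in> Obj C \<Longrightarrow>
    \<exists>J \<subseteq> I. finite J \<and> (\<forall>e \<in> Hom C P P. (\<forall>j \<in> J. e \<cdot> inc j = inc j) \<longrightarrow> e \<cdot> h = h)"
proof (induction rule: finite_sum.induct)
  case finite_sum_Zero
  then show ?case using Cmp_Zero by (intro exI[of _ "{}"]) auto
next
  case (finite_sum_step i g h)
  then obtain J where J: "J \<subseteq> I" "finite J"
    "\<And>e. e \<in> Hom C P P \<Longrightarrow> \<forall>j \<in> J. e \<cdot> inc j = inc j \<Longrightarrow> e \<cdot> h = h" by auto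
  note i = inc_Hom[OF finite_sum_step(1)]
  note h = finite_sum_Hom[OF finite_sum_step(3,5)] and ig = Cmp_in_Hom[OF finite_sum_step(2) i]
  show ?case
  proof (intro exI[of _ "insert i J"] conjI ballI impI)
    fix e assume e: "e \<in> Hom C P P" "\<forall>j \<in> insert i J. e \<cdot> inc j = inc j"
    then have "e \<cdot> h = h" using J(3) by simp
    moreover have "e \<cdot> (inc i \<cdot> g) = inc i \<cdot> g"
      using Cmp_assoc[OF finite_sum_step(2) i e(1)] e(2) by simp
    ultimately show "e \<cdot> Add C (inc i \<cdot> g) h = Add C (inc i \<cdot> g) h"
      using Add_Cmp[OF ig h e(1)] by simp
  qed (use J finite_sum_step(1) in auto)
qed

text \<open>The idempotents \<open>\<Sum>\<^bsub>j \<in> J\<^esub> inc j \<cdot> p j\<close> given by the projections \<open>p j\<close>.\<close>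

lemma partial_identity:
  "finite J \<Longrightarrow> J \<subseteq> I \<Longrightarrow> \<exists>e \<in> Hom C P P. finite_sum C I X inc P P e \<and>
    (\<forall>j \<in> I. e \<cdot> inc j = (if j \<in> J then inc j else Zero C (X j) P))"
proof (induction rule: finite_induct)
  case empty
  then show ?case
    using Zero_in_Hom[OF P_Obj P_Obj] Zero_Cmp[OF inc_Hom P_Obj] sum_Zero by (intro bexI[of _ "Zero C P P"]) auto
next
  case (insert i J)
  then obtain e where e: "e \<in> Hom C P P" "finite_sum C I X inc P P e"
    "\<And>j. j \<in> I \<Longrightarrow> e \<cdot> inc j = (if j \<in> J then inc j else Zero C (X j) P)" by auto
  have i: "i \<in> I" using insert by simp
  obtain p where p: "p \<in> Hom C P (X i)"
    "\<And>j. j \<in> I \<Longrightarrow> p \<cdot> inc j = (if j = i then Ident C (X i) else Zero C (X j) (X i))"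
    by (rule projection[OF i]) auto
  note ip = Cmp_in_Hom[OF p(1) inc_Hom[OF i]]
  have "Add C (inc i \<cdot> p) e \<cdot> inc j = (if j \<in> insert i J then inc j else Zero C (X j) P)" if j: "j \<in> I" for j
  proof -
    have "(inc i \<cdot> p) \<cdot> inc j = (if j = i then inc j else Zero C (X j) P)"
      using Cmp_assoc[OF inc_Hom[OF j] p(1) inc_Hom[OF i]] p(2)[OF j] Cmp_Ident[OF inc_Hom[OF i]]
        Cmp_Zero[OF inc_Hom[OF i] X_Obj[OF j]] by auto
    then have "Add C (inc i \<cdot> p) e \<cdot> inc j
        = Add C (if j = i then inc j else Zero C (X j) P) (if j \<in> J then inc j else Zero C (X j) P)"
      using Cmp_Add[OF inc_Hom[OF j] ip e(1)] e(3)[OF j] by simp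
    then show ?thesis
      using insert(2) Add_Zero[OF inc_Hom[OF j]] Add_Zero[OF Zero_in_Hom[OF X_Obj[OF j] P_Obj]] by auto
  qed
  then show ?case
    using Add_in_Hom[OF ip e(1)] sum_step[OF i p(1) e(2)] by (intro bexI[of _ "Add C (inc i \<cdot> p) e"]) auto
qed

abbreviation canonical where "canonical A \<equiv> \<lambda>g. gfinprod (hom_grp C A P) (\<lambda>i. inc i \<cdot> g i) I"
abbreviation direct_sum where "direct_sum A \<equiv> sum_group I (\<lambda>i. hom_grp C A (X i))"

lemma carrier_direct_sum:
  "A \<in> Obj C \<Longrightarrow> x \<in> carrier (direct_sum A) \<longleftrightarrow>
    x \<in> (\<Pi>\<^sub>E i \<in> I. Hom C A (X i)) \<and> finite {i \<in> I. x i \<noteq> Zero C A (X i)}"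
  using comm_group_hom_grp X_Obj by (subst carrier_sum_group) (auto simp: comm_group_def)

lemma finite_support_inc:
  assumes A: "A \<in> Obj C" and x: "x \<in> carrier (direct_sum A)"
  shows "finite {i \<in> I. inc i \<cdot> x i \<noteq> Zero C A P}" "(\<lambda>i. inc i \<cdot> x i) \<in> I \<rightarrow> Hom C A P"
proof -
  note x = carrier_direct_sum[OF A, of x, THEN iffD1, OF x]
  have "{i \<in> I. inc i \<cdot> x i \<noteq> Zero C A P} \<subseteq> {i \<in> I. x i \<noteq> Zero C A (X i)}"
    using Cmp_Zero[OF inc_Hom A] by auto
  then show "finite {i \<in> I. inc i \<cdot> x i \<noteq> Zero C A P}" using x finite_subset by auto
  show "(\<lambda>i. inc i \<cdot> x i) \<in> I \<rightarrow> Hom C A P" using x Cmp_in_Hom inc_Hom by blast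
qed

lemma canonical_hom:
  assumes A: "A \<in> Obj C"
  shows "canonical A \<in> hom (direct_sum A) (hom_grp C A P)"
proof (rule homI)
  interpret comm_group "hom_grp C A P" by (rule comm_group_hom_grp[OF A P_Obj])
  fix x assume x: "x \<in> carrier (direct_sum A)"
  note fx = finite_support_inc[OF A x]
  show "canonical A x \<in> carrier (hom_grp C A P)" using gfinprod_closed fx(2) by simp
  fix y assume y: "y \<in> carrier (direct_sum A)"
  note fy = finite_support_inc[OF A y]
  have xy: "x i \<in> Hom C A (X i)" "y i \<in> Hom C A (X i)" if "i \<in> I" for i
    using x y that carrier_direct_sum[OF A] by auto
  have "canonical A (x \<otimes>\<^bsub>direct_sum A\<^esub> y)
      = gfinprod (hom_grp C A P) (\<lambda>i. (inc i \<cdot> x i) \<otimes>\<^bsub>hom_grp C A P\<^esub> (inc i \<cdot> y i)) I"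
  proof (rule gfinprod_cong[symmetric])
    show "(\<lambda>i. (inc i \<cdot> x i) \<otimes>\<^bsub>hom_grp C A P\<^esub> (inc i \<cdot> y i)) \<in> I \<rightarrow> carrier (hom_grp C A P)"
      using fx(2) fy(2) by (auto intro!: Add_in_Hom)
  qed (use Add_Cmp[OF xy inc_Hom] in \<open>auto simp: simp_implies_def\<close>)
  also have "\<dots> = canonical A x \<otimes>\<^bsub>hom_grp C A P\<^esub> canonical A y"
    by (rule gfinprod_distrib) (use fx fy in auto)
  finally show "canonical A (x \<otimes>\<^bsub>direct_sum A\<^esub> y) = canonical A x \<otimes>\<^bsub>hom_grp C A P\<^esub> canonical A y" .
qed

text \<open>One induction serves two purposes: the first half identifies the image of the canonical
  map, the second recovers the components by projections and yields injectivity.\<close>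

lemma finprod_inc:
  assumes A: "A \<in> Obj C" and x: "x \<in> carrier (direct_sum A)"
  shows "finite S \<Longrightarrow> S \<subseteq> I \<Longrightarrow> finite_sum C I X inc A P (finprod (hom_grp C A P) (\<lambda>i. inc i \<cdot> x i) S) \<and>
    (\<forall>p j. j \<in> I \<and> p \<in> Hom C P (X j) \<and>
      (\<forall>i \<in> I. p \<cdot> inc i = (if i = j then Ident C (X j) else Zero C (X i) (X j))) \<longrightarrow>
      p \<cdot> finprod (hom_grp C A P) (\<lambda>i. inc i \<cdot> x i) S = (if j \<in> S then x j else Zero C A (X j)))"
proof (induction rule: finite_induct)
  interpret comm_group "hom_grp C A P" by (rule comm_group_hom_grp[OF A P_Obj])
  case empty
  then show ?case using sum_Zero Cmp_Zero[OF _ A] by auto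
next
  interpret comm_group "hom_grp C A P" by (rule comm_group_hom_grp[OF A P_Obj])
  case (insert i S)
  let ?s = "finprod (hom_grp C A P) (\<lambda>i. inc i \<cdot> x i) S"
  have x': "x i \<in> Hom C A (X i)" if "i \<in> I" for i
    using x that carrier_direct_sum[OF A] by auto
  have c: "(\<lambda>i. inc i \<cdot> x i) \<in> S \<rightarrow> carrier (hom_grp C A P)" "inc i \<cdot> x i \<in> carrier (hom_grp C A P)"
    using finite_support_inc(2)[OF A x] insert(4) by auto
  have eq: "finprod (hom_grp C A P) (\<lambda>i. inc i \<cdot> x i) (insert i S) = Add C (inc i \<cdot> x i) ?s"
    using finprod_insert[OF insert(1,2) c] by simp
  have i: "i \<in> I" and S: "S \<subseteq> I" using insert by auto
  have s: "?s \<in> Hom C A P" using finprod_closed[OF c(1)] by simp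
  note ix = Cmp_in_Hom[OF x'[OF i] inc_Hom[OF i]]
  show ?case
    unfolding eq
  proof (intro conjI allI impI)
    show "finite_sum C I X inc A P (Add C (inc i \<cdot> x i) ?s)"
      using sum_step[OF i x'[OF i]] insert(3)[OF S] by blast
    fix p j assume p: "j \<in> I \<and> p \<in> Hom C P (X j) \<and>
      (\<forall>i \<in> I. p \<cdot> inc i = (if i = j then Ident C (X j) else Zero C (X i) (X j)))"
    then have "p \<cdot> ?s = (if j \<in> S then x j else Zero C A (X j))" using insert(3)[OF S] by blast
    moreover have "p \<cdot> (inc i \<cdot> x i) = (if i = j then x j else Zero C A (X j))"
      using Cmp_assoc[OF x'[OF i] inc_Hom[OF i], of p "X j"] p i Ident_Cmp[OF x'[OF i]]
        Zero_Cmp[OF x'[OF i], of "X j"] X_Obj by auto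
    ultimately have "p \<cdot> Add C (inc i \<cdot> x i) ?s
        = Add C (if i = j then x j else Zero C A (X j)) (if j \<in> S then x j else Zero C A (X j))"
      using Add_Cmp[OF ix s, of p "X j"] p by simp
    then show "p \<cdot> Add C (inc i \<cdot> x i) ?s = (if j \<in> insert i S then x j else Zero C A (X j))"
      using insert(2) p Add_Zero[OF x', of j] Add_Zero[OF Zero_in_Hom[OF A X_Obj], of j] by auto
  qed
qed

lemma canonical_eq: "canonical A x = finprod (hom_grp C A P) (\<lambda>i. inc i \<cdot> x i) {i \<in> I. inc i \<cdot> x i \<noteq> Zero C A P}"
  if "A \<in> Obj C" "x \<in> carrier (direct_sum A)"
  using finite_support_inc(1)[OF that] by (simp add: gfinprod_def)

lemma canonical_inj:
  assumes A: "A \<in> Obj C"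
  shows "inj_on (canonical A) (carrier (direct_sum A))"
proof (rule inj_onI)
  have proj: "p \<cdot> canonical A x = x j"
    if x: "x \<in> carrier (direct_sum A)" and j: "j \<in> I" and p: "p \<in> Hom C P (X j)"
      "\<And>i. i \<in> I \<Longrightarrow> p \<cdot> inc i = (if i = j then Ident C (X j) else Zero C (X i) (X j))" for x j p
  proof -
    have xj: "x j \<in> Hom C A (X j)" using x j carrier_direct_sum[OF A] by auto
    \<comment> \<open>\<open>gfinprod\<close> runs over the indices with
      \<open>inc i \<cdot> x i\<close> nonzero. A projection splits each injection, so outside this
      set \<open>x j\<close> itself vanishes and no component is lost.\<close>
    have z: "x j = Zero C A (X j)" if "inc j \<cdot> x j = Zero C A P"
      using Cmp_assoc[OF xj inc_Hom[OF j] p(1)] p(2)[OF j] that Ident_Cmp[OF xj] Cmp_Zero[OF p(1) A] by simp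
    let ?S = "{i \<in> I. inc i \<cdot> x i \<noteq> Zero C A P}"
    have "p \<cdot> finprod (hom_grp C A P) (\<lambda>i. inc i \<cdot> x i) ?S = (if j \<in> ?S then x j else Zero C A (X j))"
      using conjunct2[OF finprod_inc[OF A x finite_support_inc(1)[OF A x]], rule_format, of j p] j p by blast
    then show ?thesis
      unfolding canonical_eq[OF A x] using z j by auto
  qed
  fix x y assume x: "x \<in> carrier (direct_sum A)" and y: "y \<in> carrier (direct_sum A)"
    and eq: "canonical A x = canonical A y"
  show "x = y"
  proof (rule extensionalityI[of _ I])
    show "x \<in> extensional I" "y \<in> extensional I" using x y carrier_direct_sum[OF A] by (auto simp: PiE_def)
    fix j assume j: "j \<in> I"
    obtain p where p: "p \<in> Hom C P (X j)"
      "\<And>i. i \<in> I \<Longrightarrow> p \<cdot> inc i = (if i = j then Ident C (X j) else Zero C (X i) (X j))"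
      by (rule projection[OF j]) auto
    show "x j = y j" using proj[OF x j p] proj[OF y j p] eq by simp
  qed
qed

lemma canonical_image:
  assumes A: "A \<in> Obj C"
  shows "h \<in> canonical A ` carrier (direct_sum A) \<longleftrightarrow> finite_sum C I X inc A P h"
proof
  assume "h \<in> canonical A ` carrier (direct_sum A)"
  then obtain x where x: "x \<in> carrier (direct_sum A)" "h = canonical A x" by auto
  show "finite_sum C I X inc A P h"
    unfolding x(2) canonical_eq[OF A x(1)]
    using finprod_inc[OF A x(1) finite_support_inc(1)[OF A x(1)]] by auto
next
  interpret comm_group "hom_grp C A P" by (rule comm_group_hom_grp[OF A P_Obj])
  interpret D: group "direct_sum A"
    using comm_group_hom_grp[OF A X_Obj] by (intro sum_group) (auto simp: comm_group_def)
  show "finite_sum C I X inc A P h \<Longrightarrow> h \<in> canonical A ` carrier (direct_sum A)"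
  proof (induction rule: finite_sum.induct)
    case finite_sum_Zero
    have "canonical A \<one>\<^bsub>direct_sum A\<^esub> = Zero C A P"
      using hom_one[OF canonical_hom[OF A] D.group_axioms group_axioms] by simp
    then show ?case by (rule image_eqI[OF sym D.one_closed])
  next
    case (finite_sum_step i g h)
    then obtain y where y: "y \<in> carrier (direct_sum A)" "h = canonical A y" by auto
    \<comment> \<open>The family with \<open>g\<close> in position \<open>i\<close> and zero
      elsewhere, whose canonical image is the single summand \<open>inc i \<cdot> g\<close>.\<close>
    define x where "x = (\<lambda>j\<in>I. if j = i then g else Zero C A (X j))"
    have "{j \<in> I. x j \<noteq> Zero C A (X j)} \<subseteq> {i}" by (auto simp: x_def)
    then have "finite {j \<in> I. x j \<noteq> Zero C A (X j)}" using finite_subset by blast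
    then have x: "x \<in> carrier (direct_sum A)"
      using finite_sum_step(2) Zero_in_Hom[OF A X_Obj] by (auto simp: carrier_direct_sum[OF A] x_def)
    note ig = Cmp_in_Hom[OF finite_sum_step(2) inc_Hom[OF finite_sum_step(1)]]
    have "gfinprod (hom_grp C A P) (\<lambda>j. inc i \<cdot> g) {i} = canonical A x"
    proof (rule gfinprod_mono_neutral_cong_left)
      show "inc j \<cdot> x j = \<one>\<^bsub>hom_grp C A P\<^esub>" if "j \<in> I - {i}" for j
        using that Cmp_Zero[OF inc_Hom A] by (simp add: x_def)
    qed (use finite_support_inc(2)[OF A x] finite_sum_step(1) in \<open>auto simp: x_def\<close>)
    then have "canonical A x = inc i \<cdot> g" using ig by simp
    then have "canonical A (x \<otimes>\<^bsub>direct_sum A\<^esub> y) = Add C (inc i \<cdot> g) h"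
      using canonical_hom[OF A] x y by (simp add: hom_def)
    then show ?case by (rule image_eqI[OF sym D.m_closed[OF x y(1)]])
  qed
qed

lemma canonical_iso_iff:
  assumes A: "A \<in> Obj C"
  shows "canonical A \<in> iso (direct_sum A) (hom_grp C A P) \<longleftrightarrow> (\<forall>h \<in> Hom C A P. finite_sum C I X inc A P h)"
  using canonical_hom[OF A] canonical_inj[OF A] canonical_image[OF A] finite_sum_Hom[OF _ A]
  unfolding iso_def bij_betw_def by auto

end

section \<open>Closure properties of compact objects\<close>

context preadditive_category
begin

lemma coproductI:
  assumes "X \<in> I \<rightarrow> Obj C" "is_coproduct C I X P inc"
  shows "coproduct C I X P inc"
  by unfold_locales (use assms in auto)

lemma compacts_iff:
  "A \<in> compacts (u :: 'u itself) C \<longleftrightarrow> A \<in> Obj C \<and>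
    (\<forall>(I :: 'u set) X P inc. I \<prec> (UNIV :: 'u set) \<longrightarrow> X \<in> I \<rightarrow> Obj C \<longrightarrow> is_coproduct C I X P inc \<longrightarrow>
      (\<forall>h \<in> Hom C A P. finite_sum C I X inc A P h))"
  unfolding compacts_def mem_Collect_eq
  by (intro conj_cong refl iff_allI) (auto simp: coproduct.canonical_iso_iff[OF coproductI])

lemma compacts_Obj: "A \<in> compacts u C \<Longrightarrow> A \<in> Obj C"
  by (simp add: compacts_def)

text \<open>The map \<open>h \<cdot> r\<close> on \<open>A\<close> is a finite sum, and composing it
  with \<open>s\<close> gives back \<open>h\<close>.\<close>

lemma compacts_retract:
  assumes A: "A \<in> compacts (u :: 'u itself) C" and s: "s \<in> Hom C B A" and r: "r \<in> Hom C A B" and rs: "r \<cdot> s = Ident C B"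
  shows "B \<in> compacts u C"
  unfolding compacts_iff
proof (intro conjI allI impI ballI)
  show "B \<in> Obj C" using Hom_Obj[OF s] by simp
  fix I :: "'u set" and X P inc h
  assume I: "I \<prec> (UNIV :: 'u set)" and X: "X \<in> I \<rightarrow> Obj C" and c: "is_coproduct C I X P inc" and h: "h \<in> Hom C B P"
  interpret coproduct C I X P inc by (rule coproductI[OF X c])
  have "finite_sum C I X inc A P (h \<cdot> r)"
    using A I X c Cmp_in_Hom[OF r h] unfolding compacts_iff by blast
  then show "finite_sum C I X inc B P h"
    using finite_sum_Cmp[OF _ s] Cmp_assoc[OF s r h] rs Cmp_Ident[OF h] by metis
qed

lemma compacts_zero_obj:
  assumes "zero_obj C Z"
  shows "Z \<in> compacts (u :: 'u itself) C"
  unfolding compacts_iff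
proof (intro conjI allI impI ballI)
  show "Z \<in> Obj C" using assms by (simp add: zero_obj_def)
  fix I :: "'u set" and X P inc h assume "h \<in> Hom C Z P"
  then have "h = Zero C Z P" by (rule zero_obj_Hom(2)[OF assms])
  then show "finite_sum C I X inc Z P h" using finite_sum_Zero by metis
qed

text \<open>The equivalence preserves the coproduct, so \<open>Fm h\<close> is a finite sum; by
  fullness its terms lift one at a time, by additivity the lifted sum maps to \<open>Fm h\<close>,
  and by faithfulness it is \<open>h\<close>.\<close>

lemma compacts_reflect:
  assumes E: "cat_equivalence C C Fo Fm"
    and add: "\<And>f g A B. f \<in> Hom C A B \<Longrightarrow> g \<in> Hom C A B \<Longrightarrow> Fm (Add C f g) = Add C (Fm f) (Fm g)"
    and A: "A \<in> Obj C" and FA: "Fo A \<in> compacts (u :: 'u itself) C"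
  shows "A \<in> compacts u C"
  unfolding compacts_iff
proof (intro conjI allI impI ballI A)
  have "is_functor C C Fo Fm" using E by (simp add: cat_equivalence_def)
  note F = is_functorD[OF this]
  fix I :: "'u set" and X P inc h
  assume I: "I \<prec> (UNIV :: 'u set)" and X: "X \<in> I \<rightarrow> Obj C" and c: "is_coproduct C I X P inc" and h: "h \<in> Hom C A P"
  interpret coproduct C I X P inc by (rule coproductI[OF X c])
  have "is_coproduct C I (Fo \<circ> X) (Fo P) (Fm \<circ> inc)" by (rule is_coproduct_equivalence[OF E c X_Obj])
  moreover have "Fo \<circ> X \<in> I \<rightarrow> Obj C" using X_Obj F(3) by auto
  ultimately have "finite_sum C I (Fo \<circ> X) (Fm \<circ> inc) (Fo A) (Fo P) (Fm h)"
    using FA I F(4)[OF h] unfolding compacts_iff by blast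
  moreover have "\<exists>h' \<in> Hom C A P. Fm h' = k \<and> finite_sum C I X inc A P h'"
    if "finite_sum C I (Fo \<circ> X) (Fm \<circ> inc) (Fo A) (Fo P) k" for k
    using that
  proof (induction rule: finite_sum.induct)
    case finite_sum_Zero
    note z = Zero_in_Hom[OF A P_Obj]
    have "Fm (Zero C A P) = Zero C (Fo A) (Fo P)"
      using add[OF z z] z by (intro Add_self_Zero[OF F(4)[OF z]]) simp
    then show ?case using z sum_Zero by blast
  next
    case (finite_sum_step i g k)
    then obtain h' where h': "h' \<in> Hom C A P" "Fm h' = k" "finite_sum C I X inc A P h'" by blast
    note i = finite_sum_step(1)
    obtain g' where g': "g' \<in> Hom C A (X i)" "Fm g' = g"
      using equivalence_full[OF E A X_Obj[OF i], of g] finite_sum_step(2) by auto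
    have "Fm (Add C (inc i \<cdot> g') h') = Add C ((Fm \<circ> inc) i \<cdot> g) k"
      using add[OF Cmp_in_Hom[OF g'(1) inc_Hom[OF i]] h'(1)] F(6)[OF g'(1) inc_Hom[OF i]] g'(2) h'(2) by simp
    then show ?case
      using Add_in_Hom[OF Cmp_in_Hom[OF g'(1) inc_Hom[OF i]] h'(1)] sum_step[OF i g'(1) h'(3)] by blast
  qed
  ultimately obtain h' where h': "h' \<in> Hom C A P" "Fm h' = Fm h" "finite_sum C I X inc A P h'" by blast
  then show "finite_sum C I X inc A P h" using equivalence_faithful[OF E h'(1) h h'(2)] by simp
qed

end

lemma (in additive_category) biproduct:
  assumes A: "A \<in> Obj C" and B: "B \<in> Obj C"
  obtains P i j p q where "i \<in> Hom C A P" "j \<in> Hom C B P" "p \<in> Hom C P A" "q \<in> Hom C P B"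
    "p \<cdot> i = Ident C A" "q \<cdot> i = Zero C A B" "p \<cdot> j = Zero C B A" "q \<cdot> j = Ident C B"
    "Add C (i \<cdot> p) (j \<cdot> q) = Ident C P"
proof -
  obtain P inc where c: "is_coproduct C (UNIV :: bool set) (\<lambda>b. if b then A else B) P inc"
    using ex_binary_coproduct[OF A B] by blast
  interpret c: coproduct C "UNIV :: bool set" "\<lambda>b. if b then A else B" P inc
    by unfold_locales (use c A B in auto)
  have i: "inc True \<in> Hom C A P" and j: "inc False \<in> Hom C B P"
    using c.inc_Hom[of True] c.inc_Hom[of False] by simp_all
  obtain p where p: "p \<in> Hom C P A" "p \<cdot> inc True = Ident C A" "p \<cdot> inc False = Zero C B A"
    using c.projection[of True] by (simp, metis)
  obtain q where q: "q \<in> Hom C P B" "q \<cdot> inc False = Ident C B" "q \<cdot> inc True = Zero C A B"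
    using c.projection[of False] by (simp, metis)
  note ip = Cmp_in_Hom[OF p(1) i] and jq = Cmp_in_Hom[OF q(1) j]
  have "Add C (inc True \<cdot> p) (inc False \<cdot> q) = Ident C P"
  proof (rule c.coproduct_eqI[OF Add_in_Hom[OF ip jq] Ident_in_Hom[OF c.P_Obj]])
    fix b :: bool
    have "Add C (inc True \<cdot> p) (inc False \<cdot> q) \<cdot> inc True = inc True"
      using Cmp_Add[OF i ip jq] Cmp_assoc[OF i p(1) i] Cmp_assoc[OF i q(1) j] p q Cmp_Ident[OF i] Cmp_Zero[OF j A]
        Add_Zero[OF i] by simp
    moreover have "Add C (inc True \<cdot> p) (inc False \<cdot> q) \<cdot> inc False = inc False"
      using Cmp_Add[OF j ip jq] Cmp_assoc[OF j p(1) i] Cmp_assoc[OF j q(1) j] p q Cmp_Ident[OF j] Cmp_Zero[OF i B]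
        Add_Zero[OF j] by simp
    ultimately show "Add C (inc True \<cdot> p) (inc False \<cdot> q) \<cdot> inc b = Ident C P \<cdot> inc b"
      using Ident_Cmp[OF i] Ident_Cmp[OF j] by (cases b) auto
  qed
  then show ?thesis by (rule that[OF i j p(1) q(1) p(2) q(3) p(3) q(2)])
qed

text \<open>\<open>h\<close> is the sum of \<open>h \<cdot> i \<cdot> p\<close> and
  \<open>h \<cdot> j \<cdot> q\<close>, and finite sums are stable under precomposition and
  addition.\<close>

lemma (in preadditive_category) compacts_biproduct:
  assumes A: "A \<in> compacts (u :: 'u itself) C" and B: "B \<in> compacts u C"
    and i: "i \<in> Hom C A S" and j: "j \<in> Hom C B S" and p: "p \<in> Hom C S A" and q: "q \<in> Hom C S B"
    and id: "Add C (i \<cdot> p) (j \<cdot> q) = Ident C S"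
  shows "S \<in> compacts u C"
  unfolding compacts_iff
proof (intro conjI allI impI ballI)
  show S: "S \<in> Obj C" using Hom_Obj[OF p] by simp
  fix I :: "'u set" and X P inc h
  assume I: "I \<prec> (UNIV :: 'u set)" and X: "X \<in> I \<rightarrow> Obj C" and c: "is_coproduct C I X P inc" and h: "h \<in> Hom C S P"
  interpret coproduct C I X P inc by (rule coproductI[OF X c])
  have "finite_sum C I X inc A P (h \<cdot> i)"
    using A I X c Cmp_in_Hom[OF i h] unfolding compacts_iff by blast
  moreover have "finite_sum C I X inc B P (h \<cdot> j)"
    using B I X c Cmp_in_Hom[OF j h] unfolding compacts_iff by blast
  ultimately have "finite_sum C I X inc S P (Add C (h \<cdot> i \<cdot> p) (h \<cdot> j \<cdot> q))"
    by (intro finite_sum_Add[OF _ S] finite_sum_Cmp[OF _ p] finite_sum_Cmp[OF _ q])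
  moreover have "Add C (h \<cdot> i \<cdot> p) (h \<cdot> j \<cdot> q) = h"
    using Cmp_assoc[OF p i h] Cmp_assoc[OF q j h] Add_Cmp[OF Cmp_in_Hom[OF p i] Cmp_in_Hom[OF q j] h] id Cmp_Ident[OF h]
    by simp
  ultimately show "finite_sum C I X inc S P h" by simp
qed

context triangulated_category
begin

lemma compacts_unshift: "ShO T A \<in> compacts u T \<Longrightarrow> A \<in> Obj T \<Longrightarrow> A \<in> compacts u T"
  by (rule compacts_reflect[OF shift_equivalence shift_additive])

text \<open>The quasi-inverse inherits additivity from the shift: after applying the shift,
  naturality of \<open>\<epsilon>\<close> turns the claim into distributivity of composition, and
  the isomorphism \<open>\<epsilon> B\<close> is then cancelled.\<close>

lemma unshift:
  obtains Go Gm \<epsilon> where "cat_equivalence T T Go Gm"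
    "\<And>f g A B. f \<in> Hom T A B \<Longrightarrow> g \<in> Hom T A B \<Longrightarrow> Gm (Add T f g) = Add T (Gm f) (Gm g)"
    "\<And>A. A \<in> Obj T \<Longrightarrow> isomorphic T A (Go (ShO T A))"
proof -
  obtain Go Gm \<eta> \<epsilon> where G: "is_functor T T Go Gm"
    and h: "natural_iso T T id id (Go \<circ> ShO T) (Gm \<circ> ShM T) \<eta>"
    and e: "natural_iso T T (ShO T \<circ> Go) (ShM T \<circ> Gm) id id \<epsilon>"
    using shift_equivalence unfolding cat_equivalence_def by blast
  note E = cat_equivalence_sym[OF shift_functor G h e]
  note G' = is_functorD[OF G] and e' = natural_isoD[OF e]
  have "Gm (Add T f g) = Add T (Gm f) (Gm g)" if f: "f \<in> Hom T A B" and g: "g \<in> Hom T A B" for f g A B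
  proof (rule shift_faithful[OF G'(4)[OF Add_in_Hom[OF f g]] Add_in_Hom[OF G'(4)[OF f] G'(4)[OF g]]])
    have O: "A \<in> Obj T" "B \<in> Obj T" using Hom_Obj[OF f] by auto
    have eA: "\<epsilon> A \<in> Hom T (ShO T (Go A)) A" and eB: "\<epsilon> B \<in> Hom T (ShO T (Go B)) B"
      using e'(1)[OF O(1)] e'(1)[OF O(2)] by simp_all
    note i = inv_mor[OF e'(2)[OF O(2)] eB]
    let ?f = "ShM T (Gm f)" and ?g = "ShM T (Gm g)" and ?s = "ShM T (Gm (Add T f g))"
    note m = shift_Hom[OF G'(4)[OF f]] shift_Hom[OF G'(4)[OF g]] shift_Hom[OF G'(4)[OF Add_in_Hom[OF f g]]]
    have "\<epsilon> B \<cdot> ?s = Add T f g \<cdot> \<epsilon> A" using e'(3)[OF Add_in_Hom[OF f g]] by simp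
    also have "\<dots> = Add T (\<epsilon> B \<cdot> ?f) (\<epsilon> B \<cdot> ?g)"
      using Cmp_Add[OF eA f g] e'(3)[OF f] e'(3)[OF g] by simp
    also have "\<dots> = \<epsilon> B \<cdot> Add T ?f ?g" using Add_Cmp[OF m(1,2) eB] by simp
    finally have "inv_mor T (\<epsilon> B) \<cdot> (\<epsilon> B \<cdot> ?s) = inv_mor T (\<epsilon> B) \<cdot> (\<epsilon> B \<cdot> Add T ?f ?g)" by simp
    then have "?s = Add T ?f ?g"
      using Cmp_assoc[OF m(3) eB i(1)] Cmp_assoc[OF Add_in_Hom[OF m(1,2)] eB i(1)] i(2)
        Ident_Cmp[OF m(3)] Ident_Cmp[OF Add_in_Hom[OF m(1,2)]] by simp
    also have "\<dots> = ShM T (Add T (Gm f) (Gm g))" using shift_additive[OF G'(4)[OF f] G'(4)[OF g]] by simp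
    finally show "?s = ShM T (Add T (Gm f) (Gm g))" .
  qed
  moreover have "isomorphic T A (Go (ShO T A))" if "A \<in> Obj T" for A
    using natural_isoD(1,2)[OF h that] unfolding isomorphic_def by auto
  ultimately show ?thesis by (rule that[OF E])
qed

lemma compacts_isomorphic:
  assumes "A \<in> compacts u T" "isomorphic T A B"
  shows "B \<in> compacts u T"
proof -
  obtain f where f: "f \<in> Hom T A B" "iso_mor T f" using assms(2) unfolding isomorphic_def by blast
  note i = inv_mor[OF f(2,1)]
  show ?thesis by (rule compacts_retract[OF assms(1) i(1) f(1) i(3)])
qed

text \<open>Compactness is reflected by the quasi-inverse of the shift, whose value at
  \<open>ShO T A\<close> is isomorphic to \<open>A\<close>.\<close>

lemma compacts_shift:
  assumes A: "A \<in> compacts u T"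
  shows "ShO T A \<in> compacts u T"
proof -
  obtain Go Gm where E: "cat_equivalence T T Go Gm"
    and add: "\<And>f g A B. f \<in> Hom T A B \<Longrightarrow> g \<in> Hom T A B \<Longrightarrow> Gm (Add T f g) = Add T (Gm f) (Gm g)"
    and iso: "\<And>A. A \<in> Obj T \<Longrightarrow> isomorphic T A (Go (ShO T A))" using unshift by metis
  note O = compacts_Obj[OF A]
  show ?thesis
    by (rule compacts_reflect[OF E add shift_Obj[OF O] compacts_isomorphic[OF A iso[OF O]]])
qed

text \<open>A five lemma argument carried out on a single map \<open>h\<close>: a finite sum
  accounts for its restriction to \<open>B\<close>, and compactness of the shift of \<open>A\<close>
  accounts for what remains.\<close>

lemma compacts_cone:
  assumes d: "(u, v, w) \<in> Dist T" and u: "u \<in> Hom T A B" and v: "v \<in> Hom T B D"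
    and A: "A \<in> compacts (U :: 'u itself) T" and B: "B \<in> compacts U T"
  shows "D \<in> compacts U T"
  unfolding compacts_iff
proof (intro conjI allI impI ballI)
  show D: "D \<in> Obj T" using Hom_Obj[OF v] by simp
  fix I :: "'u set" and X P inc h
  assume I: "I \<prec> (UNIV :: 'u set)" and X: "X \<in> I \<rightarrow> Obj T" and c: "is_coproduct T I X P inc" and h: "h \<in> Hom T D P"
  interpret coproduct T I X P inc by (rule coproductI[OF X c])
  note w = DistD[OF d u v]
  \<comment> \<open>Split off \<open>e \<cdot> h\<close>, where \<open>e\<close> fixes \<open>h \<cdot> v\<close>: the rest vanishes on \<open>B\<close>, so it factors through \<open>\<Sigma> A\<close>.\<close>
  have "finite_sum T I X inc B P (h \<cdot> v)"
    using B I X c Cmp_in_Hom[OF v h] unfolding compacts_iff by blast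
  from finite_sum_support[OF this compacts_Obj[OF B]]
  obtain J where J: "J \<subseteq> I" "finite J"
    "\<And>e. e \<in> Hom T P P \<Longrightarrow> \<forall>j \<in> J. e \<cdot> inc j = inc j \<Longrightarrow> e \<cdot> (h \<cdot> v) = h \<cdot> v" by blast
  obtain e where e': "e \<in> Hom T P P" "finite_sum T I X inc P P e"
    "\<forall>j \<in> I. e \<cdot> inc j = (if j \<in> J then inc j else Zero T (X j) P)"
    using partial_identity[OF J(2,1)] by blast
  then have e: "e \<in> Hom T P P" "finite_sum T I X inc P P e" "\<forall>j \<in> J. e \<cdot> inc j = inc j"
    using J(1) by auto
  note eh = Cmp_in_Hom[OF h e(1)]
  have k: "Diff T h (e \<cdot> h) \<in> Hom T D P" by (rule Diff_in_Hom[OF h eh])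
  have "Diff T h (e \<cdot> h) \<cdot> v = Zero T B P"
    using Diff_Cmp[OF v h eh] Cmp_assoc[OF v h e(1)] J(3)[OF e(1,3)]
      Diff_eq_Zero_iff[OF Cmp_in_Hom[OF v h] Cmp_in_Hom[OF v h]] by simp
  then obtain k where k': "k \<in> Hom T (ShO T A) P" "Diff T h (e \<cdot> h) = k \<cdot> w"
    using Dist_weak_cokernel[OF Dist_rotate[OF d] v w k] by blast
  have "finite_sum T I X inc (ShO T A) P k"
    using compacts_shift[OF A] I X c k'(1) unfolding compacts_iff by blast
  then have "finite_sum T I X inc D P (Add T (k \<cdot> w) (e \<cdot> h))"
    using finite_sum_Add[OF finite_sum_Cmp[OF _ w] D finite_sum_Cmp[OF e(2) h]] by blast
  moreover have "h = Add T (k \<cdot> w) (e \<cdot> h)"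
    using Diff_eq_iff[OF h eh k] k'(2) by simp
  ultimately show "finite_sum T I X inc D P h" by simp
qed

end

section \<open>Coherent functors and finitely presented modules\<close>

lemma op_compacts_simps [simp]:
  "Obj (op_compacts u T) = compacts u T" "Src (op_compacts u T) = Tgt T" "Tgt (op_compacts u T) = Src T"
  "Ident (op_compacts u T) = Ident T" "Cmp (op_compacts u T) g f = Cmp T f g"
  "Add (op_compacts u T) = Add T" "Zero (op_compacts u T) A B = Zero T B A"
  "Mor (op_compacts u T) = {f \<in> Mor T. Src T f \<in> compacts u T \<and> Tgt T f \<in> compacts u T}"
  by (simp_all add: op_compacts_def op_preadd_def op_cat_def full_subcat_def)

lemma Hom_op_compacts:
  "Hom (op_compacts u T) A B = (if A \<in> compacts u T \<and> B \<in> compacts u T then Hom T B A else {})"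
  by (auto simp: Hom_def)

lemma hom_grp_op_compacts:
  "A \<in> compacts u T \<Longrightarrow> B \<in> compacts u T \<Longrightarrow> hom_grp (op_compacts u T) A B = hom_grp T B A"
  by (simp add: hom_grp_def Hom_op_compacts)

context preadditive_category
begin

lemma preadditive_op_compacts: "preadditive_category (op_compacts u C)"
proof (rule preadditive_category.intro)
  show "category (op_compacts u C)"
    by unfold_locales
      (auto simp: Hom_op_compacts Ident_Cmp Cmp_Ident Cmp_assoc split: if_splits
        intro: Cmp_in_Hom Ident_in_Hom compacts_Obj)
  show "preadditive_category_axioms (op_compacts u C)"
  proof (rule preadditive_category_axioms.intro)
    fix A B assume "A \<in> Obj (op_compacts u C)" "B \<in> Obj (op_compacts u C)"
    then show "comm_group (hom_grp (op_compacts u C) A B)"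
      using comm_group_hom_grp[OF compacts_Obj[of B u] compacts_Obj[of A u]] by (simp add: hom_grp_op_compacts)
  qed (auto simp: Hom_op_compacts Cmp_Add Add_Cmp split: if_splits)
qed

lemma presents_eq_iff:
  assumes F: "additive_functor C F" and p: "presents C F f a" and f: "f \<in> Hom C A B"
    and g: "g \<in> Hom C A X" "g' \<in> Hom C A X"
  shows "FMor F g a = FMor F g' a \<longleftrightarrow> (\<exists>k \<in> Hom C B X. g = Add C (k \<cdot> f) g')"
proof -
  interpret F: additive_functor_on C F by unfold_locales (fact F)
  have "FMor F g a = FMor F g' a \<longleftrightarrow> (\<exists>k \<in> Hom C B X. Diff C g g' = k \<cdot> f)"
    using F.FMor_eq_iff[OF g presentsD(1)[OF p f]] presentsD(3)[OF p f Diff_in_Hom[OF g]] by simp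
  also have "\<dots> \<longleftrightarrow> (\<exists>k \<in> Hom C B X. g = Add C (k \<cdot> f) g')"
    using Diff_eq_iff[OF g Cmp_in_Hom[OF f]] by blast
  finally show ?thesis .
qed

text \<open>Since \<open>e\<close> is a split monomorphism, \<open>f\<close> and
  \<open>e \<cdot> f\<close> have the same multiples. This allows the target of a presentation to be
  replaced by an isomorphic object that is a shift.\<close>

lemma presents_iso:
  assumes p: "presents C F f a" and f: "f \<in> Hom C A B"
    and e: "e \<in> Hom C B B'" "e' \<in> Hom C B' B" "e' \<cdot> e = Ident C B"
  shows "presents C F (e \<cdot> f) a"
proof -
  have "(\<exists>k \<in> Hom C B X. g = k \<cdot> f) \<longleftrightarrow> (\<exists>k \<in> Hom C B' X. g = k \<cdot> (e \<cdot> f))" for g X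
  proof
    assume "\<exists>k \<in> Hom C B X. g = k \<cdot> f"
    then obtain k where k: "k \<in> Hom C B X" "g = k \<cdot> f" by blast
    have "g = (k \<cdot> e') \<cdot> (e \<cdot> f)"
      using Cmp_assoc[OF Cmp_in_Hom[OF f e(1)] e(2) k(1)] Cmp_assoc[OF f e(1,2)] e(3) Ident_Cmp[OF f] k(2) by simp
    then show "\<exists>k \<in> Hom C B' X. g = k \<cdot> (e \<cdot> f)" using Cmp_in_Hom[OF e(2) k(1)] by blast
  next
    assume "\<exists>k \<in> Hom C B' X. g = k \<cdot> (e \<cdot> f)"
    then obtain k where k: "k \<in> Hom C B' X" "g = k \<cdot> (e \<cdot> f)" by blast
    then have "g = (k \<cdot> e) \<cdot> f" using Cmp_assoc[OF f e(1) k(1)] by simp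
    then show "\<exists>k \<in> Hom C B X. g = k \<cdot> f" using Cmp_in_Hom[OF e(1) k(1)] by blast
  qed
  then have "precomp_image C (e \<cdot> f) X = precomp_image C f X" for X
    using HomD[OF f] HomD[OF Cmp_in_Hom[OF f e(1)]] by (auto simp: precomp_image_def image_def)
  then show ?thesis
    using p HomD[OF f] HomD[OF Cmp_in_Hom[OF f e(1)]] by (simp add: presents_def)
qed

text \<open>The criterion refers to \<open>f\<close> alone, so functors with a common presentation
  vanish on the same objects.\<close>

lemma vanishes_iff:
  assumes F: "additive_functor C F" and p: "presents C F f a" and f: "f \<in> Hom C A B" and X: "X \<in> Obj C"
  shows "vanishes F X \<longleftrightarrow> (\<forall>g \<in> Hom C A X. \<exists>k \<in> Hom C B X. g = k \<cdot> f)"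
proof -
  interpret F: additive_functor_on C F by unfold_locales (fact F)
  interpret X: comm_group "FObj F X" by (rule F.FObj_group[OF X])
  have "vanishes F X \<longleftrightarrow> (\<forall>x \<in> carrier (FObj F X). x = \<one>\<^bsub>FObj F X\<^esub>)"
    unfolding vanishes_def using X.one_closed by blast
  also have "\<dots> \<longleftrightarrow> (\<forall>g \<in> Hom C A X. FMor F g a = \<one>\<^bsub>FObj F X\<^esub>)"
    using presentsD(2)[OF p f X] F.FMor_closed[OF _ presentsD(1)[OF p f]] by metis
  finally show ?thesis using presentsD(3)[OF p f] by simp
qed

lemma additive_restricted_yoneda:
  assumes X: "X \<in> Obj C"
  shows "additive_functor (op_compacts u C) (restricted_yoneda C X)"
  unfolding additive_functor_def restricted_yoneda_def ab_functor.simps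
proof (intro conjI ballI impI)
  show "comm_group (hom_grp C A X)" if "A \<in> Obj (op_compacts u C)" for A
    using that by (intro comm_group_hom_grp[OF compacts_Obj X]) simp
  fix f assume "f \<in> Mor (op_compacts u C)"
  then have f: "f \<in> Hom C (Src C f) (Tgt C f)" by (simp add: Hom_def)
  show "(\<lambda>g. g \<cdot> f) \<in> hom (hom_grp C (Src (op_compacts u C) f) X) (hom_grp C (Tgt (op_compacts u C) f) X)"
    using Cmp_in_Hom[OF f] Cmp_Add[OF f] by (auto simp: hom_def)
  fix x assume x: "x \<in> carrier (hom_grp C (Src (op_compacts u C) f) X)"
  show "x \<cdot> (g \<cdot>\<^bsub>op_compacts u C\<^esub> f) = (x \<cdot> f) \<cdot> g"
    if "g \<in> Mor (op_compacts u C)" "Tgt (op_compacts u C) f = Src (op_compacts u C) g" for g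
    using Cmp_assoc[of g "Src C g" "Src C f" f "Tgt C f" x X] that f x by (simp add: Hom_def)
  show "x \<cdot> Add (op_compacts u C) f g = (x \<cdot> f) \<otimes>\<^bsub>hom_grp C (Tgt (op_compacts u C) f) X\<^esub> (x \<cdot> g)"
    if "g \<in> Hom (op_compacts u C) (Src (op_compacts u C) f) (Tgt (op_compacts u C) f)" for g
    using that x Add_Cmp[OF f, of g x X] by (auto simp: Hom_op_compacts split: if_splits)
qed (use Cmp_Ident in auto)

end

section \<open>Maps of triangles, and triangles with a prescribed last map\<close>

context triangulated_category
begin

lemma triangle_fill:
  assumes d: "(f, g, h) \<in> Dist T" "f \<in> Hom T A B" "g \<in> Hom T B D"
    and d': "(f', g', h') \<in> Dist T" "f' \<in> Hom T A' B'" "g' \<in> Hom T B' D'"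
    and ab: "a \<in> Hom T A A'" "b \<in> Hom T B B'" "b \<cdot> f = f' \<cdot> a"
  shows "\<exists>c \<in> Hom T D D'. c \<cdot> g = g' \<cdot> b \<and> ShM T a \<cdot> h = h' \<cdot> c"
  using TR3[OF d(1) d'(1), of a b] ab HomD[OF d(2)] HomD[OF d(3)] HomD[OF d'(2)] HomD[OF d'(3)] by auto

text \<open>The third axiom read backwards along the triangle. Rotating twice puts \<open>h\<close>
  and \<open>h'\<close> in front, the fill-in is a map between the shifts of \<open>B\<close> and
  \<open>B'\<close>, and full faithfulness of the shift brings it and \<open>e\<close> down to
  \<open>b\<close> and \<open>a\<close>.\<close>

lemma triangle_fill_middle:
  assumes d: "(f, g, h) \<in> Dist T" "f \<in> Hom T A B" "g \<in> Hom T B D"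
    and d': "(f', g', h') \<in> Dist T" "f' \<in> Hom T A' B'" "g' \<in> Hom T B' D'"
    and c: "c \<in> Hom T D D'" and e: "e \<in> Hom T (ShO T A) (ShO T A')" "h' \<cdot> c = e \<cdot> h"
  shows "\<exists>a \<in> Hom T A A'. \<exists>b \<in> Hom T B B'. b \<cdot> f = f' \<cdot> a \<and> c \<cdot> g = g' \<cdot> b"
proof -
  note h = DistD[OF d] and h' = DistD[OF d']
  note O = Hom_Obj[OF d(2)] Hom_Obj[OF d'(2)]
  note sf = shift_Hom[OF d(2)] and sg = shift_Hom[OF d(3)] and sf' = shift_Hom[OF d'(2)] and sg' = shift_Hom[OF d'(3)]
  obtain a where a: "a \<in> Hom T A A'" "ShM T a = e" by (rule shift_full[OF O(1,3) e(1)])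
  have "(h, Neg T (ShM T f), Neg T (ShM T g)) \<in> Dist T" "(h', Neg T (ShM T f'), Neg T (ShM T g')) \<in> Dist T"
    using Dist_rotate[OF Dist_rotate[OF d(1)]] Dist_rotate[OF Dist_rotate[OF d'(1)]] by auto
  from triangle_fill[OF this(1) h Neg_in_Hom[OF sf] this(2) h' Neg_in_Hom[OF sf'] c e(1) e(2)[symmetric]]
  obtain k where k: "k \<in> Hom T (ShO T B) (ShO T B')" "k \<cdot> Neg T (ShM T f) = Neg T (ShM T f') \<cdot> e"
    "ShM T c \<cdot> Neg T (ShM T g) = Neg T (ShM T g') \<cdot> k" by blast
  obtain b where b: "b \<in> Hom T B B'" "ShM T b = k" by (rule shift_full[OF O(2,4) k(1)])
  have "Neg T (k \<cdot> ShM T f) = Neg T (ShM T f' \<cdot> e)"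
    using k(2) Cmp_Neg[OF sf k(1)] Neg_Cmp[OF e(1) sf'] by simp
  then have "k \<cdot> ShM T f = ShM T f' \<cdot> e"
    using Neg_Neg[OF Cmp_in_Hom[OF sf k(1)]] Neg_Neg[OF Cmp_in_Hom[OF e(1) sf']] by metis
  then have "ShM T (b \<cdot> f) = ShM T (f' \<cdot> a)"
    using shift_Cmp[OF d(2) b(1)] shift_Cmp[OF a(1) d'(2)] a(2) b(2) by simp
  then have 1: "b \<cdot> f = f' \<cdot> a"
    by (rule shift_faithful[OF Cmp_in_Hom[OF d(2) b(1)] Cmp_in_Hom[OF a(1) d'(2)]])
  note sc = shift_Hom[OF c]
  have "Neg T (ShM T c \<cdot> ShM T g) = Neg T (ShM T g' \<cdot> k)"
    using k(3) Cmp_Neg[OF sg sc] Neg_Cmp[OF k(1) sg'] by simp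
  then have "ShM T c \<cdot> ShM T g = ShM T g' \<cdot> k"
    using Neg_Neg[OF Cmp_in_Hom[OF sg sc]] Neg_Neg[OF Cmp_in_Hom[OF k(1) sg']] by metis
  then have "ShM T (c \<cdot> g) = ShM T (g' \<cdot> b)"
    using shift_Cmp[OF d(3) c] shift_Cmp[OF b(1) d'(3)] b(2) by simp
  then have "c \<cdot> g = g' \<cdot> b"
    by (rule shift_faithful[OF Cmp_in_Hom[OF d(3) c] Cmp_in_Hom[OF b(1) d'(3)]])
  with 1 a(1) b(1) show ?thesis by blast
qed

text \<open>A triangle starting with \<open>k\<close> is rotated backwards twice, which is possible
  only if its second and third objects are shifts. Both are shifts up to isomorphism:
  \<open>e\<close> replaces the target of \<open>k\<close>, and \<open>z'\<close> below replaces its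
  cone.\<close>

lemma triangle_ending:
  assumes k: "k \<in> Hom T D E" and DE: "D \<in> compacts u T" "E \<in> compacts u T"
  obtains A B f g e e' where "A \<in> compacts u T" "B \<in> compacts u T" "f \<in> Hom T A B" "g \<in> Hom T B D"
    "e \<in> Hom T E (ShO T A)" "e' \<in> Hom T (ShO T A) E" "e' \<cdot> e = Ident T E" "(f, g, e \<cdot> k) \<in> Dist T"
proof -
  obtain A e' e where A: "A \<in> Obj T" and e': "e' \<in> Hom T (ShO T A) E" and e: "e \<in> Hom T E (ShO T A)"
    and ee: "e \<cdot> e' = Ident T (ShO T A)" "e' \<cdot> e = Ident T E"
    by (rule equivalence_ess_surj[OF shift_equivalence compacts_Obj[OF DE(2)]])
  have sA: "ShO T A \<in> compacts u T" by (rule compacts_retract[OF DE(2) e' e ee(1)])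
  define h where "h = e \<cdot> k"
  have h: "h \<in> Hom T D (ShO T A)" unfolding h_def by (rule Cmp_in_Hom[OF k e])
  obtain Z v w where d: "(h, v, w) \<in> Dist T" and v: "v \<in> Hom T (ShO T A) Z" and w: "w \<in> Hom T Z (ShO T D)"
    by (rule Dist_ex[OF h])
  have Z: "Z \<in> compacts u T" by (rule compacts_cone[OF d h v DE(1) sA])
  obtain B z z' where B: "B \<in> Obj T" and z: "z \<in> Hom T (ShO T B) Z" and z': "z' \<in> Hom T Z (ShO T B)"
    and zz: "z' \<cdot> z = Ident T (ShO T B)" "z \<cdot> z' = Ident T Z"
    by (rule equivalence_ess_surj[OF shift_equivalence compacts_Obj[OF Z]])
  have sB: "ShO T B \<in> compacts u T" by (rule compacts_retract[OF Z z z' zz(1)])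
  note v' = Cmp_in_Hom[OF v z'] and w' = Cmp_in_Hom[OF z w]
  note O = Hom_Obj[OF h] shift_Obj[OF Hom_Obj(1)[OF h]]
  note iD = Ident_in_Hom[OF O(1)] and iA = Ident_in_Hom[OF O(2)]
  have iso_I: "iso_mor T (Ident T X)" if "X \<in> Obj T" for X
    using iso_morI[OF Ident_in_Hom[OF that] Ident_in_Hom[OF that]] Cmp_Ident[OF Ident_in_Hom[OF that]] by simp
  \<comment> \<open>The same triangle with the cone \<open>Z\<close> replaced by the isomorphic
    shift of \<open>B\<close>.\<close>
  have d': "(h, z' \<cdot> v, w \<cdot> z) \<in> Dist T"
  proof (rule TR1_iso[OF d triangleI[OF h v' w'], of "Ident T D" "Ident T (ShO T A)" z'])
    show "ShM T (Ident T D) \<cdot> w = w \<cdot> z \<cdot> z'"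
      using Cmp_assoc[OF z' z w] zz(2) Cmp_Ident[OF w] Ident_Cmp[OF w] shift_Ident[OF O(1)] by simp
  qed (use iD iA z' iso_I O iso_morI[OF z' z zz(2,1)] Cmp_Ident[OF h] Ident_Cmp[OF h] Cmp_Ident[OF v']
      HomD[OF h] HomD[OF v] HomD[OF v'] in auto)
  \<comment> \<open>The negative signs in \<open>f\<close> and \<open>g\<close> compensate those
    that two rotations introduce.\<close>
  obtain f where f: "f \<in> Hom T A B" "ShM T f = Neg T (z' \<cdot> v)"
    by (rule shift_full[OF A B Neg_in_Hom[OF v']])
  obtain g where g: "g \<in> Hom T B D" "ShM T g = Neg T (w \<cdot> z)"
    by (rule shift_full[OF B O(1) Neg_in_Hom[OF w']])
  have "(h, Neg T (ShM T f), Neg T (ShM T g)) \<in> Dist T" using d' f(2) g(2) Neg_Neg[OF v'] Neg_Neg[OF w'] by simp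
  then have "(g, h, Neg T (ShM T f)) \<in> Dist T"
    by (rule Dist_unrotate[OF _ g(1) h Neg_in_Hom[OF shift_Hom[OF f(1)]]])
  then have "(f, g, h) \<in> Dist T" by (rule Dist_unrotate[OF _ f(1) g(1) h])
  then show ?thesis
    using that[OF compacts_unshift[OF sA A] compacts_unshift[OF sB B] f(1) g(1) e e' ee(2)] by (simp add: h_def)
qed

end

text \<open>
  By exactness of the triangle the module \<open>G\<close>, a cokernel of \<open>(-, f)\<close>, and the coherent functor \<open>F\<close>,
  a cokernel of \<open>(h, -)\<close>, are related by \<open>F X \<cong> (G, y X)\<close>.
\<close>

locale dual_pair = triangulated_category T
  for T :: "('o, 'm, 'z) tri_cat_scheme" (structure) +
  fixes u :: "'u itself" and A B D :: 'o and f g h :: 'm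
    and F :: "('o, 'm, 'm set) ab_functor" and \<alpha> and G :: "('o, 'm, 'm set) ab_functor" and \<gamma>
  assumes A: "A \<in> compacts u T" and B: "B \<in> compacts u T"
    and f: "f \<in> Hom T A B" and g: "g \<in> Hom T B D" and dist: "(f, g, h) \<in> Dist T"
    and additive_F: "additive_functor T F" and presents_F: "presents T F h \<alpha>"
    and additive_G: "additive_functor (op_compacts u T) G" and presents_G: "presents (op_compacts u T) G f \<gamma>"
begin

lemma h: "h \<in> Hom T D (ShO T A)"
  by (rule DistD[OF dist f g])

lemma D: "D \<in> compacts u T"
  by (rule compacts_cone[OF dist f g A B])

lemma sA: "ShO T A \<in> compacts u T"
  by (rule compacts_shift[OF A])

lemma f_op: "f \<in> Hom (op_compacts u T) B A"
  using f A B by (simp add: Hom_op_compacts)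

lemma F_Coh: "F \<in> presented_functors T (compacts u T)"
  unfolding presented_functors_iff using additive_F presents_F D sA HomD[OF h] by auto

lemma G_mod: "G \<in> presented_functors (op_compacts u T) (compacts u T)"
  unfolding preadditive_category.presented_functors_iff[OF preadditive_op_compacts]
  using additive_G presents_G A B HomD[OF f_op] by (auto intro!: exI[of _ f])

text \<open>Both sides say that every map \<open>D \<rightarrow> X\<close> is killed by \<open>g\<close>.\<close>

lemma vanishes_iff_no_maps:
  assumes X: "X \<in> Obj T"
  shows "vanishes F X \<longleftrightarrow> (\<forall>\<eta> \<in> nat_trans (op_compacts u T) G (restricted_yoneda T X).
     \<forall>E \<in> compacts u T. \<forall>x \<in> carrier (FObj G E). \<eta> E x = Zero T E X)" (is "_ \<longleftrightarrow> ?no_maps")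
proof -
  interpret op: preadditive_category "op_compacts u T" by (rule preadditive_op_compacts)
  note Y = additive_restricted_yoneda[OF X, of u]
  \<comment> \<open>By the Yoneda lemma maps from \<open>G\<close> to the restricted representable
    of \<open>X\<close> are the \<open>b : B \<rightarrow> X\<close> with
    \<open>b \<cdot> f = 0\<close>, so that their absence is injectivity of composition with
    \<open>f\<close>.\<close>
  have "?no_maps \<longleftrightarrow> (\<forall>b \<in> Hom T B X. b \<cdot> f = Zero T A X \<longrightarrow> b = Zero T B X)" (is "_ \<longleftrightarrow> ?inj")
  proof
    assume n: ?no_maps
    show ?inj
    proof (intro ballI impI)
      fix b assume b: "b \<in> Hom T B X" "b \<cdot> f = Zero T A X"
      obtain \<eta> where "\<eta> \<in> nat_trans (op_compacts u T) G (restricted_yoneda T X)" "\<eta> B \<gamma> = b"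
        by (rule op.nat_trans_extension[OF presents_G f_op additive_G Y, of b])
          (use b in \<open>auto simp: restricted_yoneda_def\<close>)
      then show "b = Zero T B X" using n B op.presentsD(1)[OF presents_G f_op] by auto
    qed
  next
    assume i: ?inj
    show ?no_maps
    proof (intro ballI)
      fix \<eta> E x assume e: "\<eta> \<in> nat_trans (op_compacts u T) G (restricted_yoneda T X)"
        and E: "E \<in> compacts u T" and x: "x \<in> carrier (FObj G E)"
      have b: "\<eta> B \<gamma> \<in> Hom T B X" "\<eta> B \<gamma> \<cdot> f = Zero T A X"
        using op.nat_trans_generator[OF presents_G f_op additive_G e Y] by (simp_all add: restricted_yoneda_def)
      then have z: "\<eta> B \<gamma> = Zero T B X" using i by blast
      obtain v where v: "v \<in> Hom (op_compacts u T) B E" "x = FMor G v \<gamma>"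
        using op.presentsD(2)[OF presents_G f_op _ x] E by auto
      have "\<eta> E x = FMor (restricted_yoneda T X) v (\<eta> B \<gamma>)"
        using nat_transD(3)[OF e v(1) op.presentsD(1)[OF presents_G f_op]] v(2) by simp
      then show "\<eta> E x = Zero T E X"
        using z v(1) Zero_Cmp[OF _ X, of v E B] by (auto simp: restricted_yoneda_def Hom_op_compacts split: if_splits)
    qed
  qed
  \<comment> \<open>Exactness at two places: the maps from \<open>B\<close> killed by
    \<open>f\<close> are the composites \<open>c \<cdot> g\<close>, and \<open>c \<cdot> g\<close>
    is zero exactly if \<open>c\<close> factors through \<open>h\<close>.\<close>
  moreover have "?inj \<longleftrightarrow> (\<forall>c \<in> Hom T D X. \<exists>k \<in> Hom T (ShO T A) X. c = k \<cdot> h)" (is "_ \<longleftrightarrow> ?surj")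
  proof
    assume i: ?inj
    show ?surj
    proof
      fix c assume c: "c \<in> Hom T D X"
      have "(c \<cdot> g) \<cdot> f = Zero T A X"
        using Cmp_assoc[OF f g c] Dist_Cmp_zero[OF dist f g] Cmp_Zero[OF c compacts_Obj[OF A]] by simp
      then have "c \<cdot> g = Zero T B X" using i Cmp_in_Hom[OF g c] by blast
      then show "\<exists>k \<in> Hom T (ShO T A) X. c = k \<cdot> h" by (rule Dist_weak_cokernel[OF Dist_rotate[OF dist] g h c])
    qed
  next
    assume s: ?surj
    show ?inj
    proof (intro ballI impI)
      fix b assume b: "b \<in> Hom T B X" "b \<cdot> f = Zero T A X"
      obtain c where c: "c \<in> Hom T D X" "b = c \<cdot> g" using Dist_weak_cokernel[OF dist f g b] by blast
      obtain k where k: "k \<in> Hom T (ShO T A) X" "c = k \<cdot> h" using s c(1) by blast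
      show "b = Zero T B X"
        using c(2) k(2) Cmp_assoc[OF g h k(1)] Dist_Cmp_zero[OF Dist_rotate[OF dist] g h]
          Cmp_Zero[OF k(1) compacts_Obj[OF B]] by simp
    qed
  qed
  ultimately show ?thesis using vanishes_iff[OF additive_F presents_F h X] by simp
qed

end

lemma prod_cases10:
  fixes y :: "'a \<times> 'b \<times> 'c \<times> 'd \<times> 'e \<times> 'f \<times> 'g \<times> 'h \<times> 'i \<times> 'j"
  obtains a b c d e f g h i j where "y = (a, b, c, d, e, f, g, h, i, j)"
proof (cases y rule: prod_cases7)
  case (fields a b c d e f g)
  then show ?thesis using that by (cases g rule: prod_cases4) auto
qed

section \<open>Finitely presented modules are dual to coherent functors\<close>

context triangulated_category
begin

text \<open>A transformation \<open>t\<close> is a square on \<open>h'\<close> and \<open>h\<close>,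
  a transformation \<open>s\<close> a square on \<open>f'\<close> and \<open>f\<close>. Each square
  extends to a map of triangles, and the square on \<open>g'\<close> and \<open>g\<close>, made of
  \<open>b\<close> and \<open>c\<close>, is the part through which \<open>t\<close> and
  \<open>s\<close> are compared.\<close>

lemma dual_pair_nat_trans:
  assumes "dual_pair T (u :: 'u itself) A B D f g h F \<alpha> G \<gamma>" "dual_pair T u A' B' D' f' g' h' F' \<alpha>' G' \<gamma>'"
  shows "t \<in> nat_trans T F F' \<Longrightarrow> \<exists>s \<in> nat_trans (op_compacts u T) G' G. \<exists>b \<in> Hom T B' B. \<exists>c \<in> Hom T D' D.
      c \<cdot> g' = g \<cdot> b \<and> t D \<alpha> = FMor F' c \<alpha>' \<and> s B' \<gamma>' = FMor G b \<gamma>"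
    and "s \<in> nat_trans (op_compacts u T) G' G \<Longrightarrow> \<exists>t \<in> nat_trans T F F'. \<exists>b \<in> Hom T B' B. \<exists>c \<in> Hom T D' D.
      c \<cdot> g' = g \<cdot> b \<and> t D \<alpha> = FMor F' c \<alpha>' \<and> s B' \<gamma>' = FMor G b \<gamma>"
proof -
  interpret w: dual_pair T u A B D f g h F \<alpha> G \<gamma> by (fact assms(1))
  interpret w': dual_pair T u A' B' D' f' g' h' F' \<alpha>' G' \<gamma>' by (fact assms(2))
  interpret op: preadditive_category "op_compacts u T" by (rule preadditive_op_compacts)
  note t_iff = presents_nat_trans_iff[OF w.additive_F w.presents_F w'.additive_F w'.presents_F w.h w'.h]
  note s_iff = op.presents_nat_trans_iff[OF w'.additive_G w'.presents_G w.additive_G w.presents_G w'.f_op w.f_op]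
  {
    assume t: "t \<in> nat_trans T F F'"
    have "t D \<alpha> \<in> carrier (FObj F' D)"
      using nat_trans_generator(1)[OF w.presents_F w.h w.additive_F t w'.additive_F] .
    then obtain c where c: "c \<in> Hom T D' D" "t D \<alpha> = FMor F' c \<alpha>'"
      using presentsD(2)[OF w'.presents_F w'.h compacts_Obj[OF w.D]] by blast
    then obtain v where v: "v \<in> Hom T (ShO T A') (ShO T A)" "h \<cdot> c = v \<cdot> h'"
      using t_iff[OF c(1)] t by blast
    obtain a b where ab: "a \<in> Hom T A' A" "b \<in> Hom T B' B" "b \<cdot> f' = f \<cdot> a" "c \<cdot> g' = g \<cdot> b"
      using triangle_fill_middle[OF w'.dist w'.f w'.g w.dist w.f w.g c(1) v] by blast
    then have "b \<in> Hom (op_compacts u T) B B'" "a \<in> Hom (op_compacts u T) A A'"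
      using w.A w.B w'.A w'.B by (auto simp: Hom_op_compacts)
    then obtain s where "s \<in> nat_trans (op_compacts u T) G' G" "s B' \<gamma>' = FMor G b \<gamma>"
      using s_iff[of b] ab(3) by auto
    then show "\<exists>s \<in> nat_trans (op_compacts u T) G' G. \<exists>b \<in> Hom T B' B. \<exists>c \<in> Hom T D' D.
      c \<cdot> g' = g \<cdot> b \<and> t D \<alpha> = FMor F' c \<alpha>' \<and> s B' \<gamma>' = FMor G b \<gamma>" using ab(2,4) c by blast
  next
    assume s: "s \<in> nat_trans (op_compacts u T) G' G"
    have "s B' \<gamma>' \<in> carrier (FObj G B')"
      using op.nat_trans_generator(1)[OF w'.presents_G w'.f_op w'.additive_G s w.additive_G] .
    then obtain b where b: "b \<in> Hom (op_compacts u T) B B'" "s B' \<gamma>' = FMor G b \<gamma>"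
      using op.presentsD(2)[OF w.presents_G w.f_op, of B' "s B' \<gamma>'"] w'.B by auto
    then obtain a where a: "a \<in> Hom (op_compacts u T) A A'" "b \<cdot> f' = f \<cdot> a"
      using s_iff[OF b(1)] s by auto
    have ab: "b \<in> Hom T B' B" "a \<in> Hom T A' A"
      using a(1) b(1) by (auto simp: Hom_op_compacts split: if_splits)
    obtain c where c: "c \<in> Hom T D' D" "c \<cdot> g' = g \<cdot> b" "ShM T a \<cdot> h' = h \<cdot> c"
      using triangle_fill[OF w'.dist w'.f w'.g w.dist w.f w.g ab(2,1) a(2)] by blast
    then obtain t where "t \<in> nat_trans T F F'" "t D \<alpha> = FMor F' c \<alpha>'"
      using t_iff[OF c(1)] shift_Hom[OF ab(2)] by metis
    then show "\<exists>t \<in> nat_trans T F F'. \<exists>b \<in> Hom T B' B. \<exists>c \<in> Hom T D' D.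
      c \<cdot> g' = g \<cdot> b \<and> t D \<alpha> = FMor F' c \<alpha>' \<and> s B' \<gamma>' = FMor G b \<gamma>" using ab c b(2) by blast
  }
qed

text \<open>Both equalities say that one diagonal is zero, namely
  \<open>(c - c') \<cdot> g' = g \<cdot> (b - b')\<close>. On the left this holds as
  \<open>h'\<close> is a weak cokernel of \<open>g'\<close>, on the right as \<open>f\<close> is a
  weak kernel of \<open>g\<close>.\<close>

lemma dual_pair_unique:
  assumes "dual_pair T (u :: 'u itself) A B D f g h F \<alpha> G \<gamma>" "dual_pair T u A' B' D' f' g' h' F' \<alpha>' G' \<gamma>'"
    and b: "b \<in> Hom T B' B" "b' \<in> Hom T B' B" and c: "c \<in> Hom T D' D" "c' \<in> Hom T D' D"
    and eq: "c \<cdot> g' = g \<cdot> b" "c' \<cdot> g' = g \<cdot> b'"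
  shows "FMor F' c \<alpha>' = FMor F' c' \<alpha>' \<longleftrightarrow> FMor G b \<gamma> = FMor G b' \<gamma>"
proof -
  interpret w: dual_pair T u A B D f g h F \<alpha> G \<gamma> by (fact assms(1))
  interpret w': dual_pair T u A' B' D' f' g' h' F' \<alpha>' G' \<gamma>' by (fact assms(2))
  interpret op: preadditive_category "op_compacts u T" by (rule preadditive_op_compacts)
  note dc = Diff_in_Hom[OF c] and db = Diff_in_Hom[OF b]
  have cg: "Diff T c c' \<cdot> g' = g \<cdot> Diff T b b'"
    using Diff_Cmp[OF w'.g c] Cmp_Diff[OF b w.g] eq by simp
  have "FMor F' c \<alpha>' = FMor F' c' \<alpha>' \<longleftrightarrow> (\<exists>k \<in> Hom T (ShO T A') D. Diff T c c' = k \<cdot> h')"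
    using presents_eq_iff[OF w'.additive_F w'.presents_F w'.h c] Diff_eq_iff[OF c Cmp_in_Hom[OF w'.h]] by blast
  also have "\<dots> \<longleftrightarrow> Diff T c c' \<cdot> g' = Zero T B' D"
    using Dist_weak_cokernel[OF Dist_rotate[OF w'.dist] w'.g w'.h dc]
      Cmp_assoc[OF w'.g w'.h] Dist_Cmp_zero[OF Dist_rotate[OF w'.dist] w'.g w'.h]
      Cmp_Zero[OF _ compacts_Obj[OF w'.B]] by metis
  also have "\<dots> \<longleftrightarrow> (\<exists>k \<in> Hom T B' A. Diff T b b' = f \<cdot> k)"
    using Dist_weak_kernel[OF w.dist w.f w.g db] Cmp_assoc[OF _ w.f w.g] Dist_Cmp_zero[OF w.dist w.f w.g]
      Zero_Cmp[OF _ compacts_Obj[OF w.D]] cg by metis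
  also have "\<dots> \<longleftrightarrow> (\<exists>k \<in> Hom T B' A. b = Add T (f \<cdot> k) b')"
    using Diff_eq_iff[OF b Cmp_in_Hom[OF _ w.f]] by blast
  also have "\<dots> \<longleftrightarrow> FMor G b \<gamma> = FMor G b' \<gamma>"
    using op.presents_eq_iff[OF w.additive_G w.presents_G w.f_op, of b B' b'] b w.A w.B w'.B
    by (simp add: Hom_op_compacts)
  finally show ?thesis .
qed

text \<open>Witnesses are dual pairs with their triangle and generators. Totality of
  \<open>R\<close> in both directions is \<open>dual_pair_nat_trans\<close>, single-valuedness is
  \<open>dual_pair_unique\<close>, and the subcategories match by
  \<open>vanishes_iff_no_maps\<close>.\<close>

theorem Coh_dual_mod:
  assumes \<D>: "\<D> \<subseteq> Obj T"
  shows "equivalent_categories (serre_quotient (Coh (u :: 'u itself) T) (Ann_Coh u T \<D>))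
    (serre_quotient (op_cat (mod_compacts u T)) (S_mod u T \<D>))"
proof -
  let ?M = "op_compacts u T" and ?K = "compacts u T"
  let ?Coh = "nat_cat T (presented_functors T ?K) (\<lambda>F. F)"
    and ?opmod = "op_cat (nat_cat ?M (presented_functors ?M ?K) (\<lambda>F. F))"
  interpret op: preadditive_category ?M by (rule preadditive_op_compacts)
  define Wit where "Wit = {(A, B, D, f, g, h, F, \<alpha>, G, \<gamma>). dual_pair T u A B D f g h F \<alpha> G \<gamma>}"
  define P :: "'o \<times> 'o \<times> 'o \<times> 'm \<times> 'm \<times> 'm \<times> ('o, 'm, 'm set) ab_functor \<times> 'm set
      \<times> ('o, 'm, 'm set) ab_functor \<times> 'm set \<Rightarrow> ('o, 'm, 'm set) ab_functor"
    where "P = (\<lambda>(A, B, D, f, g, h, F, \<alpha>, G, \<gamma>). F)"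
  define Q :: "'o \<times> 'o \<times> 'o \<times> 'm \<times> 'm \<times> 'm \<times> ('o, 'm, 'm set) ab_functor \<times> 'm set
      \<times> ('o, 'm, 'm set) ab_functor \<times> 'm set \<Rightarrow> ('o, 'm, 'm set) ab_functor"
    where "Q = (\<lambda>(A, B, D, f, g, h, F, \<alpha>, G, \<gamma>). G)"
  define R where "R = (\<lambda>(A, B, D, f, g, h, F, \<alpha>, G, \<gamma>) (A', B', D', f', g', h', F', \<alpha>', G', \<gamma>') \<theta> \<eta>.
      dual_pair T u A B D f g h F \<alpha> G \<gamma> \<and> dual_pair T u A' B' D' f' g' h' F' \<alpha>' G' \<gamma>' \<and>
      (\<exists>t \<in> nat_trans T F F'. \<exists>s \<in> nat_trans ?M G' G. \<theta> = (F, F', t) \<and> \<eta> = (G', G, s) \<and>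
      (\<exists>b \<in> Hom T B' B. \<exists>c \<in> Hom T D' D.
         c \<cdot> g' = g \<cdot> b \<and> t D \<alpha> = FMor F' c \<alpha>' \<and> s B' \<gamma>' = FMor G b \<gamma>)))"
  note [simp] = Hom_nat_cat op_cat_simps
  have Coh: "Coh u T = ?Coh"
    and mod: "mod_compacts u T = nat_cat ?M (presented_functors ?M ?K) (\<lambda>F. F)"
    by (simp_all add: Coh_def mod_compacts_def presented_functor_cat_eq)
  have pair: "F \<in> presented_functors T ?K \<and> G \<in> presented_functors ?M ?K"
    if "dual_pair T u A B D f g h F \<alpha> G \<gamma>" for A B D f g h F \<alpha> G \<gamma>
    using dual_pair.F_Coh[OF that] dual_pair.G_mod[OF that] by simp
  have RI: "R (A, B, D, f, g, h, F, \<alpha>, G, \<gamma>) (A', B', D', f', g', h', F', \<alpha>', G', \<gamma>') (F, F', t) (G', G, s)"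
    if "dual_pair T u A B D f g h F \<alpha> G \<gamma>" "dual_pair T u A' B' D' f' g' h' F' \<alpha>' G' \<gamma>'"
      "t \<in> nat_trans T F F'" "s \<in> nat_trans ?M G' G" "b \<in> Hom T B' B" "c \<in> Hom T D' D"
      "c \<cdot> g' = g \<cdot> b" "t D \<alpha> = FMor F' c \<alpha>'" "s B' \<gamma>' = FMor G b \<gamma>"
    for A B D f g h F \<alpha> G \<gamma> A' B' D' f' g' h' F' \<alpha>' G' \<gamma>' t s b c
    using that unfolding R_def by auto
  interpret correspondence "Coh u T" "op_cat (mod_compacts u T)" Wit P Q R
    unfolding Coh mod
  proof (rule correspondence.intro)
    show "category ?Coh"
      by (rule category_nat_cat) (simp add: presented_functors_def)
    show "category ?opmod"
      by (rule category_op_cat, rule op.category_nat_cat) (simp add: presented_functors_def)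
  next
    fix w assume "w \<in> Wit"
    then show "P w \<in> Obj ?Coh"
      "Q w \<in> Obj ?opmod"
      using pair unfolding Wit_def P_def Q_def by auto
  next
    fix F assume "F \<in> Obj ?Coh"
    then obtain k \<alpha> where F: "additive_functor T F" and k: "Src T k \<in> ?K" "Tgt T k \<in> ?K" and p: "presents T F k \<alpha>"
      by (auto simp: presented_functors_iff)
    have kH: "k \<in> Hom T (Src T k) (Tgt T k)" using p by (simp add: presents_def HomI)
    \<comment> \<open>The coherent functor fixes only the last map of the triangle. Its target is
      exchanged for a shift, which leaves \<open>F\<close> presented with the same generator
      \<open>\<alpha>\<close>.\<close>
    obtain A B f g e e' where t: "A \<in> ?K" "B \<in> ?K" "f \<in> Hom T A B" "g \<in> Hom T B (Src T k)"
      "e \<in> Hom T (Tgt T k) (ShO T A)" "e' \<in> Hom T (ShO T A) (Tgt T k)" "e' \<cdot> e = Ident T (Tgt T k)"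
      "(f, g, e \<cdot> k) \<in> Dist T" by (rule triangle_ending[OF kH k])
    have f_op: "f \<in> Hom ?M B A" using t by (simp add: Hom_op_compacts)
    obtain \<gamma> where "presents ?M (coker_functor ?M f) f \<gamma>" using op.coker_functor(2)[OF f_op] by blast
    then have "dual_pair T u A B (Src T k) f g (e \<cdot> k) F \<alpha> (coker_functor ?M f) \<gamma>"
      using t F presents_iso[OF p kH t(5,6,7)] op.coker_functor(1)[OF f_op] by unfold_locales auto
    then show "\<exists>w\<in>Wit. P w = F"
      by (intro bexI[of _ "(A, B, Src T k, f, g, e \<cdot> k, F, \<alpha>, coker_functor ?M f, \<gamma>)"]) (auto simp: Wit_def P_def)
  next
    fix G assume "G \<in> Obj ?opmod"
    then obtain f \<gamma> where G: "additive_functor ?M G" and p: "presents ?M G f \<gamma>"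
      by (auto simp: op.presented_functors_iff)
    define A B where "A = Src T f" and "B = Tgt T f"
    have f: "f \<in> Hom T A B" "A \<in> ?K" "B \<in> ?K" using p by (auto simp: presents_def A_def B_def HomI)
    \<comment> \<open>For a module the first map is given, and any cone of it supplies the
      presentation of a dual coherent functor.\<close>
    obtain D g h where d: "(f, g, h) \<in> Dist T" "g \<in> Hom T B D" "h \<in> Hom T D (ShO T A)" by (rule Dist_ex[OF f(1)])
    obtain \<alpha> where "presents T (coker_functor T h) h \<alpha>" using coker_functor(2)[OF d(3)] by blast
    then have "dual_pair T u A B D f g h (coker_functor T h) \<alpha> G \<gamma>"
      using f d G p coker_functor(1)[OF d(3)] by unfold_locales auto
    then show "\<exists>w\<in>Wit. Q w = G"
      by (intro bexI[of _ "(A, B, D, f, g, h, coker_functor T h, \<alpha>, G, \<gamma>)"]) (auto simp: Wit_def Q_def)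
  next
    fix w w' \<theta> \<eta> assume r: "R w w' \<theta> \<eta>"
    obtain A B D f g h F \<alpha> G \<gamma> where w: "w = (A, B, D, f, g, h, F, \<alpha>, G, \<gamma>)" by (rule prod_cases10)
    obtain A' B' D' f' g' h' F' \<alpha>' G' \<gamma>' where w': "w' = (A', B', D', f', g', h', F', \<alpha>', G', \<gamma>')" by (rule prod_cases10)
    show "w \<in> Wit \<and> w' \<in> Wit" using r unfolding w w' R_def Wit_def by auto
    have "dual_pair T u A B D f g h F \<alpha> G \<gamma>" "dual_pair T u A' B' D' f' g' h' F' \<alpha>' G' \<gamma>'"
      and "\<exists>t \<in> nat_trans T F F'. \<theta> = (F, F', t)" "\<exists>s \<in> nat_trans ?M G' G. \<eta> = (G', G, s)"
      using r unfolding w w' R_def by auto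
    then show "\<theta> \<in> Hom ?Coh (P w) (P w') \<and>
        \<eta> \<in> Hom ?opmod (Q w) (Q w')"
      using pair unfolding w w' P_def Q_def by auto
  next
    fix w w' \<theta> assume ww: "w \<in> Wit" "w' \<in> Wit"
      and th: "\<theta> \<in> Hom ?Coh (P w) (P w')"
    obtain A B D f g h F \<alpha> G \<gamma> where w: "w = (A, B, D, f, g, h, F, \<alpha>, G, \<gamma>)" by (rule prod_cases10)
    obtain A' B' D' f' g' h' F' \<alpha>' G' \<gamma>' where w': "w' = (A', B', D', f', g', h', F', \<alpha>', G', \<gamma>')" by (rule prod_cases10)
    have d: "dual_pair T u A B D f g h F \<alpha> G \<gamma>" "dual_pair T u A' B' D' f' g' h' F' \<alpha>' G' \<gamma>'"
      using ww unfolding w w' Wit_def by auto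
    obtain t where t: "t \<in> nat_trans T F F'" "\<theta> = (F, F', t)" using th unfolding w w' P_def by auto
    obtain s b c where "s \<in> nat_trans ?M G' G" "b \<in> Hom T B' B" "c \<in> Hom T D' D"
      "c \<cdot> g' = g \<cdot> b" "t D \<alpha> = FMor F' c \<alpha>'" "s B' \<gamma>' = FMor G b \<gamma>"
      using dual_pair_nat_trans(1)[OF d t(1)] by blast
    then have "R w w' \<theta> (G', G, s)" using d t unfolding w w' R_def by auto
    then show "\<exists>\<eta>. R w w' \<theta> \<eta>" by blast
  next
    fix w w' \<eta> assume ww: "w \<in> Wit" "w' \<in> Wit"
      and th: "\<eta> \<in> Hom ?opmod (Q w) (Q w')"
    obtain A B D f g h F \<alpha> G \<gamma> where w: "w = (A, B, D, f, g, h, F, \<alpha>, G, \<gamma>)" by (rule prod_cases10)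
    obtain A' B' D' f' g' h' F' \<alpha>' G' \<gamma>' where w': "w' = (A', B', D', f', g', h', F', \<alpha>', G', \<gamma>')" by (rule prod_cases10)
    have d: "dual_pair T u A B D f g h F \<alpha> G \<gamma>" "dual_pair T u A' B' D' f' g' h' F' \<alpha>' G' \<gamma>'"
      using ww unfolding w w' Wit_def by auto
    obtain s where s: "s \<in> nat_trans ?M G' G" "\<eta> = (G', G, s)" using th unfolding w w' Q_def by auto
    obtain t b c where "t \<in> nat_trans T F F'" "b \<in> Hom T B' B" "c \<in> Hom T D' D"
      "c \<cdot> g' = g \<cdot> b" "t D \<alpha> = FMor F' c \<alpha>'" "s B' \<gamma>' = FMor G b \<gamma>"
      using dual_pair_nat_trans(2)[OF d s(1)] by blast
    then have "R w w' (F, F', t) \<eta>" using d s unfolding w w' R_def by auto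
    then show "\<exists>\<theta>. R w w' \<theta> \<eta>" by blast
  next
    fix w w' \<theta> \<eta> \<eta>' assume r: "R w w' \<theta> \<eta>" "R w w' \<theta> \<eta>'"
    obtain A B D f g h F \<alpha> G \<gamma> where w: "w = (A, B, D, f, g, h, F, \<alpha>, G, \<gamma>)" by (rule prod_cases10)
    obtain A' B' D' f' g' h' F' \<alpha>' G' \<gamma>' where w': "w' = (A', B', D', f', g', h', F', \<alpha>', G', \<gamma>')" by (rule prod_cases10)
    have d: "dual_pair T u A B D f g h F \<alpha> G \<gamma>" "dual_pair T u A' B' D' f' g' h' F' \<alpha>' G' \<gamma>'"
      using r(1) unfolding w w' R_def by auto
    obtain t s b c where 1: "s \<in> nat_trans ?M G' G" "\<theta> = (F, F', t)" "\<eta> = (G', G, s)"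
      "b \<in> Hom T B' B" "c \<in> Hom T D' D" "c \<cdot> g' = g \<cdot> b" "t D \<alpha> = FMor F' c \<alpha>'" "s B' \<gamma>' = FMor G b \<gamma>"
      using r(1) unfolding w w' R_def by auto
    obtain t' s' b' c' where 2: "s' \<in> nat_trans ?M G' G" "\<theta> = (F, F', t')" "\<eta>' = (G', G, s')"
      "b' \<in> Hom T B' B" "c' \<in> Hom T D' D" "c' \<cdot> g' = g \<cdot> b'" "t' D \<alpha> = FMor F' c' \<alpha>'" "s' B' \<gamma>' = FMor G b' \<gamma>"
      using r(2) unfolding w w' R_def by auto
    have "FMor F' c \<alpha>' = FMor F' c' \<alpha>'" using 1(2,7) 2(2,7) by simp
    then have "s B' \<gamma>' = s' B' \<gamma>'"
      using dual_pair_unique[OF d 1(4) 2(4) 1(5) 2(5) 1(6) 2(6)] 1(8) 2(8) by simp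
    then have "s = s'"
      by (rule op.nat_trans_eqI[OF dual_pair.presents_G[OF d(2)] dual_pair.f_op[OF d(2)] 1(1) 2(1)])
    then show "\<eta> = \<eta>'" using 1(3) 2(3) by simp
  next
    fix w w' \<theta> \<eta> \<theta>' assume r: "R w w' \<theta> \<eta>" "R w w' \<theta>' \<eta>"
    obtain A B D f g h F \<alpha> G \<gamma> where w: "w = (A, B, D, f, g, h, F, \<alpha>, G, \<gamma>)" by (rule prod_cases10)
    obtain A' B' D' f' g' h' F' \<alpha>' G' \<gamma>' where w': "w' = (A', B', D', f', g', h', F', \<alpha>', G', \<gamma>')" by (rule prod_cases10)
    have d: "dual_pair T u A B D f g h F \<alpha> G \<gamma>" "dual_pair T u A' B' D' f' g' h' F' \<alpha>' G' \<gamma>'"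
      using r(1) unfolding w w' R_def by auto
    obtain t s b c where 1: "t \<in> nat_trans T F F'" "\<theta> = (F, F', t)" "\<eta> = (G', G, s)"
      "b \<in> Hom T B' B" "c \<in> Hom T D' D" "c \<cdot> g' = g \<cdot> b" "t D \<alpha> = FMor F' c \<alpha>'" "s B' \<gamma>' = FMor G b \<gamma>"
      using r(1) unfolding w w' R_def by auto
    obtain t' s' b' c' where 2: "t' \<in> nat_trans T F F'" "\<theta>' = (F, F', t')" "\<eta> = (G', G, s')"
      "b' \<in> Hom T B' B" "c' \<in> Hom T D' D" "c' \<cdot> g' = g \<cdot> b'" "t' D \<alpha> = FMor F' c' \<alpha>'" "s' B' \<gamma>' = FMor G b' \<gamma>"
      using r(2) unfolding w w' R_def by auto
    have "FMor G b \<gamma> = FMor G b' \<gamma>" using 1(3,8) 2(3,8) by simp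
    then have "t D \<alpha> = t' D \<alpha>"
      using dual_pair_unique[OF d 1(4) 2(4) 1(5) 2(5) 1(6) 2(6)] 1(7) 2(7) by simp
    then have "t = t'"
      by (rule nat_trans_eqI[OF dual_pair.presents_F[OF d(1)] dual_pair.h[OF d(1)] 1(1) 2(1)])
    then show "\<theta> = \<theta>'" using 1(2) 2(2) by simp
  next
    fix w assume ww: "w \<in> Wit"
    obtain A B D f g h F \<alpha> G \<gamma> where w: "w = (A, B, D, f, g, h, F, \<alpha>, G, \<gamma>)" by (rule prod_cases10)
    have d: "dual_pair T u A B D f g h F \<alpha> G \<gamma>" using ww unfolding w Wit_def by auto
    interpret w: dual_pair T u A B D f g h F \<alpha> G \<gamma> by (fact d)
    interpret F: additive_functor_on T F by unfold_locales (rule w.additive_F)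
    interpret G: additive_functor_on ?M G by unfold_locales (rule w.additive_G)
    note a = presentsD(1)[OF w.presents_F w.h] and c = op.presentsD(1)[OF w.presents_G w.f_op]
    note O = compacts_Obj[OF w.D] compacts_Obj[OF w.B]
    have "Ident T D \<cdot> g = g \<cdot> Ident T B" using Ident_Cmp[OF w.g] Cmp_Ident[OF w.g] by simp
    moreover have "FMor F (Ident T D) \<alpha> = \<alpha>" using F.FMor_Ident[OF a O(1)] .
    moreover have "FMor G (Ident T B) \<gamma> = \<gamma>" using G.FMor_Ident[OF c] w.B by simp
    ultimately show "R w w (Ident ?Coh (P w))
        (Ident ?opmod (Q w))"
      unfolding w P_def Q_def op_cat_simps nat_cat_simps prod.case
      using a c O w.B
      by (intro RI[OF d d nat_trans_Ident[OF w.additive_F] op.nat_trans_Ident[OF w.additive_G]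
            Ident_in_Hom[OF O(2)] Ident_in_Hom[OF O(1)]]) simp_all
  next
    fix w w' \<theta> \<eta> w'' \<theta>' \<eta>' assume r: "R w w' \<theta> \<eta>" "R w' w'' \<theta>' \<eta>'"
    obtain A B D f g h F \<alpha> G \<gamma> where w: "w = (A, B, D, f, g, h, F, \<alpha>, G, \<gamma>)" by (rule prod_cases10)
    obtain A' B' D' f' g' h' F' \<alpha>' G' \<gamma>' where w': "w' = (A', B', D', f', g', h', F', \<alpha>', G', \<gamma>')" by (rule prod_cases10)
    obtain A'' B'' D'' f'' g'' h'' F'' \<alpha>'' G'' \<gamma>'' where w'': "w'' = (A'', B'', D'', f'', g'', h'', F'', \<alpha>'', G'', \<gamma>'')"
      by (rule prod_cases10)
    have d: "dual_pair T u A B D f g h F \<alpha> G \<gamma>" "dual_pair T u A' B' D' f' g' h' F' \<alpha>' G' \<gamma>'"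
      "dual_pair T u A'' B'' D'' f'' g'' h'' F'' \<alpha>'' G'' \<gamma>''"
      using r unfolding w w' w'' R_def by auto
    obtain t s b c where 1: "t \<in> nat_trans T F F'" "s \<in> nat_trans ?M G' G" "\<theta> = (F, F', t)" "\<eta> = (G', G, s)"
      "b \<in> Hom T B' B" "c \<in> Hom T D' D" "c \<cdot> g' = g \<cdot> b" "t D \<alpha> = FMor F' c \<alpha>'" "s B' \<gamma>' = FMor G b \<gamma>"
      using r(1) unfolding w w' R_def by auto
    obtain t' s' b' c' where 2: "t' \<in> nat_trans T F' F''" "s' \<in> nat_trans ?M G'' G'"
      "\<theta>' = (F', F'', t')" "\<eta>' = (G'', G', s')" "b' \<in> Hom T B'' B'" "c' \<in> Hom T D'' D'" "c' \<cdot> g'' = g' \<cdot> b'"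
      "t' D' \<alpha>' = FMor F'' c' \<alpha>''" "s' B'' \<gamma>'' = FMor G' b' \<gamma>'"
      using r(2) unfolding w' w'' R_def by auto
    interpret w: dual_pair T u A B D f g h F \<alpha> G \<gamma> by (fact d(1))
    interpret w': dual_pair T u A' B' D' f' g' h' F' \<alpha>' G' \<gamma>' by (fact d(2))
    interpret w'': dual_pair T u A'' B'' D'' f'' g'' h'' F'' \<alpha>'' G'' \<gamma>'' by (fact d(3))
    interpret F'': additive_functor_on T F'' by unfold_locales (rule w''.additive_F)
    interpret G: additive_functor_on ?M G by unfold_locales (rule w.additive_G)
    have bM: "b \<in> Hom ?M B B'" "b' \<in> Hom ?M B' B''"
      using 1(5) 2(5) w.B w'.B w''.B by (simp_all add: Hom_op_compacts)
    note gens = presentsD(1)[OF w.presents_F w.h] presentsD(1)[OF w'.presents_F w'.h]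
      presentsD(1)[OF w''.presents_F w''.h] op.presentsD(1)[OF w.presents_G w.f_op]
      op.presentsD(1)[OF w'.presents_G w'.f_op] op.presentsD(1)[OF w''.presents_G w''.f_op]
    have tt: "t' D (t D \<alpha>) = FMor F'' (c \<cdot> c') \<alpha>''"
      using 1(8) 2(8) nat_transD(3)[OF 2(1) 1(6) gens(2)] F''.FMor_Cmp[OF 2(6) 1(6) gens(3)] by simp
    have ss: "s B'' (s' B'' \<gamma>'') = FMor G (b \<cdot> b') \<gamma>"
      using 1(9) 2(9) nat_transD(3)[OF 1(2) bM(2) gens(5)] G.FMor_Cmp[OF bM gens(4)] by simp
    have cc: "c \<cdot> c' \<cdot> g'' = g \<cdot> (b \<cdot> b')"
      using Cmp_assoc[OF w''.g 2(6) 1(6)] Cmp_assoc[OF 2(5) w'.g 1(6)] Cmp_assoc[OF 2(5) 1(5) w.g] 1(7) 2(7) by simp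
    have O: "D \<in> Obj T" "B'' \<in> ?K" using compacts_Obj[OF w.D] w''.B by auto
    show "R w w'' (\<theta>' \<cdot>\<^bsub>?Coh\<^esub> \<theta>)
        (\<eta>' \<cdot>\<^bsub>?opmod\<^esub> \<eta>)"
      unfolding w w'' 1(3,4) 2(3,4) op_cat_simps nat_cat_simps
      using tt ss cc O gens
      by (intro RI[OF d(1,3) nat_trans_comp[OF 1(1) 2(1) w.additive_F]
            op.nat_trans_comp[OF 2(2) 1(2) w''.additive_G] Cmp_in_Hom[OF 2(5) 1(5)] Cmp_in_Hom[OF 2(6) 1(6)]]) simp_all
  qed
  show ?thesis
  proof (rule serre_quotient_equivalence)
    fix w assume "w \<in> Wit"
    then obtain A B D f g h F \<alpha> G \<gamma> where w: "w = (A, B, D, f, g, h, F, \<alpha>, G, \<gamma>)"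
      and d: "dual_pair T u A B D f g h F \<alpha> G \<gamma>" unfolding Wit_def by auto
    interpret w: dual_pair T u A B D f g h F \<alpha> G \<gamma> by (fact d)
    have "F \<in> Ann_Coh u T \<D> \<longleftrightarrow> G \<in> S_mod u T \<D>"
      unfolding Ann_Coh_def S_mod_def Coh mod using w.vanishes_iff_no_maps \<D> w.F_Coh w.G_mod by auto
    then show "P w \<in> Ann_Coh u T \<D> \<longleftrightarrow> Q w \<in> S_mod u T \<D>" by (simp add: w P_def Q_def)
  qed
qed

end

section \<open>Positive primitive formulas\<close>

lemma (in preadditive_category) Cmp_finprod:
  assumes k: "k \<in> Hom C X Y" and E: "E \<in> Obj C" and f: "\<And>i. i \<in> I \<Longrightarrow> f i \<in> Hom C E X" and I: "finite I"
  shows "k \<cdot> finprod (hom_grp C E X) f I = finprod (hom_grp C E Y) (\<lambda>i. k \<cdot> f i) I"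
  using I f
proof (induction rule: finite_induct)
  interpret X: comm_group "hom_grp C E X" by (rule comm_group_hom_grp[OF E Hom_Obj(1)[OF k]])
  interpret Y: comm_group "hom_grp C E Y" by (rule comm_group_hom_grp[OF E Hom_Obj(2)[OF k]])
  case empty
  then show ?case using Cmp_Zero[OF k E] by simp
next
  interpret X: comm_group "hom_grp C E X" by (rule comm_group_hom_grp[OF E Hom_Obj(1)[OF k]])
  interpret Y: comm_group "hom_grp C E Y" by (rule comm_group_hom_grp[OF E Hom_Obj(2)[OF k]])
  case (insert i I)
  have c: "f i \<in> Hom C E X" "f \<in> I \<rightarrow> carrier (hom_grp C E X)" using insert(4) by auto
  have s: "finprod (hom_grp C E X) f I \<in> Hom C E X" using X.finprod_closed[OF c(2)] by simp
  have c': "k \<cdot> f i \<in> Hom C E Y" "(\<lambda>i. k \<cdot> f i) \<in> I \<rightarrow> carrier (hom_grp C E Y)"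
    using c Cmp_in_Hom[OF _ k] by auto
  show ?case
    using X.finprod_insert[OF insert(1,2) c(2)] Y.finprod_insert[OF insert(1,2) c'(2)] c(1) c'(1)
      Add_Cmp[OF c(1) s k] insert by simp
qed

context preadditive_category
begin

lemma tuples_iff:
  "xs \<in> tuples C As X \<longleftrightarrow> length xs = length As \<and> (\<forall>i < length As. xs ! i \<in> Hom C (As ! i) X)"
  by (auto simp: tuples_def list_all2_conv_all_nth)

lemma tuples_map: "xs \<in> tuples C As X \<Longrightarrow> z \<in> Hom C X Y \<Longrightarrow> map (Cmp C z) xs \<in> tuples C As Y"
  using Cmp_in_Hom by (auto simp: tuples_iff)

lemma tuples_append:
  "length xs = length As \<Longrightarrow> xs @ ys \<in> tuples C (As @ Bs) X \<longleftrightarrow> xs \<in> tuples C As X \<and> ys \<in> tuples C Bs X"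
  by (auto simp: tuples_def list_all2_append)

lemma map_Cmp_Cmp:
  assumes "xs \<in> tuples C As X" "z \<in> Hom C X Y" "w \<in> Hom C Y Z"
  shows "map (Cmp C w) (map (Cmp C z) xs) = map (Cmp C (w \<cdot> z)) xs"
  using assms(1) Cmp_assoc[OF _ assms(2,3)] by (intro nth_equalityI) (auto simp: tuples_iff)

lemma map_Cmp_Ident: "xs \<in> tuples C As X \<Longrightarrow> map (Cmp C (Ident C X)) xs = xs"
  using Ident_Cmp by (intro map_idI) (auto simp: tuples_iff in_set_conv_nth)

lemma map_Cmp_Add:
  "xs \<in> tuples C As X \<Longrightarrow> z \<in> Hom C X Y \<Longrightarrow> w \<in> Hom C X Y
    \<Longrightarrow> map (Cmp C (Add C z w)) xs = map2 (Add C) (map (Cmp C z) xs) (map (Cmp C w) xs)"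
  using Cmp_Add by (intro nth_equalityI) (auto simp: tuples_iff)

lemma map_Cmp_Zero:
  "xs \<in> tuples C As X \<Longrightarrow> Y \<in> Obj C \<Longrightarrow> map (Cmp C (Zero C X Y)) xs = map (\<lambda>A. Zero C A Y) As"
  using Zero_Cmp by (intro nth_equalityI) (auto simp: tuples_iff)

lemma satisfies_map:
  assumes xs: "xs \<in> tuples C As X" and z: "z \<in> Hom C X Y" and E: "E \<in> Obj C"
    and fs: "list_all2 (\<lambda>f A. f \<in> Hom C E A) fs As" and s: "satisfies C X xs (E, fs)"
  shows "satisfies C Y (map (Cmp C z) xs) (E, fs)"
proof -
  have i: "xs ! i \<in> Hom C (As ! i) X" "fs ! i \<in> Hom C E (As ! i)" "i < length xs" if "i < length fs" for i
    using xs fs that by (auto simp: tuples_iff list_all2_conv_all_nth)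
  interpret Y: comm_group "hom_grp C E Y" by (rule comm_group_hom_grp[OF E Hom_Obj(2)[OF z]])
  have "finprod (hom_grp C E Y) (\<lambda>i. map (Cmp C z) xs ! i \<cdot> fs ! i) {..<length fs}
      = finprod (hom_grp C E Y) (\<lambda>i. z \<cdot> (xs ! i \<cdot> fs ! i)) {..<length fs}"
  proof (rule Y.finprod_cong')
    show "(\<lambda>i. z \<cdot> (xs ! i \<cdot> fs ! i)) \<in> {..<length fs} \<rightarrow> carrier (hom_grp C E Y)"
      using Cmp_in_Hom[OF Cmp_in_Hom[OF i(2,1)] z] by auto
  qed (use Cmp_assoc[OF i(2,1) z] i(3) in auto)
  also have "\<dots> = z \<cdot> finprod (hom_grp C E X) (\<lambda>i. xs ! i \<cdot> fs ! i) {..<length fs}"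
    by (rule Cmp_finprod[OF z E, symmetric]) (use Cmp_in_Hom[OF i(2,1)] in auto)
  also have "\<dots> = Zero C E Y"
    using s Cmp_Zero[OF z E] by (simp add: satisfies_def)
  finally show ?thesis by (simp add: satisfies_def)
qed

end

section \<open>Generic solutions of systems of linear equations\<close>

context triangulated_category
begin

text \<open>\<open>D\<close> is the direct sum of the sorts, built one biproduct at a time from a
  zero object, and \<open>c\<close> is the tuple of injections.\<close>

lemma generic_tuple:
  "set As \<subseteq> compacts u T \<Longrightarrow> \<exists>D \<in> compacts u T. \<exists>c \<in> tuples T As D.
    \<forall>X \<in> Obj T. \<forall>xs \<in> tuples T As X. \<exists>z \<in> Hom T D X. xs = map (Cmp T z) c"
proof (induction As)
  case Nil
  obtain N where N: "zero_obj T N" using ex_zero_obj by blast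
  then have "N \<in> Obj T" by (simp add: zero_obj_def)
  then show ?case
    using compacts_zero_obj[OF N, of u] Zero_in_Hom by (intro bexI[of _ N] bexI[of _ "[]"]) (auto simp: tuples_iff)
next
  case (Cons A As)
  then obtain D c where D: "D \<in> compacts u T" and c: "c \<in> tuples T As D"
    and gen: "\<And>X xs. X \<in> Obj T \<Longrightarrow> xs \<in> tuples T As X \<Longrightarrow> \<exists>z \<in> Hom T D X. xs = map (Cmp T z) c" by auto
  have A: "A \<in> compacts u T" using Cons by simp
  obtain P i j p q where b: "i \<in> Hom T A P" "j \<in> Hom T D P" "p \<in> Hom T P A" "q \<in> Hom T P D"
    "p \<cdot> i = Ident T A" "q \<cdot> i = Zero T A D" "p \<cdot> j = Zero T D A" "q \<cdot> j = Ident T D"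
    "Add T (i \<cdot> p) (j \<cdot> q) = Ident T P" by (rule biproduct[OF compacts_Obj[OF A] compacts_Obj[OF D]])
  have P: "P \<in> compacts u T" by (rule compacts_biproduct[OF A D b(1-4,9)])
  have "i # map (Cmp T j) c \<in> tuples T (A # As) P"
    using tuples_map[OF c b(2)] b(1) by (simp add: tuples_def)
  moreover have "\<exists>z \<in> Hom T P X. xs = map (Cmp T z) (i # map (Cmp T j) c)"
    if X: "X \<in> Obj T" and xs: "xs \<in> tuples T (A # As) X" for X xs
  proof -
    obtain y ys where ys: "xs = y # ys" "y \<in> Hom T A X" "ys \<in> tuples T As X"
      using xs by (cases xs) (auto simp: tuples_def)
    obtain z where z: "z \<in> Hom T D X" "ys = map (Cmp T z) c" using gen[OF X ys(3)] by blast
    note yp = Cmp_in_Hom[OF b(3) ys(2)] and zq = Cmp_in_Hom[OF b(4) z(1)]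
    have w: "Add T (y \<cdot> p) (z \<cdot> q) \<in> Hom T P X" by (rule Add_in_Hom[OF yp zq])
    have "Add T (y \<cdot> p) (z \<cdot> q) \<cdot> i = y"
      using Cmp_Add[OF b(1) yp zq] Cmp_assoc[OF b(1,3) ys(2)] Cmp_assoc[OF b(1,4) z(1)] b(5,6)
        Cmp_Ident[OF ys(2)] Cmp_Zero[OF z(1) compacts_Obj[OF A]] Add_Zero[OF ys(2)] by simp
    moreover have "Add T (y \<cdot> p) (z \<cdot> q) \<cdot> j = z"
      using Cmp_Add[OF b(2) yp zq] Cmp_assoc[OF b(2,3) ys(2)] Cmp_assoc[OF b(2,4) z(1)] b(7,8)
        Cmp_Ident[OF z(1)] Cmp_Zero[OF ys(2) compacts_Obj[OF D]] Add_Zero[OF z(1)] by simp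
    ultimately show ?thesis
      using w ys(1) z(2) map_Cmp_Cmp[OF c b(2) w] by (intro bexI[OF _ w]) simp
  qed
  ultimately show ?case using P by blast
qed

text \<open>Induction on the list of equations, each one passing to a further cone. A cone is only a
  weak cokernel, so \<open>z\<close> exists without being unique. The sorts here are arbitrary
  compact objects.\<close>

lemma generic_solution:
  "set As \<subseteq> compacts u T \<Longrightarrow>
   \<forall>(E, fs) \<in> set es. E \<in> compacts u T \<and> list_all2 (\<lambda>f A. f \<in> Hom T E A) fs As \<Longrightarrow>
    \<exists>D \<in> compacts u T. \<exists>c \<in> tuples T As D. (\<forall>e \<in> set es. satisfies T D c e) \<and>
    (\<forall>X \<in> Obj T. \<forall>xs \<in> tuples T As X. (\<forall>e \<in> set es. satisfies T X xs e) \<longrightarrow>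
      (\<exists>z \<in> Hom T D X. xs = map (Cmp T z) c))"
proof (induction es)
  case Nil
  then show ?case using generic_tuple[of As u] by simp
next
  case (Cons e es)
  have es: "\<forall>(E, fs) \<in> set es. E \<in> compacts u T \<and> list_all2 (\<lambda>f A. f \<in> Hom T E A) fs As"
    using Cons(3) by simp
  obtain D c where D: "D \<in> compacts u T" and c: "c \<in> tuples T As D" and sat: "\<forall>e \<in> set es. satisfies T D c e"
    and gen: "\<forall>X \<in> Obj T. \<forall>xs \<in> tuples T As X. (\<forall>e \<in> set es. satisfies T X xs e) \<longrightarrow>
      (\<exists>z \<in> Hom T D X. xs = map (Cmp T z) c)" using Cons(1)[OF Cons(2) es] by blast
  obtain E fs where e: "e = (E, fs)" by (cases e)
  have E: "E \<in> compacts u T" and fs: "list_all2 (\<lambda>f A. f \<in> Hom T E A) fs As" using Cons(3) e by auto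
  note EO = compacts_Obj[OF E]
  \<comment> \<open>The left-hand side of the new equation evaluated at the generic tuple
    \<open>c\<close>. On a multiple of \<open>c\<close> by \<open>z\<close> the equation reads
    \<open>z \<cdot> r = 0\<close>, that is, \<open>z\<close> factors through the cone of
    \<open>r\<close>.\<close>
  define r where "r = finprod (hom_grp T E D) (\<lambda>i. c ! i \<cdot> fs ! i) {..<length fs}"
  have i: "c ! i \<in> Hom T (As ! i) D" "fs ! i \<in> Hom T E (As ! i)" "i < length c" if "i < length fs" for i
    using c fs that by (auto simp: tuples_iff list_all2_conv_all_nth)
  have r: "r \<in> Hom T E D"
  proof -
    interpret comm_group "hom_grp T E D" by (rule comm_group_hom_grp[OF EO compacts_Obj[OF D]])
    show ?thesis unfolding r_def using finprod_closed[of _ "{..<length fs}"] Cmp_in_Hom[OF i(2,1)] by simp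
  qed
  have sat_iff: "satisfies T X (map (Cmp T z) c) e \<longleftrightarrow> z \<cdot> r = Zero T E X" if z: "z \<in> Hom T D X" for z X
  proof -
    interpret comm_group "hom_grp T E X" by (rule comm_group_hom_grp[OF EO Hom_Obj(2)[OF z]])
    have "finprod (hom_grp T E X) (\<lambda>i. map (Cmp T z) c ! i \<cdot> fs ! i) {..<length fs}
        = finprod (hom_grp T E X) (\<lambda>i. z \<cdot> (c ! i \<cdot> fs ! i)) {..<length fs}"
    proof (rule finprod_cong')
      show "(\<lambda>i. z \<cdot> (c ! i \<cdot> fs ! i)) \<in> {..<length fs} \<rightarrow> carrier (hom_grp T E X)"
        using Cmp_in_Hom[OF Cmp_in_Hom[OF i(2,1)] z] by auto
    qed (use Cmp_assoc[OF i(2,1) z] i(3) in auto)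
    also have "\<dots> = z \<cdot> r"
      unfolding r_def by (rule Cmp_finprod[OF z EO, symmetric]) (use Cmp_in_Hom[OF i(2,1)] in auto)
    finally show ?thesis by (simp add: satisfies_def e)
  qed
  obtain D' v w where d: "(r, v, w) \<in> Dist T" and v: "v \<in> Hom T D D'" by (rule Dist_ex[OF r])
  have D': "D' \<in> compacts u T" by (rule compacts_cone[OF d r v E D])
  show ?case
  proof (intro bexI[OF _ D'] bexI[OF _ tuples_map[OF c v]] conjI ballI impI)
    fix e' assume "e' \<in> set (e # es)"
    moreover have "satisfies T D' (map (Cmp T v) c) e" using sat_iff[OF v] Dist_Cmp_zero[OF d r v] by simp
    moreover have "satisfies T D' (map (Cmp T v) c) e'" if "e' \<in> set es"
    proof -
      obtain E' fs' where e': "e' = (E', fs')" by (cases e')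
      have "E' \<in> compacts u T" "list_all2 (\<lambda>f A. f \<in> Hom T E' A) fs' As" using es that e' by auto
      then show ?thesis unfolding e' using satisfies_map[OF c v compacts_Obj, of E' u fs'] sat that e' by simp
    qed
    ultimately show "satisfies T D' (map (Cmp T v) c) e'" by auto
  next
    fix X xs assume X: "X \<in> Obj T" and xs: "xs \<in> tuples T As X" and s: "\<forall>e \<in> set (e # es). satisfies T X xs e"
    obtain z where z: "z \<in> Hom T D X" "xs = map (Cmp T z) c"
      using gen[rule_format, OF X xs] s by auto
    have "z \<cdot> r = Zero T E X" using sat_iff[OF z(1)] s z(2) by simp
    then obtain y where y: "y \<in> Hom T D' X" "z = y \<cdot> v" using Dist_weak_cokernel[OF d r v z(1)] by blast
    then show "\<exists>z \<in> Hom T D' X. xs = map (Cmp T z) (map (Cmp T v) c)"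
      using map_Cmp_Cmp[OF c v y(1)] z(2) by (intro bexI[OF _ y(1)]) simp
  qed
qed

end

text \<open>The free realisations of model theory of modules, in a weak sense: the multiplier
  \<open>z\<close> need not be determined by the solution.\<close>

definition realises :: "('o, 'm, 'z) preadd_cat_scheme \<Rightarrow> ('o, 'm) pp \<Rightarrow> 'o \<Rightarrow> 'm list \<Rightarrow> bool" where
  "realises T \<phi> D c \<longleftrightarrow> c \<in> tuples T (free \<phi>) D \<and> (\<forall>X \<in> Obj T. sol T \<phi> X = (\<lambda>z. map (Cmp T z) c) ` Hom T D X)"

section \<open>Free realisations and the formulas they define\<close>

context triangulated_category
begin

text \<open>A generic solution in all variables is truncated to the free ones. The quantified
  variables of an arbitrary solution are recovered as the same multiple of the discarded
  part.\<close>

lemma free_realisation: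
  assumes \<phi>: "pp_formula T K \<phi>" and K: "K \<subseteq> compacts u T"
  obtains D c where "D \<in> compacts u T" "realises T \<phi> D c"
proof -
  let ?As = "free \<phi> @ bound \<phi>" and ?n = "length (free \<phi>)"
  have As: "set ?As \<subseteq> compacts u T"
    and es: "\<forall>(E, fs) \<in> set (eqns \<phi>). E \<in> compacts u T \<and> list_all2 (\<lambda>f A. f \<in> Hom T E A) fs ?As"
    using \<phi> K unfolding pp_formula_def by auto
  obtain D c where D: "D \<in> compacts u T" and c: "c \<in> tuples T ?As D" and sat: "\<forall>e \<in> set (eqns \<phi>). satisfies T D c e"
    and gen: "\<forall>X \<in> Obj T. \<forall>xs \<in> tuples T ?As X. (\<forall>e \<in> set (eqns \<phi>). satisfies T X xs e) \<longrightarrow>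
      (\<exists>z \<in> Hom T D X. xs = map (Cmp T z) c)" using generic_solution[OF As es] by blast
  have len: "length (take ?n c) = ?n" using c by (simp add: tuples_iff)
  have parts: "take ?n c \<in> tuples T (free \<phi>) D" "drop ?n c \<in> tuples T (bound \<phi>) D"
    using tuples_append[OF len, of "drop ?n c"] c by auto
  have "sol T \<phi> X = (\<lambda>z. map (Cmp T z) (take ?n c)) ` Hom T D X" if X: "X \<in> Obj T" for X
  proof (intro equalityI subsetI)
    fix xs assume "xs \<in> sol T \<phi> X"
    then obtain ys where xs: "xs \<in> tuples T (free \<phi>) X" and ys: "ys \<in> tuples T (bound \<phi>) X"
      and s: "\<forall>e \<in> set (eqns \<phi>). satisfies T X (xs @ ys) e" by (auto simp: sol_def)
    have lx: "length xs = ?n" using xs by (simp add: tuples_iff)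
    have "xs @ ys \<in> tuples T ?As X" using tuples_append[OF lx] xs ys by simp
    then obtain z where z: "z \<in> Hom T D X" "xs @ ys = map (Cmp T z) c" using gen X s by blast
    have "xs = take ?n (xs @ ys)" using lx by simp
    then have "xs = map (Cmp T z) (take ?n c)" using z(2) by (simp add: take_map)
    then show "xs \<in> (\<lambda>z. map (Cmp T z) (take ?n c)) ` Hom T D X" using z(1) by blast
  next
    fix xs assume "xs \<in> (\<lambda>z. map (Cmp T z) (take ?n c)) ` Hom T D X"
    then obtain z where z: "z \<in> Hom T D X" "xs = map (Cmp T z) (take ?n c)" by blast
    have "satisfies T X (map (Cmp T z) c) e" if "e \<in> set (eqns \<phi>)" for e
    proof -
      obtain E fs where e: "e = (E, fs)" by (cases e)
      have "E \<in> compacts u T" "list_all2 (\<lambda>f A. f \<in> Hom T E A) fs ?As" using es that e by auto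
      then show ?thesis unfolding e using satisfies_map[OF c z(1) compacts_Obj, of E u fs] sat that e by simp
    qed
    moreover have "map (Cmp T z) c = xs @ map (Cmp T z) (drop ?n c)"
      unfolding z(2) map_append[symmetric] by simp
    ultimately show "xs \<in> sol T \<phi> X"
      using tuples_map[OF parts(1) z(1)] tuples_map[OF parts(2) z(1)] z(2) unfolding sol_def
      by (auto intro!: bexI[of _ "map (Cmp T z) (drop ?n c)"])
  qed
  then have "realises T \<phi> D (take ?n c)" using parts(1) by (simp add: realises_def)
  with D show ?thesis by (rule that)
qed

text \<open>The converse of \<open>free_realisation\<close>. The formula says that the tuple is
  \<open>y\<close> times a fixed tuple for some \<open>y\<close>. Since \<open>y\<close> needs a
  sort in \<open>K\<close>, the object \<open>D\<close> is first replaced by an isomorphic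
  \<open>D0\<close>, which changes \<open>c\<close> to \<open>d\<close> but not the set of
  multiples.\<close>

lemma definable_multiples:
  assumes K: "small_version u T K" and D: "D \<in> compacts u T" and c: "c \<in> tuples T As D" and As: "set As \<subseteq> K"
  obtains \<rho> where "pp_formula T K \<rho>" "free \<rho> = As" "realises T \<rho> D c"
proof -
  have KO: "A \<in> Obj T" if "A \<in> K" for A using that K compacts_Obj unfolding small_version_def by blast
  obtain D0 e where D0: "D0 \<in> K" and e: "e \<in> Hom T D D0" "iso_mor T e"
    using K D unfolding small_version_def isomorphic_def by blast
  note i = inv_mor[OF e(2,1)]
  let ?n = "length As"
  define d where "d = map (Cmp T e) c"
  have d: "d \<in> tuples T As D0" unfolding d_def by (rule tuples_map[OF c e(1)])
  have dj: "d ! j \<in> Hom T (As ! j) D0" "As ! j \<in> K" "As ! j \<in> Obj T" if "j < ?n" for j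
    using d that KO[OF subsetD[OF As nth_mem]] subsetD[OF As nth_mem] by (auto simp: tuples_iff)
  \<comment> \<open>The equation \<open>x j - y \<cdot> d j = 0\<close>, with \<open>y\<close> the bound variable.\<close>
  define row where "row j = map (\<lambda>k. if k = j then Ident T (As ! j) else Zero T (As ! j) (As ! k)) [0..<?n]
      @ [Neg T (d ! j)]" for j
  define \<rho> where "\<rho> = \<lparr>free = As, bound = [D0], eqns = map (\<lambda>j. (As ! j, row j)) [0..<?n]\<rparr>"
  have "list_all2 (\<lambda>f A. f \<in> Hom T (As ! j) A) (row j) (As @ [D0])" if j: "j < ?n" for j
    unfolding row_def
    using dj[OF j] Neg_in_Hom[OF dj(1)[OF j]] Ident_in_Hom[OF dj(3)[OF j]] Zero_in_Hom[OF dj(3)[OF j] dj(3)]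
    by (intro list_all2_appendI) (auto simp: list_all2_conv_all_nth)
  then have "pp_formula T K \<rho>" unfolding pp_formula_def \<rho>_def using As D0 dj(2) by auto
  moreover have sat: "satisfies T X (xs @ [y]) (As ! j, row j) \<longleftrightarrow> xs ! j = y \<cdot> d ! j"
    if X: "X \<in> Obj T" and xs: "xs \<in> tuples T As X" and y: "y \<in> Hom T D0 X" and j: "j < ?n" for X xs y j
  proof -
    interpret comm_group "hom_grp T (As ! j) X" by (rule comm_group_hom_grp[OF dj(3)[OF j] X])
    have xk: "xs ! k \<in> Hom T (As ! k) X" if "k < ?n" for k using xs that by (auto simp: tuples_iff)
    have lx: "length xs = ?n" using xs by (simp add: tuples_iff)
    define t where "t = (\<lambda>k. (xs @ [y]) ! k \<cdot> row j ! k)"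
    note yd = Cmp_in_Hom[OF dj(1)[OF j] y]
    have tk: "t k = (if j = k then xs ! k else Zero T (As ! j) X)" if "k < ?n" for k
      using that lx Cmp_Ident[OF xk[OF that]] Cmp_Zero[OF xk[OF that] dj(3)[OF j]]
      by (auto simp: t_def row_def nth_append)
    have tn: "t ?n = Neg T (y \<cdot> d ! j)"
      using lx Cmp_Neg[OF dj(1)[OF j] y] by (simp add: t_def row_def nth_append)
    have "finprod (hom_grp T (As ! j) X) t {..<?n}
        = finprod (hom_grp T (As ! j) X) (\<lambda>k. if j = k then xs ! k else \<one>\<^bsub>hom_grp T (As ! j) X\<^esub>) {..<?n}"
      by (rule finprod_cong') (use tk xk j Zero_in_Hom[OF dj(3)[OF j] X] in auto)
    also have "\<dots> = finprod (hom_grp T (As ! j) X) (\<lambda>k. if j = k then xs ! j else \<one>\<^bsub>hom_grp T (As ! j) X\<^esub>) {..<?n}"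
      by (rule finprod_cong') (use xk[OF j] Zero_in_Hom[OF dj(3)[OF j] X] in auto)
    also have "\<dots> = xs ! j"
      using finprod_singleton[of j "{..<?n}" "\<lambda>_. xs ! j"] j xk[OF j] by simp
    finally have f: "finprod (hom_grp T (As ! j) X) t {..<?n} = xs ! j" .
    have "finprod (hom_grp T (As ! j) X) t {..<Suc ?n} = t ?n \<otimes>\<^bsub>hom_grp T (As ! j) X\<^esub> finprod (hom_grp T (As ! j) X) t {..<?n}"
      unfolding lessThan_Suc
      by (rule finprod_insert) (use tk tn xk j Neg_in_Hom[OF yd] Zero_in_Hom[OF dj(3)[OF j] X] in auto)
    also have "\<dots> = Diff T (xs ! j) (y \<cdot> d ! j)"
      using f tn Add_commute[OF Neg_in_Hom[OF yd] xk[OF j]] by (simp add: Diff_def)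
    finally have "finprod (hom_grp T (As ! j) X) t {..<length (row j)} = Diff T (xs ! j) (y \<cdot> d ! j)"
      by (simp add: row_def)
    then show ?thesis
      using Diff_eq_Zero_iff[OF xk[OF j] yd] by (simp add: satisfies_def t_def)
  qed
  have "sol T \<rho> X = (\<lambda>z. map (Cmp T z) c) ` Hom T D X" if X: "X \<in> Obj T" for X
  proof -
    have "xs \<in> sol T \<rho> X \<longleftrightarrow> xs \<in> tuples T As X \<and> (\<exists>y \<in> Hom T D0 X. xs = map (Cmp T y) d)" for xs
    proof -
      have "tuples T [D0] X = (\<lambda>y. [y]) ` Hom T D0 X"
        by (auto simp: tuples_def list_all2_Cons2)
      moreover have "(\<forall>e \<in> set (eqns \<rho>). Q e) \<longleftrightarrow> (\<forall>j < ?n. Q (As ! j, row j))" for Q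
        unfolding \<rho>_def by auto
      moreover have "free \<rho> = As" "bound \<rho> = [D0]" by (simp_all add: \<rho>_def)
      ultimately have "xs \<in> sol T \<rho> X \<longleftrightarrow> xs \<in> tuples T As X \<and>
          (\<exists>y \<in> Hom T D0 X. \<forall>j < ?n. satisfies T X (xs @ [y]) (As ! j, row j))"
        unfolding sol_def by simp
      also have "\<dots> \<longleftrightarrow> xs \<in> tuples T As X \<and> (\<exists>y \<in> Hom T D0 X. \<forall>j < ?n. xs ! j = y \<cdot> d ! j)"
        using sat[OF X] by blast
      also have "\<dots> \<longleftrightarrow> xs \<in> tuples T As X \<and> (\<exists>y \<in> Hom T D0 X. xs = map (Cmp T y) d)"
        using d by (auto simp: tuples_iff list_eq_iff_nth_eq)
      finally show ?thesis .
    qed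
    moreover have "(\<exists>y \<in> Hom T D0 X. xs = map (Cmp T y) d) \<longleftrightarrow> (\<exists>z \<in> Hom T D X. xs = map (Cmp T z) c)" for xs
    proof
      assume "\<exists>y \<in> Hom T D0 X. xs = map (Cmp T y) d"
      then obtain y where y: "y \<in> Hom T D0 X" "xs = map (Cmp T y) d" by blast
      then show "\<exists>z \<in> Hom T D X. xs = map (Cmp T z) c"
        using map_Cmp_Cmp[OF c e(1) y(1)] Cmp_in_Hom[OF e(1) y(1)] unfolding d_def by auto
    next
      assume "\<exists>z \<in> Hom T D X. xs = map (Cmp T z) c"
      then obtain z where z: "z \<in> Hom T D X" "xs = map (Cmp T z) c" by blast
      note zi = Cmp_in_Hom[OF i(1) z(1)]
      have "z \<cdot> inv_mor T e \<cdot> e = z" using Cmp_assoc[OF e(1) i(1) z(1)] i(2) Cmp_Ident[OF z(1)] by simp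
      then show "\<exists>y \<in> Hom T D0 X. xs = map (Cmp T y) d"
        using map_Cmp_Cmp[OF c e(1) zi] z(2) unfolding d_def by (intro bexI[OF _ zi]) simp
    qed
    moreover have "map (Cmp T z) c \<in> tuples T As X" if "z \<in> Hom T D X" for z
      by (rule tuples_map[OF c that])
    ultimately have "xs \<in> sol T \<rho> X \<longleftrightarrow> xs \<in> (\<lambda>z. map (Cmp T z) c) ` Hom T D X" for xs
      unfolding image_iff by blast
    then show ?thesis by blast
  qed
  then have "realises T \<rho> D c" using c by (simp add: realises_def \<rho>_def)
  ultimately show ?thesis using that by (simp add: \<rho>_def)
qed

end

definition sol_functor :: "('o, 'm, 'z) preadd_cat_scheme \<Rightarrow> ('o, 'm) pp \<Rightarrow> ('o, 'm, 'm list) ab_functor" where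
  "sol_functor T \<phi> = \<lparr>FObj = sol_grp T \<phi>, FMor = (\<lambda>f. map (Cmp T f))\<rparr>"

definition pair_functor :: "('o, 'm, 'z) preadd_cat_scheme \<Rightarrow> ('o, 'm) pp \<times> ('o, 'm) pp
    \<Rightarrow> ('o, 'm, 'm list set) ab_functor" where
  "pair_functor T p = quotient_functor T (sol_functor T (fst p)) (sol T (snd p))"

lemma FObj_pair_functor [simp]: "FObj (pair_functor T p) = pair_grp T p"
  by (cases p) (simp add: pair_functor_def quotient_functor_def sol_functor_def pair_grp_def)

lemma sol_functor_simps [simp]:
  "carrier (FObj (sol_functor T \<phi>) X) = sol T \<phi> X" "monoid.mult (FObj (sol_functor T \<phi>) X) = map2 (Add T)"
  "\<one>\<^bsub>FObj (sol_functor T \<phi>) X\<^esub> = map (\<lambda>A. Zero T A X) (free \<phi>)" "FMor (sol_functor T \<phi>) f = map (Cmp T f)"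
  by (simp_all add: sol_functor_def sol_grp_def)

section \<open>Pp pairs as presented functors\<close>

context triangulated_category
begin

lemma realisesD:
  assumes "realises T \<phi> D c"
  shows "c \<in> tuples T (free \<phi>) D" "D \<in> Obj T \<Longrightarrow> c \<in> sol T \<phi> D"
    and "xs \<in> sol T \<phi> X \<Longrightarrow> X \<in> Obj T \<Longrightarrow> \<exists>z \<in> Hom T D X. xs = map (Cmp T z) c"
    and "z \<in> Hom T D X \<Longrightarrow> map (Cmp T z) c \<in> sol T \<phi> X"
proof -
  show c: "c \<in> tuples T (free \<phi>) D" using assms by (simp add: realises_def)
  show *: "map (Cmp T z) c \<in> sol T \<phi> X" if "z \<in> Hom T D X" for z X
    using assms Hom_Obj(2)[OF that] that unfolding realises_def by auto
  show "c \<in> sol T \<phi> D" if "D \<in> Obj T"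
    using *[OF Ident_in_Hom[OF that]] map_Cmp_Ident[OF c] by simp
  show "\<exists>z \<in> Hom T D X. xs = map (Cmp T z) c" if "xs \<in> sol T \<phi> X" "X \<in> Obj T"
    using assms that unfolding realises_def by auto
qed

text \<open>The solution set is the image of the group of maps \<open>D \<rightarrow> X\<close>
  under the additive map sending \<open>z\<close> to the multiple of \<open>c\<close> by
  \<open>z\<close>; the group laws are inherited from there.\<close>

lemma comm_group_sol:
  assumes r: "realises T \<phi> D c" and D: "D \<in> Obj T" and X: "X \<in> Obj T"
  shows "comm_group (FObj (sol_functor T \<phi>) X)"
proof -
  interpret H: comm_group "hom_grp T D X" by (rule comm_group_hom_grp[OF D X])
  note c = realisesD(1)[OF r]
  have el: "\<exists>z \<in> Hom T D X. xs = map (Cmp T z) c" if "xs \<in> sol T \<phi> X" for xs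
    by (rule realisesD(3)[OF r that X])
  have add: "map2 (Add T) (map (Cmp T z) c) (map (Cmp T w) c) = map (Cmp T (Add T z w)) c"
    if "z \<in> Hom T D X" "w \<in> Hom T D X" for z w
    using map_Cmp_Add[OF c that] by simp
  have zero: "map (\<lambda>A. Zero T A X) (free \<phi>) = map (Cmp T (Zero T D X)) c" using map_Cmp_Zero[OF c X] by simp
  note z = Zero_in_Hom[OF D X]
  show ?thesis
  proof (rule comm_groupI, unfold sol_functor_simps)
    fix xs ys assume "xs \<in> sol T \<phi> X" "ys \<in> sol T \<phi> X"
    then obtain z w where zw: "z \<in> Hom T D X" "w \<in> Hom T D X" "xs = map (Cmp T z) c" "ys = map (Cmp T w) c"
      using el by blast
    show "map2 (Add T) xs ys \<in> sol T \<phi> X"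
      using add[OF zw(1,2)] realisesD(4)[OF r Add_in_Hom[OF zw(1,2)]] zw(3,4) by simp
    show "map2 (Add T) xs ys = map2 (Add T) ys xs"
      unfolding zw(3,4) add[OF zw(1,2)] add[OF zw(2,1)] Add_commute[OF zw(1,2)] ..
    fix vs assume "vs \<in> sol T \<phi> X"
    then obtain v where v: "v \<in> Hom T D X" "vs = map (Cmp T v) c" using el by blast
    have "Add T (Add T z w) v = Add T z (Add T w v)"
      using H.m_assoc[of z w v] zw v by simp
    then show "map2 (Add T) (map2 (Add T) xs ys) vs = map2 (Add T) xs (map2 (Add T) ys vs)"
      unfolding zw(3,4) v(2) add[OF zw(1,2)] add[OF zw(2) v(1)]
        add[OF Add_in_Hom[OF zw(1,2)] v(1)] add[OF zw(1) Add_in_Hom[OF zw(2) v(1)]] by simp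
  next
    show "map (\<lambda>A. Zero T A X) (free \<phi>) \<in> sol T \<phi> X" unfolding zero by (rule realisesD(4)[OF r z])
  next
    fix xs assume "xs \<in> sol T \<phi> X"
    then obtain w where w: "w \<in> Hom T D X" "xs = map (Cmp T w) c" using el by blast
    show "map2 (Add T) (map (\<lambda>A. Zero T A X) (free \<phi>)) xs = xs"
      unfolding zero w(2) add[OF z w(1)] using Add_Zero[OF w(1)] by simp
    have "Add T (Neg T w) w = Zero T D X" using H.l_inv[of w] w(1) by (simp add: Neg_eq[OF w(1)])
    then have "map2 (Add T) (map (Cmp T (Neg T w)) c) xs = map (\<lambda>A. Zero T A X) (free \<phi>)"
      unfolding zero w(2) add[OF Neg_in_Hom[OF w(1)] w(1)] by simp
    then show "\<exists>ys \<in> sol T \<phi> X. map2 (Add T) ys xs = map (\<lambda>A. Zero T A X) (free \<phi>)"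
      using realisesD(4)[OF r Neg_in_Hom[OF w(1)]] by blast
  qed
qed

lemma sol_tuples: "sol T \<phi> X \<subseteq> tuples T (free \<phi>) X"
  by (auto simp: sol_def)

lemma sol_map:
  assumes "realises T \<phi> D c" "xs \<in> sol T \<phi> X" "f \<in> Hom T X Y"
  shows "map (Cmp T f) xs \<in> sol T \<phi> Y"
proof -
  obtain z where z: "z \<in> Hom T D X" "xs = map (Cmp T z) c"
    using realisesD(3)[OF assms(1,2)] Hom_Obj[OF assms(3)] by blast
  show ?thesis
    unfolding z(2) map_Cmp_Cmp[OF realisesD(1)[OF assms(1)] z(1) assms(3)]
    by (rule realisesD(4)[OF assms(1) Cmp_in_Hom[OF z(1) assms(3)]])
qed

lemma additive_sol_functor:
  assumes r: "realises T \<phi> D c" and D: "D \<in> Obj T"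
  shows "additive_functor T (sol_functor T \<phi>)"
  unfolding additive_functor_def
proof (intro conjI ballI impI)
  fix X assume X: "X \<in> Obj T"
  show "comm_group (FObj (sol_functor T \<phi>) X)" by (rule comm_group_sol[OF r D X])
  fix xs assume "xs \<in> carrier (FObj (sol_functor T \<phi>) X)"
  then show "FMor (sol_functor T \<phi>) (Ident T X) xs = xs"
    using map_Cmp_Ident[OF subsetD[OF sol_tuples]] by simp
next
  fix f assume "f \<in> Mor T"
  then have f: "f \<in> Hom T (Src T f) (Tgt T f)" by (rule HomI)
  have t: "xs \<in> tuples T (free \<phi>) X" if "xs \<in> carrier (FObj (sol_functor T \<phi>) X)" for xs X
    using that subsetD[OF sol_tuples] by simp
  show "FMor (sol_functor T \<phi>) f \<in> hom (FObj (sol_functor T \<phi>) (Src T f)) (FObj (sol_functor T \<phi>) (Tgt T f))"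
  proof (rule homI)
    fix xs assume xs: "xs \<in> carrier (FObj (sol_functor T \<phi>) (Src T f))"
    then show "FMor (sol_functor T \<phi>) f xs \<in> carrier (FObj (sol_functor T \<phi>) (Tgt T f))"
      using sol_map[OF r _ f] by simp
    fix ys assume ys: "ys \<in> carrier (FObj (sol_functor T \<phi>) (Src T f))"
    have "map (Cmp T f) (map2 (Add T) xs ys) = map2 (Add T) (map (Cmp T f) xs) (map (Cmp T f) ys)"
      using t[OF xs] t[OF ys] Add_Cmp[OF _ _ f] by (intro nth_equalityI) (auto simp: tuples_iff)
    then show "FMor (sol_functor T \<phi>) f (xs \<otimes>\<^bsub>FObj (sol_functor T \<phi>) (Src T f)\<^esub> ys)
        = FMor (sol_functor T \<phi>) f xs \<otimes>\<^bsub>FObj (sol_functor T \<phi>) (Tgt T f)\<^esub> FMor (sol_functor T \<phi>) f ys"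
      by (simp only: sol_functor_simps)
  qed
  fix xs assume xs: "xs \<in> carrier (FObj (sol_functor T \<phi>) (Src T f))"
  show "FMor (sol_functor T \<phi>) (g \<cdot> f) xs = FMor (sol_functor T \<phi>) g (FMor (sol_functor T \<phi>) f xs)"
    if "g \<in> Mor T" "Tgt T f = Src T g" for g
  proof -
    have g: "g \<in> Hom T (Tgt T f) (Tgt T g)" using that by (simp add: Hom_def)
    show ?thesis using map_Cmp_Cmp[OF t[OF xs] f g] by simp
  qed
  show "FMor (sol_functor T \<phi>) (Add T f g) xs
      = FMor (sol_functor T \<phi>) f xs \<otimes>\<^bsub>FObj (sol_functor T \<phi>) (Tgt T f)\<^esub> FMor (sol_functor T \<phi>) g xs"
    if "g \<in> Hom T (Src T f) (Tgt T f)" for g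
    using map_Cmp_Add[OF t[OF xs] f that] by (simp only: sol_functor_simps)
qed

lemma subfunctor_sol:
  assumes r: "realises T \<phi> D c" "D \<in> Obj T" and r': "realises T \<psi> D' c'" "D' \<in> Obj T"
    and fr: "free \<phi> = free \<psi>" and sub: "\<And>X. X \<in> Obj T \<Longrightarrow> sol T \<psi> X \<subseteq> sol T \<phi> X"
  shows "subfunctor T (sol_functor T \<phi>) (sol T \<psi>)"
proof -
  interpret additive_functor_on T "sol_functor T \<phi>" by unfold_locales (rule additive_sol_functor[OF r])
  show ?thesis
  proof (rule subfunctor.intro[OF additive_functor_on_axioms], rule subfunctor_axioms.intro)
    fix X assume X: "X \<in> Obj T"
    interpret P: comm_group "FObj (sol_functor T \<phi>) X" by (rule comm_group_sol[OF r X])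
    interpret Q: comm_group "FObj (sol_functor T \<psi>) X" by (rule comm_group_sol[OF r' X])
    show "subgroup (sol T \<psi> X) (FObj (sol_functor T \<phi>) X)"
    proof (rule P.subgroupI)
      show "sol T \<psi> X \<subseteq> carrier (FObj (sol_functor T \<phi>) X)" using sub[OF X] by simp
      show "sol T \<psi> X \<noteq> {}" using Q.one_closed by auto
      fix xs assume xs: "xs \<in> sol T \<psi> X"
      \<comment> \<open>The inverse is formed among the solutions of \<open>\<psi>\<close>. As both
        groups have the same addition and zero, it is also the inverse among those of
        \<open>\<phi>\<close>.\<close>
      define ys where "ys = inv\<^bsub>FObj (sol_functor T \<psi>) X\<^esub> xs"
      have ys: "ys \<in> sol T \<psi> X" "map2 (Add T) ys xs = map (\<lambda>A. Zero T A X) (free \<psi>)"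
        using Q.inv_closed[of xs] Q.l_inv[of xs] xs by (simp_all add: ys_def)
      have "inv\<^bsub>FObj (sol_functor T \<phi>) X\<^esub> xs = ys"
        using ys sub[OF X] xs fr by (intro P.inv_equality) auto
      then show "inv\<^bsub>FObj (sol_functor T \<phi>) X\<^esub> xs \<in> sol T \<psi> X" using ys(1) by simp
      fix zs assume "zs \<in> sol T \<psi> X"
      then show "xs \<otimes>\<^bsub>FObj (sol_functor T \<phi>) X\<^esub> zs \<in> sol T \<psi> X" using Q.m_closed[of xs zs] xs by simp
    qed
  next
    fix f X Y xs assume "f \<in> Hom T X Y" "xs \<in> sol T \<psi> X"
    then show "FMor (sol_functor T \<phi>) f xs \<in> sol T \<psi> Y" using sol_map[OF r'(1)] by simp
  qed
qed

text \<open>The tuple \<open>c\<close> generates the solutions of \<open>\<phi>\<close>, and a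
  multiple of \<open>c\<close> becomes zero in the quotient when it is also a multiple of
  \<open>c'\<close>. Hypothesis \<open>rel\<close> says that \<open>f\<close> divides exactly the
  corresponding maps \<open>g\<close>.\<close>

lemma presents_sol_quotient:
  assumes r: "realises T \<phi> D c" "D \<in> Obj T" and r': "realises T \<psi> D' c'" "D' \<in> Obj T"
    and fr: "free \<phi> = free \<psi>" and sub: "\<And>X. X \<in> Obj T \<Longrightarrow> sol T \<psi> X \<subseteq> sol T \<phi> X"
    and f: "f \<in> Hom T D B"
    and rel: "\<And>g X. g \<in> Hom T D X \<Longrightarrow>
      (\<exists>z \<in> Hom T D' X. map (Cmp T g) c = map (Cmp T z) c') \<longleftrightarrow> (\<exists>k \<in> Hom T B X. g = k \<cdot> f)"
  shows "presents T (pair_functor T (\<phi>, \<psi>)) f (sol T \<psi> D #>\<^bsub>FObj (sol_functor T \<phi>) D\<^esub> c)"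
proof -
  interpret subfunctor T "sol_functor T \<phi>" "sol T \<psi>" by (rule subfunctor_sol[OF r r' fr sub])
  show ?thesis
    unfolding pair_functor_def fst_conv snd_conv
  proof (rule presents_quot[OF f])
    show "c \<in> carrier (FObj (sol_functor T \<phi>) D)" using realisesD(2)[OF r] by simp
    show "\<exists>g \<in> Hom T D X. xs = FMor (sol_functor T \<phi>) g c"
      if "X \<in> Obj T" "xs \<in> carrier (FObj (sol_functor T \<phi>) X)" for X xs
      using realisesD(3)[OF r(1) _ that(1)] that(2) by simp
    fix X g assume g: "g \<in> Hom T D X"
    have "map (Cmp T g) c \<in> sol T \<psi> X \<longleftrightarrow> (\<exists>z \<in> Hom T D' X. map (Cmp T g) c = map (Cmp T z) c')"
      using realisesD(3)[OF r'(1) _ Hom_Obj(2)[OF g]] realisesD(4)[OF r'(1)] by metis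
    then show "FMor (sol_functor T \<phi>) g c \<in> sol T \<psi> X \<longleftrightarrow> (\<exists>k \<in> Hom T B X. g = k \<cdot> f)"
      using rel[OF g] by simp
  qed
qed

lemma pair_functor_realisations:
  assumes p: "p \<in> pp_pairs T K" and K: "K \<subseteq> compacts u T"
  obtains D c D' c' where "D \<in> compacts u T" "D' \<in> compacts u T" "realises T (fst p) D c" "realises T (snd p) D' c'"
    "D \<in> Obj T" "D' \<in> Obj T" "free (fst p) = free (snd p)" "subfunctor T (sol_functor T (fst p)) (sol T (snd p))"
proof -
  obtain \<phi> \<psi> where pq: "p = (\<phi>, \<psi>)" and f: "pp_formula T K \<phi>" "pp_formula T K \<psi>" "free \<phi> = free \<psi>"
    and sub: "\<And>X. X \<in> Obj T \<Longrightarrow> sol T \<psi> X \<subseteq> sol T \<phi> X" using p unfolding pp_pairs_def by auto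
  obtain D c where D: "D \<in> compacts u T" "realises T \<phi> D c" by (rule free_realisation[OF f(1) K])
  obtain D' c' where D': "D' \<in> compacts u T" "realises T \<psi> D' c'" by (rule free_realisation[OF f(2) K])
  note O = compacts_Obj[OF D(1)] compacts_Obj[OF D'(1)]
  show ?thesis
    using that[of D D' c c'] D D' O f(3) subfunctor_sol[OF D(2) O(1) D'(2) O(2) f(3) sub] by (simp add: pq)
qed

lemma additive_pair_functor:
  assumes "p \<in> pp_pairs T K" "K \<subseteq> compacts u T"
  shows "additive_functor T (pair_functor T p)"
  by (rule pair_functor_realisations[OF assms]) (simp add: pair_functor_def subfunctor.additive_quot)

text \<open>The relation \<open>g c = z c'\<close> between \<open>g : D \<rightarrow> X\<close> and
  \<open>z : D' \<rightarrow> X\<close> is a linear system in two unknowns. Its generic solution is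
  a weak pushout of the two tuples, and the component \<open>f : D \<rightarrow> B\<close> is the
  presenting map.\<close>

lemma presents_pair_functor:
  assumes p: "p \<in> pp_pairs T K" and K: "K \<subseteq> compacts u T"
  shows "\<exists>D B f a. D \<in> compacts u T \<and> B \<in> compacts u T \<and> f \<in> Hom T D B \<and> presents T (pair_functor T p) f a"
proof -
  obtain \<phi> \<psi> where pq: "p = (\<phi>, \<psi>)" by (cases p)
  have sub: "\<And>X. X \<in> Obj T \<Longrightarrow> sol T \<psi> X \<subseteq> sol T \<phi> X" and fK: "set (free \<phi>) \<subseteq> K"
    using p unfolding pq pp_pairs_def pp_formula_def by auto
  obtain D c D' c' where D: "D \<in> compacts u T" "D' \<in> compacts u T"
    and r: "realises T \<phi> D c" "realises T \<psi> D' c'" and O: "D \<in> Obj T" "D' \<in> Obj T"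
    and fr: "free \<phi> = free \<psi>" using pair_functor_realisations[OF p K] by (metis fst_conv pq snd_conv)
  let ?n = "length (free \<phi>)"
  have c: "length c = ?n" "\<And>j. j < ?n \<Longrightarrow> c ! j \<in> Hom T (free \<phi> ! j) D"
    and c': "length c' = ?n" "\<And>j. j < ?n \<Longrightarrow> c' ! j \<in> Hom T (free \<phi> ! j) D'"
    using realisesD(1)[OF r(1)] realisesD(1)[OF r(2)] by (auto simp: tuples_iff fr)
  have A: "free \<phi> ! j \<in> compacts u T" if "j < ?n" for j using nth_mem[OF that] fK K by blast
  \<comment> \<open>One equation per free variable. The unknowns have sorts \<open>D\<close> and
    \<open>D'\<close>, which may lie outside \<open>K\<close>; \<open>generic_solution\<close> asks
    only that they are compact.\<close>
  define es where "es = map (\<lambda>j. (free \<phi> ! j, [c ! j, Neg T (c' ! j)])) [0..<?n]"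
  have "set [D, D'] \<subseteq> compacts u T" using D by simp
  moreover have "\<forall>(E, fs) \<in> set es. E \<in> compacts u T \<and> list_all2 (\<lambda>f A. f \<in> Hom T E A) fs [D, D']"
    using A c(2) Neg_in_Hom[OF c'(2)] by (auto simp: es_def)
  moreover have sat: "(\<forall>e \<in> set es. satisfies T X [g, z] e) \<longleftrightarrow> map (Cmp T g) c = map (Cmp T z) c'"
    if g: "g \<in> Hom T D X" and z: "z \<in> Hom T D' X" for g z X
  proof -
    have "satisfies T X [g, z] (free \<phi> ! j, [c ! j, Neg T (c' ! j)]) \<longleftrightarrow> g \<cdot> c ! j = z \<cdot> c' ! j" if j: "j < ?n" for j
    proof -
      note gc = Cmp_in_Hom[OF c(2)[OF j] g] and zc = Cmp_in_Hom[OF c'(2)[OF j] z]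
      interpret comm_group "hom_grp T (free \<phi> ! j) X" by (rule Hom_comm_group[OF gc])
      have "finprod (hom_grp T (free \<phi> ! j) X) (\<lambda>i. [g, z] ! i \<cdot> [c ! j, Neg T (c' ! j)] ! i) {..<Suc (Suc 0)}
          = Diff T (g \<cdot> c ! j) (z \<cdot> c' ! j)"
        using gc Neg_in_Hom[OF zc] Cmp_Neg[OF c'(2)[OF j] z] Add_commute[OF gc Neg_in_Hom[OF zc]] Add_Zero[OF gc]
          Add_Zero[OF Neg_in_Hom[OF zc]]
        by (simp add: lessThan_Suc Diff_def)
      then show ?thesis using Diff_eq_Zero_iff[OF gc zc] by (simp add: satisfies_def)
    qed
    then have "(\<forall>e \<in> set es. satisfies T X [g, z] e) \<longleftrightarrow> (\<forall>j < ?n. g \<cdot> c ! j = z \<cdot> c' ! j)"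
      by (simp add: es_def atLeast0LessThan lessThan_def)
    also have "\<dots> \<longleftrightarrow> map (Cmp T g) c = map (Cmp T z) c'" using c(1) c'(1) by (simp add: list_eq_iff_nth_eq)
    finally show ?thesis .
  qed
  ultimately obtain B t where B: "B \<in> compacts u T" and t: "t \<in> tuples T [D, D'] B" and ts: "\<forall>e \<in> set es. satisfies T B t e"
    and gen: "\<forall>X \<in> Obj T. \<forall>xs \<in> tuples T [D, D'] X. (\<forall>e \<in> set es. satisfies T X xs e) \<longrightarrow>
      (\<exists>z \<in> Hom T B X. xs = map (Cmp T z) t)" using generic_solution[of "[D, D']" u es] by blast
  obtain f f' where f: "t = [f, f']" "f \<in> Hom T D B" "f' \<in> Hom T D' B"
    using t by (auto simp: tuples_def list_all2_Cons2)
  have "presents T (pair_functor T p) f (sol T \<psi> D #>\<^bsub>FObj (sol_functor T \<phi>) D\<^esub> c)"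
    unfolding pq
  proof (rule presents_sol_quotient[OF r(1) O(1) r(2) O(2) fr sub f(2)])
    fix g X assume g: "g \<in> Hom T D X"
    show "(\<exists>z \<in> Hom T D' X. map (Cmp T g) c = map (Cmp T z) c') \<longleftrightarrow> (\<exists>k \<in> Hom T B X. g = k \<cdot> f)"
    proof
      assume "\<exists>z \<in> Hom T D' X. map (Cmp T g) c = map (Cmp T z) c'"
      then obtain z where z: "z \<in> Hom T D' X" "map (Cmp T g) c = map (Cmp T z) c'" by blast
      have "[g, z] \<in> tuples T [D, D'] X" using g z(1) by (simp add: tuples_def)
      moreover have "\<forall>e \<in> set es. satisfies T X [g, z] e" using sat[OF g z(1)] z(2) by simp
      ultimately obtain k where "k \<in> Hom T B X" "[g, z] = map (Cmp T k) t"
        using bspec[OF bspec[OF gen Hom_Obj(2)[OF g]], of "[g, z]"] by auto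
      then show "\<exists>k \<in> Hom T B X. g = k \<cdot> f" using f(1) by auto
    next
      assume "\<exists>k \<in> Hom T B X. g = k \<cdot> f"
      then obtain k where k: "k \<in> Hom T B X" "g = k \<cdot> f" by blast
      have "map (Cmp T f) c = map (Cmp T f') c'" using sat[OF f(2,3)] ts f(1) by simp
      then have "map (Cmp T k) (map (Cmp T f) c) = map (Cmp T k) (map (Cmp T f') c')" by (simp only:)
      then have "map (Cmp T g) c = map (Cmp T (k \<cdot> f')) c'"
        unfolding map_Cmp_Cmp[OF realisesD(1)[OF r(1)] f(2) k(1)] map_Cmp_Cmp[OF realisesD(1)[OF r(2)] f(3) k(1)] k(2) .
      then show "\<exists>z \<in> Hom T D' X. map (Cmp T g) c = map (Cmp T z) c'" using Cmp_in_Hom[OF f(3) k(1)] by blast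
    qed
  qed
  with D(1) B f(2) show ?thesis by blast
qed

text \<open>With \<open>A0\<close> in \<open>K\<close> isomorphic to \<open>A\<close> via
  \<open>i\<close>, the formula \<open>\<phi>\<close> describes the multiples of \<open>i\<close>,
  hence all maps from \<open>A0\<close>, and \<open>\<psi>\<close> describes the multiples of
  \<open>f \<cdot> i\<close>. Their quotient is the cokernel of \<open>(f, -)\<close>.\<close>

lemma pair_functor_of_presentation:
  assumes K: "small_version u T K" and AB: "A \<in> compacts u T" "B \<in> compacts u T" and f: "f \<in> Hom T A B"
  shows "\<exists>p \<in> pp_pairs T K. \<exists>a. presents T (pair_functor T p) f a"
proof -
  obtain A0 j where A0: "A0 \<in> K" and j: "j \<in> Hom T A A0" "iso_mor T j"
    using K AB(1) unfolding small_version_def isomorphic_def by blast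
  define i where "i = inv_mor T j"
  have i: "i \<in> Hom T A0 A" "j \<cdot> i = Ident T A0" "i \<cdot> j = Ident T A"
    using inv_mor[OF j(2,1)] by (simp_all add: i_def)
  note fi = Cmp_in_Hom[OF i(1) f] and O = compacts_Obj[OF AB(1)] compacts_Obj[OF AB(2)]
  have t: "[i] \<in> tuples T [A0] A" "[f \<cdot> i] \<in> tuples T [A0] B" using i(1) fi by (simp_all add: tuples_def)
  have s: "set [A0] \<subseteq> K" using A0 by simp
  obtain \<phi> where \<phi>: "pp_formula T K \<phi>" "free \<phi> = [A0]" "realises T \<phi> A [i]"
    by (rule definable_multiples[OF K AB(1) t(1) s])
  obtain \<psi> where \<psi>: "pp_formula T K \<psi>" "free \<psi> = [A0]" "realises T \<psi> B [f \<cdot> i]"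
    by (rule definable_multiples[OF K AB(2) t(2) s])
  have fr: "free \<phi> = free \<psi>" using \<phi> \<psi> by simp
  have sub: "sol T \<psi> X \<subseteq> sol T \<phi> X" if X: "X \<in> Obj T" for X
  proof
    fix xs assume "xs \<in> sol T \<psi> X"
    then obtain z where z: "z \<in> Hom T B X" "xs = map (Cmp T z) [f \<cdot> i]" using realisesD(3)[OF \<psi>(3) _ X] by blast
    then have "xs = map (Cmp T (z \<cdot> f)) [i]" using Cmp_assoc[OF i(1) f z(1)] by simp
    then show "xs \<in> sol T \<phi> X" using realisesD(4)[OF \<phi>(3) Cmp_in_Hom[OF f z(1)]] by simp
  qed
  have "presents T (pair_functor T (\<phi>, \<psi>)) f (sol T \<psi> A #>\<^bsub>FObj (sol_functor T \<phi>) A\<^esub> [i])"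
  proof (rule presents_sol_quotient[OF \<phi>(3) O(1) \<psi>(3) O(2) fr sub f])
    fix g X assume g: "g \<in> Hom T A X"
    have "g \<cdot> i = z \<cdot> (f \<cdot> i) \<longleftrightarrow> g = z \<cdot> f" if z: "z \<in> Hom T B X" for z
    proof
      assume "g \<cdot> i = z \<cdot> (f \<cdot> i)"
      then have "(g \<cdot> i) \<cdot> j = ((z \<cdot> f) \<cdot> i) \<cdot> j" using Cmp_assoc[OF i(1) f z] by simp
      then show "g = z \<cdot> f"
        using Cmp_assoc[OF j(1) i(1) g] Cmp_assoc[OF j(1) i(1) Cmp_in_Hom[OF f z]] i(3) Cmp_Ident[OF g]
          Cmp_Ident[OF Cmp_in_Hom[OF f z]] by simp
    next
      assume "g = z \<cdot> f"
      then show "g \<cdot> i = z \<cdot> (f \<cdot> i)" using Cmp_assoc[OF i(1) f z] by simp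
    qed
    then show "(\<exists>z \<in> Hom T B X. map (Cmp T g) [i] = map (Cmp T z) [f \<cdot> i]) \<longleftrightarrow> (\<exists>k \<in> Hom T B X. g = k \<cdot> f)"
      by auto
  qed
  moreover have "(\<phi>, \<psi>) \<in> pp_pairs T K" using \<phi> \<psi> sub unfolding pp_pairs_def by auto
  ultimately show ?thesis by blast
qed

text \<open>Solutions of pp formulas are preserved by morphisms, so a pp-definable map is natural.
  Conversely a natural map is determined by a representative \<open>d\<close> of the image of the
  generator \<open>c\<close>, and the formula for the multiples of \<open>c\<close> followed by
  \<open>d\<close> defines its graph.\<close>

lemma pp_maps_eq:
  assumes p: "p \<in> pp_pairs T K" and q: "q \<in> pp_pairs T K" and K: "small_version u T K"
  shows "pp_maps T K p q = nat_trans T (pair_functor T p) (pair_functor T q)"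
proof (intro equalityI subsetI)
  have Kc: "K \<subseteq> compacts u T" using K by (simp add: small_version_def)
  obtain D c D' c' where rp: "D \<in> compacts u T" "realises T (fst p) D c" "D \<in> Obj T"
    and Sp: "subfunctor T (sol_functor T (fst p)) (sol T (snd p))" by (rule pair_functor_realisations[OF p Kc])
  obtain E e E' e' where rq: "realises T (fst q) E e"
    and Sq: "subfunctor T (sol_functor T (fst q)) (sol T (snd q))" by (rule pair_functor_realisations[OF q Kc])
  interpret P: subfunctor T "sol_functor T (fst p)" "sol T (snd p)" by (rule Sp)
  interpret Q: subfunctor T "sol_functor T (fst q)" "sol T (snd q)" by (rule Sq)
  have Pq: "pair_functor T p = P.quot" "pair_functor T q = Q.quot" by (simp_all add: pair_functor_def)
  have cp: "carrier (pair_grp T p X) = P.coset X ` sol T (fst p) X" for X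
    using P.carrier_quot by (simp add: FObj_pair_functor[symmetric] Pq del: FObj_pair_functor)
  have cq: "carrier (pair_grp T q X) = Q.coset X ` sol T (fst q) X" for X
    using Q.carrier_quot by (simp add: FObj_pair_functor[symmetric] Pq del: FObj_pair_functor)
  {
    fix h assume h: "h \<in> pp_maps T K p q"
    from h have "\<exists>\<rho>. pp_formula T K \<rho> \<and> free \<rho> = free (fst p) @ free (fst q) \<and>
          (\<forall>X \<in> Obj T. \<forall>x \<in> carrier (pair_grp T p X). \<forall>y \<in> carrier (pair_grp T q X).
             h X x = y \<longleftrightarrow> (\<exists>a \<in> x. \<exists>b \<in> y. a @ b \<in> sol T \<rho> X))"
      by (simp add: pp_maps_def)
    then obtain \<rho> where \<rho>: "pp_formula T K \<rho>"
      and \<rho>h: "\<forall>X \<in> Obj T. \<forall>x \<in> carrier (pair_grp T p X). \<forall>y \<in> carrier (pair_grp T q X).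
             h X x = y \<longleftrightarrow> (\<exists>a \<in> x. \<exists>b \<in> y. a @ b \<in> sol T \<rho> X)" by (elim exE conjE)
    have graph: "h X x = y \<longleftrightarrow> (\<exists>a \<in> x. \<exists>b \<in> y. a @ b \<in> sol T \<rho> X)"
      if "X \<in> Obj T" "x \<in> carrier (pair_grp T p X)" "y \<in> carrier (pair_grp T q X)" for X x y
      by (rule bspec[OF bspec[OF bspec[OF \<rho>h that(1)] that(2)] that(3)])
    obtain B b where rr: "realises T \<rho> B b" by (rule free_realisation[OF \<rho> Kc])
    have hE: "h \<in> (\<Pi>\<^sub>E X \<in> Obj T. hom (pair_grp T p X) (pair_grp T q X) \<inter> extensional (carrier (pair_grp T p X)))"
      using h unfolding pp_maps_def by simp
    show "h \<in> nat_trans T (pair_functor T p) (pair_functor T q)"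
    proof (rule nat_transI, unfold FObj_pair_functor)
      show "h X \<in> hom (pair_grp T p X) (pair_grp T q X)" "h X \<in> extensional (carrier (pair_grp T p X))"
        if "X \<in> Obj T" for X using hE that by auto
      show "h \<in> extensional (Obj T)" using hE by (simp add: PiE_def)
      fix m X Y x assume m: "m \<in> Hom T X Y" and x: "x \<in> carrier (pair_grp T p X)"
      note O = Hom_Obj[OF m]
      have hX: "h X \<in> hom (pair_grp T p X) (pair_grp T q X)" using hE O(1) by auto
      have y: "h X x \<in> carrier (pair_grp T q X)" using hom_in_carrier[OF hX x] .
      obtain a b where a: "a \<in> x" and b: "b \<in> h X x" and ab: "a @ b \<in> sol T \<rho> X" using graph[OF O(1) x y] by auto
      obtain a0 where a0: "a0 \<in> sol T (fst p) X" "x = P.coset X a0" using x cp by auto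
      obtain b0 where b0: "b0 \<in> sol T (fst q) X" "h X x = Q.coset X b0" using y cq by auto
      have a': "a \<in> sol T (fst p) X" "x = P.coset X a"
        using P.coset_repr[of X a0 a] O(1) a0 a by simp_all
      have b': "b \<in> sol T (fst q) X" "h X x = Q.coset X b"
        using Q.coset_repr[of X b0 b] O(1) b0 b by simp_all
      have ma: "FMor P.quot m x = P.coset Y (map (Cmp T m) a)" using P.FMor_coset[OF m, of a] a' by simp
      have mb: "FMor Q.quot m (h X x) = Q.coset Y (map (Cmp T m) b)" using Q.FMor_coset[OF m, of b] b' by simp
      have sa: "map (Cmp T m) a \<in> sol T (fst p) Y" by (rule sol_map[OF rp(2) a'(1) m])
      have sb: "map (Cmp T m) b \<in> sol T (fst q) Y" by (rule sol_map[OF rq b'(1) m])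
      \<comment> \<open>The pair of representatives in the graph over \<open>X\<close> is pushed
        along \<open>m\<close> to a pair over \<open>Y\<close>, and there the graph property
        identifies the image.\<close>
      have "map (Cmp T m) a @ map (Cmp T m) b \<in> sol T \<rho> Y" using sol_map[OF rr ab m] by simp
      moreover have "map (Cmp T m) a \<in> FMor P.quot m x" unfolding ma using P.coset_self[OF O(2)] sa by simp
      moreover have "map (Cmp T m) b \<in> FMor Q.quot m (h X x)" unfolding mb using Q.coset_self[OF O(2)] sb by simp
      moreover have "FMor P.quot m x \<in> carrier (pair_grp T p Y)" "FMor Q.quot m (h X x) \<in> carrier (pair_grp T q Y)"
        unfolding ma mb cp cq using sa sb by auto
      ultimately show "h Y (FMor (pair_functor T p) m x) = FMor (pair_functor T q) m (h X x)"
        unfolding Pq using graph[OF O(2), of "FMor P.quot m x" "FMor Q.quot m (h X x)"] by blast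
    qed
  next
    fix h assume h: "h \<in> nat_trans T (pair_functor T p) (pair_functor T q)"
    have cD: "c \<in> sol T (fst p) D" by (rule realisesD(2)[OF rp(2,3)])
    have "P.coset D c \<in> carrier (pair_grp T p D)" unfolding cp using cD by auto
    then have "h D (P.coset D c) \<in> carrier (pair_grp T q D)" using nat_transD(2)[OF h rp(3)] by simp
    then obtain d where d: "d \<in> sol T (fst q) D" "h D (P.coset D c) = Q.coset D d" using cq by auto
    have ct: "c \<in> tuples T (free (fst p)) D" and dt: "d \<in> tuples T (free (fst q)) D"
      using realisesD(1)[OF rp(2)] d(1) subsetD[OF sol_tuples] by auto
    have lc: "length c = length (free (fst p))" using ct by (simp add: tuples_iff)
    have fK: "set (free (fst p) @ free (fst q)) \<subseteq> K" using p q unfolding pp_pairs_def pp_formula_def by auto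
    have "c @ d \<in> tuples T (free (fst p) @ free (fst q)) D" using tuples_append[OF lc] ct dt by simp
    then obtain \<rho> where \<rho>: "pp_formula T K \<rho>" "free \<rho> = free (fst p) @ free (fst q)" "realises T \<rho> D (c @ d)"
      using definable_multiples[OF K rp(1) _ fK] by blast
    have hz: "h X (P.coset X (map (Cmp T z) c)) = Q.coset X (map (Cmp T z) d)" if z: "z \<in> Hom T D X" for z X
      using nat_transD(3)[OF h z, of "P.coset D c"] cD d(2) P.FMor_coset[OF z, of c] Q.FMor_coset[OF z, of d] d(1)
      by (simp add: cp Pq[symmetric])
    have "h X x = y \<longleftrightarrow> (\<exists>a \<in> x. \<exists>b \<in> y. a @ b \<in> sol T \<rho> X)"
      if X: "X \<in> Obj T" and x: "x \<in> carrier (pair_grp T p X)" and y: "y \<in> carrier (pair_grp T q X)" for X x y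
    proof
      assume hx: "h X x = y"
      obtain a0 where a0: "a0 \<in> sol T (fst p) X" "x = P.coset X a0" using x cp by auto
      obtain z where z: "z \<in> Hom T D X" "a0 = map (Cmp T z) c" using realisesD(3)[OF rp(2) a0(1) X] by blast
      have "map (Cmp T z) c \<in> x" using P.coset_self[OF X, of a0] a0 z(2) by simp
      moreover have "map (Cmp T z) d \<in> y"
        using Q.coset_self[OF X, of "map (Cmp T z) d"] sol_map[OF rq d(1) z(1)] hz[OF z(1)] hx a0(2) z(2) by simp
      moreover have "map (Cmp T z) c @ map (Cmp T z) d \<in> sol T \<rho> X" using realisesD(4)[OF \<rho>(3) z(1)] by simp
      ultimately show "\<exists>a \<in> x. \<exists>b \<in> y. a @ b \<in> sol T \<rho> X" by blast
    next
      assume "\<exists>a \<in> x. \<exists>b \<in> y. a @ b \<in> sol T \<rho> X"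
      then obtain a b where a: "a \<in> x" and b: "b \<in> y" and ab: "a @ b \<in> sol T \<rho> X" by blast
      obtain a0 where a0: "a0 \<in> sol T (fst p) X" "x = P.coset X a0" using x cp by auto
      obtain b0 where b0: "b0 \<in> sol T (fst q) X" "y = Q.coset X b0" using y cq by auto
      have a': "a \<in> sol T (fst p) X" "x = P.coset X a"
        using P.coset_repr[of X a0 a] X a0 a by simp_all
      have b': "y = Q.coset X b" using Q.coset_repr[of X b0 b] X b0 b by simp
      \<comment> \<open>A single \<open>z\<close> produces both halves of the solution, so
        \<open>b\<close> is the multiple of \<open>d\<close> by the same \<open>z\<close> that gives
        \<open>a\<close> from \<open>c\<close>; naturality then yields the value of
        \<open>h\<close>.\<close>
      obtain z where z: "z \<in> Hom T D X" "a @ b = map (Cmp T z) (c @ d)" using realisesD(3)[OF \<rho>(3) ab X] by blast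
      have "length a = length c" using a'(1) lc subsetD[OF sol_tuples] by (auto simp: tuples_iff)
      then have "a = map (Cmp T z) c" "b = map (Cmp T z) d" using z(2) by simp_all
      then show "h X x = y" using hz[OF z(1)] a'(2) b' by simp
    qed
    then show "h \<in> pp_maps T K p q"
      using h \<rho>(1,2) unfolding pp_maps_def nat_trans_def FObj_pair_functor
      by (intro CollectI conjI exI[of _ \<rho>] ballI) simp_all
  }
qed

lemma pp_imaginaries_eq:
  assumes K: "small_version u T K"
  shows "pp_imaginaries T K = nat_cat T (pp_pairs T K) (pair_functor T)"
  using pp_maps_eq[OF _ _ K] unfolding pp_imaginaries_def nat_cat_def family_cat_def by auto

text \<open>Pp pairs and coherent functors have the same presentations, the maps between compact
  objects. A pair is closed at \<open>X\<close> when its functor vanishes there, a property of the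
  presentation, so it agrees with vanishing of the matching coherent functor.\<close>

theorem pp_imaginaries_equivalent_Coh:
  assumes K: "small_version (u :: 'u itself) T K" and \<D>: "\<D> \<subseteq> Obj T"
  shows "equivalent_categories (pp_imaginaries_on T K \<D>) (serre_quotient (Coh u T) (Ann_Coh u T \<D>))"
proof -
  have Kc: "K \<subseteq> compacts u T" using K by (simp add: small_version_def)
  have Coh: "Coh u T = nat_cat T (presented_functors T (compacts u T)) (\<lambda>F. F)"
    by (simp add: Coh_def presented_functor_cat_eq)
  show ?thesis
    unfolding pp_imaginaries_on_def pp_imaginaries_eq[OF K] Coh
  proof (rule presented_serre_quotients)
    show "additive_functor T (pair_functor T p)" if "p \<in> pp_pairs T K" for p
      by (rule additive_pair_functor[OF that Kc])
    show "additive_functor T F" if "F \<in> presented_functors T (compacts u T)" for F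
      using that by (simp add: presented_functors_iff)
  next
    fix p assume "p \<in> pp_pairs T K"
    then obtain D B f a where f: "D \<in> compacts u T" "B \<in> compacts u T" "f \<in> Hom T D B"
      and a: "presents T (pair_functor T p) f a" using presents_pair_functor[OF _ Kc] by blast
    obtain b where b: "presents T (coker_functor T f) f b" using coker_functor(2)[OF f(3)] by blast
    have "coker_functor T f \<in> presented_functors T (compacts u T)"
      unfolding presented_functors_iff using coker_functor(1)[OF f(3)] b f HomD[OF f(3)] by auto
    with a b show "\<exists>F \<in> presented_functors T (compacts u T). \<exists>f a b.
        presents T (pair_functor T p) f a \<and> presents T F f b" by blast
  next
    fix F assume "F \<in> presented_functors T (compacts u T)"
    then obtain f b where f: "Src T f \<in> compacts u T" "Tgt T f \<in> compacts u T" and b: "presents T F f b"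
      by (auto simp: presented_functors_iff)
    have "f \<in> Hom T (Src T f) (Tgt T f)" using b by (simp add: presents_def HomI)
    then show "\<exists>p \<in> pp_pairs T K. \<exists>f a b. presents T (pair_functor T p) f a \<and> presents T F f b"
      using pair_functor_of_presentation[OF K f] b by blast
  next
    fix p F f a b assume p: "p \<in> pp_pairs T K" and F: "F \<in> presented_functors T (compacts u T)"
      and a: "presents T (pair_functor T p) f a" and b: "presents T F f b"
    have f: "f \<in> Hom T (Src T f) (Tgt T f)" using b by (simp add: presents_def HomI)
    have addF: "additive_functor T F" using F by (simp add: presented_functors_iff)
    obtain \<phi> \<psi> where pq: "p = (\<phi>, \<psi>)" by (cases p)
    have sub: "sol T \<psi> X \<subseteq> sol T \<phi> X" if "X \<in> Obj T" for X using p that unfolding pq pp_pairs_def by auto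
    have S: "subfunctor T (sol_functor T \<phi>) (sol T \<psi>)"
      by (rule pair_functor_realisations[OF p Kc]) (simp add: pq)
    interpret subfunctor T "sol_functor T \<phi>" "sol T \<psi>" by (rule S)
    have "vanishes F X \<longleftrightarrow> sol T \<phi> X = sol T \<psi> X" if X: "X \<in> Obj T" for X
    proof -
      have "vanishes F X \<longleftrightarrow> vanishes (pair_functor T p) X"
        using vanishes_iff[OF addF b f X] vanishes_iff[OF additive_pair_functor[OF p Kc] a f X] by simp
      also have "\<dots> \<longleftrightarrow> coset X ` sol T \<phi> X = {sol T \<psi> X}"
        unfolding vanishes_def pq pair_functor_def fst_conv snd_conv carrier_quot one_quot by simp
      also have "\<dots> \<longleftrightarrow> (\<forall>xs \<in> sol T \<phi> X. xs \<in> sol T \<psi> X)"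
      proof -
        interpret G: comm_group "FObj (sol_functor T \<phi>) X" by (rule FObj_group[OF X])
        have "sol T \<phi> X \<noteq> {}" using G.one_closed by auto
        moreover have "coset X xs = sol T \<psi> X \<longleftrightarrow> xs \<in> sol T \<psi> X" if "xs \<in> sol T \<phi> X" for xs
          using coset_eq_one_iff[OF X, of xs] that by (simp add: one_quot)
        ultimately show ?thesis by blast
      qed
      finally show ?thesis using sub[OF X] by blast
    qed
    then show "p \<in> closed_pairs T K \<D> \<longleftrightarrow> F \<in> Ann_Coh u T \<D>"
      using p F \<D> unfolding closed_pairs_def Ann_Coh_def Coh pq by auto
  qed
qed

end

theorem proposition3p13:
  fixes T :: "('o, 'm) tri_cat" and D K :: "'o set"
  assumes "compactly_generated TYPE('u) T"
    and "small_version TYPE('u) T K"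
    and "definable TYPE('u) T D"
  shows "equivalent_categories
           (pp_imaginaries_on T K D)
           (serre_quotient (Coh TYPE('u) T) (Ann_Coh TYPE('u) T D))
       \<and> equivalent_categories
           (serre_quotient (Coh TYPE('u) T) (Ann_Coh TYPE('u) T D))
           (op_cat (serre_quotient (mod_compacts TYPE('u) T) (S_mod TYPE('u) T D)))"
proof
  interpret triangulated_category T
    using assms(1) by (simp add: compactly_generated_def)
  have D: "D \<subseteq> Obj T"
    using assms(3) unfolding definable_def by blast
  show "equivalent_categories (pp_imaginaries_on T K D)
      (serre_quotient (Coh TYPE('u) T) (Ann_Coh TYPE('u) T D))"
    by (rule pp_imaginaries_equivalent_Coh[OF assms(2) D])
  interpret op: preadditive_category "op_compacts TYPE('u) T"
    by (rule preadditive_op_compacts)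
  have "category (mod_compacts TYPE('u) T)"
    unfolding mod_compacts_def presented_functor_cat_eq
    by (rule op.category_nat_cat) (simp add: presented_functors_def)
  \<comment> \<open>The duality gives a quotient of the opposite of the module category, whereas the
    claim has the opposite of the quotient; the two are compared by the universal property of
    localisations.\<close>
  then show "equivalent_categories
      (serre_quotient (Coh TYPE('u) T) (Ann_Coh TYPE('u) T D))
      (op_cat (serre_quotient (mod_compacts TYPE('u) T) (S_mod TYPE('u) T D)))"
    by (rule equivalent_categories_trans[OF Coh_dual_mod[OF D] serre_quotient_op_cat])
qed

end
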